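(* Let $\sigma>0$, $R>\sigma$ (a large constant), $L>0$, $\nu>0$, $\rho>0$ and $\gamma\in\mathbb{R}$. The steady axisymmetric Navier-Stokes system $$u \frac{\partial u}{\partial r}+ w\frac{\partial u}{\partial z}-\frac{v^2}{r}=-\frac{1}{\rho}\frac{\partial p}{\partial r} +\nu \Big(\frac{\partial ^2 u}{\partial r^2}+\frac{1}{r}\frac{\partial u}{\partial r}-\frac{u}{r^2}+\frac{\partial^2 u}{\partial z^2}\Big),$$ $$u \frac{\partial v}{\partial r}+ w\frac{\partial v}{\partial z}+\frac{uv}{r}=\nu \Big(\frac{\partial ^2 v}{\partial r^2}+\frac{1}{r}\frac{\partial v}{\partial r}-\frac{v}{r^2}+\frac{\partial^2 v}{\partial z^2}\Big),$$ $$u \frac{\partial w}{\partial r}+ w\frac{\partial w}{\partial z}=-\frac{1}{\rho}\frac{\partial p}{\partial z} +\nu \Big(\frac{\partial ^2 w}{\partial r^2}+\frac{1}{r}\frac{\partial w}{\partial r}+\frac{\partial^2 w}{\partial z^2}\Big),$$ $$\frac{\partial(ru) }{\partial r}+\frac{\partial (rw)}{\partial z}=0$$ on $\Omega'=\{(r,z):\sigma\le r<R,\ 0\le z\le L\}$, with boundary conditions $$(u,v,w)|_{z=0}=(0,0,0),\quad (u,v,w)|_{r=\sigma}=\Big(0,\frac{\gamma}{2\pi\sigma},0\Big),\quad \Big(\frac{\partial u}{\partial z},\frac{\partial v}{\partial z},w\Big)\Big|_{z=L}=(0,0,0),\quad (u,v,w)|_{r=R}=(0,0,0),$$ admits a weak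 solution $(u,v,w)$ in the following sense: with $v_s$ the azimuthal Stokes field described in the context, the triple $(u,v-v_s,w)$, renamed $(u,v,w)$, with $\mathbf U=(u,w)$, satisfies $(\mathbf U,v)\in\mathbf V_2\times V_1$ and, for every $(\tilde{\mathbf U},\tilde v)$ with $\tilde{\mathbf U}=(\tilde u,\tilde w)\in\mathbf V_2$ and $\tilde v\in V_1$, $$\int_{\Omega'}(\mathbf{U} \cdot \nabla)\mathbf{U} \cdot \tilde{\mathbf{U}} \, r\,dr\,dz -\int_{\Omega'}\frac{(v+v_s)^2}{r} \tilde{u} \, r\,dr\,dz= -\nu \int_{\Omega'} \nabla \mathbf{U}: \nabla \tilde{\mathbf{U}}\, r\,dr\,dz -\nu \int_{\Omega'} \frac{u \tilde{u}}{r^2}\, r\,dr\,dz,$$ $$\int_{\Omega'} (\mathbf{U} \cdot \nabla v) \tilde{v}\, r\,dr\,dz-\int_{\Omega'} v_s \Big[u \frac{\partial \tilde{v}}{\partial r} +w\frac{\partial \tilde{v}}{\partial z} \Big]\, r\,dr\,dz + \int_{\Omega'} \frac{u(v+v_s)}{r} \tilde{v}\, r\,dr\,dz=-\nu \int_{\Omega'} \nabla v \cdot \nabla \tilde{v}\, r\,dr\,dz -\nu \int_{\Omega'} \frac{v\, \tilde{v}}{r^2}\, r\,dr\,dz.$$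
   Context: Notation: $(r,z)$ are the radial and axial cylindrical coordinates, $(u,v,w)$ the radial, azimuthal and axial velocity components (all independent of the angle), $p$ the pressure, $\nabla=(\partial_r,\partial_z)$, and $\mathbf U\cdot\nabla=u\,\partial_r+w\,\partial_z$. For $\mathbf U=(u,w)$ and $\tilde{\mathbf U}=(\tilde u,\tilde w)$, $\nabla\mathbf U:\nabla\tilde{\mathbf U}=\nabla u\cdot\nabla\tilde u+\nabla w\cdot\nabla\tilde w$. Stokes field: $(u_s,v_s,w_s)=(0,v_s,0)$ with constant pressure is the solution of the corresponding linear axisymmetric Stokes system with the same boundary conditions; that is, $v_s=v_s(r,z)$ solves $$\frac{\partial ^2 v_s}{\partial r^2}+\frac{1}{r}\frac{\partial v_s}{\partial r}-\frac{v_s}{r^2}+\frac{\partial^2 v_s}{\partial z^2}=0 \ \text{ in } \Omega',\qquad v_s|_{z=0}=v_s|_{r=R}=0,\quad v_s|_{r=\sigma}=\frac{\gamma}{2\pi\sigma},\quad \frac{\partial v_s}{\partial z}\Big|_{z=L}=0.$$ It is obtained as the restriction to $0\le z\le L$ of the solution, even with respect to $z=L$, of the same equation on $\{\sigma<r<R,\ 0<z<2L\}$ with Dirichlet data $0$ on $z=0$, $z=2L$ and $r=R$, and $\frac{\gamma}{2\pi\sigma}$ on $r=\sigma$. These Dirichlet data are bounded but discontinuous at the corners $(\sigma,0)$ and $(\sigma,2L)$; the solution is the unique one given by the theory of the $L^p$ Dirichlet problem in Lipschitz domains (boundary data attained as nontangential limits almost everywhere). It lies in $H^{1/2}$ and in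 $L^\infty$, and is smooth in the interior. Function spaces: $$V_1=\Big\{u : \int_{\Omega'} \Big[\Big(\frac{\partial u}{\partial r}\Big)^2+\Big(\frac{\partial u}{\partial z}\Big)^2\Big]\, r\,dr\,dz < \infty,\ u|_{z=0}=u|_{r=\sigma}=u|_{r=R}=0\Big\},$$ $$W_1=\Big\{w : \int_{\Omega'} \Big[\Big(\frac{\partial w}{\partial r}\Big)^2+\Big(\frac{\partial w}{\partial z}\Big)^2\Big]\, r\,dr\,dz < \infty,\ w|_{z=0}=w|_{r=\sigma}=w|_{z=L}=w|_{r=R}=0\Big\},$$ $$\mathbf V_2=\Big\{(u,w)\in V_1\times W_1 : \frac{\partial(ru)}{\partial r}+\frac{\partial(rw)}{\partial z}=0\Big\},$$ Hilbert spaces with the inner product $\int_{\Omega'}\big(\frac{\partial f}{\partial r}\frac{\partial g}{\partial r}+\frac{\partial f}{\partial z}\frac{\partial g}{\partial z}\big)r\,dr\,dz$ (summed over components for $\mathbf V_2$). Boundary values in these spaces are understood in the sense of traces and derivatives in the weak sense. *)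

theory Defs
  imports "HOL-Analysis.Analysis"
begin

text \<open>
  A point of the meridional half-plane is a pair \<open>x = (r, z)\<close>, so \<open>fst x\<close> is the radius \<open>r\<close>.
  Fields are total functions on the plane; only their values on the domain matter.  Integrals
  are taken with respect to the complete measure \<^const>\<open>lebesgue\<close>, so that values on null sets
  (such as the boundary of the domain) affect neither measurability nor integrals.
\<close>

section \<open>Smooth functions, weak derivatives, traces\<close>

fun C_k_on :: "nat \<Rightarrow> (real \<times> real) set \<Rightarrow> (real \<times> real \<Rightarrow> real) \<Rightarrow> bool" where
  "C_k_on 0 S f \<longleftrightarrow> continuous_on S f"
| "C_k_on (Suc k) S f \<longleftrightarrow>
     f differentiable_on S \<and> (\<forall>e. C_k_on k S (\<lambda>x. frechet_derivative f (at x) e))"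

text \<open>\<open>C\<^sup>\<infinity>\<close> regularity; meant for open sets \<open>S\<close> only.\<close>

definition smooth_on :: "(real \<times> real) set \<Rightarrow> (real \<times> real \<Rightarrow> real) \<Rightarrow> bool" where
  "smooth_on S f \<longleftrightarrow> (\<forall>k. C_k_on k S f)"

definition pd :: "real \<times> real \<Rightarrow> (real \<times> real \<Rightarrow> real) \<Rightarrow> real \<times> real \<Rightarrow> real" where
  "pd e f x = frechet_derivative f (at x) e"

abbreviation pdr where "pdr \<equiv> pd (1, 0)"
abbreviation pdz where "pdz \<equiv> pd (0, 1)"

definition test_functions :: "(real \<times> real) set \<Rightarrow> (real \<times> real \<Rightarrow> real) set" where
  "test_functions S =
     {\<phi>. smooth_on UNIV \<phi> \<and> (\<exists>K. compact K \<and> K \<subseteq> S \<and> (\<forall>x. x \<notin> K \<longrightarrow> \<phi> x = 0))}"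

definition locally_integrable_on :: "(real \<times> real) set \<Rightarrow> (real \<times> real \<Rightarrow> real) \<Rightarrow> bool" where
  "locally_integrable_on S f \<longleftrightarrow>
     (\<forall>K. compact K \<and> K \<subseteq> S \<longrightarrow> set_integrable lebesgue K f)"

definition has_weak_deriv ::
  "(real \<times> real) set \<Rightarrow> real \<times> real \<Rightarrow> (real \<times> real \<Rightarrow> real) \<Rightarrow> (real \<times> real \<Rightarrow> real) \<Rightarrow> bool" where
  "has_weak_deriv D e f g \<longleftrightarrow>
     locally_integrable_on (interior D) f \<and> locally_integrable_on (interior D) g \<and>
     (\<forall>\<phi> \<in> test_functions (interior D).
        (LINT x:interior D|lebesgue. f x * pd e \<phi> x)
          = - (LINT x:interior D|lebesgue. g x * \<phi> x))"

text \<open>The weak derivative, determined almost everywhere when it exists.\<close>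

definition wd :: "(real \<times> real) set \<Rightarrow> real \<times> real \<Rightarrow> (real \<times> real \<Rightarrow> real) \<Rightarrow> real \<times> real \<Rightarrow> real" where
  "wd D e f = (SOME g. has_weak_deriv D e f g)"

abbreviation wdr where "wdr D \<equiv> wd D (1, 0)"
abbreviation wdz where "wdz D \<equiv> wd D (0, 1)"

definition weakly_differentiable :: "(real \<times> real) set \<Rightarrow> (real \<times> real \<Rightarrow> real) \<Rightarrow> bool" where
  "weakly_differentiable D f \<longleftrightarrow>
     (\<exists>g. has_weak_deriv D (1, 0) f g) \<and> (\<exists>g. has_weak_deriv D (0, 1) f g)"

definition axi_integrable :: "(real \<times> real) set \<Rightarrow> (real \<times> real \<Rightarrow> real) \<Rightarrow> bool" where
  "axi_integrable D f \<longleftrightarrow> set_integrable lebesgue D (\<lambda>x. f x * fst x)"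

definition axi_integral :: "(real \<times> real) set \<Rightarrow> (real \<times> real \<Rightarrow> real) \<Rightarrow> real" where
  "axi_integral D f = (LINT x:D|lebesgue. f x * fst x)"

definition axi_L2 :: "(real \<times> real) set \<Rightarrow> (real \<times> real \<Rightarrow> real) set" where
  "axi_L2 D = {f. set_borel_measurable lebesgue D f \<and> axi_integrable D (\<lambda>x. (f x)\<^sup>2)}"

definition axi_H1 :: "(real \<times> real) set \<Rightarrow> (real \<times> real \<Rightarrow> real) set" where
  "axi_H1 D = {f. f \<in> axi_L2 D \<and> weakly_differentiable D f \<and> wdr D f \<in> axi_L2 D \<and> wdz D f \<in> axi_L2 D}"

text \<open>
  \<open>has_trace D f P I g\<close>: the trace of \<open>f \<in> H\<^sup>1(D)\<close> on the boundary piece parametrised by arc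
  length by \<open>P\<close> on the interval \<open>I\<close> is \<open>g \<in> L\<^sup>2(I)\<close>.  The trace operator is the continuous
  extension, from functions smooth up to the boundary, of the restriction to the boundary.
\<close>

definition has_trace ::
  "(real \<times> real) set \<Rightarrow> (real \<times> real \<Rightarrow> real) \<Rightarrow> (real \<Rightarrow> real \<times> real) \<Rightarrow> real set \<Rightarrow> (real \<Rightarrow> real) \<Rightarrow> bool"
  where
  "has_trace D f P I g \<longleftrightarrow>
     f \<in> axi_H1 D \<and> set_borel_measurable lebesgue I g \<and> set_integrable lebesgue I (\<lambda>t. (g t)\<^sup>2) \<and>
     (\<exists>\<phi> :: nat \<Rightarrow> real \<times> real \<Rightarrow> real.
        (\<forall>n. smooth_on UNIV (\<phi> n)) \<and>
        (\<lambda>n. axi_integral D (\<lambda>x. (\<phi> n x - f x)\<^sup>2 + (pdr (\<phi> n) x - wdr D f x)\<^sup>2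
                                    + (pdz (\<phi> n) x - wdz D f x)\<^sup>2)) \<longlonglongrightarrow> 0 \<and>
        (\<lambda>n. LINT t:I|lebesgue. (\<phi> n (P t) - g t)\<^sup>2) \<longlonglongrightarrow> 0)"

section \<open>The meridional domain and the function spaces\<close>

definition Omega :: "real \<Rightarrow> real \<Rightarrow> real \<Rightarrow> (real \<times> real) set" where
  "Omega \<sigma> R L = {\<sigma>..<R} \<times> {0..L}"

definition zero_trace_at_r ::
  "real \<Rightarrow> real \<Rightarrow> real \<Rightarrow> real \<Rightarrow> (real \<times> real \<Rightarrow> real) \<Rightarrow> bool" where
  "zero_trace_at_r \<sigma> R L r0 f \<longleftrightarrow> has_trace (Omega \<sigma> R L) f (\<lambda>z. (r0, z)) {0..L} (\<lambda>_. 0)"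

definition zero_trace_at_z ::
  "real \<Rightarrow> real \<Rightarrow> real \<Rightarrow> real \<Rightarrow> (real \<times> real \<Rightarrow> real) \<Rightarrow> bool" where
  "zero_trace_at_z \<sigma> R L z0 f \<longleftrightarrow> has_trace (Omega \<sigma> R L) f (\<lambda>r. (r, z0)) {\<sigma>..R} (\<lambda>_. 0)"

text \<open>
  On this bounded domain a function with square integrable weak gradient is automatically in
  \<open>L\<^sup>2\<close>; membership in \<open>H\<^sup>1\<close> is required explicitly because the traces need it.
\<close>

definition V1 :: "real \<Rightarrow> real \<Rightarrow> real \<Rightarrow> (real \<times> real \<Rightarrow> real) set" where
  "V1 \<sigma> R L = {u \<in> axi_H1 (Omega \<sigma> R L).
     zero_trace_at_z \<sigma> R L 0 u \<and> zero_trace_at_r \<sigma> R L \<sigma> u \<and> zero_trace_at_r \<sigma> R L R u}"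

definition W1 :: "real \<Rightarrow> real \<Rightarrow> real \<Rightarrow> (real \<times> real \<Rightarrow> real) set" where
  "W1 \<sigma> R L = {w \<in> axi_H1 (Omega \<sigma> R L).
     zero_trace_at_z \<sigma> R L 0 w \<and> zero_trace_at_r \<sigma> R L \<sigma> w \<and>
     zero_trace_at_z \<sigma> R L L w \<and> zero_trace_at_r \<sigma> R L R w}"

definition V2 :: "real \<Rightarrow> real \<Rightarrow> real \<Rightarrow> ((real \<times> real \<Rightarrow> real) \<times> (real \<times> real \<Rightarrow> real)) set" where
  "V2 \<sigma> R L = {(u, w). u \<in> V1 \<sigma> R L \<and> w \<in> W1 \<sigma> R L \<and>
     (AE x in lebesgue. x \<in> Omega \<sigma> R L \<longrightarrow>
        wdr (Omega \<sigma> R L) (\<lambda>y. fst y * u y) x + wdz (Omega \<sigma> R L) (\<lambda>y. fst y * w y) x = 0)}"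

section \<open>The azimuthal Stokes field\<close>

definition approach_region :: "(real \<times> real) set \<Rightarrow> real \<Rightarrow> real \<times> real \<Rightarrow> (real \<times> real) set" where
  "approach_region D \<alpha> q = {x \<in> D. dist x q < (1 + \<alpha>) * infdist x (frontier D)}"

definition nontangential_limit ::
  "(real \<times> real) set \<Rightarrow> (real \<times> real \<Rightarrow> real) \<Rightarrow> real \<times> real \<Rightarrow> real \<Rightarrow> bool" where
  "nontangential_limit D f q l \<longleftrightarrow>
     (\<forall>\<alpha>>0. (f \<longlongrightarrow> l) (at q within approach_region D \<alpha> q))"

text \<open>
  The Dirichlet problem is posed on the rectangle doubled by even reflection in \<open>z = L\<close>.  For
  bounded data, uniqueness of solutions attaining their data as nontangential limits almost
  everywhere requires control of the nontangential maximal function; here it is bounded,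
  i.e. \<open>vs\<close> is bounded.  Without such a condition, Poisson kernels with pole on the boundary
  could be added to \<open>vs\<close>.  The Neumann condition on \<open>z = L\<close> follows from evenness.
\<close>

definition azimuthal_stokes_field ::
  "real \<Rightarrow> real \<Rightarrow> real \<Rightarrow> real \<Rightarrow> (real \<times> real \<Rightarrow> real) \<Rightarrow> bool" where
  "azimuthal_stokes_field \<sigma> R L \<gamma> vs \<longleftrightarrow>
     (let D = {\<sigma><..<R} \<times> {0<..<2 * L} in
        smooth_on D vs \<and> bounded (vs ` D) \<and>
        (\<forall>x\<in>D. pdr (pdr vs) x + pdr vs x / fst x - vs x / (fst x)\<^sup>2 + pdz (pdz vs) x = 0) \<and>
        (\<forall>r z. (r, z) \<in> D \<longrightarrow> vs (r, 2 * L - z) = vs (r, z)) \<and>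
        (AE z in lebesgue. z \<in> {0<..<2 * L} \<longrightarrow>
           nontangential_limit D vs (\<sigma>, z) (\<gamma> / (2 * pi * \<sigma>)) \<and>
           nontangential_limit D vs (R, z) 0) \<and>
        (AE r in lebesgue. r \<in> {\<sigma><..<R} \<longrightarrow>
           nontangential_limit D vs (r, 0) 0 \<and>
           nontangential_limit D vs (r, 2 * L) 0))"

section \<open>Weak solutions\<close>

definition advect ::
  "(real \<times> real) set \<Rightarrow> (real \<times> real \<Rightarrow> real) \<Rightarrow> (real \<times> real \<Rightarrow> real) \<Rightarrow> (real \<times> real \<Rightarrow> real)
     \<Rightarrow> real \<times> real \<Rightarrow> real" where
  "advect D u w f x = u x * wdr D f x + w x * wdz D f x"

definition grad_dot ::
  "(real \<times> real) set \<Rightarrow> (real \<times> real \<Rightarrow> real) \<Rightarrow> (real \<times> real \<Rightarrow> real) \<Rightarrow> real \<times> real \<Rightarrow> real" where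
  "grad_dot D f g x = wdr D f x * wdr D g x + wdz D f x * wdz D g x"

text \<open>Here \<open>v\<close> is the azimuthal velocity minus the Stokes field \<open>vs\<close>.\<close>

definition shifted_weak_solution ::
  "real \<Rightarrow> real \<Rightarrow> real \<Rightarrow> real \<Rightarrow> (real \<times> real \<Rightarrow> real) \<Rightarrow> (real \<times> real \<Rightarrow> real) \<Rightarrow>
     (real \<times> real \<Rightarrow> real) \<Rightarrow> (real \<times> real \<Rightarrow> real) \<Rightarrow> bool" where
  "shifted_weak_solution \<sigma> R L \<nu> vs u v w \<longleftrightarrow>
     (let D = Omega \<sigma> R L in
        (u, w) \<in> V2 \<sigma> R L \<and> v \<in> V1 \<sigma> R L \<and>
        (\<forall>u' w' v'. (u', w') \<in> V2 \<sigma> R L \<and> v' \<in> V1 \<sigma> R L \<longrightarrow>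
           axi_integral D (\<lambda>x. advect D u w u x * u' x + advect D u w w x * w' x)
             - axi_integral D (\<lambda>x. (v x + vs x)\<^sup>2 / fst x * u' x)
           = - \<nu> * axi_integral D (\<lambda>x. grad_dot D u u' x + grad_dot D w w' x)
             - \<nu> * axi_integral D (\<lambda>x. u x * u' x / (fst x)\<^sup>2)
         \<and>
           axi_integral D (\<lambda>x. advect D u w v x * v' x)
             - axi_integral D (\<lambda>x. vs x * advect D u w v' x)
             + axi_integral D (\<lambda>x. u x * (v x + vs x) / fst x * v' x)
           = - \<nu> * axi_integral D (\<lambda>x. grad_dot D v v' x)
             - \<nu> * axi_integral D (\<lambda>x. v x * v' x / (fst x)\<^sup>2)))"

text \<open>
  Weak solutions of the steady axisymmetric Navier--Stokes system.  The test fields are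
  divergence free, so the pressure and the density \<open>\<rho>\<close> drop out; the circulation \<open>\<gamma>\<close> enters
  through \<open>vs\<close>.
\<close>

definition ns_weak_solution ::
  "real \<Rightarrow> real \<Rightarrow> real \<Rightarrow> real \<Rightarrow> (real \<times> real \<Rightarrow> real) \<Rightarrow> (real \<times> real \<Rightarrow> real) \<Rightarrow>
     (real \<times> real \<Rightarrow> real) \<Rightarrow> (real \<times> real \<Rightarrow> real) \<Rightarrow> bool" where
  "ns_weak_solution \<sigma> R L \<nu> vs u v w \<longleftrightarrow>
     shifted_weak_solution \<sigma> R L \<nu> vs u (\<lambda>x. v x - vs x) w"

end

theory Submission
  imports Defs "HOL-Analysis.Analysis" "HOL-Library.Diagonal_Subsequence" "HOL-Computational_Algebra.Polynomial"
begin

text \<open>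
  Only the boundedness of \<open>v\<^sub>s\<close> is used.  Testing the system with its own solution removes the
  convective terms and leaves \<open>\<nu>\<parallel>(u, w, v)\<parallel>\<^sup>2\<close> against a quadratic term
  \<open>\<integral> v\<^sub>s (u v / r + U \<cdot> \<nabla> v) r dr dz\<close> with no sign and no small factor, so there is no direct
  a priori bound.  Leray's argument by contradiction replaces it: Brouwer's theorem yields, for
  every radius \<open>M\<close>, a Galerkin solution in the ball of radius \<open>M\<close>, or a point \<open>x\<close> of its boundary
  solving the system with an additional term \<open>c x\<close>, \<open>c \<ge> 0\<close>.  If these blow up as the radius
  grows, their normalisations converge weakly to some \<open>(U, v)\<close> for which the convective form
  vanishes against all test fields, that is \<open>U \<cdot> \<nabla> v + u v / r = 0\<close> in the azimuthal
  equation.  The quadratic term of the limit is then zero, which contradicts coercivity.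
  Otherwise a weak limit of the Galerkin solutions is a solution.

  Passing to the limit in the products uses Rellich's theorem, obtained from the Poincare
  inequality on the cells of a fine grid, and Ladyzhenskaya's inequality
  \<open>\<parallel>f g\<parallel>\<^sup>2 \<le> K \<parallel>f\<parallel> \<parallel>f\<parallel>\<^sub>1 \<parallel>g\<parallel> \<parallel>g\<parallel>\<^sub>1\<close> (indices for \<open>H\<^sup>1\<close> norms).  Both are proved for smooth
  functions and extended by density.
\<close>

section \<open>Zeros of continuous fields in finite dimension\<close>

text \<open>For \<gamma> \<noteq> 0 the data of \<open>vs\<close> jump at the corners, so its
  gradient is not square integrable, and \<open>vs\<close> is no admissible test field. Closing
  Leray's argument nevertheless means pairing the degenerate limit equation with \<open>vs\<close>.
  Azimuthal test fields (0, 0, phi) carry no divergence constraint, so against them no pressure can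
  survive and the limit equation holds almost everywhere; a pointwise identity may be multiplied by
  any bounded function. The other obstacle is the notion of trace: each side of the rectangle has
  its own approximating sequence, and no smooth sequence vanishing on all sides at once is at hand.
  Boundary terms are therefore removed one side at a time, and in the energy identity the
  transported field is approximated while the velocity stays as it is. Dimension and radius of the
  Galerkin problems grow together, so that a single sequence covers both alternatives, blow-up and
  boundedness.\<close>

lemma cube_limit_subseq:
  fixes X :: "nat \<Rightarrow> nat \<Rightarrow> real"
  assumes "\<And>k i. \<bar>X k i\<bar> \<le> M i"
  obtains r x where "strict_mono r" "\<And>i. (\<lambda>k. X (r k) i) \<longlonglongrightarrow> x i"
proof -
  define P where "P i r \<longleftrightarrow> convergent (\<lambda>k. X (r k) i)" for i and r :: "nat \<Rightarrow> nat"
  interpret subseqs P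
  proof
    fix n and s :: "nat \<Rightarrow> nat" assume "strict_mono s"
    have "bounded (range (\<lambda>k. X (s k) n))"
      using assms by (intro boundedI[of _ "M n"]) auto
    then obtain l r where "strict_mono r" "((\<lambda>k. X (s k) n) \<circ> r) \<longlonglongrightarrow> l"
      using bounded_imp_convergent_subsequence by blast
    then show "\<exists>r'. strict_mono r' \<and> P n (s \<circ> r')"
      unfolding P_def by (auto simp: convergent_def o_def)
  qed
  have P: "P i (diagseq \<circ> ((+) (Suc i)))" for i
  proof (rule diagseq_holds)
    fix i r s assume "strict_mono (r :: nat \<Rightarrow> nat)" "P i s"
    then show "P i (s \<circ> r)"
      unfolding P_def convergent_def using LIMSEQ_subseq_LIMSEQ[of "\<lambda>k. X (s k) i" _ r]
      by (auto simp: o_def)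
  qed
  \<comment> \<open>Only the tail of the diagonal sequence from index \<open>Suc i\<close> on is a
    subsequence of the one chosen for coordinate \<open>i\<close>; the offset is removed again in
    the limit.\<close>
  have "(\<lambda>k. X (diagseq (k + Suc i)) i) = (\<lambda>k. X ((diagseq \<circ> ((+) (Suc i))) k) i)" for i
    by (simp add: add.commute)
  then have "\<exists>l. (\<lambda>k. X (diagseq (k + Suc i)) i) \<longlonglongrightarrow> l" for i
    using P[of i] unfolding P_def convergent_def by simp
  then have "\<exists>l. (\<lambda>k. X (diagseq k) i) \<longlonglongrightarrow> l" for i
    by (rule exE) (rule exI, rule LIMSEQ_offset)
  then show ?thesis using that subseq_diagseq by metis
qed

text \<open>The dimension is a number and not a type, because it grows along the Galerkin sequence.
  Points are functions on all of \<open>nat\<close> of which only the first \<open>n\<close> values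
  matter, so continuity is expressed by coordinatewise sequences. The proof is Kuhn's: a labelled
  grid cell for every mesh size, and compactness.\<close>

lemma brouwer_unit_cube_nat:
  fixes f :: "(nat \<Rightarrow> real) \<Rightarrow> nat \<Rightarrow> real" and n :: nat
  assumes cont: "\<And>X x i. (\<And>j. j < n \<Longrightarrow> (\<lambda>k. X k j) \<longlonglongrightarrow> x j)
      \<Longrightarrow> (\<And>k j. j < n \<Longrightarrow> X k j \<in> {0..1}) \<Longrightarrow> i < n \<Longrightarrow> (\<lambda>k. f (X k) i) \<longlonglongrightarrow> f x i"
    and maps: "\<And>x i. (\<And>j. j < n \<Longrightarrow> x j \<in> {0..1}) \<Longrightarrow> i < n \<Longrightarrow> f x i \<in> {0..1}"
  shows "\<exists>x. \<forall>i<n. x i \<in> {0..1} \<and> f x i = x i"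
proof -
  define pt where "pt p q i = real (q i) / real p" for p :: nat and q :: "nat \<Rightarrow> nat" and i
  \<comment> \<open>Label 0 means that \<open>f\<close> does not decrease coordinate
    \<open>i\<close>, label 1 that it decreases it. On the faces the labels are prescribed by Kuhn's
    lemma; they still imply the weak inequality between \<open>f\<close> and the point, since
    \<open>f\<close> maps the cube into itself.\<close>
  define label where "label p q i =
      (if q i = 0 then 0 else if q i = p then 1 else if f (pt p q) i \<ge> pt p q i then 0 else 1 :: nat)" for p q i
  define Q where "Q p q i r s \<longleftrightarrow> (\<forall>j<n. q j \<le> r j \<and> r j \<le> q j + 1) \<and> (\<forall>j<n. q j \<le> s j \<and> s j \<le> q j + 1) \<and>
      label (Suc p) r i = 0 \<and> label (Suc p) s i = 1" for p q i and r s :: "nat \<Rightarrow> nat"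
  have "\<exists>q. (\<forall>i<n. q i < Suc p) \<and> (\<forall>i<n. \<exists>r s. Q p q i r s)" for p
  proof -
    obtain q where q: "\<forall>i<n. q i < Suc p"
      "\<forall>i<n. \<exists>r s. (\<forall>j<n. q j \<le> r j \<and> r j \<le> q j + 1) \<and> (\<forall>j<n. q j \<le> s j \<and> s j \<le> q j + 1) \<and> label (Suc p) r i \<noteq> label (Suc p) s i"
      by (rule kuhn_lemma[of "Suc p" n "label (Suc p)"]) (auto simp: label_def)
    have "\<exists>r s. Q p q i r s" if i: "i < n" for i
    proof -
      obtain r s where *: "\<forall>j<n. q j \<le> r j \<and> r j \<le> q j + 1" "\<forall>j<n. q j \<le> s j \<and> s j \<le> q j + 1"
        "label (Suc p) r i \<noteq> label (Suc p) s i" using q(2) i by blast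
      have "label (Suc p) r i \<in> {0,1}" "label (Suc p) s i \<in> {0,1}" by (auto simp: label_def)
      then have "Q p q i r s \<or> Q p q i s r"
        using * unfolding Q_def by auto
      then show ?thesis by blast
    qed
    then show ?thesis using q(1) by blast
  qed
  then obtain q where q: "\<And>p i. i < n \<Longrightarrow> q p i < Suc p"
    and RS: "\<And>p i. i < n \<Longrightarrow> \<exists>r s. Q p (q p) i r s"
    by metis
  define R where "R p i = (SOME r. \<exists>s. Q p (q p) i r s)" for p i
  define S where "S p i = (SOME s. Q p (q p) i (R p i) s)" for p i
  have Q: "Q p (q p) i (R p i) (S p i)" if "i < n" for p i
  proof -
    have "\<exists>s. Q p (q p) i (R p i) s"
      using someI_ex[OF RS[OF that, of p]] unfolding R_def .
    then show ?thesis unfolding S_def by (rule someI_ex)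
  qed
  have R: "\<And>p i j. i < n \<Longrightarrow> j < n \<Longrightarrow> q p j \<le> R p i j \<and> R p i j \<le> q p j + 1"
    and S: "\<And>p i j. i < n \<Longrightarrow> j < n \<Longrightarrow> q p j \<le> S p i j \<and> S p i j \<le> q p j + 1"
    and lR: "\<And>p i. i < n \<Longrightarrow> label (Suc p) (R p i) i = 0"
    and lS: "\<And>p i. i < n \<Longrightarrow> label (Suc p) (S p i) i = 1"
    using Q unfolding Q_def by blast+
  \<comment> \<open>Coordinates from \<open>n\<close> on are set to 0, so that the compactness lemma
    for all coordinates applies.\<close>
  define X where "X p i = (if i < n then pt (Suc p) (q p) i else 0)" for p i
  have "\<bar>X p i\<bar> \<le> 1" for p i
    using q[of i p] by (auto simp: X_def pt_def divide_simps)
  then obtain r x where r: "strict_mono r" and x: "\<And>i. (\<lambda>k. X (r k) i) \<longlonglongrightarrow> x i"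
    using cube_limit_subseq[of X "\<lambda>_. 1"] by blast
  have near: "(\<lambda>k. pt (Suc (r k)) (Q (r k)) j) \<longlonglongrightarrow> x j"
    if "j < n" "\<And>p. q p j \<le> Q p j \<and> Q p j \<le> q p j + 1" for Q j
  proof -
    have "(\<lambda>k. inverse (real (Suc k))) \<longlonglongrightarrow> 0" by (rule LIMSEQ_inverse_real_of_nat)
    then have 0: "(\<lambda>k. inverse (real (Suc (r k)))) \<longlonglongrightarrow> 0"
      using LIMSEQ_subseq_LIMSEQ[OF _ r] by (fastforce simp: o_def)
    have "(\<lambda>k. pt (Suc (r k)) (Q (r k)) j - X (r k) j) \<longlonglongrightarrow> 0"
    proof (rule Lim_null_comparison[OF _ 0], rule always_eventually, rule allI)
      fix k
      have a: "real (q (r k) j) \<le> real (Q (r k) j)" "real (Q (r k) j) \<le> real (q (r k) j) + 1"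
        using that(2)[of "r k"] by linarith+
      have "\<bar>real (Q (r k) j) - real (q (r k) j)\<bar> \<le> 1" using a by linarith
      moreover have "pt (Suc (r k)) (Q (r k)) j - X (r k) j = (real (Q (r k) j) - real (q (r k) j)) / real (Suc (r k))"
        using that(1) by (simp add: pt_def X_def diff_divide_distrib)
      ultimately show "norm (pt (Suc (r k)) (Q (r k)) j - X (r k) j) \<le> inverse (real (Suc (r k)))"
        by (simp add: divide_simps)
    qed
    from tendsto_add[OF this x[of j]] show ?thesis by simp
  qed
  have range: "pt (Suc p) Q j \<in> {0..1}" if "j < n" "q p j \<le> Q j \<and> Q j \<le> q p j + 1" for Q j p
    using that q[of j p] by (auto simp: pt_def divide_simps)
  have xr: "x i \<in> {0..1}" if "i < n" for i
    using Lim_in_closed_set[of "{0..1}" "\<lambda>k. X (r k) i" sequentially "x i"] x[of i] range[OF that, of _ "q _"] that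
    by (auto simp: X_def)
  \<comment> \<open>Every cell has a vertex with label 1 and one with label 0 for coordinate
    \<open>i\<close>. Both vertices converge to \<open>x\<close>, and the two labels give the two
    inequalities in the limit.\<close>
  have "f x i = x i" if i: "i < n" for i
  proof (rule antisym)
    have 1: "(\<lambda>k. pt (Suc (r k)) (S (r k) i) j) \<longlonglongrightarrow> x j" if "j < n" for j
      using near[OF that, of "\<lambda>p. S p i"] S[OF i that] by simp
    have 2: "pt (Suc p) (S p i) j \<in> {0..1}" if "j < n" for j p
      using range[where Q="S p i" and p=p and j=j, OF that S[OF i that]] .
    have "(\<lambda>k. f (pt (Suc (r k)) (S (r k) i)) i) \<longlonglongrightarrow> f x i"
      by (rule cont) (fact 1, fact 2, fact i)
    moreover have "f (pt (Suc (r k)) (S (r k) i)) i \<le> pt (Suc (r k)) (S (r k) i) i" for k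
    proof -
      have "f (pt (Suc (r k)) (S (r k) i)) i \<in> {0..1}" by (rule maps) (fact 2, fact i)
      then show ?thesis using lS[OF i, of "r k"] by (auto simp: label_def pt_def split: if_splits)
    qed
    ultimately show "f x i \<le> x i" using 1[OF i] by (intro LIMSEQ_le) auto
  next
    have 1: "(\<lambda>k. pt (Suc (r k)) (R (r k) i) j) \<longlonglongrightarrow> x j" if "j < n" for j
      using near[OF that, of "\<lambda>p. R p i"] R[OF i that] by simp
    have 2: "pt (Suc p) (R p i) j \<in> {0..1}" if "j < n" for j p
      using range[where Q="R p i" and p=p and j=j, OF that R[OF i that]] .
    have "(\<lambda>k. f (pt (Suc (r k)) (R (r k) i)) i) \<longlonglongrightarrow> f x i"
      by (rule cont) (fact 1, fact 2, fact i)
    moreover have "pt (Suc (r k)) (R (r k) i) i \<le> f (pt (Suc (r k)) (R (r k) i)) i" for k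
    proof -
      have "f (pt (Suc (r k)) (R (r k) i)) i \<in> {0..1}" by (rule maps) (fact 2, fact i)
      then show ?thesis using lR[OF i, of "r k"] by (auto simp: label_def pt_def split: if_splits)
    qed
    ultimately show "x i \<le> f x i" using 1[OF i] by (intro LIMSEQ_le) auto
  qed
  then show ?thesis using xr by blast
qed

text \<open>If \<open>P\<close> has no zero in the ball of radius \<open>M\<close>, then y |-> - M
  P(y) / |P(y)| is continuous from the ball to its sphere. A fixed point has norm \<open>M\<close>
  and satisfies P(y) = - c y with c = |P(y)| / M.\<close>

lemma leray_schauder_nat:
  fixes P :: "(nat \<Rightarrow> real) \<Rightarrow> nat \<Rightarrow> real"
  assumes cont: "\<And>X x i. (\<And>j. j < n \<Longrightarrow> (\<lambda>k. X k j) \<longlonglongrightarrow> x j) \<Longrightarrow> i < n \<Longrightarrow> (\<lambda>k. P (X k) i) \<longlonglongrightarrow> P x i"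
    and M: "M > 0"
  shows "\<exists>x c. c \<ge> 0 \<and> (\<Sum>i<n. (x i)\<^sup>2) \<le> M\<^sup>2 \<and> (c = 0 \<or> (\<Sum>i<n. (x i)\<^sup>2) = M\<^sup>2) \<and> (\<forall>i<n. P x i + c * x i = 0)"
proof (cases "\<exists>x. (\<Sum>i<n. (x i)\<^sup>2) \<le> M\<^sup>2 \<and> (\<forall>i<n. P x i = 0)")
  case True
  then obtain x where "(\<Sum>i<n. (x i)\<^sup>2) \<le> M\<^sup>2" "\<forall>i<n. P x i = 0" by blast
  then show ?thesis by (intro exI[of _ x] exI[of _ "0::real"]) simp
next
  case False
  define nrm :: "(nat \<Rightarrow> real) \<Rightarrow> real" where "nrm y = L2_set y {..<n}" for y
  define pj where "pj y i = y i * (M / max M (nrm y))" for y i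
  define g where "g t i = M * (2 * t i - 1)" for t :: "nat \<Rightarrow> real" and i
  define Z where "Z t = P (pj (g t))" for t
  \<comment> \<open>\<open>g\<close> carries the unit cube onto the cube of side 2 M around the
    ball, \<open>pj\<close> retracts radially onto the ball, and \<open>f\<close> is the normalised
    map written in cube coordinates. Its fixed points correspond to points of the sphere, where
    \<open>pj\<close> is the identity.\<close>
  define f where "f t i = (1 - Z t i / nrm (Z t)) / 2" for t i
  have nrm2: "(nrm y)\<^sup>2 = (\<Sum>i<n. (y i)\<^sup>2)" for y
    by (simp add: nrm_def L2_set_def sum_nonneg)
  have nrm0: "nrm y \<ge> 0" for y by (simp add: nrm_def)
  have "nrm (pj y) \<le> M" for y
  proof -
    have "nrm (pj y) = nrm y * (M / max M (nrm y))"
      unfolding nrm_def pj_def using M by (subst L2_set_left_distrib) (auto simp: nrm_def)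
    also have "\<dots> \<le> M" using M nrm0[of y] by (auto simp: max_def divide_simps)
    finally show ?thesis .
  qed
  then have "(\<Sum>i<n. (pj y i)\<^sup>2) \<le> M\<^sup>2" for y
    unfolding nrm2[symmetric] using nrm0 by (intro power_mono) auto
  with False have Znz: "\<exists>i<n. Z t i \<noteq> 0" for t
    unfolding Z_def by blast
  have nZ: "nrm (Z t) > 0" for t
  proof -
    obtain i where "i < n" "Z t i \<noteq> 0" using Znz by blast
    then have "(\<Sum>i<n. (Z t i)\<^sup>2) > 0" by (intro sum_pos2[of _ i]) auto
    then show ?thesis using nrm0[of "Z t"] nrm2[of "Z t"] by (cases "nrm (Z t) = 0") auto
  qed
  have comp: "\<bar>Z t i\<bar> \<le> nrm (Z t)" if "i < n" for t i
    unfolding nrm_def using member_le_L2_set[of "{..<n}" i "\<lambda>i. \<bar>Z t i\<bar>"] that by (simp add: L2_set_def)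
  have nrm_lim: "(\<lambda>k. nrm (X k)) \<longlonglongrightarrow> nrm x" if "\<And>j. j < n \<Longrightarrow> (\<lambda>k. X k j) \<longlonglongrightarrow> x j" for X x
    unfolding nrm_def L2_set_def using that by (intro tendsto_intros) auto
  have Zlim: "(\<lambda>k. Z (X k) i) \<longlonglongrightarrow> Z x i" if "\<And>j. j < n \<Longrightarrow> (\<lambda>k. X k j) \<longlonglongrightarrow> x j" "i < n" for X x i
  proof -
    have *: "(\<lambda>k. g (X k) j) \<longlonglongrightarrow> g x j" if "j < n" for j
      unfolding g_def using \<open>\<And>j. j < n \<Longrightarrow> (\<lambda>k. X k j) \<longlonglongrightarrow> x j\<close>[OF that] by (intro tendsto_intros)
    have "(\<lambda>k. pj (g (X k)) j) \<longlonglongrightarrow> pj (g x) j" if "j < n" for j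
      unfolding pj_def using * that M by (intro tendsto_intros nrm_lim) (auto simp: max_def)
    then show ?thesis unfolding Z_def using that(2) by (intro cont) auto
  qed
  have "\<exists>t. \<forall>i<n. t i \<in> {0..1} \<and> f t i = t i"
  proof (rule brouwer_unit_cube_nat)
    fix X and x :: "nat \<Rightarrow> real" and i assume "\<And>j. j < n \<Longrightarrow> (\<lambda>k. X k j) \<longlonglongrightarrow> x j" "i < n"
    then show "(\<lambda>k. f (X k) i) \<longlonglongrightarrow> f x i"
      unfolding f_def using nZ[of x] by (intro tendsto_intros nrm_lim Zlim) auto
  next
    fix x i assume "i < n"
    then show "f x i \<in> {0..1}" unfolding f_def using comp[of i x] nZ[of x] by (auto simp: field_simps)
  qed
  then obtain t where t: "\<And>i. i < n \<Longrightarrow> f t i = t i" by blast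
  define y where "y = g t"
  have y: "y i = - M * Z t i / nrm (Z t)" if "i < n" for i
  proof -
    have *: "2 * b - 1 = - a" if "(1 - a) / 2 = b" for a b :: real
      using that by auto
    have "2 * t i - 1 = - (Z t i / nrm (Z t))" by (rule *, rule t[OF that, unfolded f_def])
    then show ?thesis unfolding y_def g_def by simp
  qed
  have "(\<Sum>i<n. (y i)\<^sup>2) = (\<Sum>i<n. (M / nrm (Z t))\<^sup>2 * (Z t i)\<^sup>2)"
    by (intro sum.cong) (auto simp: y power_divide power_mult_distrib)
  also have "\<dots> = (M / nrm (Z t))\<^sup>2 * (nrm (Z t))\<^sup>2" by (simp add: nrm2 sum_distrib_left)
  also have "\<dots> = M\<^sup>2"
    unfolding power_mult_distrib[symmetric] using nZ[of t] by simp
  finally have yM: "(\<Sum>i<n. (y i)\<^sup>2) = M\<^sup>2" .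
  then have "nrm y = M" by (intro power2_eq_imp_eq[OF _ nrm0[of y] less_imp_le[OF M]]) (simp only: nrm2)
  then have "pj y = y" using M by (auto simp: pj_def)
  then have "Z t = P y" unfolding Z_def y_def[symmetric] by simp
  then have "P y i + (nrm (Z t) / M) * y i = 0" if "i < n" for i
  proof -
    have "nrm (Z t) / M * y i = - Z t i"
      unfolding y[OF that] using nZ[of t] M by simp
    then show ?thesis using \<open>Z t = P y\<close> by simp
  qed
  then have "\<forall>i<n. P y i + (nrm (Z t) / M) * y i = 0" by blast
  moreover have "nrm (Z t) / M \<ge> 0" using nrm0[of "Z t"] M by simp
  moreover note yM eq_refl[OF yM]
  ultimately show ?thesis by blast
qed

section \<open>Weak compactness in separable Hilbert spaces\<close>

text \<open>Gram--Schmidt without assuming independence: \<open>sgn 0 = 0\<close>, so dependent vectors give \<open>0\<close>.\<close>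

fun gs :: "(nat \<Rightarrow> 'a::real_inner) \<Rightarrow> nat \<Rightarrow> 'a" where
  "gs d n = sgn (d n - (\<Sum>i<n. inner (d n) (gs d i) *\<^sub>R gs d i))"

declare gs.simps [simp del]

lemma gs_unit_or_zero: "inner (gs d i) (gs d i) = (if gs d i = 0 then 0 else 1)"
  by (subst (1 2 3) gs.simps) (auto simp: sgn_div_norm norm_eq_sqrt_inner[symmetric] power2_norm_eq_inner[symmetric] power2_eq_square)

lemma gs_scale: "inner (gs d i) (gs d i) *\<^sub>R gs d i = gs d i"
  by (simp add: gs_unit_or_zero)

lemma gs_orthogonal_less: "i < j \<Longrightarrow> inner (gs d j) (gs d i) = 0"
proof (induction j arbitrary: i rule: less_induct)
  case (less j)
  have *: "inner (gs d k) (gs d i) = 0" if "k < j" "k \<noteq> i" for k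
    using less.IH[of k i] less.IH[of i k] that less.prems by (cases "i < k") (auto simp: inner_commute)
  have "inner (\<Sum>k<j. inner (d j) (gs d k) *\<^sub>R gs d k) (gs d i)
      = (\<Sum>k<j. if k = i then inner (d j) (gs d i) * inner (gs d i) (gs d i) else 0)"
    unfolding inner_sum_left by (intro sum.cong) (auto simp: *)
  also have "\<dots> = inner (d j) (inner (gs d i) (gs d i) *\<^sub>R gs d i)"
    using less.prems by simp
  finally have "inner (d j - (\<Sum>k<j. inner (d j) (gs d k) *\<^sub>R gs d k)) (gs d i) = 0"
    by (simp add: inner_diff_left gs_scale)
  then show ?case by (subst gs.simps) (simp add: sgn_div_norm)
qed

lemma gs_orthogonal: "i \<noteq> j \<Longrightarrow> inner (gs d i) (gs d j) = 0"
  using gs_orthogonal_less[of i j d] gs_orthogonal_less[of j i d] by (cases "i < j") (auto simp: inner_commute)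

text \<open>The residual equals its norm times \<open>gs d n\<close> also when it is zero. Hence the
  span is preserved although dependent vectors are not discarded.\<close>

lemma gs_expand: "d n = (\<Sum>i\<le>n. inner (d n) (gs d i) *\<^sub>R gs d i)"
proof -
  define \<rho> where "\<rho> = d n - (\<Sum>i<n. inner (d n) (gs d i) *\<^sub>R gs d i)"
  have e: "gs d n = sgn \<rho>" by (subst gs.simps) (simp add: \<rho>_def)
  have "inner (\<Sum>i<n. inner (d n) (gs d i) *\<^sub>R gs d i) (gs d n) = 0"
    unfolding inner_sum_left by (intro sum.neutral) (auto simp: gs_orthogonal)
  then have "inner (d n) (gs d n) = inner \<rho> (gs d n)" by (simp add: \<rho>_def inner_diff_left)
  also have "\<dots> = norm \<rho>"
    by (cases "\<rho> = 0") (auto simp: e sgn_div_norm power2_norm_eq_inner[symmetric] power2_eq_square)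
  finally have "inner (d n) (gs d n) *\<^sub>R gs d n = \<rho>" by (cases "\<rho> = 0") (auto simp: e sgn_div_norm)
  then show ?thesis by (simp add: \<rho>_def lessThan_Suc_atMost[symmetric])
qed

lemma gs_in_subspace:
  assumes "subspace S" "\<And>n. d n \<in> S"
  shows "gs d n \<in> S"
proof (induction n rule: less_induct)
  case (less n)
  have "d n - (\<Sum>i<n. inner (d n) (gs d i) *\<^sub>R gs d i) \<in> S"
    using assms less by (intro subspace_diff subspace_sum subspace_scale) auto
  then show ?case by (subst gs.simps) (simp add: sgn_div_norm assms subspace_scale)
qed

lemma gs_pythagoras:
  "finite I \<Longrightarrow> (norm (\<Sum>i\<in>I. c i *\<^sub>R gs d i))\<^sup>2 = (\<Sum>i\<in>I. (c i)\<^sup>2 * inner (gs d i) (gs d i))"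
  by (subst norm_sum_Pythagorean)
     (auto simp: pairwise_def orthogonal_def gs_orthogonal power_mult_distrib power2_norm_eq_inner[symmetric])

lemma gs_bessel: "(\<Sum>i<m. (inner x (gs d i))\<^sup>2) \<le> (norm x)\<^sup>2"
proof -
  define s where "s = (\<Sum>i<m. inner x (gs d i) *\<^sub>R gs d i)"
  have c1: "(inner x (gs d i))\<^sup>2 * inner (gs d i) (gs d i) = (inner x (gs d i))\<^sup>2" for i
    by (simp add: gs_unit_or_zero)
  have ss: "(norm s)\<^sup>2 = (\<Sum>i<m. (inner x (gs d i))\<^sup>2)"
    unfolding s_def gs_pythagoras[OF finite_lessThan] c1 ..
  have xs: "inner x s = (\<Sum>i<m. (inner x (gs d i))\<^sup>2)"
    by (simp add: s_def inner_sum_right power2_eq_square)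
  have "0 \<le> (norm (x - s))\<^sup>2" by simp
  also have "\<dots> = (norm x)\<^sup>2 - (norm s)\<^sup>2"
    unfolding power2_norm_eq_inner using xs ss by (simp add: inner_diff_left inner_diff_right inner_commute power2_norm_eq_inner)
  finally show ?thesis using ss by simp
qed

text \<open>Pythagoras makes the partial sums Cauchy as soon as the squares are summable. The
  condition \<open>c0\<close> is forced: the coefficient of any vector at a vanishing Gram-Schmidt
  vector is 0.\<close>

lemma gs_riesz_fischer:
  fixes d :: "nat \<Rightarrow> 'a::{real_inner,banach}"
  assumes S: "subspace S" "closed S" "\<And>n. d n \<in> S"
    and B: "\<And>m. (\<Sum>i<m. (c i)\<^sup>2) \<le> B" and c0: "\<And>i. gs d i = 0 \<Longrightarrow> c i = 0"
  shows "\<exists>x\<in>S. (\<forall>i. inner x (gs d i) = c i) \<and> (\<lambda>i. c i *\<^sub>R gs d i) sums x"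
proof -
  have c1: "(c i)\<^sup>2 * inner (gs d i) (gs d i) = (c i)\<^sup>2" for i
    using c0[of i] by (auto simp: gs_unit_or_zero)
  have "summable (\<lambda>i. (c i)\<^sup>2)"
    by (rule summableI_nonneg_bounded[of _ B]) (auto simp: B)
  then have "summable (\<lambda>i. c i *\<^sub>R gs d i)"
    unfolding summable_Cauchy
  proof (intro allI impI)
    fix e :: real assume *: "\<forall>e>0. \<exists>N. \<forall>m\<ge>N. \<forall>n. norm (\<Sum>i\<in>{m..<n}. (c i)\<^sup>2) < e" and "e > 0"
    then obtain N where N: "\<And>m n. m \<ge> N \<Longrightarrow> norm (\<Sum>i\<in>{m..<n}. (c i)\<^sup>2) < e\<^sup>2" by (meson zero_less_power)
    have "norm (\<Sum>i\<in>{m..<n}. c i *\<^sub>R gs d i) < e" if "m \<ge> N" for m n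
    proof (rule power2_less_imp_less)
      show "(norm (\<Sum>i\<in>{m..<n}. c i *\<^sub>R gs d i))\<^sup>2 < e\<^sup>2"
        unfolding gs_pythagoras[OF finite_atLeastLessThan] c1 using N[OF that, of n] by (simp add: sum_nonneg)
    qed (use \<open>e > 0\<close> in auto)
    then show "\<exists>N. \<forall>m\<ge>N. \<forall>n. norm (\<Sum>i\<in>{m..<n}. c i *\<^sub>R gs d i) < e" by blast
  qed
  then obtain x where x: "(\<lambda>i. c i *\<^sub>R gs d i) sums x" by (auto simp: summable_def)
  have "x \<in> S"
  proof (rule closed_sequentially[OF S(2)])
    show "(\<lambda>n. \<Sum>i<n. c i *\<^sub>R gs d i) \<longlonglongrightarrow> x" using x by (simp add: sums_def)
    show "(\<Sum>i<n. c i *\<^sub>R gs d i) \<in> S" for n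
      by (intro subspace_sum S(1) subspace_scale gs_in_subspace S(3))
  qed
  moreover have "inner x (gs d j) = c j" for j
  proof -
    have "(\<lambda>i. inner (c i *\<^sub>R gs d i) (gs d j)) sums inner x (gs d j)"
      by (rule bounded_linear.sums[OF bounded_linear_inner_left x])
    moreover have "(\<lambda>i. inner (c i *\<^sub>R gs d i) (gs d j)) = (\<lambda>i. if i = j then c j else 0)"
      using c0[of j] by (auto simp: gs_orthogonal gs_unit_or_zero)
    ultimately show ?thesis using sums_unique2[OF _ sums_single[of j "\<lambda>_. c j"]] by auto
  qed
  ultimately show ?thesis using x by blast
qed

text \<open>The functional is required to be linear and bounded on \<open>S\<close> only, with the
  laws listed one by one, because it will be applied to the convective form, whose products of
  functions are controlled only for H1 fields.\<close>

lemma gs_total: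
  assumes "S \<subseteq> closure (range d)" "subspace S" "\<And>n. d n \<in> S"
    and lin: "\<And>y z. y \<in> S \<Longrightarrow> z \<in> S \<Longrightarrow> g (y + z) = g y + g z"
      "\<And>y c. y \<in> S \<Longrightarrow> g (c *\<^sub>R y) = c * g y"
    and bd: "\<And>y. y \<in> S \<Longrightarrow> \<bar>g y\<bar> \<le> K * norm y"
    and z: "\<And>i. g (gs d i) = (0::real)" and y: "y \<in> S"
  shows "g y = 0"
proof -
  have g0: "g 0 = 0" using lin(2)[OF y, of 0] by simp
  have gsS: "gs d i \<in> S" for i using assms by (intro gs_in_subspace)
  have sum0: "(\<Sum>i\<in>I. c i *\<^sub>R gs d i) \<in> S \<and> g (\<Sum>i\<in>I. c i *\<^sub>R gs d i) = 0" if "finite I" for I :: "nat set" and c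
    using that by induction (auto simp: g0 lin gsS z \<open>subspace S\<close> subspace_0 subspace_add subspace_scale)
  have gd: "g (d n) = 0" for n
    using sum0[of "{..n}" "\<lambda>i. inner (d n) (gs d i)"] gs_expand[of d n] by simp
  have "\<bar>g y\<bar> \<le> e" if "e > 0" for e
  proof -
    have "\<bar>K\<bar> + 1 > 0" by simp
    then have "e / (\<bar>K\<bar> + 1) > 0" using that by simp
    moreover have "y \<in> closure (range d)" using assms(1) y by blast
    ultimately obtain n where n: "dist (d n) y < e / (\<bar>K\<bar> + 1)"
      unfolding closure_approachable by blast
    have "y - d n \<in> S" using assms y by (auto intro: subspace_diff)
    have "g y = g (y - d n) + g (d n)"
      using lin(1)[OF \<open>y - d n \<in> S\<close> assms(3)[of n]] by simp
    then have "\<bar>g y\<bar> \<le> K * norm (y - d n)" using bd[OF \<open>y - d n \<in> S\<close>] gd by simp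
    also have "\<dots> \<le> (\<bar>K\<bar> + 1) * norm (y - d n)" by (intro mult_right_mono) auto
    also have "\<dots> \<le> e" using n by (simp add: dist_norm norm_minus_commute field_simps)
    finally show ?thesis .
  qed
  then have "\<bar>g y\<bar> \<le> 0" using field_le_epsilon[of "\<bar>g y\<bar>" 0] by simp
  then show ?thesis by simp
qed

lemma countable_dense_subspace:
  fixes S :: "'a::{real_inner,second_countable_topology} set"
  assumes "subspace S"
  shows "\<exists>d :: nat \<Rightarrow> 'a. (\<forall>n. d n \<in> S) \<and> S \<subseteq> closure (range d)"
proof -
  obtain T where T: "countable T" "T \<subseteq> S" "S \<subseteq> closure T"
    using separable by blast
  have "T \<noteq> {}" using T(3) subspace_0[OF assms] by auto
  then have "range (from_nat_into T) = T" using T(1) by (rule range_from_nat_into)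
  moreover have "from_nat_into T n \<in> S" for n using from_nat_into[OF \<open>T \<noteq> {}\<close>, of n] T(2) by blast
  ultimately show ?thesis using T(3) by (intro exI[of _ "from_nat_into T"]) simp
qed

text \<open>Riesz-Fischer applied to the coefficients of \<open>z\<close>. It allows weak
  convergence, once tested on \<open>S\<close>, to be tested against every vector of the
  space.\<close>

lemma orthogonal_projection_ex:
  fixes S :: "'a::{real_inner,banach,second_countable_topology} set"
  assumes S: "subspace S" "closed S"
  shows "\<exists>p\<in>S. \<forall>y\<in>S. inner p y = inner z y"
proof -
  obtain d :: "nat \<Rightarrow> 'a" where "(\<forall>n. d n \<in> S) \<and> S \<subseteq> closure (range d)"
    using countable_dense_subspace[OF S(1)] ..
  then have d: "\<And>n. d n \<in> S" "S \<subseteq> closure (range d)" by simp_all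
  obtain p where p: "p \<in> S" "\<And>i. inner p (gs d i) = inner z (gs d i)"
    using gs_riesz_fischer[of S d "\<lambda>i. inner z (gs d i)" "(norm z)\<^sup>2"] S d(1) gs_bessel[of z d] by auto
  have "inner p y - inner z y = 0" if "y \<in> S" for y
  proof (rule gs_total[where g="\<lambda>y. inner p y - inner z y" and K="norm (p - z)", OF d(2) S(1) d(1)])
    show "\<bar>inner p y - inner z y\<bar> \<le> norm (p - z) * norm y" for y
      using Cauchy_Schwarz_ineq2[of "p - z" y] by (simp add: inner_diff_left)
  qed (auto simp: that p inner_add_right algebra_simps)
  then show ?thesis using p(1) by auto
qed

text \<open>Boundedness is part of the notion, which replaces an appeal to the uniform boundedness
  principle.\<close>

definition weakly :: "(nat \<Rightarrow> 'a::real_inner) \<Rightarrow> 'a \<Rightarrow> bool" where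
  "weakly X x \<longleftrightarrow> (\<exists>B. \<forall>n. norm (X n) \<le> B) \<and> (\<forall>z. (\<lambda>n. inner (X n) z) \<longlonglongrightarrow> inner x z)"

lemma tendsto_imp_weakly:
  assumes "X \<longlonglongrightarrow> x" shows "weakly X x"
proof -
  have "Bseq X" using assms by (intro convergent_imp_Bseq convergentI)
  then have "\<exists>B. \<forall>n. norm (X n) \<le> B" by (auto simp: Bseq_def)
  then show ?thesis using assms by (auto simp: weakly_def intro: tendsto_inner)
qed

text \<open>A diagonal subsequence makes all Gram-Schmidt coefficients converge. Bessel's inequality
  survives the limit, so Riesz-Fischer produces the weak limit inside \<open>S\<close>; density and
  boundedness extend the convergence to all test vectors.\<close>

lemma weak_compactness:
  fixes S :: "'a::{real_inner,banach,second_countable_topology} set" and X :: "nat \<Rightarrow> 'a"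
  assumes S: "subspace S" "closed S" and X: "\<And>n. X n \<in> S" "\<And>n. norm (X n) \<le> B"
  shows "\<exists>r x. strict_mono r \<and> x \<in> S \<and> weakly (X \<circ> r) x"
proof -
  obtain d :: "nat \<Rightarrow> 'a" where "(\<forall>n. d n \<in> S) \<and> S \<subseteq> closure (range d)"
    using countable_dense_subspace[OF S(1)] ..
  then have d: "\<And>n. d n \<in> S" "S \<subseteq> closure (range d)" by simp_all
  have "\<bar>inner (X k) (gs d i)\<bar> \<le> B * norm (gs d i)" for k i
    using Cauchy_Schwarz_ineq2[of "X k" "gs d i"] mult_right_mono[OF X(2)[of k], of "norm (gs d i)"] by simp
  then obtain r c where r: "strict_mono r" and c: "\<And>i. (\<lambda>k. inner (X (r k)) (gs d i)) \<longlonglongrightarrow> c i"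
    using cube_limit_subseq[of "\<lambda>k i. inner (X k) (gs d i)" "\<lambda>i. B * norm (gs d i)"] by metis
  have "(\<Sum>i<m. (c i)\<^sup>2) \<le> B\<^sup>2" for m
  proof (rule LIMSEQ_le_const2)
    show "(\<lambda>k. \<Sum>i<m. (inner (X (r k)) (gs d i))\<^sup>2) \<longlonglongrightarrow> (\<Sum>i<m. (c i)\<^sup>2)"
      by (intro tendsto_intros c)
    have "(\<Sum>i<m. (inner (X (r k)) (gs d i))\<^sup>2) \<le> B\<^sup>2" for k
      using gs_bessel[of "X (r k)" d m] power_mono[OF X(2)[of "r k"], of 2] by simp
    then show "\<exists>N. \<forall>n\<ge>N. (\<Sum>i<m. (inner (X (r n)) (gs d i))\<^sup>2) \<le> B\<^sup>2" by blast
  qed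
  moreover have "c i = 0" if "gs d i = 0" for i
    using LIMSEQ_unique[OF c[of i], of 0] that by simp
  ultimately obtain x where x: "x \<in> S" "\<And>i. inner x (gs d i) = c i"
    using gs_riesz_fischer[of S d c "B\<^sup>2"] S d(1) by blast
  have conv: "(\<lambda>k. inner (X (r k)) y) \<longlonglongrightarrow> inner x y" if y: "y \<in> S" for y
  proof -
    have "B \<ge> 0" using X(2)[of 0] norm_ge_zero order_trans by blast
    have bound: "\<bar>inner (X (r k) - x) y\<bar> \<le> (B + norm x) * norm y" for k y
    proof -
      have "norm (X (r k) - x) \<le> B + norm x"
        using norm_triangle_ineq4[of "X (r k)" x] X(2)[of "r k"] by linarith
      then show ?thesis
        using Cauchy_Schwarz_ineq2[of "X (r k) - x" y] mult_right_mono[of "norm (X (r k) - x)" "B + norm x" "norm y"] by simp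
    qed
    have fin: "(\<lambda>k. inner (X (r k) - x) (\<Sum>i\<in>I. a i *\<^sub>R gs d i)) \<longlonglongrightarrow> 0" if "finite I" for I a
    proof -
      have "(\<lambda>k. inner (X (r k) - x) (gs d i)) \<longlonglongrightarrow> 0" for i
        using tendsto_diff[OF c[of i] tendsto_const[of "c i"]] by (simp add: inner_diff_left x)
      then have "(\<lambda>k. \<Sum>i\<in>I. a i * inner (X (r k) - x) (gs d i)) \<longlonglongrightarrow> (\<Sum>i\<in>I. a i * 0)"
        by (intro tendsto_intros)
      then show ?thesis by (simp add: inner_sum_right)
    qed
    have "(\<lambda>k. inner (X (r k) - x) y) \<longlonglongrightarrow> 0"
    proof (rule LIMSEQ_I)
      fix e :: real assume "e > 0"
      define K where "K = B + norm x + 1"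
      have K: "K > 0" using \<open>B \<ge> 0\<close> by (simp add: K_def add_nonneg_pos)
      have "y \<in> closure (range d)" using d(2) y by blast
      moreover have "e / 2 / K > 0" using \<open>e > 0\<close> K by simp
      ultimately obtain n where n: "dist (d n) y < e / 2 / K"
        unfolding closure_approachable by blast
      have "(\<lambda>k. inner (X (r k) - x) (d n)) \<longlonglongrightarrow> 0"
        using fin[of "{..n}" "\<lambda>i. inner (d n) (gs d i)"] gs_expand[of d n] by simp
      then obtain N where N: "\<And>k. k \<ge> N \<Longrightarrow> \<bar>inner (X (r k) - x) (d n)\<bar> < e / 2"
        using LIMSEQ_D[of _ 0 "e/2"] \<open>e > 0\<close> by force
      have "norm (inner (X (r k) - x) y - 0) < e" if "k \<ge> N" for k
      proof -
        have "\<bar>inner (X (r k) - x) (y - d n)\<bar> \<le> (B + norm x) * norm (y - d n)" by (rule bound)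
        also have "\<dots> \<le> K * norm (y - d n)" by (intro mult_right_mono) (auto simp: K_def)
        also have "\<dots> \<le> e / 2" using n K by (simp add: dist_norm norm_minus_commute field_simps)
        finally have "\<bar>inner (X (r k) - x) (y - d n)\<bar> \<le> e / 2" .
        moreover have "inner (X (r k) - x) y = inner (X (r k) - x) (y - d n) + inner (X (r k) - x) (d n)"
          by (simp add: inner_diff_right)
        ultimately show ?thesis using N[OF that] by simp
      qed
      then show "\<exists>N. \<forall>k\<ge>N. norm (inner (X (r k) - x) y - 0) < e" by blast
    qed
    from tendsto_add[OF this tendsto_const[of "inner x y"]] show ?thesis by (simp add: inner_diff_left)
  qed
  have "(\<lambda>k. inner (X (r k)) z) \<longlonglongrightarrow> inner x z" for z
  proof -
    obtain p where p: "p \<in> S" "\<And>y. y \<in> S \<Longrightarrow> inner p y = inner z y"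
      using orthogonal_projection_ex[OF S, of z] by blast
    have "inner y z = inner y p" if "y \<in> S" for y
      using p(2)[OF that] by (simp add: inner_commute)
    then show ?thesis using conv[OF p(1)] X(1) x(1) by simp
  qed
  then have "weakly (X \<circ> r) x" unfolding weakly_def using X(2) by auto
  then show ?thesis using r x(1) by blast
qed

section \<open>Leray's existence argument\<close>

text \<open>\<open>b x y\<close> is quadratic in \<open>x\<close> and linear in \<open>y\<close>,
  the shape of a convection term tested with \<open>y\<close>. \<open>l_weak2\<close> expresses that
  the indefinite quadratic form of \<open>l\<close> is compact, so it keeps its value in the weak
  limit, whereas \<open>A\<close> is only bounded below. \<open>euler\<close> is the fact that
  refutes blow-up: a blow-up limit is annihilated by \<open>b\<close> against all of
  \<open>S\<close>, and then \<open>l\<close> cannot balance the coercivity of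
  \<open>A\<close>.\<close>

theorem galerkin_leray:
  fixes S :: "'a::{real_inner,banach,second_countable_topology} set"
  assumes S: "subspace S" "closed S"
    and A: "bounded_bilinear A" and l: "bounded_bilinear l" and f: "bounded_linear f"
    and coercive: "\<alpha> > 0" "\<And>x. x \<in> S \<Longrightarrow> A x x \<ge> \<alpha> * (norm x)\<^sup>2"
    and b_add: "\<And>x y z. x \<in> S \<Longrightarrow> y \<in> S \<Longrightarrow> z \<in> S \<Longrightarrow> b x (y + z) = b x y + b x z"
    and b_scale: "\<And>x y c. x \<in> S \<Longrightarrow> y \<in> S \<Longrightarrow> b x (c *\<^sub>R y) = c * b x y"
    and b_quad: "\<And>x y c. x \<in> S \<Longrightarrow> y \<in> S \<Longrightarrow> b (c *\<^sub>R x) y = c\<^sup>2 * b x y"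
    and b_bound: "\<And>x y. x \<in> S \<Longrightarrow> y \<in> S \<Longrightarrow> \<bar>b x y\<bar> \<le> Kb * (norm x)\<^sup>2 * norm y"
    and b_diag: "\<And>x. x \<in> S \<Longrightarrow> b x x = 0"
    and A_weak: "\<And>X x y. (\<And>n. X n \<in> S) \<Longrightarrow> x \<in> S \<Longrightarrow> y \<in> S \<Longrightarrow> weakly X x \<Longrightarrow> (\<lambda>n. A (X n) y) \<longlonglongrightarrow> A x y"
    and l_weak: "\<And>X x y. (\<And>n. X n \<in> S) \<Longrightarrow> x \<in> S \<Longrightarrow> y \<in> S \<Longrightarrow> weakly X x \<Longrightarrow> (\<lambda>n. l (X n) y) \<longlonglongrightarrow> l x y"
    and l_weak2: "\<And>X x. (\<And>n. X n \<in> S) \<Longrightarrow> x \<in> S \<Longrightarrow> weakly X x \<Longrightarrow> (\<lambda>n. l (X n) (X n)) \<longlonglongrightarrow> l x x"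
    and b_weak: "\<And>X x y. (\<And>n. X n \<in> S) \<Longrightarrow> x \<in> S \<Longrightarrow> y \<in> S \<Longrightarrow> weakly X x \<Longrightarrow> (\<lambda>n. b (X n) y) \<longlonglongrightarrow> b x y"
    and euler: "\<And>x. x \<in> S \<Longrightarrow> (\<And>y. y \<in> S \<Longrightarrow> b x y = 0) \<Longrightarrow> l x x = 0"
  shows "\<exists>x\<in>S. \<forall>y\<in>S. A x y + b x y + l x y + f y = 0"
proof -
  interpret A: bounded_bilinear A by fact
  interpret l: bounded_bilinear l by fact
  interpret f: bounded_linear f by fact
  obtain d :: "nat \<Rightarrow> 'a" where "(\<forall>n. d n \<in> S) \<and> S \<subseteq> closure (range d)"
    using countable_dense_subspace[OF S(1)] ..
  then have d: "\<And>n. d n \<in> S" "S \<subseteq> closure (range d)" by simp_all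
  define e where "e = gs d"
  have eS: "e n \<in> S" for n unfolding e_def using S(1) d(1) by (rule gs_in_subspace)
  define T where "T x y = A x y + b x y + l x y + f y" for x y
  have T_add: "T x (y + z) = T x y + T x z" if "x \<in> S" "y \<in> S" "z \<in> S" for x y z
    using that by (simp add: T_def A.add_right l.add_right f.add b_add)
  have T_scale: "T x (c *\<^sub>R y) = c * T x y" if "x \<in> S" "y \<in> S" for x y c
    using that by (simp add: T_def A.scaleR_right l.scaleR_right f.scaleR b_scale algebra_simps)
  have T_zero: "T x 0 = 0" if "x \<in> S" for x
    using T_scale[OF that that, of 0] by simp
  have T_weak: "(\<lambda>n. T (X n) y) \<longlonglongrightarrow> T x y"
    if "\<And>n. X n \<in> S" "x \<in> S" "y \<in> S" "weakly X x" for X x y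
    unfolding T_def using that by (intro tendsto_intros A_weak l_weak b_weak) auto
  have sumS: "(\<Sum>i<n. t i *\<^sub>R e i) \<in> S" for n :: nat and t
    by (intro subspace_sum S(1) subspace_scale eS)
  have sum_e: "inner (\<Sum>j<n. t j *\<^sub>R e j) (e i) = t i * inner (e i) (e i)" if "i < n" for n i :: nat and t
  proof -
    have "inner (\<Sum>j<n. t j *\<^sub>R e j) (e i) = (\<Sum>j<n. if j = i then t i * inner (e i) (e i) else 0)"
      unfolding inner_sum_left by (intro sum.cong) (auto simp: e_def gs_orthogonal)
    then show ?thesis using that by simp
  qed
  have T_sum: "T x (\<Sum>i<n. t i *\<^sub>R e i) = (\<Sum>i<n. t i * T x (e i))" if "x \<in> S" for x t and n :: nat
    by (induction n) (simp_all add: T_zero T_add T_scale that sumS eS S(1) subspace_scale)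
  \<comment> \<open>The n-th problem has dimension n and radius n + 1, which is positive also for n
    = 0. Besides the Galerkin equations the energy identity is recorded, obtained by testing with
    the solution itself.\<close>
  have "\<exists>x c. x \<in> S \<and> c \<ge> 0 \<and> norm x \<le> real n + 1 \<and> (c = 0 \<or> norm x = real n + 1) \<and>
      (\<forall>i<n. T x (e i) + c * inner x (e i) = 0) \<and> T x x + c * (norm x)\<^sup>2 = 0" for n
  proof -
    define xt where "xt t = (\<Sum>j<n. t j *\<^sub>R e j)" for t
    have xtS: "xt t \<in> S" for t unfolding xt_def by (rule sumS)
    obtain t c where t: "c \<ge> 0" "(\<Sum>i<n. (t i)\<^sup>2) \<le> (real n + 1)\<^sup>2"
      "c = 0 \<or> (\<Sum>i<n. (t i)\<^sup>2) = (real n + 1)\<^sup>2" "\<And>i. i < n \<Longrightarrow> T (xt t) (e i) + c * t i = 0"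
    proof -
      have "\<exists>t c. c \<ge> 0 \<and> (\<Sum>i<n. (t i)\<^sup>2) \<le> (real n + 1)\<^sup>2 \<and> (c = 0 \<or> (\<Sum>i<n. (t i)\<^sup>2) = (real n + 1)\<^sup>2)
          \<and> (\<forall>i<n. T (xt t) (e i) + c * t i = 0)"
      proof (rule leray_schauder_nat)
        fix X and x :: "nat \<Rightarrow> real" and i
        assume "\<And>j. j < n \<Longrightarrow> (\<lambda>k. X k j) \<longlonglongrightarrow> x j"
        then have "(\<lambda>k. xt (X k)) \<longlonglongrightarrow> xt x" unfolding xt_def by (intro tendsto_intros) auto
        then show "(\<lambda>k. T (xt (X k)) (e i)) \<longlonglongrightarrow> T (xt x) (e i)"
          by (intro T_weak xtS eS tendsto_imp_weakly)
      qed auto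
      then show ?thesis using that by blast
    qed
    \<comment> \<open>The finite-dimensional lemma produces c times the coefficient, the Hilbert
      space needs c times the inner product. They differ only where \<open>e i = 0\<close>; there
      the equation of index \<open>i\<close> reads c t_i = 0, so both vanish.\<close>
    have ct: "c * t i = c * inner (xt t) (e i)" if "i < n" for i
    proof (cases "e i = 0")
      case True
      then show ?thesis using t(4)[OF that] T_zero[OF xtS] by simp
    next
      case False
      then show ?thesis using sum_e[OF that, of t] gs_unit_or_zero[of d i] by (simp add: xt_def e_def)
    qed
    have ni: "(t i)\<^sup>2 * inner (e i) (e i) \<le> (t i)\<^sup>2" for i
      by (auto simp: e_def gs_unit_or_zero)
    have nx: "(norm (xt t))\<^sup>2 = (\<Sum>i<n. (t i)\<^sup>2 * inner (e i) (e i))"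
      unfolding xt_def e_def by (rule gs_pythagoras) simp
    have "(norm (xt t))\<^sup>2 \<le> (real n + 1)\<^sup>2"
      unfolding nx using sum_mono[of "{..<n}" "\<lambda>i. (t i)\<^sup>2 * inner (e i) (e i)" "\<lambda>i. (t i)\<^sup>2"] ni t(2) by fastforce
    then have n1: "norm (xt t) \<le> real n + 1" by (rule power2_le_imp_le) simp
    \<comment> \<open>For c \<noteq> 0 the previous fact makes the coefficients at vanishing
      \<open>e i\<close> zero, so the norm of the coefficients is the norm of the vector.\<close>
    have n2: "c = 0 \<or> norm (xt t) = real n + 1"
    proof (cases "c = 0")
      case False
      have "(t i)\<^sup>2 * inner (e i) (e i) = (t i)\<^sup>2" if "i < n" for i
        using ct[OF that] False gs_unit_or_zero[of d i] by (auto simp: e_def)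
      then have "(norm (xt t))\<^sup>2 = (\<Sum>i<n. (t i)\<^sup>2)" unfolding nx by (intro sum.cong) auto
      then have "(norm (xt t))\<^sup>2 = (real n + 1)\<^sup>2" using t(3) False by simp
      then have "norm (xt t) = real n + 1" by (rule power2_eq_imp_eq) auto
      then show ?thesis ..
    qed simp
    have eq: "T (xt t) (e i) + c * inner (xt t) (e i) = 0" if "i < n" for i
      using t(4)[OF that] ct[OF that] by simp
    have "T (xt t) (xt t) = (\<Sum>i<n. t i * T (xt t) (e i))"
      using T_sum[OF xtS, where n=n and t=t] by (simp add: xt_def)
    also have "\<dots> = (\<Sum>i<n. - c * (t i * inner (xt t) (e i)))"
    proof (intro sum.cong refl)
      fix i assume "i \<in> {..<n}"
      then have *: "T (xt t) (e i) = - (c * inner (xt t) (e i))" using eq[of i] by (simp add: eq_neg_iff_add_eq_0)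
      show "t i * T (xt t) (e i) = - c * (t i * inner (xt t) (e i))" unfolding * by simp
    qed
    also have "\<dots> = - c * inner (xt t) (xt t)"
      by (subst (3) xt_def) (simp add: inner_sum_right sum_distrib_left)
    finally have "T (xt t) (xt t) + c * (norm (xt t))\<^sup>2 = 0" by (simp add: power2_norm_eq_inner)
    then show ?thesis using xtS t(1) n1 n2 eq by blast
  qed
  then obtain x c where xS: "\<And>n. x n \<in> S" and c0: "\<And>n. c n \<ge> 0"
    and cx: "\<And>n. c n = 0 \<or> norm (x n) = real n + 1"
    and eq: "\<And>n i. i < n \<Longrightarrow> T (x n) (e i) + c n * inner (x n) (e i) = 0"
    and energy: "\<And>n. T (x n) (x n) + c n * (norm (x n))\<^sup>2 = 0" by metis
  have "\<exists>K N. \<forall>n\<ge>N. norm (x n) \<le> K"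
  proof (rule ccontr)
    assume "\<not> ?thesis"
    then have "\<forall>k. \<exists>n\<ge>k. norm (x n) > real k + 1" by (meson not_le)
    then obtain r where r: "\<And>k. r k \<ge> k" "\<And>k. norm (x (r k)) > real k + 1" by metis
    define g where "g k = (1 / norm (x (r k))) *\<^sub>R x (r k)" for k
    have rn0: "norm (x (r k)) \<noteq> 0" for k using r(2)[of k] by linarith
    have "norm (g k) = 1" for k
      unfolding g_def using rn0[of k] by (simp only: norm_scaleR) simp
    moreover have gS: "g k \<in> S" for k by (simp add: g_def S(1) subspace_scale xS)
    ultimately obtain s h where s: "strict_mono s" "h \<in> S" "weakly (g \<circ> s) h"
      using weak_compactness[OF S, of g 1] by auto
    define q where "q k = r (s k)" for k
    define m where "m k = norm (x (q k))" for k
    define G where "G k = g (s k)" for k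
    have GS: "G k \<in> S" for k by (simp add: G_def gS)
    have Gn: "norm (G k) = 1" for k by (simp add: G_def \<open>\<And>k. norm (g k) = 1\<close>)
    have qk: "q k \<ge> k" for k
      using r(1)[of "s k"] seq_suble[OF s(1), of k] by (simp add: q_def)
    have mk: "m k > real k + 1" for k
      using r(2)[of "s k"] seq_suble[OF s(1), of k] by (simp add: m_def q_def)
    have m0: "m k > 0" for k using mk[of k] by linarith
    have xq: "x (q k) = m k *\<^sub>R G k" for k
      using rn0[of "s k"] by (simp add: m_def G_def g_def q_def)
    have weakG: "weakly G h" using s(3) by (simp add: G_def[abs_def] o_def)
    have minv: "(\<lambda>k. 1 / m k) \<longlonglongrightarrow> 0"
    proof (rule Lim_null_comparison[OF always_eventually LIMSEQ_inverse_real_of_nat], rule allI)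
      fix k show "norm (1 / m k) \<le> inverse (real (Suc k))"
        using mk[of k] m0[of k] by (simp add: field_simps)
    qed
    have lim_l: "(\<lambda>k. l (G k) (G k)) \<longlonglongrightarrow> l h h" using GS s(2) weakG by (rule l_weak2)
    obtain Kf where Kf: "\<And>y. \<bar>f y\<bar> \<le> Kf * norm y" using f.bounded by (auto simp: mult.commute)
    have lim_f: "(\<lambda>k. f (G k) * (1 / m k)) \<longlonglongrightarrow> 0"
    proof (rule Lim_null_comparison[OF always_eventually])
      have "norm (f (G k) * (1 / m k)) \<le> Kf * (1 / m k)" for k
        using mult_right_mono[of "\<bar>f (G k)\<bar>" Kf "1 / m k"] Kf[of "G k"] Gn[of k] m0[of k] by (simp add: abs_mult)
      then show "\<forall>k. norm (f (G k) * (1 / m k)) \<le> Kf * (1 / m k)" ..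
      show "(\<lambda>k. Kf * (1 / m k)) \<longlonglongrightarrow> 0" using tendsto_mult[OF tendsto_const minv, of Kf] by simp
    qed
    have en: "A (G k) (G k) + l (G k) (G k) + f (G k) * (1 / m k) + c (q k) = 0" for k
    proof -
      have "A (x (q k)) (x (q k)) + l (x (q k)) (x (q k)) + f (x (q k)) + c (q k) * (m k)\<^sup>2 = 0"
        using energy[of "q k"] b_diag[OF xS[of "q k"]] by (simp add: T_def m_def)
      then have "(m k)\<^sup>2 * A (G k) (G k) + (m k)\<^sup>2 * l (G k) (G k) + m k * f (G k) + c (q k) * (m k)\<^sup>2 = 0"
        by (simp add: xq A.scaleR_left A.scaleR_right l.scaleR_left l.scaleR_right f.scaleR power2_eq_square algebra_simps)
      then have "(m k)\<^sup>2 * (A (G k) (G k) + l (G k) (G k) + f (G k) * (1 / m k) + c (q k)) = 0"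
        using m0[of k] by (simp add: algebra_simps power2_eq_square)
      then show ?thesis using m0[of k] by simp
    qed
    have Al: "\<alpha> \<le> A (G k) (G k)" for k using coercive(2)[OF GS[of k]] Gn[of k] by simp
    \<comment> \<open>The energy identity divided by the squared norm is used twice: it bounds the
      multipliers, so that their contribution to the rescaled equations fades, and with c \<ge> 0
      dropped it gives \<alpha> \<le> - l h h in the limit.\<close>
    have up: "c (q k) + \<alpha> \<le> - l (G k) (G k) - f (G k) * (1 / m k)" for k
      using en[of k] Al[of k] by linarith
    have lim_up: "(\<lambda>k. - l (G k) (G k) - f (G k) * (1 / m k)) \<longlonglongrightarrow> - l h h - 0"
      by (intro tendsto_intros lim_l lim_f)
    then have "Bseq (\<lambda>k. - l (G k) (G k) - f (G k) * (1 / m k))"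
      by (intro convergent_imp_Bseq convergentI)
    then obtain C where C: "\<And>k. \<bar>- l (G k) (G k) - f (G k) * (1 / m k)\<bar> \<le> C"
      unfolding Bseq_def by auto
    have cC: "c (q k) \<le> C" for k using up[of k] C[of k] coercive(1) by linarith
    have lim_C: "(\<lambda>k. c (q k) * inner (G k) (e i) * (1 / m k)) \<longlonglongrightarrow> 0" for i
    proof (rule Lim_null_comparison[OF always_eventually])
      have "\<bar>c (q k) * inner (G k) (e i) * (1 / m k)\<bar> \<le> C * norm (e i) * (1 / m k)" for k
      proof -
        have "\<bar>inner (G k) (e i)\<bar> \<le> norm (e i)" using Cauchy_Schwarz_ineq2[of "G k" "e i"] Gn by simp
        then have "c (q k) * \<bar>inner (G k) (e i)\<bar> \<le> C * norm (e i)"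
          using cC[of k] c0[of "q k"] by (intro mult_mono) auto
        then have "c (q k) * \<bar>inner (G k) (e i)\<bar> * (1 / m k) \<le> C * norm (e i) * (1 / m k)"
          using m0[of k] by (intro mult_right_mono) auto
        then show ?thesis using c0[of "q k"] m0[of k] by (simp add: abs_mult)
      qed
      then show "\<forall>k. norm (c (q k) * inner (G k) (e i) * (1 / m k)) \<le> C * norm (e i) * (1 / m k)" by simp
      show "(\<lambda>k. C * norm (e i) * (1 / m k)) \<longlonglongrightarrow> 0"
        using tendsto_mult[OF tendsto_const minv, of "C * norm (e i)"] by simp
    qed
    \<comment> \<open>The equations are divided by the squared norm \<open>m k\<close>^2. Every term
      except the quadratic one then carries a factor 1 / m, so only \<open>b\<close> remains in the
      limit.\<close>
    have bh: "b h (e i) = 0" for i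
    proof -
      have eqG: "b (G k) (e i) = - (A (G k) (e i) * (1 / m k)) - l (G k) (e i) * (1 / m k)
          - f (e i) * (1 / m k) * (1 / m k) - c (q k) * inner (G k) (e i) * (1 / m k)" if "k > i" for k
      proof -
        have "i < q k" using that qk[of k] by linarith
        from eq[OF this] have "m k * A (G k) (e i) + (m k)\<^sup>2 * b (G k) (e i) + m k * l (G k) (e i) + f (e i)
            + c (q k) * (m k * inner (G k) (e i)) = 0"
          by (simp add: xq T_def A.scaleR_left l.scaleR_left b_quad GS eS)
        then have "(m k)\<^sup>2 * b (G k) (e i) = (m k)\<^sup>2 * (- (A (G k) (e i) * (1 / m k)) - l (G k) (e i) * (1 / m k)
          - f (e i) * (1 / m k) * (1 / m k) - c (q k) * inner (G k) (e i) * (1 / m k))"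
          using m0[of k] by (simp add: algebra_simps power2_eq_square)
        then show ?thesis using m0[of k] by simp
      qed
      have "(\<lambda>k. - (A (G k) (e i) * (1 / m k)) - l (G k) (e i) * (1 / m k)
          - f (e i) * (1 / m k) * (1 / m k) - c (q k) * inner (G k) (e i) * (1 / m k))
          \<longlonglongrightarrow> - (A h (e i) * 0) - l h (e i) * 0 - f (e i) * 0 * 0 - 0"
        by (intro tendsto_intros minv lim_C A_weak l_weak GS s(2) eS weakG)
      then have "(\<lambda>k. - (A (G k) (e i) * (1 / m k)) - l (G k) (e i) * (1 / m k)
          - f (e i) * (1 / m k) * (1 / m k) - c (q k) * inner (G k) (e i) * (1 / m k)) \<longlonglongrightarrow> 0" by simp
      then have "(\<lambda>k. b (G k) (e i)) \<longlonglongrightarrow> 0"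
        by (rule Lim_transform_eventually)
           (use eqG in \<open>auto intro!: eventually_sequentiallyI[of "Suc i"] simp: Suc_le_eq\<close>)
      moreover have "(\<lambda>k. b (G k) (e i)) \<longlonglongrightarrow> b h (e i)" by (intro b_weak GS s(2) eS weakG)
      ultimately show ?thesis using LIMSEQ_unique by blast
    qed
    have "b h y = 0" if "y \<in> S" for y
      by (rule gs_total[where g="b h" and K="Kb * (norm h)\<^sup>2", OF d(2) S(1) d(1)])
         (use s(2) that b_add b_scale b_bound bh in \<open>auto simp: e_def\<close>)
    then have "l h h = 0" using euler[OF s(2)] by blast
    moreover have "\<alpha> \<le> - l (G k) (G k) - f (G k) * (1 / m k)" for k using up[of k] c0[of "q k"] by linarith
    then have "\<alpha> \<le> - l h h - 0"
      by (intro LIMSEQ_le_const[OF lim_up]) blast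
    ultimately show False using coercive(1) by simp
  qed
  then obtain K N where K: "\<And>n. n \<ge> N \<Longrightarrow> norm (x n) \<le> K" by blast
  \<comment> \<open>From this index on the radius n + 1 exceeds the bound \<open>K\<close>. The
    solutions then lie strictly inside the ball, and the multiplier is 0.\<close>
  define N' where "N' = max N (nat \<lceil>K\<rceil>)"
  have cz: "c (n + N') = 0" for n
  proof -
    have "norm (x (n + N')) \<le> K" by (intro K) (simp add: N'_def)
    also have "K < real (n + N') + 1" unfolding N'_def by linarith
    finally show ?thesis using cx[of "n + N'"] by auto
  qed
  have "norm (x (n + N')) \<le> K" for n by (intro K) (simp add: N'_def)
  then obtain s y where s: "strict_mono s" "y \<in> S" "weakly ((\<lambda>n. x (n + N')) \<circ> s) y"
    using weak_compactness[OF S, of "\<lambda>n. x (n + N')" K] xS by blast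
  have "T y (e i) = 0" for i
  proof -
    have lim: "(\<lambda>n. T (((\<lambda>n. x (n + N')) \<circ> s) n) (e i)) \<longlonglongrightarrow> T y (e i)"
      by (intro T_weak eS s(2,3)) (simp add: xS)
    have "T (((\<lambda>n. x (n + N')) \<circ> s) n) (e i) = 0" if "n > i" for n
      using eq[of i "s n + N'"] cz[of "s n"] that seq_suble[OF s(1), of n] by simp
    then have ev: "\<forall>\<^sub>F n in sequentially. T (((\<lambda>n. x (n + N')) \<circ> s) n) (e i) = 0"
      by (intro eventually_sequentiallyI[of "Suc i"]) (auto simp: Suc_le_eq)
    show ?thesis by (rule LIMSEQ_unique[OF lim tendsto_eventually[OF ev]])
  qed
  note Te = this
  obtain KA where KA: "\<And>a b. \<bar>A a b\<bar> \<le> norm a * norm b * KA" using A.bounded by auto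
  obtain Kl where Kl: "\<And>a b. \<bar>l a b\<bar> \<le> norm a * norm b * Kl" using l.bounded by auto
  obtain Kf where Kf: "\<And>y. \<bar>f y\<bar> \<le> norm y * Kf" using f.bounded by auto
  have "T y z = 0" if "z \<in> S" for z
  proof (rule gs_total[where g="T y" and K="norm y * KA + Kb * (norm y)\<^sup>2 + norm y * Kl + Kf", OF d(2) S(1) d(1)])
    show "\<bar>T y z\<bar> \<le> (norm y * KA + Kb * (norm y)\<^sup>2 + norm y * Kl + Kf) * norm z" if "z \<in> S" for z
    proof -
      have "\<bar>T y z\<bar> \<le> \<bar>A y z\<bar> + \<bar>b y z\<bar> + \<bar>l y z\<bar> + \<bar>f z\<bar>" unfolding T_def by linarith
      also have "\<dots> \<le> norm y * norm z * KA + Kb * (norm y)\<^sup>2 * norm z + norm y * norm z * Kl + norm z * Kf"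
        by (intro add_mono KA Kl Kf b_bound s(2) that)
      also have "\<dots> = (norm y * KA + Kb * (norm y)\<^sup>2 + norm y * Kl + Kf) * norm z"
        by (simp add: algebra_simps)
      finally show ?thesis .
    qed
    show "T y (gs d i) = 0" for i using Te by (simp add: e_def)
  qed (use that T_add[OF s(2)] T_scale[OF s(2)] in auto)
  then show ?thesis using s(2) unfolding T_def by blast
qed

section \<open>The Hilbert space of square integrable functions\<close>

definition sqint :: "(real \<times> real \<Rightarrow> real) \<Rightarrow> bool" where
  "sqint f \<longleftrightarrow> f \<in> borel_measurable lebesgue \<and> integrable lebesgue (\<lambda>x. (f x)\<^sup>2)"

lemma sqint_mult_integrable:
  assumes "sqint f" "sqint g"
  shows "integrable lebesgue (\<lambda>x. f x * g x)"
proof (rule Bochner_Integration.integrable_bound)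
  show "integrable lebesgue (\<lambda>x. (f x)\<^sup>2 + (g x)\<^sup>2)"
    using assms by (auto simp: sqint_def)
  show "(\<lambda>x. f x * g x) \<in> borel_measurable lebesgue"
    using assms by (auto simp: sqint_def)
  have "\<bar>a * b\<bar> \<le> a\<^sup>2 + b\<^sup>2" for a b :: real
    using sum_squares_bound[of "\<bar>a\<bar>" "\<bar>b\<bar>"] abs_ge_zero[of "a * b"]
    unfolding abs_mult power2_abs mult.assoc by linarith
  then show "AE x in lebesgue. norm (f x * g x) \<le> norm ((f x)\<^sup>2 + (g x)\<^sup>2)"
    by auto
qed

lemma sqint_cong_AE:
  assumes "sqint f" "g \<in> borel_measurable lebesgue" "AE x in lebesgue. g x = f x"
  shows "sqint g"
proof -
  have "integrable lebesgue (\<lambda>x. (g x)\<^sup>2) \<longleftrightarrow> integrable lebesgue (\<lambda>x. (f x)\<^sup>2)"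
    using assms by (intro integrable_cong_AE) (auto simp: sqint_def)
  then show ?thesis using assms by (auto simp: sqint_def)
qed

lemma sqint_zero [simp]: "sqint (\<lambda>x. 0)"
  by (simp add: sqint_def)

lemma sqint_add:
  assumes "sqint f" "sqint g" shows "sqint (\<lambda>x. f x + g x)"
proof -
  have "integrable lebesgue (\<lambda>x. (f x)\<^sup>2 + (g x)\<^sup>2 + 2 * (f x * g x))"
    using assms sqint_mult_integrable[OF assms] by (auto simp: sqint_def)
  also have "(\<lambda>x. (f x)\<^sup>2 + (g x)\<^sup>2 + 2 * (f x * g x)) = (\<lambda>x. (f x + g x)\<^sup>2)"
    by (auto simp: power2_sum)
  finally show ?thesis using assms by (auto simp: sqint_def)
qed

lemma sqint_scale: "sqint f \<Longrightarrow> sqint (\<lambda>x. c * f x)"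
  by (auto simp: sqint_def power_mult_distrib)

lemma sqint_uminus: "sqint f \<Longrightarrow> sqint (\<lambda>x. - f x)"
  using sqint_scale[of f "-1"] by simp

lemma sqint_diff: "sqint f \<Longrightarrow> sqint g \<Longrightarrow> sqint (\<lambda>x. f x - g x)"
  using sqint_add[OF _ sqint_uminus, of f g] by simp

lemma sqint_bounded_mult:
  assumes "sqint f" "k \<in> borel_measurable lebesgue" "\<And>x. \<bar>k x\<bar> \<le> C"
  shows "sqint (\<lambda>x. k x * f x)"
proof -
  have "integrable lebesgue (\<lambda>x. (k x * f x)\<^sup>2)"
  proof (rule Bochner_Integration.integrable_bound)
    show "integrable lebesgue (\<lambda>x. C\<^sup>2 * (f x)\<^sup>2)"
      using assms by (auto simp: sqint_def)
    show "(\<lambda>x. (k x * f x)\<^sup>2) \<in> borel_measurable lebesgue"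
      using assms by (auto simp: sqint_def)
    have "(k x)\<^sup>2 \<le> C\<^sup>2" for x
      using power_mono[OF assms(3), of x 2] by simp
    then show "AE x in lebesgue. norm ((k x * f x)\<^sup>2) \<le> norm (C\<^sup>2 * (f x)\<^sup>2)"
      by (auto simp: power_mult_distrib mult_right_mono)
  qed
  then show ?thesis using assms by (auto simp: sqint_def)
qed

definition l2eq :: "(real \<times> real \<Rightarrow> real) \<Rightarrow> (real \<times> real \<Rightarrow> real) \<Rightarrow> bool" where
  "l2eq f g \<longleftrightarrow> sqint f \<and> sqint g \<and> (AE x in lebesgue. f x = g x)"

lemma part_equivp_l2eq: "part_equivp l2eq"
proof (rule part_equivpI)
  show "\<exists>x. l2eq x x" by (rule exI[of _ "\<lambda>_. 0"]) (simp add: l2eq_def)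
  show "symp l2eq" by (auto simp: symp_def l2eq_def)
  show "transp l2eq" by (auto simp: transp_def l2eq_def)
qed

\<comment> \<open>A type of classes and not a set of functions: the norm has to separate points, and
  the existence theorem asks for a complete separable inner product space as a type.\<close>
quotient_type l2 = "real \<times> real \<Rightarrow> real" / partial: l2eq
  by (rule part_equivp_l2eq)

instantiation l2 :: real_inner
begin

lift_definition zero_l2 :: l2 is "\<lambda>_. 0" by (simp add: l2eq_def)
lift_definition plus_l2 :: "l2 \<Rightarrow> l2 \<Rightarrow> l2" is "\<lambda>f g x. f x + g x"
  unfolding l2eq_def by (auto intro: sqint_add)
lift_definition minus_l2 :: "l2 \<Rightarrow> l2 \<Rightarrow> l2" is "\<lambda>f g x. f x - g x"
  unfolding l2eq_def by (auto intro: sqint_diff)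
lift_definition uminus_l2 :: "l2 \<Rightarrow> l2" is "\<lambda>f x. - f x"
  unfolding l2eq_def by (auto intro: sqint_uminus)
lift_definition scaleR_l2 :: "real \<Rightarrow> l2 \<Rightarrow> l2" is "\<lambda>c f x. c * f x"
  unfolding l2eq_def by (auto intro: sqint_scale)
lift_definition inner_l2 :: "l2 \<Rightarrow> l2 \<Rightarrow> real" is "\<lambda>f g. LINT x|lebesgue. f x * g x"
  unfolding l2eq_def by (auto intro!: integral_cong_AE simp: sqint_def)
definition norm_l2 :: "l2 \<Rightarrow> real" where "norm_l2 x = sqrt (inner x x)"
definition sgn_l2 :: "l2 \<Rightarrow> l2" where "sgn_l2 x = inverse (norm x) *\<^sub>R x"
definition dist_l2 :: "l2 \<Rightarrow> l2 \<Rightarrow> real" where "dist_l2 x y = norm (x - y)"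
definition uniformity_l2 :: "(l2 \<times> l2) filter" where
  "uniformity_l2 = (INF e\<in>{0<..}. principal {(x, y). dist x y < e})"
definition open_l2 :: "l2 set \<Rightarrow> bool" where
  "open_l2 U \<longleftrightarrow> (\<forall>x\<in>U. \<forall>\<^sub>F (x', y) in uniformity. x' = x \<longrightarrow> y \<in> U)"

instance
proof
  fix x y z :: l2 and a b :: real
  show "dist x y = norm (x - y)" "norm x = sqrt (inner x x)" "sgn x = inverse (norm x) *\<^sub>R x"
    by (simp_all add: dist_l2_def norm_l2_def sgn_l2_def)
  show "uniformity = (INF e\<in>{0<..}. principal {(x, y). dist x (y::l2) < e})"
    by (rule uniformity_l2_def)
  fix U :: "l2 set"
  show "open U \<longleftrightarrow> (\<forall>x\<in>U. \<forall>\<^sub>F (x', y) in uniformity. x' = x \<longrightarrow> y \<in> U)"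
    by (rule open_l2_def)
next
  fix x y z :: l2 and a b :: real
  show "x + y + z = x + (y + z)"
    by transfer (auto simp: l2eq_def add.assoc intro: sqint_add)
  show "x + y = y + x"
    by transfer (auto simp: l2eq_def add.commute intro: sqint_add)
  show "0 + x = x" by transfer (auto simp: l2eq_def)
  show "- x + x = 0" by transfer (auto simp: l2eq_def)
  show "x - y = x + - y" by transfer (auto simp: l2eq_def intro: sqint_diff)
  show "a *\<^sub>R (x + y) = a *\<^sub>R x + a *\<^sub>R y"
    by transfer (auto simp: l2eq_def algebra_simps intro!: sqint_add sqint_scale)
  show "(a + b) *\<^sub>R x = a *\<^sub>R x + b *\<^sub>R x"
    by transfer (auto simp: l2eq_def algebra_simps intro!: sqint_add sqint_scale)
  show "a *\<^sub>R b *\<^sub>R x = (a * b) *\<^sub>R x"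
    by transfer (auto simp: l2eq_def algebra_simps intro!: sqint_scale)
  show "1 *\<^sub>R x = x" by transfer (auto simp: l2eq_def)
  show "inner x y = inner y x" by transfer (auto simp: mult.commute)
  show "inner (x + y) z = inner x z + inner y z"
    by transfer (auto simp: l2eq_def distrib_right sqint_mult_integrable)
  show "inner (a *\<^sub>R x) y = a * inner x y"
    by transfer (auto simp: l2eq_def mult.assoc)
  show "0 \<le> inner x x" by transfer (auto simp: l2eq_def)
  show "inner x x = 0 \<longleftrightarrow> x = 0"
  proof transfer
    fix f assume "l2eq f f"
    then have f: "sqint f" by (simp add: l2eq_def)
    have "(LINT x|lebesgue. f x * f x) = 0 \<longleftrightarrow> (AE x in lebesgue. f x * f x = 0)"
      using sqint_mult_integrable[OF f f] by (intro integral_nonneg_eq_0_iff_AE) auto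
    then show "(LINT x|lebesgue. f x * f x) = 0 \<longleftrightarrow> l2eq f (\<lambda>_. 0)"
      using f by (auto simp: l2eq_def)
  qed
qed

end

text \<open>\<open>fn\<close> is an arbitrary representative; identities for its values hold only
  almost everywhere.\<close>

definition fn :: "l2 \<Rightarrow> real \<times> real \<Rightarrow> real" where "fn = rep_l2"
definition cl :: "(real \<times> real \<Rightarrow> real) \<Rightarrow> l2" where "cl = abs_l2"

lemma l2eq_fn: "l2eq (fn x) (fn x)"
  unfolding fn_def using Quotient3_l2 by (metis Quotient3_rep_reflp)

lemma sqint_fn [simp]: "sqint (fn x)"
  using l2eq_fn by (simp add: l2eq_def)

lemma fn_measurable [measurable, simp]: "fn x \<in> borel_measurable lebesgue"
  using sqint_fn[of x] by (simp add: sqint_def)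

lemma cl_fn [simp]: "cl (fn x) = x"
  unfolding fn_def cl_def using Quotient3_l2 by (metis Quotient3_abs_rep)

lemma cl_eq_iff: "sqint f \<Longrightarrow> sqint g \<Longrightarrow> cl f = cl g \<longleftrightarrow> (AE x in lebesgue. f x = g x)"
  unfolding cl_def using Quotient3_rel[OF Quotient3_l2, of f g] by (auto simp: l2eq_def)

lemma fn_cl: "sqint f \<Longrightarrow> AE x in lebesgue. fn (cl f) x = f x"
  using cl_eq_iff[of "fn (cl f)" f] by simp

lemma l2_eq_iff: "x = y \<longleftrightarrow> (AE t in lebesgue. fn x t = fn y t)"
  using cl_eq_iff[of "fn x" "fn y"] by simp

lemma cl_cong_AE: "sqint f \<Longrightarrow> sqint g \<Longrightarrow> AE x in lebesgue. f x = g x \<Longrightarrow> cl f = cl g"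
  by (simp add: cl_eq_iff)

lemma cl_add: "sqint f \<Longrightarrow> sqint g \<Longrightarrow> cl f + cl g = cl (\<lambda>x. f x + g x)"
  unfolding cl_def using plus_l2.abs_eq[of f g] by (simp add: l2eq_def)
lemma cl_diff: "sqint f \<Longrightarrow> sqint g \<Longrightarrow> cl f - cl g = cl (\<lambda>x. f x - g x)"
  unfolding cl_def using minus_l2.abs_eq[of f g] by (simp add: l2eq_def)
lemma cl_scale: "sqint f \<Longrightarrow> c *\<^sub>R cl f = cl (\<lambda>x. c * f x)"
  unfolding cl_def using scaleR_l2.abs_eq[of f c] by (simp add: l2eq_def)
lemma cl_zero: "cl (\<lambda>_. 0) = 0"
  unfolding cl_def zero_l2_def ..

lemma inner_cl: "sqint f \<Longrightarrow> sqint g \<Longrightarrow> inner (cl f) (cl g) = (LINT x|lebesgue. f x * g x)"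
  unfolding cl_def using inner_l2.abs_eq[of f g] by (simp add: l2eq_def)

lemma inner_fn: "inner x y = (LINT t|lebesgue. fn x t * fn y t)"
  using inner_cl[of "fn x" "fn y"] by simp

lemma norm_fn: "(norm x)\<^sup>2 = (LINT t|lebesgue. (fn x t)\<^sup>2)" for x :: l2
  unfolding power2_norm_eq_inner inner_fn by (simp add: power2_eq_square)

lemma norm_cl: "sqint f \<Longrightarrow> (norm (cl f))\<^sup>2 = (LINT x|lebesgue. (f x)\<^sup>2)"
  unfolding power2_norm_eq_inner by (simp add: inner_cl power2_eq_square)

lemma fn_add: "AE t in lebesgue. fn (x + y) t = fn x t + fn y t"
  using fn_cl[OF sqint_add[of "fn x" "fn y"]] cl_add[of "fn x" "fn y"] by simp
lemma fn_diff: "AE t in lebesgue. fn (x - y) t = fn x t - fn y t"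
  using fn_cl[OF sqint_diff[of "fn x" "fn y"]] cl_diff[of "fn x" "fn y"] by simp
lemma fn_scale: "AE t in lebesgue. fn (c *\<^sub>R x) t = c * fn x t"
  using fn_cl[OF sqint_scale[of "fn x" c]] cl_scale[of "fn x" c] by simp
lemma fn_zero: "AE t in lebesgue. fn 0 t = 0"
  using fn_cl[OF sqint_zero] by (simp add: cl_zero)

text \<open>Pointwise convergence: \<open>\<Sum> 2\<^sup>n d\<^sub>n\<^sup>2\<close> has a finite integral, hence \<open>d\<^sub>n = O(2\<^sup>-\<^sup>n\<^sup>/\<^sup>2)\<close>
  almost everywhere.\<close>

lemma l2_rapidly_cauchy:
  assumes "\<And>n. norm (X (Suc n) - X n) \<le> (1/2)^n"
  shows "\<exists>x. X \<longlonglongrightarrow> x \<and> (AE t in lebesgue. (\<lambda>n. fn (X n) t) \<longlonglongrightarrow> fn x t)"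
proof -
  define d where "d n t = fn (X (Suc n)) t - fn (X n) t" for n t
  have d: "sqint (d n)" for n
    unfolding d_def by (intro sqint_diff) auto
  then have dm [measurable]: "d n \<in> borel_measurable lebesgue" for n
    by (simp add: sqint_def)
  have cld: "cl (d n) = X (Suc n) - X n" for n
    unfolding d_def using cl_diff[of "fn (X (Suc n))" "fn (X n)"] by simp
  have dn: "(\<integral>\<^sup>+t. ennreal (2^n * (d n t)\<^sup>2) \<partial>lebesgue) \<le> ennreal ((1/2)^n)" for n
  proof -
    have "(\<integral>\<^sup>+t. ennreal (2^n * (d n t)\<^sup>2) \<partial>lebesgue) = ennreal (LINT t|lebesgue. 2^n * (d n t)\<^sup>2)"
      using d[of n] by (intro nn_integral_eq_integral) (auto simp: sqint_def)
    also have "(LINT t|lebesgue. 2^n * (d n t)\<^sup>2) = 2^n * (norm (X (Suc n) - X n))\<^sup>2"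
      using norm_cl[OF d[of n]] by (simp add: cld)
    also have "\<dots> \<le> 2^n * ((1/2)^n)\<^sup>2"
      using assms[of n] by (intro mult_left_mono power_mono) auto
    also have "\<dots> = (1/2)^n"
      by (simp add: power2_eq_square flip: power_mult_distrib)
    finally show ?thesis by (simp add: ennreal_leI)
  qed
  have "(\<integral>\<^sup>+t. (\<Sum>n. ennreal (2^n * (d n t)\<^sup>2)) \<partial>lebesgue) = (\<Sum>n. \<integral>\<^sup>+t. ennreal (2^n * (d n t)\<^sup>2) \<partial>lebesgue)"
    by (intro nn_integral_suminf) measurable
  also have "\<dots> \<le> (\<Sum>n. ennreal ((1/2)^n))"
    by (intro suminf_le dn) auto
  also have "\<dots> = ennreal (\<Sum>n. (1/2)^n)"
    by (intro suminf_ennreal2) (auto intro: summable_geometric)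
  also have "\<dots> < top" by simp
  finally have fin: "(\<integral>\<^sup>+t. (\<Sum>n. ennreal (2^n * (d n t)\<^sup>2)) \<partial>lebesgue) < top" .
  then have "AE t in lebesgue. (\<Sum>n. ennreal (2^n * (d n t)\<^sup>2)) \<noteq> \<infinity>"
    by (intro nn_integral_PInf_AE) (auto simp: top_unique)
  then have conv: "AE t in lebesgue. convergent (\<lambda>n. fn (X n) t)"
  proof eventually_elim
    case (elim t)
    have "summable (\<lambda>n. 2^n * (d n t)\<^sup>2)"
      using elim by (intro summable_suminf_not_top) auto
    then have "(\<lambda>n. 2^n * (d n t)\<^sup>2) \<longlonglongrightarrow> 0" by (rule summable_LIMSEQ_zero)
    then have "Bseq (\<lambda>n. 2^n * (d n t)\<^sup>2)" by (intro convergent_imp_Bseq convergentI)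
    then obtain C where C: "C > 0" "\<And>n. 2^n * (d n t)\<^sup>2 \<le> C"
      unfolding Bseq_def by (auto simp: abs_mult)
    have bound: "\<bar>d n t\<bar> \<le> sqrt C * (1 / sqrt 2)^n" for n
    proof -
      have "(d n t)\<^sup>2 \<le> C * (1/2)^n"
        using C(2)[of n] by (simp add: field_simps power_divide)
      then have "\<bar>d n t\<bar> \<le> sqrt (C * (1/2)^n)" using real_sqrt_le_mono by fastforce
      also have "\<dots> = sqrt C * (1 / sqrt 2)^n"
        by (simp add: real_sqrt_mult real_sqrt_power real_sqrt_divide)
      finally show ?thesis .
    qed
    have "summable (\<lambda>n. sqrt C * (1 / sqrt 2)^n)"
      by (intro summable_mult summable_geometric) auto
    then have "summable (\<lambda>n. d n t)"
      using bound by (intro summable_comparison_test'[of "\<lambda>n. sqrt C * (1 / sqrt 2)^n" 0 "\<lambda>n. d n t"]) auto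
    then have "convergent (\<lambda>n. \<Sum>i<n. d i t)" by (simp add: summable_iff_convergent)
    then have "convergent (\<lambda>n. (\<Sum>i<n. d i t) + fn (X 0) t)"
      by (intro convergent_add convergent_const)
    moreover have "(\<Sum>i<n. d i t) + fn (X 0) t = fn (X n) t" for n
      unfolding d_def by (simp add: sum_lessThan_telescope[of "\<lambda>i. fn (X i) t" n])
    ultimately show ?case by simp
  qed
  define f where "f t = lim (\<lambda>n. fn (X n) t)" for t
  have f_m [measurable]: "f \<in> borel_measurable lebesgue"
    unfolding f_def by measurable
  have f: "AE t in lebesgue. (\<lambda>n. fn (X n) t) \<longlonglongrightarrow> f t"
    using conv by eventually_elim (simp add: f_def convergent_LIMSEQ_iff)
  have dist: "norm (X (n + k) - X n) \<le> 2 * (1/2)^n" for n k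
  proof -
    have "norm (X (n + k) - X n) \<le> (\<Sum>i<k. (1/2)^(n + i))"
    proof (induction k)
      case (Suc k)
      have "norm (X (n + Suc k) - X n) \<le> norm (X (Suc (n + k)) - X (n + k)) + norm (X (n + k) - X n)"
        using norm_triangle_ineq[of "X (Suc (n + k)) - X (n + k)" "X (n + k) - X n"] by simp
      then show ?case using Suc assms[of "n + k"] by simp
    qed simp
    also have "\<dots> = (1/2)^n * (\<Sum>i<k. (1/2)^i)" by (simp add: power_add sum_distrib_left)
    also have "\<dots> \<le> (1/2)^n * 2"
    proof (rule mult_left_mono)
      show "(\<Sum>i<k. (1/2)^i) \<le> (2::real)"
        by (subst sum_gp_strict) (auto simp: field_simps)
    qed simp
    finally show ?thesis by simp
  qed
  \<comment> \<open>Fatou's lemma in \<open>k\<close> transfers the geometric bound on the distance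
    between two members of the sequence to the distance from the pointwise limit.\<close>
  have bnd: "(\<integral>\<^sup>+t. ennreal ((f t - fn (X n) t)\<^sup>2) \<partial>lebesgue) \<le> ennreal ((2 * (1/2)^n)\<^sup>2)" for n
  proof -
    have "(\<integral>\<^sup>+t. ennreal ((f t - fn (X n) t)\<^sup>2) \<partial>lebesgue)
       = (\<integral>\<^sup>+t. liminf (\<lambda>k. ennreal ((fn (X (n + k)) t - fn (X n) t)\<^sup>2)) \<partial>lebesgue)"
    proof (rule nn_integral_cong_AE, use f in eventually_elim)
      case (elim t)
      have "(\<lambda>k. fn (X (n + k)) t) \<longlonglongrightarrow> f t"
        using LIMSEQ_ignore_initial_segment[OF elim, of n] by (simp add: add.commute)
      then have "(\<lambda>k. ennreal ((fn (X (n + k)) t - fn (X n) t)\<^sup>2)) \<longlonglongrightarrow> ennreal ((f t - fn (X n) t)\<^sup>2)"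
        by (intro tendsto_intros)
      from lim_imp_Liminf[OF _ this] show ?case by simp
    qed
    also have "\<dots> \<le> liminf (\<lambda>k. \<integral>\<^sup>+t. ennreal ((fn (X (n + k)) t - fn (X n) t)\<^sup>2) \<partial>lebesgue)"
      by (intro nn_integral_liminf) measurable
    also have "\<dots> \<le> liminf (\<lambda>k. ennreal ((2 * (1/2)^n)\<^sup>2))"
    proof (rule Liminf_mono, rule always_eventually, rule allI)
      fix k
      have s: "sqint (\<lambda>t. fn (X (n + k)) t - fn (X n) t)" by (intro sqint_diff) auto
      have "(\<integral>\<^sup>+t. ennreal ((fn (X (n + k)) t - fn (X n) t)\<^sup>2) \<partial>lebesgue)
          = ennreal (LINT t|lebesgue. (fn (X (n + k)) t - fn (X n) t)\<^sup>2)"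
        using s by (intro nn_integral_eq_integral) (auto simp: sqint_def)
      also have "(LINT t|lebesgue. (fn (X (n + k)) t - fn (X n) t)\<^sup>2) = (norm (X (n + k) - X n))\<^sup>2"
        using norm_cl[OF s] cl_diff[of "fn (X (n + k))" "fn (X n)"] by simp
      also have "\<dots> \<le> (2 * (1/2)^n)\<^sup>2" using dist[of n k] by (intro power_mono) auto
      finally show "(\<integral>\<^sup>+t. ennreal ((fn (X (n + k)) t - fn (X n) t)\<^sup>2) \<partial>lebesgue) \<le> ennreal ((2 * (1/2)^n)\<^sup>2)"
        by (simp add: ennreal_leI)
    qed
    also have "\<dots> = ennreal ((2 * (1/2)^n)\<^sup>2)" by (simp add: Liminf_const)
    finally show ?thesis .
  qed
  have s: "sqint (\<lambda>t. f t - fn (X n) t)" for n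
  proof -
    have "integrable lebesgue (\<lambda>t. (f t - fn (X n) t)\<^sup>2)"
      using bnd[of n] by (intro integrableI_nonneg) (auto intro: le_less_trans)
    then show ?thesis by (simp add: sqint_def)
  qed
  have sf: "sqint f"
    using sqint_add[OF s[of 0] sqint_fn[of "X 0"]] by simp
  have clf: "cl (\<lambda>t. f t - fn (X n) t) = cl f - X n" for n
    using cl_diff[OF sf sqint_fn[of "X n"]] by simp
  have "norm (cl f - X n) \<le> 2 * (1/2)^n" for n
  proof -
    have "ennreal ((norm (cl f - X n))\<^sup>2) = (\<integral>\<^sup>+t. ennreal ((f t - fn (X n) t)\<^sup>2) \<partial>lebesgue)"
      using norm_cl[OF s[of n]] s[of n] by (subst nn_integral_eq_integral) (auto simp: sqint_def clf)
    then have "(norm (cl f - X n))\<^sup>2 \<le> (2 * (1/2)^n)\<^sup>2"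
      using bnd[of n] by (metis ennreal_le_iff zero_le_power2)
    then show ?thesis by (rule power2_le_imp_le) simp
  qed
  then have "X \<longlonglongrightarrow> cl f"
  proof (intro metric_LIMSEQ_I)
    fix r :: real assume r: "r > 0"
    then obtain N where N: "(1/2)^N < r / 2"
      using real_arch_pow_inv[of "r/2" "1/2"] by auto
    have "dist (X n) (cl f) < r" if "n \<ge> N" for n
    proof -
      have "(1/2)^n \<le> (1/2::real)^N" using that by (intro power_decreasing) auto
      then have "norm (cl f - X n) < r" using N \<open>norm (cl f - X n) \<le> 2 * (1/2)^n\<close> by linarith
      then show ?thesis by (simp add: dist_norm norm_minus_commute)
    qed
    then show "\<exists>N. \<forall>n\<ge>N. dist (X n) (cl f) < r" by blast
  qed
  moreover have "AE t in lebesgue. (\<lambda>n. fn (X n) t) \<longlonglongrightarrow> fn (cl f) t"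
    using f fn_cl[OF sf] by eventually_elim simp
  ultimately show ?thesis by blast
qed

lemma rapid_subseq:
  fixes X :: "nat \<Rightarrow> 'a::real_normed_vector"
  assumes "Cauchy X"
  shows "\<exists>r. strict_mono r \<and> (\<forall>n. norm (X (r (Suc n)) - X (r n)) \<le> (1/2)^n)"
proof -
  have "\<exists>M. \<forall>m\<ge>M. \<forall>n\<ge>M. norm (X m - X n) < (1/2)^k" for k
    using assms by (simp add: Cauchy_iff)
  then obtain M where M: "\<And>k m n. m \<ge> M k \<Longrightarrow> n \<ge> M k \<Longrightarrow> norm (X m - X n) < (1/2)^k"
    by metis
  \<comment> \<open>The sum makes \<open>r k\<close> at least \<open>M k\<close>, the summand
    \<open>k\<close> makes \<open>r\<close> strictly increasing.\<close>
  define r where "r k = k + (\<Sum>i\<le>k. M i)" for k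
  have "strict_mono r" by (rule strict_monoI_Suc) (simp add: r_def)
  moreover have "norm (X (r (Suc n)) - X (r n)) \<le> (1/2)^n" for n
  proof -
    have "M n \<le> (\<Sum>i\<le>n. M i)" by (rule member_le_sum) auto
    then show ?thesis by (intro less_imp_le[OF M]) (simp_all add: r_def)
  qed
  ultimately show ?thesis by blast
qed

lemma l2_AE_subseq:
  assumes "X \<longlonglongrightarrow> x"
  obtains r where "strict_mono r" "AE t in lebesgue. (\<lambda>n. fn (X (r n)) t) \<longlonglongrightarrow> fn x t"
proof -
  have "Cauchy X" using assms by (intro LIMSEQ_imp_Cauchy)
  then obtain r where r: "strict_mono r" "\<And>n. norm (X (r (Suc n)) - X (r n)) \<le> (1/2)^n"
    using rapid_subseq by metis
  from l2_rapidly_cauchy[of "X \<circ> r"] r obtain y where y: "(X \<circ> r) \<longlonglongrightarrow> y"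
    "AE t in lebesgue. (\<lambda>n. fn (X (r n)) t) \<longlonglongrightarrow> fn y t" by auto
  have "(X \<circ> r) \<longlonglongrightarrow> x" using assms r(1) by (rule LIMSEQ_subseq_LIMSEQ)
  then have "x = y" using y(1) LIMSEQ_unique by blast
  then show ?thesis using r y that by blast
qed

instance l2 :: complete_space
proof
  fix X :: "nat \<Rightarrow> l2" assume X: "Cauchy X"
  then obtain r where r: "strict_mono r" "\<And>n. norm (X (r (Suc n)) - X (r n)) \<le> (1/2)^n"
    using rapid_subseq by metis
  from l2_rapidly_cauchy[of "X \<circ> r"] r obtain y where y: "(X \<circ> r) \<longlonglongrightarrow> y" by auto
  then show "convergent X" using X r(1) Cauchy_converges_subseq by (auto simp: convergent_def)
qed

section \<open>Smooth functions and bumps\<close>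

abbreviation smooth :: "(real \<times> real \<Rightarrow> real) \<Rightarrow> bool" where "smooth \<equiv> smooth_on UNIV"

lemma has_derivative_pd:
  assumes "f differentiable_on UNIV"
  shows "(f has_derivative (\<lambda>e. pd e f x)) (at x)"
proof -
  have "f differentiable at x" using assms unfolding differentiable_on_def by blast
  then show ?thesis unfolding pd_def using frechet_derivative_works by blast
qed

lemma pd_eqI:
  assumes "(f has_derivative f') (at x)"
  shows "pd e f x = f' e"
  using frechet_derivative_at[OF assms] by (simp add: pd_def)

lemma C_k_Suc: "C_k_on (Suc k) UNIV f \<longleftrightarrow> f differentiable_on UNIV \<and> (\<forall>e. C_k_on k UNIV (pd e f))"
  by (simp add: pd_def[abs_def])

declare C_k_on.simps(2) [simp del]

lemma C_k_on_Suc_imp: "C_k_on (Suc k) UNIV f \<Longrightarrow> C_k_on k UNIV f"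
proof (induction k arbitrary: f)
  case 0
  then have "f differentiable_on UNIV" using C_k_Suc[of 0 f] by blast
  then show ?case by (simp add: differentiable_imp_continuous_on)
next
  case (Suc k)
  then show ?case unfolding C_k_Suc[of "Suc k"] unfolding C_k_Suc[of k] by blast
qed

lemma C_k_const: "C_k_on k UNIV (\<lambda>_. c)"
proof (induction k arbitrary: c)
  case (Suc k)
  have "pd e (\<lambda>_. c) = (\<lambda>_. 0)" for e by (intro ext pd_eqI[where f'="\<lambda>_. 0"]) simp
  then show ?case using Suc by (simp add: C_k_Suc)
qed simp

lemma pd_add:
  assumes "f differentiable_on UNIV" "g differentiable_on UNIV"
  shows "pd e (\<lambda>x. f x + g x) x = pd e f x + pd e g x"
  by (rule pd_eqI[OF has_derivative_add[OF has_derivative_pd[OF assms(1)] has_derivative_pd[OF assms(2)]]])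

lemma pd_mult:
  assumes "f differentiable_on UNIV" "g differentiable_on UNIV"
  shows "pd e (\<lambda>x. f x * g x) x = f x * pd e g x + pd e f x * g x"
  by (rule pd_eqI[OF has_derivative_mult[OF has_derivative_pd[OF assms(1)] has_derivative_pd[OF assms(2)]]])

lemma C_k_add: "C_k_on k UNIV f \<Longrightarrow> C_k_on k UNIV g \<Longrightarrow> C_k_on k UNIV (\<lambda>x. f x + g x)"
proof (induction k arbitrary: f g)
  case 0
  then show ?case by (auto intro: continuous_intros)
next
  case (Suc k)
  then have d: "f differentiable_on UNIV" "g differentiable_on UNIV" by (auto simp: C_k_Suc)
  have "pd e (\<lambda>x. f x + g x) = (\<lambda>x. pd e f x + pd e g x)" for e using pd_add[OF d] by blast
  then show ?case using Suc d by (simp add: C_k_Suc)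
qed

lemma C_k_mult: "C_k_on k UNIV f \<Longrightarrow> C_k_on k UNIV g \<Longrightarrow> C_k_on k UNIV (\<lambda>x. f x * g x)"
proof (induction k arbitrary: f g)
  case 0
  then show ?case by (auto intro: continuous_intros)
next
  case (Suc k)
  then have d: "f differentiable_on UNIV" "g differentiable_on UNIV" by (auto simp: C_k_Suc)
  have "pd e (\<lambda>x. f x * g x) = (\<lambda>x. f x * pd e g x + pd e f x * g x)" for e using pd_mult[OF d] by blast
  moreover have "C_k_on k UNIV (\<lambda>x. f x * pd e g x + pd e f x * g x)" for e
  proof (intro C_k_add Suc.IH)
    show "C_k_on k UNIV f" "C_k_on k UNIV g"
      using C_k_on_Suc_imp[OF Suc.prems(1)] C_k_on_Suc_imp[OF Suc.prems(2)] .
    show "C_k_on k UNIV (pd e f)" "C_k_on k UNIV (pd e g)"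
      using Suc.prems unfolding C_k_Suc by blast+
  qed
  ultimately show ?case using d by (simp add: C_k_Suc)
qed

text \<open>The induction on the order moves from \<open>D j\<close> to \<open>D (Suc j)\<close>, so
  the whole family of successive derivatives has to be handled at once. Affine arguments suffice for
  coordinates and for cutoffs along the axes.\<close>

lemma C_k_compose_affine:
  fixes D :: "nat \<Rightarrow> real \<Rightarrow> real"
  assumes D: "\<And>j t. (D j has_real_derivative D (Suc j) t) (at t)"
  shows "C_k_on k UNIV (\<lambda>x. D j (a * fst x + b * snd x + c))"
proof (induction k arbitrary: j)
  case 0
  have "continuous_on UNIV (D j)"
    using D by (intro continuous_at_imp_continuous_on) (auto intro: DERIV_isCont)
  then show ?case by (auto intro!: continuous_on_compose2[of UNIV "D j"] continuous_intros)
next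
  case (Suc k)
  have d: "((\<lambda>x. D j (a * fst x + b * snd x + c)) has_derivative
      (\<lambda>e. D (Suc j) (a * fst x + b * snd x + c) * (a * fst e + b * snd e))) (at x)" for x :: "real \<times> real"
  proof (rule has_derivative_compose[of "\<lambda>x. a * fst x + b * snd x + c" "\<lambda>e. a * fst e + b * snd e" x UNIV "D j",
        simplified])
    show "((\<lambda>x. a * fst x + b * snd x + c) has_derivative (\<lambda>e. a * fst e + b * snd e)) (at x)"
      by (auto intro!: derivative_eq_intros)
    show "(D j has_derivative (*) (D (Suc j) (a * fst x + b * snd x + c))) (at (a * fst x + b * snd x + c))"
      using D[of j "a * fst x + b * snd x + c"] by (simp add: has_field_derivative_def)
  qed
  then have "pd e (\<lambda>x. D j (a * fst x + b * snd x + c))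
      = (\<lambda>x. D (Suc j) (a * fst x + b * snd x + c) * (a * fst e + b * snd e))" for e
    by (intro ext pd_eqI)
  moreover have "(\<lambda>x. D j (a * fst x + b * snd x + c)) differentiable_on UNIV"
    using d by (auto simp: differentiable_on_def differentiable_def intro: has_derivative_at_withinI)
  ultimately show ?case using Suc by (auto simp: C_k_Suc intro!: C_k_mult C_k_const)
qed

lemma smooth_compose_affine:
  fixes D :: "nat \<Rightarrow> real \<Rightarrow> real"
  assumes "\<And>j t. (D j has_real_derivative D (Suc j) t) (at t)"
  shows "smooth (\<lambda>x. D 0 (a * fst x + b * snd x + c))"
  unfolding smooth_on_def using C_k_compose_affine[of D, OF assms] by blast

lemma smooth_const [simp]: "smooth (\<lambda>_. c)"
  by (simp add: smooth_on_def C_k_const)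

lemma smooth_add: "smooth f \<Longrightarrow> smooth g \<Longrightarrow> smooth (\<lambda>x. f x + g x)"
  by (simp add: smooth_on_def C_k_add)

lemma smooth_mult: "smooth f \<Longrightarrow> smooth g \<Longrightarrow> smooth (\<lambda>x. f x * g x)"
  by (simp add: smooth_on_def C_k_mult)

lemma smooth_affine: "smooth (\<lambda>x. a * fst x + b * snd x + c)"
  using smooth_compose_affine[of "\<lambda>j t. if j = 0 then t else if j = 1 then 1 else 0" a b c]
  by (auto intro!: derivative_eq_intros)

lemma smooth_fst: "smooth fst"
  using smooth_affine[of 1 0 0] by simp

lemma smooth_scale: "smooth f \<Longrightarrow> smooth (\<lambda>x. c * f x)"
  by (rule smooth_mult) simp_all

lemma smooth_diff: "smooth f \<Longrightarrow> smooth g \<Longrightarrow> smooth (\<lambda>x. f x - g x)"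
  using smooth_add[of f "\<lambda>x. (-1) * g x"] smooth_scale[of g "-1"] by simp

lemma smooth_differentiable: "smooth f \<Longrightarrow> f differentiable_on UNIV"
  unfolding smooth_on_def using C_k_Suc[of 0 f] by blast

lemma smooth_pd: "smooth f \<Longrightarrow> smooth (pd e f)"
  unfolding smooth_on_def using C_k_Suc[of _ f] by blast

lemma smooth_continuous: "smooth f \<Longrightarrow> continuous_on S f"
  by (rule continuous_on_subset[OF differentiable_imp_continuous_on[OF smooth_differentiable]]) auto

lemma smooth_has_derivative: "smooth f \<Longrightarrow> (f has_derivative (\<lambda>e. pd e f x)) (at x)"
  by (intro has_derivative_pd smooth_differentiable)

lemma pd_smooth_add: "smooth f \<Longrightarrow> smooth g \<Longrightarrow> pd e (\<lambda>x. f x + g x) x = pd e f x + pd e g x"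
  by (intro pd_add smooth_differentiable)

lemma pd_smooth_mult: "smooth f \<Longrightarrow> smooth g \<Longrightarrow> pd e (\<lambda>x. f x * g x) x = f x * pd e g x + pd e f x * g x"
  by (intro pd_mult smooth_differentiable)

lemma pd_const: "pd e (\<lambda>_. c) x = 0"
  by (intro pd_eqI[where f'="\<lambda>_. 0"]) simp

lemma pd_smooth_scale: "smooth f \<Longrightarrow> pd e (\<lambda>x. c * f x) x = c * pd e f x"
  by (simp add: pd_smooth_mult pd_const)

lemma pd_smooth_diff: "smooth f \<Longrightarrow> smooth g \<Longrightarrow> pd e (\<lambda>x. f x - g x) x = pd e f x - pd e g x"
  using pd_smooth_add[of f "\<lambda>x. (-1) * g x" e x] smooth_scale[of g "-1"] pd_smooth_scale[of g e "-1"] by simp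

lemma pd_fst: "pd e fst x = fst e"
  by (intro pd_eqI) (rule has_derivative_fst[OF has_derivative_ident])

lemma smooth_pdr: "smooth f \<Longrightarrow> ((\<lambda>t. f (t, z)) has_real_derivative pdr f (r, z)) (at r within S)"
proof -
  assume f: "smooth f"
  have d: "((\<lambda>t. f (t, z)) has_derivative (\<lambda>h. pd (h, 0) f (r, z))) (at r within S)"
    by (rule has_derivative_compose[OF _ smooth_has_derivative[OF f], of "\<lambda>t. (t, z)" "\<lambda>h. (h, 0)"])
       (auto intro!: derivative_eq_intros)
  have eq: "pd (h, 0) f (r, z) = pdr f (r, z) * h" for h
    using linear_scale[OF has_derivative_linear[OF smooth_has_derivative[OF f, of "(r, z)"]], of h "(1, 0)"] by simp
  have "(\<lambda>h. pd (h, 0) f (r, z)) = (*) (pdr f (r, z))" by (rule ext) (rule eq)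
  with d show ?thesis unfolding has_field_derivative_def by simp
qed

lemma smooth_pdz: "smooth f \<Longrightarrow> ((\<lambda>t. f (r, t)) has_real_derivative pdz f (r, z)) (at z within S)"
proof -
  assume f: "smooth f"
  have d: "((\<lambda>t. f (r, t)) has_derivative (\<lambda>h. pd (0, h) f (r, z))) (at z within S)"
    by (rule has_derivative_compose[OF _ smooth_has_derivative[OF f], of "\<lambda>t. (r, t)" "\<lambda>h. (0, h)"])
       (auto intro!: derivative_eq_intros)
  have eq: "pd (0, h) f (r, z) = pdz f (r, z) * h" for h
    using linear_scale[OF has_derivative_linear[OF smooth_has_derivative[OF f, of "(r, z)"]], of h "(0, 1)"] by simp
  have "(\<lambda>h. pd (0, h) f (r, z)) = (*) (pdz f (r, z))" by (rule ext) (rule eq)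
  with d show ?thesis unfolding has_field_derivative_def by simp
qed

text \<open>The \<open>k\<close>-th derivative of \<open>exp (- 1 / t)\<close> at \<open>t > 0\<close> is \<open>p\<^sub>k (1 / t) exp (- 1 / t)\<close>, where
  \<open>p\<^sub>0 = 1\<close> and \<open>p\<^sub>k\<^sub>+\<^sub>1 = X\<^sup>2 (p\<^sub>k - p\<^sub>k')\<close>.\<close>

fun bump_poly :: "nat \<Rightarrow> real poly" where
  "bump_poly 0 = 1"
| "bump_poly (Suc k) = [:0, 0, 1:] * (bump_poly k - pderiv (bump_poly k))"

definition bump_deriv :: "nat \<Rightarrow> real \<Rightarrow> real" where
  "bump_deriv k t = (if t > 0 then poly (bump_poly k) (1 / t) * exp (- (1 / t)) else 0)"

text \<open>The additional power of s absorbs the factor that appears when the constant coefficient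
  is split off in the induction over the polynomial.\<close>

lemma poly_times_exp_tendsto_0: "((\<lambda>s. s ^ n * poly p s * exp (- s)) \<longlongrightarrow> (0::real)) at_top"
proof (induction p arbitrary: n)
  case (pCons a p)
  have "((\<lambda>s::real. a * (s ^ n / exp s) + s ^ Suc n * poly p s * exp (- s)) \<longlongrightarrow> a * 0 + 0) at_top"
    by (intro tendsto_intros tendsto_power_div_exp_0 pCons)
  then show ?case by (simp add: algebra_simps exp_minus divide_inverse)
qed simp

lemma poly_exp_inverse_tendsto_0:
  "((\<lambda>t. if t > 0 then poly p (1 / t) * exp (- (1 / t)) else 0) \<longlongrightarrow> (0::real)) (at 0)"
proof -
  have "((\<lambda>t. poly p (1 / t) * exp (- (1 / t))) \<longlongrightarrow> 0) (at_right (0::real))"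
    using filterlim_compose[OF poly_times_exp_tendsto_0[of 0 p] filterlim_inverse_at_top_right]
    by (simp add: inverse_eq_divide)
  then have "((\<lambda>t. if t > 0 then poly p (1 / t) * exp (- (1 / t)) else 0) \<longlongrightarrow> 0) (at_right (0::real))"
    by (rule Lim_transform_eventually) (auto simp: eventually_at_filter)
  moreover have "((\<lambda>t. if t > 0 then poly p (1 / t) * exp (- (1 / t)) else 0) \<longlongrightarrow> 0) (at_left (0::real))"
    by (rule Lim_transform_eventually[OF tendsto_const]) (auto simp: eventually_at_filter)
  ultimately show ?thesis by (rule filterlim_split_at[rotated])
qed

lemma bump_deriv_has_derivative: "(bump_deriv k has_real_derivative bump_deriv (Suc k) t) (at t)"
proof (cases t "0::real" rule: linorder_cases)
  case less
  have "((\<lambda>_. 0) has_real_derivative bump_deriv (Suc k) t) (at t)"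
    using less by (simp add: bump_deriv_def)
  then show ?thesis
    by (rule DERIV_cong_ev[THEN iffD1, rotated -1])
       (use less in \<open>auto simp: bump_deriv_def intro!: eventually_mono[OF eventually_nhds_in_open[of "{..<0}"]]\<close>)
next
  case equal
  have "(bump_deriv k has_real_derivative 0) (at 0)"
    unfolding has_field_derivative_iff
  \<comment> \<open>The difference quotient at 0 is an expression of the same kind, with the
    polynomial multiplied by X, and hence tends to 0.\<close>
  proof (rule Lim_transform_eventually[OF poly_exp_inverse_tendsto_0[of "pCons 0 (bump_poly k)"]])
    show "\<forall>\<^sub>F t in at 0. (if 0 < t then poly (pCons 0 (bump_poly k)) (1 / t) * exp (- (1 / t)) else 0)
        = (bump_deriv k t - bump_deriv k 0) / (t - 0)"
      by (auto simp: bump_deriv_def)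
  qed
  then show ?thesis using equal by (simp add: bump_deriv_def)
next
  case greater
  have "((\<lambda>t. poly (bump_poly k) (1 / t) * exp (- (1 / t))) has_real_derivative bump_deriv (Suc k) t) (at t)"
    using greater
    by (auto intro!: derivative_eq_intros poly_DERIV[THEN DERIV_chain2] simp: bump_deriv_def power2_eq_square)
       (simp add: field_simps)
  then show ?thesis
    by (rule DERIV_cong_ev[THEN iffD1, rotated -1])
       (use greater in \<open>auto simp: bump_deriv_def intro!: eventually_mono[OF eventually_nhds_in_open[of "{0<..}"]]\<close>)
qed

definition step :: "real \<Rightarrow> real" where
  "step t = (if t > 0 then exp (- (1 / t)) else 0)"

lemma step_eq_bump_deriv: "step = bump_deriv 0"
  by (auto simp: step_def bump_deriv_def)

lemma step_bounds: "0 \<le> step t" "step t \<le> 1"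
  by (auto simp: step_def)

lemma smooth_step: "smooth (\<lambda>x. step (a * fst x + b * snd x + c))"
  unfolding step_eq_bump_deriv by (rule smooth_compose_affine[of bump_deriv, OF bump_deriv_has_derivative])

lemma step_tendsto: "(\<lambda>n. step (real n * t)) \<longlonglongrightarrow> (if t > 0 then 1 else 0)"
proof (cases "t > 0")
  case True
  have "(\<lambda>n. 1 / t * (1 / real n)) \<longlonglongrightarrow> 1 / t * 0"
    by (intro tendsto_intros lim_1_over_n)
  then have "(\<lambda>n. exp (- (1 / t * (1 / real n)))) \<longlonglongrightarrow> exp (- (1 / t * 0))"
    by (intro tendsto_intros)
  then have "(\<lambda>n. exp (- (1 / t * (1 / real n)))) \<longlonglongrightarrow> 1" by simp
  moreover have "\<forall>\<^sub>F n in sequentially. exp (- (1 / t * (1 / real n))) = step (real n * t)"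
    using eventually_gt_at_top[of "0::nat"] by eventually_elim (use True in \<open>simp add: step_def mult.commute\<close>)
  ultimately show ?thesis using True by (auto intro: Lim_transform_eventually)
next
  case False
  then have "step (real n * t) = 0" for n
    by (auto simp: step_def zero_less_mult_iff)
  then show ?thesis using False by simp
qed

text \<open>\<open>step\<close> has no plateau: it stays below 1 and reaches it only as its argument
  grows. A steepening factor \<open>n\<close> therefore yields bounded smooth functions converging
  at every point to the indicator of the open box, which is enough for dominated
  convergence.\<close>

definition box_bump :: "nat \<Rightarrow> real \<times> real \<Rightarrow> real \<times> real \<Rightarrow> real \<times> real \<Rightarrow> real" where
  "box_bump n p q x = step (real n * (fst x - fst p)) * step (real n * (fst q - fst x))
     * (step (real n * (snd x - snd p)) * step (real n * (snd q - snd x)))"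

lemma smooth_box_bump: "smooth (box_bump n p q)"
proof -
  have "smooth (\<lambda>x. step (real n * fst x + 0 * snd x + (- real n * fst p))
      * step (- real n * fst x + 0 * snd x + real n * fst q)
      * (step (0 * fst x + real n * snd x + (- real n * snd p))
      * step (0 * fst x + (- real n) * snd x + real n * snd q)))"
    by (intro smooth_mult smooth_step)
  then show ?thesis by (simp add: box_bump_def[abs_def] algebra_simps)
qed

lemma box_bump_test:
  assumes "cbox p q \<subseteq> S"
  shows "box_bump n p q \<in> test_functions S"
proof -
  have "box_bump n p q x = 0" if "x \<notin> cbox p q" for x
    using that by (cases p; cases q; cases x)
      (auto simp: box_bump_def step_def cbox_Pair_eq zero_less_mult_iff)
  then show ?thesis using assms smooth_box_bump by (auto simp: test_functions_def intro!: exI[of _ "cbox p q"])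
qed

lemma box_bump_bounds: "0 \<le> box_bump n p q x" "box_bump n p q x \<le> 1"
  unfolding box_bump_def using step_bounds by (auto intro!: mult_le_one)

lemma box_bump_tendsto: "(\<lambda>n. box_bump n p q x) \<longlonglongrightarrow> indicator (box p q) x"
proof -
  let ?s = "\<lambda>t. if t > 0 then 1 else 0 :: real"
  have "(\<lambda>n. box_bump n p q x) \<longlonglongrightarrow> ?s (fst x - fst p) * ?s (fst q - fst x)
     * (?s (snd x - snd p) * ?s (snd q - snd x))"
    unfolding box_bump_def by (intro tendsto_intros step_tendsto)
  moreover have "?s (fst x - fst p) * ?s (fst q - fst x) * (?s (snd x - snd p) * ?s (snd q - snd x))
      = indicator (box p q) x"
    by (cases p; cases q; cases x) (auto simp: mem_box Basis_prod_def indicator_def)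
  ultimately show ?thesis by simp
qed

section \<open>Separability and the fundamental lemma of the calculus of variations\<close>

text \<open>The measures whose densities are the positive and the negative part of \<open>h\<close>
  agree on boxes. These are stable under intersection and exhaust the space by sets of finite
  measure, so the measures coincide, and with them the densities.\<close>

lemma AE_zero_if_box_integrals_zero_lborel:
  fixes h :: "'a::euclidean_space \<Rightarrow> real"
  assumes h: "integrable lborel h" and z: "\<And>p q. (LINT x|lborel. indicator (box p q) x * h x) = 0"
  shows "AE x in lborel. h x = 0"
proof -
  define P where "P x = ennreal (h x)" for x
  define N where "N x = ennreal (- h x)" for x
  have [measurable]: "h \<in> borel_measurable lborel" using h by auto
  have [measurable]: "P \<in> borel_measurable lborel" "N \<in> borel_measurable lborel"
    unfolding P_def N_def by measurable
  have em: "emeasure (density lborel (\<lambda>x. ennreal (g x))) (box p q)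
      = ennreal (LINT x|lborel. indicator (box p q) x * max 0 (g x))"
    if [measurable]: "g \<in> borel_measurable lborel" and i: "integrable lborel g" for g :: "'a \<Rightarrow> real" and p q
  proof -
    have "emeasure (density lborel (\<lambda>x. ennreal (g x))) (box p q) = (\<integral>\<^sup>+x. ennreal (g x) * indicator (box p q) x \<partial>lborel)"
      by (subst emeasure_density) auto
    also have "\<dots> = (\<integral>\<^sup>+x. ennreal (indicator (box p q) x * max 0 (g x)) \<partial>lborel)"
      by (intro nn_integral_cong) (auto simp: indicator_def max_def ennreal_neg)
    also have "\<dots> = ennreal (LINT x|lborel. indicator (box p q) x * max 0 (g x))"
    proof (rule nn_integral_eq_integral)
      show "integrable lborel (\<lambda>x. indicator (box p q) x * max 0 (g x))"
        by (rule Bochner_Integration.integrable_bound[OF i]) (auto simp: indicator_def max_def)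
    qed (auto simp: indicator_def)
    finally show ?thesis .
  qed
  have eq: "emeasure (density lborel P) (box p q) = emeasure (density lborel N) (box p q)" for p q
  proof -
    have i: "integrable lborel (\<lambda>x. indicator (box p q) x * max 0 (g x))" if "integrable lborel g" for g :: "'a \<Rightarrow> real"
      by (rule Bochner_Integration.integrable_bound[OF that]) (use that in \<open>auto simp: indicator_def max_def\<close>)
    have "(LINT x|lborel. indicator (box p q) x * max 0 (h x)) - (LINT x|lborel. indicator (box p q) x * max 0 (- h x))
        = (LINT x|lborel. indicator (box p q) x * max 0 (h x) - indicator (box p q) x * max 0 (- h x))"
      by (rule Bochner_Integration.integral_diff[symmetric]) (intro i h Bochner_Integration.integrable_minus)+
    also have "\<dots> = (LINT x|lborel. indicator (box p q) x * h x)"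
      by (intro Bochner_Integration.integral_cong) (auto simp: indicator_def max_def)
    also have "\<dots> = 0" by (rule z)
    finally show ?thesis unfolding P_def N_def using h by (subst (1 2) em) auto
  qed
  have "density lborel P = density lborel N"
  proof (rule measure_eqI_generator_eq[where A="\<lambda>i::nat. box (- real i *\<^sub>R One) (real i *\<^sub>R One)" and \<Omega>=UNIV
      and E="range (\<lambda>(a, b). box a b)"])
    show "Int_stable (range (\<lambda>(a, b). box a b) :: 'a set set)"
      by (auto simp: Int_stable_def box_Int_box)
    show "sets (density lborel P) = sigma_sets UNIV (range (\<lambda>(a, b). box a b))"
      "sets (density lborel N) = sigma_sets UNIV (range (\<lambda>(a, b). box a b))"
      by (simp_all add: borel_eq_box)
    show "(\<Union>i::nat. box (- real i *\<^sub>R One) (real i *\<^sub>R One)) = (UNIV :: 'a set)"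
      using UN_box_eq_UNIV by simp
    show "emeasure (density lborel P) (box (- real i *\<^sub>R One) (real i *\<^sub>R One)) \<noteq> \<infinity>" for i
      unfolding P_def using h by (subst em) auto
    show "emeasure (density lborel P) X = emeasure (density lborel N) X" if "X \<in> range (\<lambda>(a, b). box a b)" for X
      using that eq by auto
  qed auto
  then have "AE x in lborel. P x = N x"
    by (intro sigma_finite_measure.density_unique[OF sigma_finite_lborel]) auto
  then show ?thesis
  proof eventually_elim
    case (elim x)
    show ?case
    proof (cases "h x \<ge> 0")
      case True
      then have "ennreal (h x) = 0" using elim by (simp add: P_def N_def ennreal_neg)
      then show ?thesis using True by simp
    next
      case False
      then have "ennreal (- h x) = 0" using elim by (simp add: P_def N_def ennreal_neg)
      then show ?thesis using False by simp
    qed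
  qed
qed

lemma AE_zero_if_box_integrals_zero:
  fixes h :: "'a::euclidean_space \<Rightarrow> real"
  assumes h: "integrable lebesgue h" and z: "\<And>p q. (LINT x|lebesgue. indicator (box p q) x * h x) = 0"
  shows "AE x in lebesgue. h x = 0"
proof -
  have hm: "h \<in> borel_measurable (completion lborel)" using h by auto
  obtain g where g [measurable]: "g \<in> borel_measurable lborel" and hg: "AE x in lborel. h x = g x"
    using completion_ex_borel_measurable_real[OF hm] by blast
  have hg': "AE x in lebesgue. h x = g x" using hg by (rule AE_completion)
  have gm: "g \<in> borel_measurable lebesgue" using g by (simp add: measurable_completion)
  have "integrable lebesgue g"
    using h hg' gm hm by (subst integrable_cong_AE[of g _ h]) auto
  then have gi: "integrable lborel g" by (simp add: integrable_completion)
  have "(LINT x|lborel. indicator (box p q) x * g x) = 0" for p q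
  proof -
    have "(LINT x|lborel. indicator (box p q) x * g x) = (LINT x|lebesgue. indicator (box p q) x * g x)"
      by (rule integral_completion[symmetric]) measurable
    also have "\<dots> = (LINT x|lebesgue. indicator (box p q) x * h x)"
    proof (rule integral_cong_AE)
      show "(\<lambda>x. indicator (box p q) x * g x) \<in> borel_measurable lebesgue"
        by (intro measurable_completion) measurable
      show "(\<lambda>x. indicator (box p q) x * h x) \<in> borel_measurable lebesgue"
        by (intro borel_measurable_times hm borel_measurable_indicator) auto
      show "AE x in lebesgue. indicator (box p q) x * g x = indicator (box p q) x * h x"
        using hg' by eventually_elim simp
    qed
    finally show ?thesis using z by simp
  qed
  then have "AE x in lborel. g x = 0" by (intro AE_zero_if_box_integrals_zero_lborel gi)
  then have "AE x in lebesgue. g x = 0" by (rule AE_completion)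
  then show ?thesis using hg' by eventually_elim simp
qed

lemma smooth_lebesgue_measurable: "smooth f \<Longrightarrow> f \<in> borel_measurable lebesgue"
  using borel_measurable_continuous_onI[OF smooth_continuous, of f] by (simp add: measurable_completion)

text \<open>Bumps give zero integrals of \<open>g\<close> over boxes whose closure lies in
  \<open>S\<close>. Intersections of such boxes are boxes, so the criterion for integrable functions
  applies to \<open>g\<close> cut off by one of them, and countably many closed boxes cover
  \<open>S\<close>.\<close>

lemma AE_zero_if_test_integrals_zero:
  assumes S: "open S" and g: "locally_integrable_on S g"
    and z: "\<And>\<phi>. \<phi> \<in> test_functions S \<Longrightarrow> (LINT x:S|lebesgue. g x * \<phi> x) = 0"
  shows "AE x in lebesgue. x \<in> S \<longrightarrow> g x = 0"
proof -
  have smallbox: "(LINT x:box p q|lebesgue. g x) = 0" if pq: "cbox p q \<subseteq> S" for p q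
  proof -
    have gi: "integrable lebesgue (\<lambda>x. indicator (cbox p q) x * g x)"
      using g pq unfolding locally_integrable_on_def set_integrable_def by force
    have "(\<lambda>n. LINT x|lebesgue. box_bump n p q x * (indicator (cbox p q) x * g x))
        \<longlonglongrightarrow> (LINT x|lebesgue. indicator (box p q) x * (indicator (cbox p q) x * g x))"
    proof (rule integral_dominated_convergence)
      show "integrable lebesgue (\<lambda>x. \<bar>indicator (cbox p q) x * g x\<bar>)" using gi by (rule integrable_abs)
      show "(\<lambda>x. box_bump n p q x * (indicator (cbox p q) x * g x)) \<in> borel_measurable lebesgue" for n
        by (rule borel_measurable_times[OF smooth_lebesgue_measurable[OF smooth_box_bump] borel_measurable_integrable[OF gi]])
      show "(\<lambda>x. indicator (box p q) x * (indicator (cbox p q) x * g x)) \<in> borel_measurable lebesgue"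
        by (rule borel_measurable_times[OF borel_measurable_indicator borel_measurable_integrable[OF gi]]) auto
      show "AE x in lebesgue. (\<lambda>n. box_bump n p q x * (indicator (cbox p q) x * g x))
          \<longlonglongrightarrow> indicator (box p q) x * (indicator (cbox p q) x * g x)"
        by (intro AE_I2 tendsto_intros box_bump_tendsto)
      show "AE x in lebesgue. norm (box_bump n p q x * (indicator (cbox p q) x * g x)) \<le> \<bar>indicator (cbox p q) x * g x\<bar>" for n
        using box_bump_bounds[of n p q] by (intro AE_I2) (auto simp: abs_mult intro!: mult_left_le_one_le)
    qed
    moreover have "(LINT x|lebesgue. box_bump n p q x * (indicator (cbox p q) x * g x)) = 0" for n
    proof -
      have "box_bump n p q x = 0" if "x \<notin> cbox p q" for x
        using that by (cases p; cases q; cases x)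
          (auto simp: box_bump_def step_def cbox_Pair_eq zero_less_mult_iff)
      then have "(LINT x|lebesgue. box_bump n p q x * (indicator (cbox p q) x * g x)) = (LINT x:S|lebesgue. g x * box_bump n p q x)"
        unfolding set_lebesgue_integral_def using pq
        by (intro Bochner_Integration.integral_cong) (auto simp: indicator_def)
      then show ?thesis using z[OF box_bump_test[OF pq]] by simp
    qed
    moreover have "(LINT x|lebesgue. indicator (box p q) x * (indicator (cbox p q) x * g x)) = (LINT x:box p q|lebesgue. g x)"
      unfolding set_lebesgue_integral_def using box_subset_cbox[of p q]
      by (intro Bochner_Integration.integral_cong) (auto simp: indicator_def)
    ultimately show ?thesis by (simp add: LIMSEQ_const_iff)
  qed
  have onbox: "AE x in lebesgue. x \<in> cbox p q \<longrightarrow> g x = 0" if pq: "cbox p q \<subseteq> S" for p q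
  proof -
    have gi: "integrable lebesgue (\<lambda>x. indicator (box p q) x * g x)"
    proof -
      have "set_integrable lebesgue (cbox p q) g"
        using g pq unfolding locally_integrable_on_def by auto
      then have "set_integrable lebesgue (box p q) g"
        by (rule set_integrable_subset) (auto simp: box_subset_cbox)
      then show ?thesis by (simp add: set_integrable_def)
    qed
    have "AE x in lebesgue. indicator (box p q) x * g x = 0"
    proof (rule AE_zero_if_box_integrals_zero[OF gi])
      fix p' q' :: "real \<times> real"
      have "\<exists>p'' q''. box p' q' \<inter> box p q = box p'' q''" by (intro exI) (rule box_Int_box)
      then obtain p'' q'' where I: "box p' q' \<inter> box p q = box p'' q''" by (elim exE)
      have "(LINT x|lebesgue. indicator (box p' q') x * (indicator (box p q) x * g x)) = (LINT x:box p'' q''|lebesgue. g x)"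
        unfolding set_lebesgue_integral_def I[symmetric]
        by (intro Bochner_Integration.integral_cong) (auto simp: indicator_def)
      also have "\<dots> = 0"
      \<comment> \<open>The empty box is set apart because the corresponding \<open>cbox\<close> can
        be a nonempty segment that leaves \<open>S\<close>.\<close>
      proof (cases "box p'' q'' = {}")
        case False
        then have "cbox p'' q'' = closure (box p'' q'')" by (rule closure_box[symmetric])
        also have "\<dots> \<subseteq> closure (box p q)" by (rule closure_mono) (use I in auto)
        also have "\<dots> \<subseteq> cbox p q" by (rule closure_minimal) (auto simp: box_subset_cbox)
        finally show ?thesis using pq by (intro smallbox) auto
      qed (simp add: set_lebesgue_integral_def)
      finally show "(LINT x|lebesgue. indicator (box p' q') x * (indicator (box p q) x * g x)) = 0" .
    qed
    moreover have "AE x in lebesgue. x \<notin> cbox p q - box p q"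
      by (rule AE_not_in[OF negligible_frontier_interval[of p q, unfolded negligible_iff_null_sets]])
    ultimately show ?thesis by eventually_elim (auto simp: indicator_def split: if_splits)
  qed
  obtain \<D> where D: "countable \<D>" "\<D> \<subseteq> Pow S" "\<And>X. X \<in> \<D> \<Longrightarrow> \<exists>a b. X = cbox a b" "\<Union>\<D> = S"
    using open_countable_Union_open_cbox[OF S] by metis
  have "AE x in lebesgue. \<forall>X\<in>\<D>. x \<in> X \<longrightarrow> g x = 0"
  proof (rule AE_ball_countable'[OF _ D(1)])
    fix X assume X: "X \<in> \<D>"
    obtain a b where ab: "X = cbox a b" using D(3)[OF X] by blast
    show "AE x in lebesgue. x \<in> X \<longrightarrow> g x = 0" unfolding ab using X D(2) ab by (intro onbox) auto
  qed
  then show ?thesis by eventually_elim (use D(4) in auto)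
qed

text \<open>Every open box is an increasing limit, up to monotone choice of the corners, of rational
  boxes inside it; countability of these is what makes \<open>l2\<close> separable.\<close>

lemma AE_zero_if_rational_box_integrals_zero:
  fixes h :: "real \<times> real \<Rightarrow> real"
  assumes h: "integrable lebesgue h"
    and z: "\<And>a b c d :: rat. (LINT x|lebesgue. indicator (box (of_rat a, of_rat b) (of_rat c, of_rat d)) x * h x) = 0"
  shows "AE x in lebesgue. h x = 0"
proof (rule AE_zero_if_box_integrals_zero[OF h])
  fix p q :: "real \<times> real"
  have above: "\<exists>r::nat \<Rightarrow> rat. (\<forall>n. t < of_rat (r n)) \<and> (\<lambda>n. of_rat (r n)) \<longlonglongrightarrow> t" for t :: real
  proof -
    have "\<exists>r. t < of_rat r \<and> of_rat r < t + inverse (real (Suc n))" for n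
      by (rule of_rat_dense) simp
    then obtain r where r: "\<And>n. t < of_rat (r n)" "\<And>n. of_rat (r n) < t + inverse (real (Suc n))" by metis
    have "(\<lambda>n. t + inverse (real (Suc n))) \<longlonglongrightarrow> t + 0"
      by (intro tendsto_intros LIMSEQ_inverse_real_of_nat)
    then have "(\<lambda>n. of_rat (r n)) \<longlonglongrightarrow> t"
      using r by (intro tendsto_sandwich[of "\<lambda>_. t" "\<lambda>n. of_rat (r n)" sequentially "\<lambda>n. t + inverse (real (Suc n))" t])
        (auto intro!: always_eventually less_imp_le)
    then show ?thesis using r(1) by blast
  qed
  have below: "\<exists>r::nat \<Rightarrow> rat. (\<forall>n. of_rat (r n) < t) \<and> (\<lambda>n. of_rat (r n)) \<longlonglongrightarrow> t" for t :: real
  proof -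
    obtain r :: "nat \<Rightarrow> rat" where r: "\<And>n. - t < of_rat (r n)" "(\<lambda>n. of_rat (r n)) \<longlonglongrightarrow> - t"
      using above[of "- t"] by blast
    have "of_rat (- r n) < t" for n using r(1)[of n] by (simp add: of_rat_minus)
    moreover have "(\<lambda>n. of_rat (- r n)) \<longlonglongrightarrow> t"
      using tendsto_minus[OF r(2)] by (simp add: of_rat_minus)
    ultimately show ?thesis by (intro exI[of _ "\<lambda>n. - r n"]) blast
  qed
  obtain a b c d :: "nat \<Rightarrow> rat" where
      a: "\<And>n. fst p < of_rat (a n)" "(\<lambda>n. of_rat (a n)) \<longlonglongrightarrow> fst p"
    and b: "\<And>n. snd p < of_rat (b n)" "(\<lambda>n. of_rat (b n)) \<longlonglongrightarrow> snd p"
    and c: "\<And>n. of_rat (c n) < fst q" "(\<lambda>n. of_rat (c n)) \<longlonglongrightarrow> fst q"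
    and d: "\<And>n. of_rat (d n) < snd q" "(\<lambda>n. of_rat (d n)) \<longlonglongrightarrow> snd q"
    using above[of "fst p"] above[of "snd p"] below[of "fst q"] below[of "snd q"] by blast
  define B where "B n = (box (of_rat (a n), of_rat (b n)) (of_rat (c n), of_rat (d n)) :: (real \<times> real) set)" for n
  have memB: "x \<in> B n \<longleftrightarrow> of_rat (a n) < fst x \<and> fst x < of_rat (c n) \<and> of_rat (b n) < snd x \<and> snd x < of_rat (d n)" for x n
    by (cases x) (auto simp: B_def mem_box Basis_prod_def)
  have mem: "x \<in> box p q \<longleftrightarrow> fst p < fst x \<and> fst x < fst q \<and> snd p < snd x \<and> snd x < snd q" for x
    by (cases x; cases p; cases q) (auto simp: mem_box Basis_prod_def)
  have ind: "(\<lambda>n. indicator (B n) x :: real) \<longlonglongrightarrow> indicator (box p q) x" for x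
  proof (cases "x \<in> box p q")
    case True
    then have "\<forall>\<^sub>F n in sequentially. x \<in> B n"
      unfolding memB mem using order_tendstoD[OF a(2)] order_tendstoD[OF b(2)] order_tendstoD[OF c(2)] order_tendstoD[OF d(2)]
      by (auto intro!: eventually_conj)
    then have "\<forall>\<^sub>F n in sequentially. indicator (B n) x = (indicator (box p q) x :: real)"
      by eventually_elim (use True in simp)
    then show ?thesis by (rule tendsto_eventually)
  next
    case False
    have "x \<notin> B n" for n
      using False a(1)[of n] b(1)[of n] c(1)[of n] d(1)[of n] unfolding memB mem by (auto dest: less_trans)
    then show ?thesis using False by simp
  qed
  have "(\<lambda>n. LINT x|lebesgue. indicator (B n) x * h x) \<longlonglongrightarrow> (LINT x|lebesgue. indicator (box p q) x * h x)"
  proof (rule integral_dominated_convergence)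
    show "integrable lebesgue (\<lambda>x. \<bar>h x\<bar>)" using h by (rule integrable_abs)
    show "(\<lambda>x. indicator (B n) x * h x) \<in> borel_measurable lebesgue" for n
      using h by (intro borel_measurable_times borel_measurable_indicator) (auto simp: B_def)
    show "(\<lambda>x. indicator (box p q) x * h x) \<in> borel_measurable lebesgue"
      using h by (intro borel_measurable_times borel_measurable_indicator) auto
    show "AE x in lebesgue. (\<lambda>n. indicator (B n) x * h x) \<longlonglongrightarrow> indicator (box p q) x * h x"
      by (intro AE_I2 tendsto_intros ind)
    show "AE x in lebesgue. norm (indicator (B n) x * h x) \<le> \<bar>h x\<bar>" for n
      by (intro AE_I2) (auto simp: indicator_def)
  qed
  moreover have "(LINT x|lebesgue. indicator (B n) x * h x) = 0" for n
    unfolding B_def by (rule z)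
  ultimately show "(LINT x|lebesgue. indicator (box p q) x * h x) = 0"
    by (simp add: LIMSEQ_const_iff)
qed

lemma sqint_indicator_box: "sqint (indicator (box p q))"
proof -
  have "(\<lambda>x. (indicator (box p q) x)\<^sup>2 :: real) = indicator (box p q)" by (auto simp: indicator_def)
  moreover have "emeasure lebesgue (box p q) < \<infinity>"
    by (rule order.strict_trans1[OF emeasure_mono[OF box_subset_cbox]]) (auto simp: emeasure_lborel_cbox_eq)
  ultimately show ?thesis by (auto simp: sqint_def intro!: borel_measurable_indicator)
qed

lemma l2_rational_boxes_total:
  assumes z: "\<And>a b c d :: rat. inner y (cl (indicator (box (of_rat a, of_rat b) (of_rat c, of_rat d)))) = 0"
  shows "y = (0 :: l2)"
proof -
  \<comment> \<open>\<open>y\<close> is square integrable but possibly not integrable over the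
    plane, hence the cutoff to a bounded square. Its corners are rational, so that intersecting it
    with a rational box gives a rational box again.\<close>
  define N where "N n = (box (of_rat (- of_nat n), of_rat (- of_nat n)) (of_rat (of_nat n), of_rat (of_nat n)) :: (real \<times> real) set)" for n :: nat
  have "AE x in lebesgue. indicator (N n) x * fn y x = 0" for n
  proof (rule AE_zero_if_rational_box_integrals_zero)
    show "integrable lebesgue (\<lambda>x. indicator (N n) x * fn y x)"
      unfolding N_def by (rule sqint_mult_integrable[OF sqint_indicator_box sqint_fn])
    fix a b c d :: rat
    define m where "m = (of_nat n :: rat)"
    have r: "of_rat (max s t) = max (of_rat s) (of_rat t :: real)" "of_rat (min s t) = min (of_rat s) (of_rat t :: real)" for s t
      by (auto simp: max_def min_def of_rat_less_eq)
    have "box (of_rat a, of_rat b) (of_rat c, of_rat d) \<inter> N n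
        = box (of_rat (max a (- m)), of_rat (max b (- m))) (of_rat (min c m), of_rat (min d m))"
      unfolding N_def m_def[symmetric] r by (auto simp: mem_box Basis_prod_def)
    then have eq: "indicator (box (of_rat a, of_rat b) (of_rat c, of_rat d)) x * (indicator (N n) x * fn y x)
        = indicator (box (of_rat (max a (- m)), of_rat (max b (- m))) (of_rat (min c m), of_rat (min d m))) x * fn y x" for x
      by (metis indicator_inter_arith mult.assoc)
    have "(LINT x|lebesgue. indicator (box (of_rat a, of_rat b) (of_rat c, of_rat d)) x * (indicator (N n) x * fn y x))
       = inner (cl (indicator (box (of_rat (max a (- m)), of_rat (max b (- m))) (of_rat (min c m), of_rat (min d m))))) (cl (fn y))"
      unfolding eq by (rule inner_cl[OF sqint_indicator_box sqint_fn, symmetric])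
    also have "\<dots> = 0" using z by (simp add: inner_commute)
    finally show "(LINT x|lebesgue. indicator (box (of_rat a, of_rat b) (of_rat c, of_rat d)) x * (indicator (N n) x * fn y x)) = 0" .
  qed
  then have "AE x in lebesgue. \<forall>n. indicator (N n) x * fn y x = 0" by (subst AE_all_countable) blast
  then have "AE x in lebesgue. fn y x = fn 0 x"
    using fn_zero
  proof eventually_elim
    case (elim x)
    obtain n where n: "max \<bar>fst x\<bar> \<bar>snd x\<bar> < real n" using reals_Archimedean2 by blast
    have "x \<in> N n" using n unfolding N_def by (cases x) (auto simp: mem_box Basis_prod_def of_rat_minus)
    then show ?case using elim(1)[rule_format, of n] elim(2) by simp
  qed
  then show ?thesis by (simp add: l2_eq_iff)
qed

lemma countable_dense_imp_second_countable:
  fixes T :: "'a::metric_space set"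
  assumes "countable T" "closure T = UNIV"
  shows "\<exists>B::'a set set. countable B \<and> open = generate_topology B"
proof -
  define B where "B = (\<lambda>(t, n). ball t (inverse (real (Suc n)))) ` (T \<times> UNIV)"
  have "topological_basis B"
  proof (rule topological_basisI)
    show "open X" if "X \<in> B" for X using that by (auto simp: B_def)
    fix U x assume "open (U :: 'a set)" "x \<in> U"
    then obtain e where e: "e > 0" "ball x e \<subseteq> U" by (metis open_contains_ball)
    obtain n where n: "inverse (real (Suc n)) < e / 2" using reals_Archimedean e(1) half_gt_zero by blast
    have "x \<in> closure T" using assms(2) by simp
    then obtain t where t: "t \<in> T" "dist t x < inverse (real (Suc n))"
      unfolding closure_approachable using inverse_positive_iff_positive of_nat_0_less_iff zero_less_Suc by metis
    have "ball t (inverse (real (Suc n))) \<subseteq> U"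
    proof (rule order_trans[OF _ e(2)], rule subsetI)
      fix y assume "y \<in> ball t (inverse (real (Suc n)))"
      then have "dist t y < inverse (real (Suc n))" by simp
      then have "dist x y < e" using t(2) n dist_triangle[of x y t] by (simp add: dist_commute)
      then show "y \<in> ball x e" by simp
    qed
    moreover have "x \<in> ball t (inverse (real (Suc n)))" using t(2) by simp
    moreover have "ball t (inverse (real (Suc n))) \<in> B" using t(1) unfolding B_def by force
    ultimately show "\<exists>V\<in>B. x \<in> V \<and> V \<subseteq> U" by blast
  qed
  moreover have "countable B" unfolding B_def using assms(1) by auto
  ultimately show ?thesis using topological_basis_imp_subbasis by blast
qed

instance l2 :: banach ..

text \<open>The Gram-Schmidt expansion of \<open>y\<close> along rational box indicators converges
  to a vector with the same inner products against all of them, that is to \<open>y\<close>.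
  Rounding the coefficients of a partial sum to rationals leaves a countable dense set.\<close>

instance l2 :: second_countable_topology
proof
  define d where "d n = (case from_nat n of (a, b, c, d) \<Rightarrow>
      cl (indicator (box (of_rat a, of_rat b) (of_rat c, of_rat d))))" for n
  define T where "T = range (\<lambda>qs :: rat list. \<Sum>i<length qs. of_rat (qs ! i) *\<^sub>R gs d i)"
  have "y \<in> closure T" for y
    unfolding closure_approachable
  proof (intro allI impI)
    fix e :: real assume e: "e > 0"
    obtain x where x: "\<And>i. inner x (gs d i) = inner y (gs d i)" "(\<lambda>i. inner y (gs d i) *\<^sub>R gs d i) sums x"
      using gs_riesz_fischer[of UNIV d "\<lambda>i. inner y (gs d i)" "(norm y)\<^sup>2"] gs_bessel[of y d] by auto
    have dn: "inner (y - x) (d n) = 0" for n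
      by (subst gs_expand[of d n]) (simp add: inner_sum_right inner_diff_left x(1))
    have "y - x = 0"
    proof (rule l2_rational_boxes_total)
      fix a b c e :: rat
      show "inner (y - x) (cl (indicator (box (of_rat a, of_rat b) (of_rat c, of_rat e)))) = 0"
        using dn[of "to_nat (a, b, c, e)"] by (simp add: d_def)
    qed
    then have "(\<lambda>n. \<Sum>i<n. inner y (gs d i) *\<^sub>R gs d i) \<longlonglongrightarrow> y" using x(2) by (simp add: sums_def)
    from LIMSEQ_D[OF this, of "e / 2"] e
    obtain n where "\<forall>m\<ge>n. norm ((\<Sum>i<m. inner y (gs d i) *\<^sub>R gs d i) - y) < e / 2" by auto
    then have n: "norm ((\<Sum>i<n. inner y (gs d i) *\<^sub>R gs d i) - y) < e / 2" by blast
    have "\<exists>q. inner y (gs d i) < of_rat q \<and> of_rat q < inner y (gs d i) + e / (2 * real (Suc n))" for i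
      by (rule of_rat_dense) (use e in simp)
    then obtain q where q: "\<And>i. inner y (gs d i) < of_rat (q i)"
      "\<And>i. of_rat (q i) < inner y (gs d i) + e / (2 * real (Suc n))" by metis
    define s where "s = (\<Sum>i<n. of_rat (q i) *\<^sub>R gs d i)"
    have "norm (s - (\<Sum>i<n. inner y (gs d i) *\<^sub>R gs d i)) \<le> (\<Sum>i<n. e / (2 * real (Suc n)))"
      unfolding s_def sum_subtractf[symmetric] scaleR_diff_left[symmetric]
    proof (rule sum_norm_le)
      fix i
      have "norm (gs d i) \<le> 1" using gs_unit_or_zero[of d i] by (simp add: norm_eq_sqrt_inner)
      then have "norm ((of_rat (q i) - inner y (gs d i)) *\<^sub>R gs d i) \<le> \<bar>of_rat (q i) - inner y (gs d i)\<bar> * 1"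
        unfolding norm_scaleR by (rule mult_left_mono) simp
      also have "\<dots> \<le> e / (2 * real (Suc n))" using q[of i] by simp
      finally show "norm ((of_rat (q i) - inner y (gs d i)) *\<^sub>R gs d i) \<le> e / (2 * real (Suc n))" .
    qed
    also have "\<dots> \<le> e / 2" using e by (simp add: field_simps)
    finally have "norm (s - y) < e"
      using n norm_triangle_ineq[of "s - (\<Sum>i<n. inner y (gs d i) *\<^sub>R gs d i)" "(\<Sum>i<n. inner y (gs d i) *\<^sub>R gs d i) - y"]
      by simp
    moreover have "s \<in> T"
      unfolding T_def s_def by (rule range_eqI[of _ _ "map q [0..<n]"]) simp
    ultimately show "\<exists>t\<in>T. dist t y < e" by (auto simp: dist_norm)
  qed
  then have "closure T = UNIV" by blast
  moreover have "countable T" unfolding T_def by simp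
  ultimately show "\<exists>B::l2 set set. countable B \<and> open = generate_topology B"
    by (intro countable_dense_imp_second_countable)
qed

section \<open>Multiplication by bounded measurable weights\<close>

definition bmeas :: "(real \<times> real \<Rightarrow> real) \<Rightarrow> bool" where
  "bmeas k \<longleftrightarrow> k \<in> borel_measurable lebesgue \<and> (\<exists>C. \<forall>x. \<bar>k x\<bar> \<le> C)"

lemma sqint_bmeas: "bmeas k \<Longrightarrow> sqint f \<Longrightarrow> sqint (\<lambda>x. k x * f x)"
  unfolding bmeas_def using sqint_bounded_mult by blast

text \<open>The weights r and 1 / r of cylindrical coordinates enter the forms as operators of this
  kind, so that one unweighted space serves throughout.\<close>

definition wt :: "(real \<times> real \<Rightarrow> real) \<Rightarrow> l2 \<Rightarrow> l2" where
  "wt k x = cl (\<lambda>t. k t * fn x t)"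

lemma fn_wt: "bmeas k \<Longrightarrow> AE t in lebesgue. fn (wt k x) t = k t * fn x t"
  unfolding wt_def by (intro fn_cl sqint_bmeas) auto

lemma wt_cl:
  assumes k: "bmeas k" and f: "sqint f" shows "wt k (cl f) = cl (\<lambda>t. k t * f t)"
  unfolding wt_def
proof (rule cl_cong_AE)
  show "AE x in lebesgue. k x * fn (cl f) x = k x * f x"
    using fn_cl[OF f] by eventually_elim simp
qed (use assms in \<open>auto intro: sqint_bmeas\<close>)

lemma wt_add: "bmeas k \<Longrightarrow> wt k (x + y) = wt k x + wt k y"
proof -
  assume k: "bmeas k"
  show ?thesis
    unfolding l2_eq_iff using fn_wt[OF k, of "x + y"] fn_wt[OF k, of x] fn_wt[OF k, of y] fn_add[of x y] fn_add[of "wt k x" "wt k y"]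
    by eventually_elim (simp add: algebra_simps)
qed

lemma inner_wt: "bmeas k \<Longrightarrow> inner (wt k x) y = (LINT t|lebesgue. k t * fn x t * fn y t)"
  using inner_cl[of "\<lambda>t. k t * fn x t" "fn y"] by (simp add: wt_def sqint_bmeas)

lemma inner_wt_commute: "bmeas k \<Longrightarrow> inner (wt k x) y = inner x (wt k y)"
  by (subst inner_commute, simp only: inner_wt[of k x y] inner_wt[of k y x] inner_commute[of x "wt k y"])
     (simp add: mult.commute mult.left_commute)

lemma norm_wt_le:
  assumes k: "bmeas k" and C: "\<And>x. \<bar>k x\<bar> \<le> C"
  shows "norm (wt k x) \<le> C * norm x"
proof (rule power2_le_imp_le)
  have "(norm (wt k x))\<^sup>2 = (LINT t|lebesgue. (k t * fn x t)\<^sup>2)"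
    unfolding wt_def by (rule norm_cl) (intro sqint_bmeas k sqint_fn)
  also have "\<dots> \<le> (LINT t|lebesgue. C\<^sup>2 * (fn x t)\<^sup>2)"
  proof (rule integral_mono)
    show "integrable lebesgue (\<lambda>t. (k t * fn x t)\<^sup>2)"
      using sqint_bmeas[OF k sqint_fn[of x]] by (simp add: sqint_def)
    show "integrable lebesgue (\<lambda>t. C\<^sup>2 * (fn x t)\<^sup>2)" using sqint_fn[of x] by (simp add: sqint_def)
    show "(k t * fn x t)\<^sup>2 \<le> C\<^sup>2 * (fn x t)\<^sup>2" for t
      unfolding power_mult_distrib using power_mono[OF C[of t], of 2] by (intro mult_right_mono) auto
  qed
  also have "\<dots> = (C * norm x)\<^sup>2" by (simp add: norm_fn power_mult_distrib)
  finally show "(norm (wt k x))\<^sup>2 \<le> (C * norm x)\<^sup>2" .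
  show "0 \<le> C * norm x" using C[of undefined] by (intro mult_nonneg_nonneg) auto
qed

lemma bounded_linear_wt: "bmeas k \<Longrightarrow> bounded_linear (wt k)"
proof -
  assume k: "bmeas k"
  then obtain C where C: "\<And>x. \<bar>k x\<bar> \<le> C" by (auto simp: bmeas_def)
  show ?thesis
  proof (rule bounded_linear_intro[where K=C])
    show "wt k (x + y) = wt k x + wt k y" for x y by (rule wt_add[OF k])
    show "wt k (r *\<^sub>R x) = r *\<^sub>R wt k x" for r x
      unfolding l2_eq_iff using fn_wt[OF k, of "r *\<^sub>R x"] fn_wt[OF k, of x] fn_scale[of r x] fn_scale[of r "wt k x"]
      by eventually_elim simp
    show "norm (wt k x) \<le> norm x * C" for x using norm_wt_le[OF k C, of x] by (simp add: mult.commute)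
  qed
qed

section \<open>One-dimensional inequalities\<close>

lemma integral_shifted_square:
  fixes f :: "real \<Rightarrow> real"
  assumes ab: "a \<le> b" and f: "continuous_on {a..b} f"
  shows "integral {a..b} (\<lambda>t. (f t - c)\<^sup>2)
    = integral {a..b} (\<lambda>t. (f t)\<^sup>2) - 2 * c * integral {a..b} f + (b - a) * c\<^sup>2"
proof -
  have i: "f integrable_on {a..b}" "(\<lambda>t. (f t)\<^sup>2) integrable_on {a..b}"
    using f by (auto intro!: integrable_continuous_interval continuous_intros)
  have "integral {a..b} (\<lambda>t. (f t - c)\<^sup>2) = integral {a..b} (\<lambda>t. ((f t)\<^sup>2 - 2 * c * f t) + c\<^sup>2)"
    by (intro integral_cong) (simp add: power2_eq_square algebra_simps)
  also have "\<dots> = integral {a..b} (\<lambda>t. (f t)\<^sup>2 - 2 * c * f t) + integral {a..b} (\<lambda>t. c\<^sup>2)"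
    using i by (intro integral_add integrable_diff integrable_on_mult_right) auto
  also have "integral {a..b} (\<lambda>t. (f t)\<^sup>2 - 2 * c * f t) = integral {a..b} (\<lambda>t. (f t)\<^sup>2) - integral {a..b} (\<lambda>t. 2 * c * f t)"
    using i by (intro integral_diff integrable_on_mult_right) auto
  finally show ?thesis using ab by simp
qed

lemma integral_square_le:
  fixes f :: "real \<Rightarrow> real"
  assumes ab: "a \<le> b" and f: "continuous_on {a..b} f"
  shows "(integral {a..b} f)\<^sup>2 \<le> (b - a) * integral {a..b} (\<lambda>t. (f t)\<^sup>2)"
proof (cases "a = b")
  case False
  define m where "m = integral {a..b} f / (b - a)"
  have "0 \<le> integral {a..b} (\<lambda>t. (f t - m)\<^sup>2)"
    by (rule integral_nonneg) (auto intro!: integrable_continuous_interval continuous_intros f)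
  also have "\<dots> = integral {a..b} (\<lambda>t. (f t)\<^sup>2) - (integral {a..b} f)\<^sup>2 / (b - a)"
  proof -
    have "X - 2 * (I / d) * I + d * (I / d)\<^sup>2 = X - I\<^sup>2 / d" if "d \<noteq> 0" for X I d :: real
      using that by (simp add: field_simps power2_eq_square)
    then show ?thesis unfolding integral_shifted_square[OF ab f] m_def using False by simp
  qed
  finally have "(integral {a..b} f)\<^sup>2 / (b - a) \<le> integral {a..b} (\<lambda>t. (f t)\<^sup>2)" by simp
  then show ?thesis using ab False by (simp add: field_simps)
qed simp

text \<open>The left side is the integral of the squared deviation from the mean, and the mean is
  the best constant.\<close>

lemma integral_square_minus_mean_le:
  fixes f :: "real \<Rightarrow> real"
  assumes ab: "a < b" and f: "continuous_on {a..b} f"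
  shows "integral {a..b} (\<lambda>t. (f t)\<^sup>2) - (integral {a..b} f)\<^sup>2 / (b - a) \<le> integral {a..b} (\<lambda>t. (f t - c)\<^sup>2)"
proof -
  have "0 \<le> (b - a) * (c - integral {a..b} f / (b - a))\<^sup>2" using ab by simp
  also have "\<dots> = (integral {a..b} f)\<^sup>2 / (b - a) - 2 * c * integral {a..b} f + (b - a) * c\<^sup>2"
  proof -
    have "d * (c - I / d)\<^sup>2 = I\<^sup>2 / d - 2 * c * I + d * c\<^sup>2" if "d \<noteq> 0" for I d :: real
      using that by (simp add: field_simps power2_eq_square)
    then show ?thesis using ab by simp
  qed
  finally show ?thesis unfolding integral_shifted_square[OF less_imp_le[OF ab] f] by linarith
qed

text \<open>Since the mean is the best constant, \<open>f\<close> may be compared with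
  \<open>f a\<close> instead, and Cauchy-Schwarz bounds (f t - f a)^2 pointwise. The constant (b -
  a)^2 is not sharp; it only has to vanish with the length.\<close>

lemma poincare_1d:
  fixes f f' :: "real \<Rightarrow> real"
  assumes ab: "a < b" and d: "\<And>t. (f has_real_derivative f' t) (at t)" and f': "continuous_on {a..b} f'"
  shows "integral {a..b} (\<lambda>t. (f t)\<^sup>2)
    \<le> (integral {a..b} f)\<^sup>2 / (b - a) + (b - a)\<^sup>2 * integral {a..b} (\<lambda>t. (f' t)\<^sup>2)"
proof -
  have f: "continuous_on {a..b} f"
    using d by (meson DERIV_isCont continuous_at_imp_continuous_on)
  define D where "D = integral {a..b} (\<lambda>t. (f' t)\<^sup>2)"
  have sq: "continuous_on {a..b} (\<lambda>t. (f' t)\<^sup>2)" using f' by (intro continuous_intros)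
  have pt: "(f t - f a)\<^sup>2 \<le> (b - a) * D" if t: "t \<in> {a..b}" for t
  proof -
    have c: "continuous_on {a..t} f'" using f' t by (auto intro: continuous_on_subset)
    have "(f' has_integral (f t - f a)) {a..t}"
      using t d by (intro fundamental_theorem_of_calculus)
        (auto simp: has_real_derivative_iff_has_vector_derivative[symmetric] intro: has_field_derivative_at_within)
    then have "(f t - f a)\<^sup>2 \<le> (t - a) * integral {a..t} (\<lambda>t. (f' t)\<^sup>2)"
      using integral_square_le[OF _ c] t by (simp add: integral_unique)
    also have "\<dots> \<le> (b - a) * D"
    proof (rule mult_mono)
      show "integral {a..t} (\<lambda>t. (f' t)\<^sup>2) \<le> D"
        unfolding D_def using t sq
        by (intro integral_subset_le integrable_continuous_interval) (auto intro: continuous_on_subset)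
    qed (use t in \<open>auto intro!: integral_nonneg integrable_continuous_interval continuous_intros c\<close>)
    finally show ?thesis .
  qed
  have "integral {a..b} (\<lambda>t. (f t - f a)\<^sup>2) \<le> integral {a..b} (\<lambda>t. (b - a) * D)"
    using pt by (intro integral_le) (auto intro!: integrable_continuous_interval continuous_intros f)
  also have "\<dots> = (b - a)\<^sup>2 * D" using ab by (simp add: power2_eq_square)
  finally show ?thesis using integral_square_minus_mean_le[OF ab f, of "f a"] by (simp add: D_def)
qed

lemma integral_partition_sum:
  fixes f :: "real \<Rightarrow> real"
  assumes h: "h \<ge> 0" and f: "continuous_on {a..a + real N * h} f"
  shows "integral {a..a + real N * h} f = (\<Sum>i<N. integral {a + real i * h..a + real (Suc i) * h} f)"
  using f
proof (induction N)
  case (Suc N)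
  have le: "real N * h \<le> real (Suc N) * h" using h by (simp add: mult_right_mono)
  have "integral {a..a + real (Suc N) * h} f
      = integral {a..a + real N * h} f + integral {a + real N * h..a + real (Suc N) * h} f"
    using h le Suc.prems by (intro Henstock_Kurzweil_Integration.integral_combine[symmetric]) (auto intro: integrable_continuous_interval)
  also have "integral {a..a + real N * h} f = (\<Sum>i<N. integral {a + real i * h..a + real (Suc i) * h} f)"
    using Suc.prems le by (intro Suc.IH) (auto intro: continuous_on_subset)
  finally show ?case by simp
qed simp

lemma poincare_1d_partition:
  fixes f f' :: "real \<Rightarrow> real"
  assumes h: "h > 0" and d: "\<And>t. (f has_real_derivative f' t) (at t)" and f': "continuous_on UNIV f'"
  shows "integral {a..a + real N * h} (\<lambda>t. (f t)\<^sup>2)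
    \<le> (\<Sum>i<N. (integral {a + real i * h..a + real (Suc i) * h} f)\<^sup>2 / h) + h\<^sup>2 * integral {a..a + real N * h} (\<lambda>t. (f' t)\<^sup>2)"
proof -
  have f: "continuous_on S f" for S
    using d by (meson DERIV_isCont continuous_at_imp_continuous_on)
  have f'c: "continuous_on S f'" for S using f' by (rule continuous_on_subset) simp
  have e: "a + real (Suc i) * h - (a + real i * h) = h" for i by (simp add: algebra_simps)
  have "integral {a..a + real N * h} (\<lambda>t. (f t)\<^sup>2) = (\<Sum>i<N. integral {a + real i * h..a + real (Suc i) * h} (\<lambda>t. (f t)\<^sup>2))"
    using h by (intro integral_partition_sum continuous_intros f) auto
  also have "\<dots> \<le> (\<Sum>i<N. (integral {a + real i * h..a + real (Suc i) * h} f)\<^sup>2 / h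
      + h\<^sup>2 * integral {a + real i * h..a + real (Suc i) * h} (\<lambda>t. (f' t)\<^sup>2))"
  proof (rule sum_mono)
    fix i
    show "integral {a + real i * h..a + real (Suc i) * h} (\<lambda>t. (f t)\<^sup>2)
      \<le> (integral {a + real i * h..a + real (Suc i) * h} f)\<^sup>2 / h
      + h\<^sup>2 * integral {a + real i * h..a + real (Suc i) * h} (\<lambda>t. (f' t)\<^sup>2)"
      using poincare_1d[of "a + real i * h" "a + real (Suc i) * h" f f', OF _ d f'c] h unfolding e
      by (simp add: mult_strict_right_mono)
  qed
  also have "\<dots> = (\<Sum>i<N. (integral {a + real i * h..a + real (Suc i) * h} f)\<^sup>2 / h)
      + h\<^sup>2 * (\<Sum>i<N. integral {a + real i * h..a + real (Suc i) * h} (\<lambda>t. (f' t)\<^sup>2))"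
    by (simp add: sum.distrib sum_distrib_left)
  also have "(\<Sum>i<N. integral {a + real i * h..a + real (Suc i) * h} (\<lambda>t. (f' t)\<^sup>2)) = integral {a..a + real N * h} (\<lambda>t. (f' t)\<^sup>2)"
    using h by (intro integral_partition_sum[symmetric] continuous_intros f'c) auto
  finally show ?thesis .
qed

text \<open>The square of \<open>f\<close> has derivative 2 f f', so its values at two points differ
  by at most twice the integral of |f f'|; averaging over the second point gives the claim. The mean
  stands in for a boundary condition, which the smooth approximations do not satisfy.\<close>

lemma square_le_mean_plus_derivative:
  fixes f f' :: "real \<Rightarrow> real"
  assumes ab: "a < b" and d: "\<And>t. (f has_real_derivative f' t) (at t)" and f': "continuous_on {a..b} f'" and t: "t \<in> {a..b}"
  shows "(f t)\<^sup>2 \<le> integral {a..b} (\<lambda>t. (f t)\<^sup>2) / (b - a) + 2 * integral {a..b} (\<lambda>t. \<bar>f t * f' t\<bar>)"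
proof -
  have f: "continuous_on S f" for S
    using d by (meson DERIV_isCont continuous_at_imp_continuous_on)
  define D where "D = integral {a..b} (\<lambda>t. \<bar>f t * f' t\<bar>)"
  have step: "\<bar>(f v)\<^sup>2 - (f u)\<^sup>2\<bar> \<le> 2 * D" if uv: "a \<le> u" "u \<le> v" "v \<le> b" for u v
  proof -
    have c: "continuous_on {u..v} (\<lambda>t. \<bar>f t * f' t\<bar>)"
      by (intro continuous_intros f) (rule continuous_on_subset[OF f'], use uv in auto)
    have "((\<lambda>t. 2 * (f t * f' t)) has_integral ((f v)\<^sup>2 - (f u)\<^sup>2)) {u..v}"
      using uv by (intro fundamental_theorem_of_calculus)
        (auto simp: has_real_derivative_iff_has_vector_derivative[symmetric] power2_eq_square
          intro!: derivative_eq_intros has_field_derivative_at_within[OF d])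
    from integral_unique[OF this]
    have "\<bar>(f v)\<^sup>2 - (f u)\<^sup>2\<bar> = \<bar>integral {u..v} (\<lambda>t. 2 * (f t * f' t))\<bar>" by (simp only:)
    also have "\<dots> \<le> integral {u..v} (\<lambda>t. 2 * \<bar>f t * f' t\<bar>)"
      unfolding real_norm_def[symmetric]
      by (rule integral_norm_bound_integral)
         (auto intro!: integrable_continuous_interval continuous_intros c f continuous_on_subset[OF f'] simp: abs_mult, use uv in auto)
    also have "\<dots> = 2 * integral {u..v} (\<lambda>t. \<bar>f t * f' t\<bar>)" by simp
    also have "integral {u..v} (\<lambda>t. \<bar>f t * f' t\<bar>) \<le> D"
    proof -
      have "(\<lambda>t. \<bar>f t * f' t\<bar>) integrable_on {u..v}" "(\<lambda>t. \<bar>f t * f' t\<bar>) integrable_on {a..b}"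
        by (rule integrable_continuous_interval[OF c], intro integrable_continuous_interval continuous_intros f f')
      then show ?thesis unfolding D_def using uv by (intro integral_subset_le) auto
    qed
    finally show ?thesis by simp
  qed
  have "(b - a) * (f t)\<^sup>2 = integral {a..b} (\<lambda>s. (f t)\<^sup>2)" using ab by simp
  also have "\<dots> \<le> integral {a..b} (\<lambda>s. (f s)\<^sup>2 + 2 * D)"
  proof (rule integral_le)
    fix s assume s: "s \<in> {a..b}"
    show "(f t)\<^sup>2 \<le> (f s)\<^sup>2 + 2 * D"
      using step[of s t] step[of t s] s t by (cases "s \<le> t") auto
  qed (auto intro!: integrable_continuous_interval continuous_intros f)
  also have "\<dots> = integral {a..b} (\<lambda>s. (f s)\<^sup>2) + integral {a..b} (\<lambda>s. 2 * D)"
    by (intro integral_add integrable_continuous_interval continuous_intros f)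
  also have "\<dots> = integral {a..b} (\<lambda>s. (f s)\<^sup>2) + (b - a) * (2 * D)" using ab by simp
  finally show ?thesis using ab by (simp add: field_simps D_def)
qed

section \<open>Ladyzhenskaya's inequality\<close>

text \<open>A function of \<open>H\<^sup>1\<close> is represented by the triple of itself and its two partial derivatives,
  all extended by \<open>0\<close> outside the rectangle.\<close>

type_synonym h1 = "l2 \<times> l2 \<times> l2"

locale annulus =
  fixes \<sigma> R L :: real
  assumes \<sigma>0: "\<sigma> > 0" and \<sigma>R: "\<sigma> < R" and L0: "L > 0"
begin

text \<open>Closed, so that continuous functions are bounded and integrable on it; it differs from
  \<open>Omega\<close> by a null set.\<close>

definition B :: "(real \<times> real) set" where "B = cbox (\<sigma>, 0) (R, L)"

lemma mem_B: "x \<in> B \<longleftrightarrow> fst x \<in> {\<sigma>..R} \<and> snd x \<in> {0..L}"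
  by (cases x) (simp add: B_def cbox_Pair_eq)

lemma continuous_B_lebesgue:
  fixes f :: "real \<times> real \<Rightarrow> real"
  assumes "continuous_on B f"
  shows "integrable lebesgue (\<lambda>x. indicator B x * f x)" "(LINT x|lebesgue. indicator B x * f x) = integral B f"
proof -
  have "set_integrable lebesgue B f"
    using assms unfolding B_def by (rule absolutely_integrable_continuous)
  then show "integrable lebesgue (\<lambda>x. indicator B x * f x)" "(LINT x|lebesgue. indicator B x * f x) = integral B f"
    using set_lebesgue_integral_eq_integral(2)[of B f] by (simp_all add: set_integrable_def set_lebesgue_integral_def)
qed

definition J :: "(real \<times> real \<Rightarrow> real) \<Rightarrow> l2" where "J f = cl (\<lambda>x. indicator B x * f x)"

lemma sqint_B:
  assumes "continuous_on B f"
  shows "sqint (\<lambda>x. indicator B x * f x)"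
proof -
  have "(\<lambda>x. (indicator B x * f x)\<^sup>2) = (\<lambda>x. indicator B x * (f x)\<^sup>2)"
    by (auto simp: indicator_def)
  then show ?thesis
    using continuous_B_lebesgue(1)[of "\<lambda>x. (f x)\<^sup>2"] borel_measurable_integrable[OF continuous_B_lebesgue(1)[OF assms]] assms
    by (auto simp: sqint_def intro: continuous_intros)
qed

lemma fn_J: "continuous_on B f \<Longrightarrow> AE x in lebesgue. fn (J f) x = indicator B x * f x"
  unfolding J_def by (intro fn_cl sqint_B)

lemma inner_J:
  assumes "continuous_on B f" "continuous_on B g"
  shows "inner (J f) (J g) = integral B (\<lambda>x. f x * g x)"
proof -
  have "inner (J f) (J g) = (LINT x|lebesgue. indicator B x * f x * (indicator B x * g x))"
    unfolding J_def by (intro inner_cl sqint_B assms)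
  also have "\<dots> = (LINT x|lebesgue. indicator B x * (f x * g x))"
    by (intro Bochner_Integration.integral_cong) (auto simp: indicator_def)
  finally show ?thesis using continuous_B_lebesgue(2)[of "\<lambda>x. f x * g x"] assms by (simp add: continuous_on_mult)
qed

lemma norm_J: "continuous_on B f \<Longrightarrow> (norm (J f))\<^sup>2 = integral B (\<lambda>x. (f x)\<^sup>2)"
  unfolding power2_norm_eq_inner by (simp add: inner_J power2_eq_square)

lemma J_add: "continuous_on B f \<Longrightarrow> continuous_on B g \<Longrightarrow> J (\<lambda>x. f x + g x) = J f + J g"
  unfolding J_def by (simp add: cl_add sqint_B distrib_left)

lemma J_scale: "continuous_on B f \<Longrightarrow> J (\<lambda>x. c * f x) = c *\<^sub>R J f"
  unfolding J_def by (simp add: cl_scale sqint_B mult.left_commute)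

lemma integral_B:
  fixes f :: "real \<times> real \<Rightarrow> real"
  assumes "continuous_on B f"
  shows "integral B f = integral {\<sigma>..R} (\<lambda>r. integral {0..L} (\<lambda>z. f (r, z)))"
    "integral B f = integral {0..L} (\<lambda>z. integral {\<sigma>..R} (\<lambda>r. f (r, z)))"
proof -
  show *: "integral B f = integral {\<sigma>..R} (\<lambda>r. integral {0..L} (\<lambda>z. f (r, z)))"
    using integral_prod_continuous[of \<sigma> 0 R L f] assms by (simp add: B_def)
  have "continuous_on (cbox (\<sigma>, 0) (R, L)) (\<lambda>(x, y). f (x, y))" using assms by (simp add: B_def)
  from integral_swap_continuous[OF this] * show "integral B f = integral {0..L} (\<lambda>z. integral {\<sigma>..R} (\<lambda>r. f (r, z)))" by simp
qed

lemma continuous_slice: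
  assumes f: "continuous_on UNIV (f :: real \<times> real \<Rightarrow> real)"
  shows "continuous_on S (\<lambda>z. f (r, z))" "continuous_on S (\<lambda>r. f (r, z))"
  by (auto intro!: continuous_on_compose2[OF f] continuous_intros)

lemma continuous_integral_slice:
  assumes f: "continuous_on UNIV (f :: real \<times> real \<Rightarrow> real)"
  shows "continuous_on S (\<lambda>r. integral {a..b} (\<lambda>z. f (r, z)))" "continuous_on S (\<lambda>z. integral {a..b} (\<lambda>r. f (r, z)))"
proof -
  have "continuous_on (S \<times> cbox a b) (\<lambda>(x, t). f (x, t))" using continuous_on_subset[OF f] by auto
  from integral_continuous_on_param[OF this] show "continuous_on S (\<lambda>r. integral {a..b} (\<lambda>z. f (r, z)))" by simp
  have "continuous_on (S \<times> cbox a b) (\<lambda>(x, t). f (t, x))"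
    by (auto intro!: continuous_on_compose2[OF f] continuous_intros simp: case_prod_unfold)
  from integral_continuous_on_param[OF this] show "continuous_on S (\<lambda>z. integral {a..b} (\<lambda>r. f (r, z)))" by simp
qed

lemma integral_pd_smooth:
  assumes f: "smooth f"
  shows "integral B (pdr f) = integral {0..L} (\<lambda>z. f (R, z) - f (\<sigma>, z))"
    "integral B (pdz f) = integral {\<sigma>..R} (\<lambda>r. f (r, L) - f (r, 0))"
proof -
  have "integral {\<sigma>..R} (\<lambda>r. pdr f (r, z)) = f (R, z) - f (\<sigma>, z)" for z
    using \<sigma>R by (intro integral_unique fundamental_theorem_of_calculus)
      (auto simp: has_real_derivative_iff_has_vector_derivative[symmetric] intro: smooth_pdr[OF f])
  then show "integral B (pdr f) = integral {0..L} (\<lambda>z. f (R, z) - f (\<sigma>, z))"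
    using integral_B(2)[OF smooth_continuous[OF smooth_pd[OF f]]] by simp
  have "integral {0..L} (\<lambda>z. pdz f (r, z)) = f (r, L) - f (r, 0)" for r
    using L0 by (intro integral_unique fundamental_theorem_of_calculus)
      (auto simp: has_real_derivative_iff_has_vector_derivative[symmetric] intro: smooth_pdz[OF f])
  then show "integral B (pdz f) = integral {\<sigma>..R} (\<lambda>r. f (r, L) - f (r, 0))"
    using integral_B(1)[OF smooth_continuous[OF smooth_pd[OF f]]] by simp
qed

definition Jh :: "(real \<times> real \<Rightarrow> real) \<Rightarrow> h1" where "Jh f = (J f, J (pdr f), J (pdz f))"

lemma Jh_add: "smooth f \<Longrightarrow> smooth g \<Longrightarrow> Jh (\<lambda>x. f x + g x) = Jh f + Jh g"
proof -
  assume fg: "smooth f" "smooth g"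
  have "pd e (\<lambda>x. f x + g x) = (\<lambda>x. pd e f x + pd e g x)" for e using fg by (intro ext pd_smooth_add)
  then show ?thesis using fg by (simp add: Jh_def J_add smooth_continuous smooth_pd)
qed

lemma Jh_scale: "smooth f \<Longrightarrow> Jh (\<lambda>x. c * f x) = c *\<^sub>R Jh f"
proof -
  assume f: "smooth f"
  have "pd e (\<lambda>x. c * f x) = (\<lambda>x. c * pd e f x)" for e using f by (intro ext pd_smooth_scale)
  then show ?thesis using f by (simp add: Jh_def J_scale smooth_continuous smooth_pd)
qed

lemma norm_h1_comps: "norm (fst x) \<le> norm x" "norm (fst (snd x)) \<le> norm x" "norm (snd (snd x)) \<le> norm x" for x :: h1
  using norm_fst_le[of "fst x" "snd x"] norm_snd_le[of "snd x" "fst x"] norm_fst_le[of "fst (snd x)" "snd (snd x)"]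
    norm_snd_le[of "snd (snd x)" "fst (snd x)"] by auto

lemma integral_abs_mult_le:
  assumes f: "continuous_on B f" and g: "continuous_on B g"
  shows "integral B (\<lambda>x. \<bar>f x * g x\<bar>) \<le> norm (J f) * norm (J g)"
proof -
  have c: "continuous_on B (\<lambda>x. \<bar>f x\<bar>)" "continuous_on B (\<lambda>x. \<bar>g x\<bar>)" using f g by (auto intro: continuous_intros)
  have n: "norm (J (\<lambda>x. \<bar>f x\<bar>)) = norm (J f)" if "continuous_on B f" for f
  proof (rule power2_eq_imp_eq[OF _ norm_ge_zero norm_ge_zero])
    show "(norm (J (\<lambda>x. \<bar>f x\<bar>)))\<^sup>2 = (norm (J f))\<^sup>2"
      unfolding norm_J[OF that] norm_J[OF continuous_on_rabs[OF that]] by simp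
  qed
  have "integral B (\<lambda>x. \<bar>f x * g x\<bar>) = inner (J (\<lambda>x. \<bar>f x\<bar>)) (J (\<lambda>x. \<bar>g x\<bar>))"
    by (simp add: inner_J[OF c] abs_mult)
  also have "\<dots> \<le> norm (J f) * norm (J g)"
    using norm_cauchy_schwarz[of "J (\<lambda>x. \<bar>f x\<bar>)" "J (\<lambda>x. \<bar>g x\<bar>)"] by (simp add: n f g)
  finally show ?thesis .
qed

text \<open>The product of the constants of \<open>square_le_mean_plus_derivative\<close> in z and
  in r: in each direction 1 / length comes from the mean and 2 from the derivative of the
  square.\<close>

definition Klad :: real where "Klad = (1 / L + 2) * (1 / (R - \<sigma>) + 2)"

lemma Klad_pos: "Klad > 0"
  using L0 \<sigma>R by (auto simp: Klad_def intro!: mult_pos_pos add_pos_pos)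

text \<open>On lines in z the square of \<open>f\<close> is bounded by a function \<open>a\<close>
  of r alone, on lines in r the square of \<open>g\<close> by a function \<open>b\<close> of z
  alone. The double integral of their product splits into two single integrals. Using one direction
  for each function yields the bilinear form directly.\<close>

lemma ladyzhenskaya_smooth:
  assumes f: "smooth f" and g: "smooth g"
  shows "(norm (J (\<lambda>x. f x * g x)))\<^sup>2 \<le> Klad * (norm (J f) * norm (Jh f) * (norm (J g) * norm (Jh g)))"
proof -
  note cf = smooth_continuous[OF f] and cg = smooth_continuous[OF g]
    and cf' = smooth_continuous[OF smooth_pd[OF f]] and cg' = smooth_continuous[OF smooth_pd[OF g]]
  define a where "a r = integral {0..L} (\<lambda>z. (f (r, z))\<^sup>2) / L + 2 * integral {0..L} (\<lambda>z. \<bar>f (r, z) * pdz f (r, z)\<bar>)" for r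
  define b where "b z = integral {\<sigma>..R} (\<lambda>r. (g (r, z))\<^sup>2) / (R - \<sigma>) + 2 * integral {\<sigma>..R} (\<lambda>r. \<bar>g (r, z) * pdr g (r, z)\<bar>)" for z
  have ca: "continuous_on S a" for S
    unfolding a_def using L0
    by (intro continuous_intros continuous_integral_slice(1)[of "\<lambda>x. (f x)\<^sup>2"]
        continuous_integral_slice(1)[of "\<lambda>x. \<bar>f x * pdz f x\<bar>"] cf cf') auto
  have cb: "continuous_on S b" for S
    unfolding b_def using \<sigma>R
    by (intro continuous_intros continuous_integral_slice(2)[of "\<lambda>x. (g x)\<^sup>2"]
        continuous_integral_slice(2)[of "\<lambda>x. \<bar>g x * pdr g x\<bar>"] cg cg') auto
  have fa: "(f (r, z))\<^sup>2 \<le> a r" if "z \<in> {0..L}" for r z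
    using square_le_mean_plus_derivative[OF L0 smooth_pdz[OF f] continuous_slice(1)[OF cf'] that, of r]
    by (simp add: a_def)
  have gb: "(g (r, z))\<^sup>2 \<le> b z" if "r \<in> {\<sigma>..R}" for r z
    using square_le_mean_plus_derivative[OF \<sigma>R smooth_pdr[OF g] continuous_slice(2)[OF cg'] that, of z]
    by (simp add: b_def)
  have cab: "continuous_on B (\<lambda>x. a (fst x) * b (snd x))"
    by (intro continuous_intros continuous_on_compose2[OF ca] continuous_on_compose2[OF cb]) auto
  have ia: "integral {\<sigma>..R} a = integral B (\<lambda>x. (f x)\<^sup>2) / L + 2 * integral B (\<lambda>x. \<bar>f x * pdz f x\<bar>)"
  proof -
    have c1: "continuous_on {\<sigma>..R} (\<lambda>r. integral {0..L} (\<lambda>z. (f (r, z))\<^sup>2))"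
      by (rule continuous_integral_slice(1)[of "\<lambda>x. (f x)\<^sup>2"]) (intro continuous_intros cf)
    have c2: "continuous_on {\<sigma>..R} (\<lambda>r. integral {0..L} (\<lambda>z. \<bar>f (r, z) * pdz f (r, z)\<bar>))"
      by (rule continuous_integral_slice(1)[of "\<lambda>x. \<bar>f x * pdz f x\<bar>"]) (intro continuous_intros cf cf')
    have "integral {\<sigma>..R} a = integral {\<sigma>..R} (\<lambda>r. integral {0..L} (\<lambda>z. (f (r, z))\<^sup>2) / L)
       + integral {\<sigma>..R} (\<lambda>r. 2 * integral {0..L} (\<lambda>z. \<bar>f (r, z) * pdz f (r, z)\<bar>))"
      unfolding a_def using L0
      by (intro integral_add integrable_continuous_interval continuous_intros c1 c2) auto
    moreover have "integral B (\<lambda>x. (f x)\<^sup>2) = integral {\<sigma>..R} (\<lambda>r. integral {0..L} (\<lambda>z. (f (r, z))\<^sup>2))"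
      by (rule integral_B(1)) (intro continuous_intros cf)
    moreover have "integral B (\<lambda>x. \<bar>f x * pdz f x\<bar>) = integral {\<sigma>..R} (\<lambda>r. integral {0..L} (\<lambda>z. \<bar>f (r, z) * pdz f (r, z)\<bar>))"
      by (rule integral_B(1)) (intro continuous_intros cf cf')
    ultimately show ?thesis by simp
  qed
  have ib: "integral {0..L} b = integral B (\<lambda>x. (g x)\<^sup>2) / (R - \<sigma>) + 2 * integral B (\<lambda>x. \<bar>g x * pdr g x\<bar>)"
  proof -
    have c1: "continuous_on {0..L} (\<lambda>z. integral {\<sigma>..R} (\<lambda>r. (g (r, z))\<^sup>2))"
      by (rule continuous_integral_slice(2)[of "\<lambda>x. (g x)\<^sup>2"]) (intro continuous_intros cg)
    have c2: "continuous_on {0..L} (\<lambda>z. integral {\<sigma>..R} (\<lambda>r. \<bar>g (r, z) * pdr g (r, z)\<bar>))"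
      by (rule continuous_integral_slice(2)[of "\<lambda>x. \<bar>g x * pdr g x\<bar>"]) (intro continuous_intros cg cg')
    have "integral {0..L} b = integral {0..L} (\<lambda>z. integral {\<sigma>..R} (\<lambda>r. (g (r, z))\<^sup>2) / (R - \<sigma>))
       + integral {0..L} (\<lambda>z. 2 * integral {\<sigma>..R} (\<lambda>r. \<bar>g (r, z) * pdr g (r, z)\<bar>))"
      unfolding b_def using \<sigma>R
      by (intro integral_add integrable_continuous_interval continuous_intros c1 c2) auto
    moreover have "integral B (\<lambda>x. (g x)\<^sup>2) = integral {0..L} (\<lambda>z. integral {\<sigma>..R} (\<lambda>r. (g (r, z))\<^sup>2))"
      by (rule integral_B(2)) (intro continuous_intros cg)
    moreover have "integral B (\<lambda>x. \<bar>g x * pdr g x\<bar>) = integral {0..L} (\<lambda>z. integral {\<sigma>..R} (\<lambda>r. \<bar>g (r, z) * pdr g (r, z)\<bar>))"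
      by (rule integral_B(2)) (intro continuous_intros cg cg')
    ultimately show ?thesis by simp
  qed
  have a0: "integral {\<sigma>..R} a \<ge> 0"
    by (intro integral_nonneg integrable_continuous_interval ca) (rule order_trans[OF _ fa[of 0]], use L0 in auto)
  have *: "(norm (J h))\<^sup>2 / l + 2 * integral B (\<lambda>x. \<bar>h x * pd e h x\<bar>) \<le> (1 / l + 2) * (norm (J h) * norm (Jh h))"
    if h: "smooth h" and "l > 0" and e: "norm (J (pd e h)) \<le> norm (Jh h)" for h l e
  proof -
    have "norm (J h) \<le> norm (Jh h)" using norm_h1_comps(1)[of "Jh h"] by (simp add: Jh_def)
    then have "(norm (J h))\<^sup>2 \<le> norm (J h) * norm (Jh h)" by (simp add: power2_eq_square mult_left_mono)
    moreover have "integral B (\<lambda>x. \<bar>h x * pd e h x\<bar>) \<le> norm (J h) * norm (Jh h)"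
      using integral_abs_mult_le[OF smooth_continuous[OF h] smooth_continuous[OF smooth_pd[OF h]], of e]
        mult_left_mono[OF e norm_ge_zero[of "J h"]] by linarith
    ultimately show ?thesis using \<open>l > 0\<close> by (simp add: distrib_right add_mono divide_right_mono)
  qed
  have "(norm (J (\<lambda>x. f x * g x)))\<^sup>2 = integral B (\<lambda>x. (f x * g x)\<^sup>2)"
    by (intro norm_J continuous_intros cf cg)
  also have "\<dots> \<le> integral B (\<lambda>x. a (fst x) * b (snd x))"
  proof (rule integral_le)
    show "(\<lambda>x. (f x * g x)\<^sup>2) integrable_on B" "(\<lambda>x. a (fst x) * b (snd x)) integrable_on B"
      unfolding B_def by (intro integrable_continuous continuous_intros cf cg, intro integrable_continuous cab[unfolded B_def])
    fix x assume "x \<in> B"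
    then have "(f x)\<^sup>2 \<le> a (fst x)" "(g x)\<^sup>2 \<le> b (snd x)"
      using fa[of "snd x" "fst x"] gb[of "fst x" "snd x"] by (auto simp: mem_B)
    moreover from this have "0 \<le> a (fst x)" using zero_le_power2[of "f x"] by linarith
    ultimately show "(f x * g x)\<^sup>2 \<le> a (fst x) * b (snd x)" by (simp add: power_mult_distrib mult_mono)
  qed
  also have "\<dots> = integral {\<sigma>..R} (\<lambda>r. a r * integral {0..L} b)"
    using integral_B(1)[OF cab] by simp
  also have "\<dots> = integral {\<sigma>..R} a * integral {0..L} b" by simp
  also have "\<dots> \<le> (1 / L + 2) * (norm (J f) * norm (Jh f)) * ((1 / (R - \<sigma>) + 2) * (norm (J g) * norm (Jh g)))"
  proof (rule mult_mono)
    show "integral {\<sigma>..R} a \<le> (1 / L + 2) * (norm (J f) * norm (Jh f))"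
      unfolding ia norm_J[OF cf, symmetric] using norm_h1_comps(3)[of "Jh f"] by (intro * f L0) (simp add: Jh_def)
    show "integral {0..L} b \<le> (1 / (R - \<sigma>) + 2) * (norm (J g) * norm (Jh g))"
      unfolding ib norm_J[OF cg, symmetric] using norm_h1_comps(2)[of "Jh g"] \<sigma>R by (intro * g) (auto simp: Jh_def)
    show "0 \<le> (1 / L + 2) * (norm (J f) * norm (Jh f))" using L0 by (intro mult_nonneg_nonneg) auto
    show "0 \<le> integral {0..L} b"
      by (intro integral_nonneg integrable_continuous_interval cb) (rule order_trans[OF _ gb[of \<sigma>]], use \<sigma>R in auto)
  qed
  finally show ?thesis by (simp add: Klad_def mult_ac)
qed

end

section \<open>Rellich's theorem\<close>

definition pr :: "l2 \<Rightarrow> l2 \<Rightarrow> l2" where "pr x y = cl (\<lambda>t. fn x t * fn y t)"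
text \<open>A product of two square integrable functions is in general only integrable, and then
  \<open>pr\<close> has no meaning. Every law for \<open>pr\<close> that refers to values carries
  this condition.\<close>

definition mult_ok :: "l2 \<Rightarrow> l2 \<Rightarrow> bool" where "mult_ok x y \<longleftrightarrow> sqint (\<lambda>t. fn x t * fn y t)"

lemma fn_pr: "mult_ok x y \<Longrightarrow> AE t in lebesgue. fn (pr x y) t = fn x t * fn y t"
  unfolding pr_def mult_ok_def by (rule fn_cl)

lemma pr_commute: "pr x y = pr y x"
  by (simp add: pr_def mult.commute)

lemma inner_pr: "mult_ok x y \<Longrightarrow> inner (pr x y) z = (LINT t|lebesgue. fn x t * fn y t * fn z t)"
  using inner_cl[of "\<lambda>t. fn x t * fn y t" "fn z"] by (simp add: pr_def mult_ok_def)

lemma mult_ok_add: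
  assumes "mult_ok x z" "mult_ok y z" shows "mult_ok (x + y) z" "pr (x + y) z = pr x z + pr y z"
proof -
  have s: "sqint (\<lambda>t. fn x t * fn z t + fn y t * fn z t)"
    using assms sqint_add unfolding mult_ok_def by blast
  have e: "AE t in lebesgue. fn (x + y) t * fn z t = fn x t * fn z t + fn y t * fn z t"
    using fn_add[of x y] by eventually_elim (simp add: distrib_right)
  show ok: "mult_ok (x + y) z"
    unfolding mult_ok_def using s e by (intro sqint_cong_AE[OF s]) auto
  show "pr (x + y) z = pr x z + pr y z"
    unfolding l2_eq_iff using fn_pr[OF ok] fn_pr[OF assms(1)] fn_pr[OF assms(2)] fn_add[of "pr x z" "pr y z"] fn_add[of x y]
    by eventually_elim (simp add: distrib_right)
qed

lemma mult_ok_scale: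
  assumes "mult_ok x z" shows "mult_ok (c *\<^sub>R x) z" "pr (c *\<^sub>R x) z = c *\<^sub>R pr x z"
proof -
  have s: "sqint (\<lambda>t. c * (fn x t * fn z t))"
    using assms sqint_scale unfolding mult_ok_def by blast
  have e: "AE t in lebesgue. fn (c *\<^sub>R x) t * fn z t = c * (fn x t * fn z t)"
    using fn_scale[of c x] by eventually_elim (simp add: mult.assoc)
  show ok: "mult_ok (c *\<^sub>R x) z"
    unfolding mult_ok_def using s e by (intro sqint_cong_AE[OF s]) auto
  show "pr (c *\<^sub>R x) z = c *\<^sub>R pr x z"
    unfolding l2_eq_iff using fn_pr[OF ok] fn_pr[OF assms(1)] fn_scale[of c "pr x z"] fn_scale[of c x]
    by eventually_elim simp
qed

lemma pr_diff: "mult_ok x z \<Longrightarrow> mult_ok y z \<Longrightarrow> pr (x - y) z = pr x z - pr y z"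
  using mult_ok_add(2)[of x z "(-1) *\<^sub>R y"] mult_ok_scale[of y z "-1"] by simp

context annulus begin

lemma inner_J_cell:
  assumes f: "continuous_on UNIV f" and ab: "\<sigma> \<le> a" "b \<le> R" "0 \<le> c" "d \<le> L"
  shows "inner (J f) (cl (indicator (cbox (a, c) (b, d)))) = integral {a..b} (\<lambda>r. integral {c..d} (\<lambda>z. f (r, z)))"
proof -
  have fc: "continuous_on S f" for S using f continuous_on_subset by blast
  have sub: "cbox (a, c) (b, d) \<subseteq> B" using ab by (auto simp: B_def cbox_Pair_eq)
  have s: "sqint (indicator (cbox (a, c) (b, d)))"
  proof -
    have "(\<lambda>x. (indicator (cbox (a, c) (b, d)) x)\<^sup>2 :: real) = indicator (cbox (a, c) (b, d))"
      by (auto simp: indicator_def)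
    then show ?thesis by (auto simp: sqint_def emeasure_lborel_cbox_eq intro!: borel_measurable_indicator)
  qed
  have "inner (J f) (cl (indicator (cbox (a, c) (b, d)))) = (LINT x|lebesgue. indicator B x * f x * indicator (cbox (a, c) (b, d)) x)"
    unfolding J_def by (rule inner_cl[OF sqint_B[OF fc] s])
  also have "\<dots> = (LINT x:cbox (a, c) (b, d)|lebesgue. f x)"
    unfolding set_lebesgue_integral_def using sub by (intro Bochner_Integration.integral_cong) (auto simp: indicator_def)
  also have "\<dots> = integral (cbox (a, c) (b, d)) f"
    by (intro set_lebesgue_integral_eq_integral absolutely_integrable_continuous fc)
  also have "\<dots> = integral {a..b} (\<lambda>r. integral {c..d} (\<lambda>z. f (r, z)))"
    using integral_prod_continuous[of a c b d f, OF fc] by simp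
  finally show ?thesis .
qed

text \<open>Poincare's inequality on a grid of N^2 cells: in z on each line, and then in r for the
  integrals \<open>F j\<close> over the strips. The cell means remain as finitely many inner
  products, which is exactly what weak convergence controls.\<close>

lemma rellich_smooth:
  assumes f: "smooth f" and N: "N > 0" and h: "h = (R - \<sigma>) / real N" and k: "k = L / real N"
  shows "(norm (J f))\<^sup>2 \<le> (\<Sum>j<N. \<Sum>i<N. (inner (J f) (cl (indicator (cbox (\<sigma> + real i * h, 0 + real j * k)
      (\<sigma> + real (Suc i) * h, 0 + real (Suc j) * k)))))\<^sup>2 / (h * k))
      + h\<^sup>2 * (norm (J (pdr f)))\<^sup>2 + k\<^sup>2 * (norm (J (pdz f)))\<^sup>2"
proof -
  have h0: "h > 0" and k0: "k > 0" using N L0 \<sigma>R by (auto simp: h k)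
  have Nh: "\<sigma> + real N * h = R" and Nk: "0 + real N * k = L" using N by (auto simp: h k)
  note cf = smooth_continuous[OF f] and cf' = smooth_continuous[OF smooth_pd[OF f]]
  \<comment> \<open>The bounds keep the form \<open>0 + real j * k\<close> because
    \<open>poincare_1d_partition\<close> produces them so for the left end 0.\<close>
  define F where "F j r = integral {0 + real j * k..0 + real (Suc j) * k} (\<lambda>z. f (r, z))" for j r
  define F' where "F' j r = integral {0 + real j * k..0 + real (Suc j) * k} (\<lambda>z. pdr f (r, z))" for j r
  have F: "(F j has_real_derivative F' j r) (at r)" for j r
  proof -
    have "((\<lambda>r. integral (cbox (0 + real j * k) (0 + real (Suc j) * k)) (\<lambda>z. f (r, z))) has_field_derivative
        integral (cbox (0 + real j * k) (0 + real (Suc j) * k)) (\<lambda>z. pdr f (r, z))) (at r within UNIV)"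
    proof (rule leibniz_rule_field_derivative)
      show "(\<lambda>z. f (x, z)) integrable_on cbox (0 + real j * k) (0 + real (Suc j) * k)" for x
        unfolding cbox_interval by (intro integrable_continuous_interval continuous_slice cf)
      show "continuous_on (UNIV \<times> cbox (0 + real j * k) (0 + real (Suc j) * k)) (\<lambda>(x, t). pdr f (x, t))"
        by (simp add: cf')
    qed (auto intro: smooth_pdr[OF f])
    then show ?thesis by (simp add: F_def[abs_def] F'_def)
  qed
  have cF: "continuous_on S (F j)" for S j unfolding F_def by (rule continuous_integral_slice(1)[OF cf])
  have cF': "continuous_on S (F' j)" for S j unfolding F'_def by (rule continuous_integral_slice(1)[OF cf'])
  have csl: "continuous_on S (\<lambda>r. integral {a..b} (\<lambda>z. (pd e f (r, z))\<^sup>2))" for S a b e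
    by (rule continuous_integral_slice(1)[of "\<lambda>x. (pd e f x)\<^sup>2"]) (intro continuous_intros cf')
  have cell: "inner (J f) (cl (indicator (cbox (\<sigma> + real i * h, 0 + real j * k)
      (\<sigma> + real (Suc i) * h, 0 + real (Suc j) * k)))) = integral {\<sigma> + real i * h..\<sigma> + real (Suc i) * h} (F j)"
    if "i < N" "j < N" for i j
  proof -
    have "real (Suc i) * h \<le> real N * h" "real (Suc j) * k \<le> real N * k"
      using that h0 k0 by (auto intro!: mult_right_mono simp: Suc_le_eq)
    then show ?thesis unfolding F_def using Nh Nk h0 k0 by (intro inner_J_cell cf) auto
  qed
  \<comment> \<open>The derivative of \<open>F j\<close> is a strip integral of
    \<open>pdr f\<close>. Cauchy-Schwarz over the width k produces a factor k, which the division by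
    k cancels.\<close>
  have S1: "integral {\<sigma>..R} (\<lambda>r. (F j r)\<^sup>2) / k \<le> (\<Sum>i<N. (integral {\<sigma> + real i * h..\<sigma> + real (Suc i) * h} (F j))\<^sup>2 / (h * k))
      + h\<^sup>2 * integral {\<sigma>..R} (\<lambda>r. integral {0 + real j * k..0 + real (Suc j) * k} (\<lambda>z. (pdr f (r, z))\<^sup>2))" for j
  proof -
    have "integral {\<sigma>..R} (\<lambda>r. (F' j r)\<^sup>2) \<le> integral {\<sigma>..R} (\<lambda>r. k * integral {0 + real j * k..0 + real (Suc j) * k} (\<lambda>z. (pdr f (r, z))\<^sup>2))"
    proof (rule integral_le)
      fix r
      have e: "0 + real (Suc j) * k - (0 + real j * k) = k" by (simp add: algebra_simps)
      show "(F' j r)\<^sup>2 \<le> k * integral {0 + real j * k..0 + real (Suc j) * k} (\<lambda>z. (pdr f (r, z))\<^sup>2)"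
        using integral_square_le[OF _ continuous_slice(1)[OF cf'], of "0 + real j * k" "0 + real (Suc j) * k"] k0
        unfolding F'_def e by (simp add: mult_right_mono)
    qed (intro integrable_continuous_interval continuous_intros cF' csl)+
    then have "integral {\<sigma>..R} (\<lambda>r. (F' j r)\<^sup>2) / k \<le> integral {\<sigma>..R} (\<lambda>r. integral {0 + real j * k..0 + real (Suc j) * k} (\<lambda>z. (pdr f (r, z))\<^sup>2))"
      using k0 by (simp add: field_simps)
    then have 2: "h\<^sup>2 * (integral {\<sigma>..R} (\<lambda>r. (F' j r)\<^sup>2) / k) \<le> h\<^sup>2 * integral {\<sigma>..R} (\<lambda>r. integral {0 + real j * k..0 + real (Suc j) * k} (\<lambda>z. (pdr f (r, z))\<^sup>2))"
      by (rule mult_left_mono) simp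
    have "integral {\<sigma>..R} (\<lambda>r. (F j r)\<^sup>2) \<le> (\<Sum>i<N. (integral {\<sigma> + real i * h..\<sigma> + real (Suc i) * h} (F j))\<^sup>2 / h)
       + h\<^sup>2 * integral {\<sigma>..R} (\<lambda>r. (F' j r)\<^sup>2)"
      using poincare_1d_partition[OF h0 F cF', of \<sigma> N] unfolding Nh .
    then have "integral {\<sigma>..R} (\<lambda>r. (F j r)\<^sup>2) / k \<le> ((\<Sum>i<N. (integral {\<sigma> + real i * h..\<sigma> + real (Suc i) * h} (F j))\<^sup>2 / h)
       + h\<^sup>2 * integral {\<sigma>..R} (\<lambda>r. (F' j r)\<^sup>2)) / k"
      using k0 by (intro divide_right_mono) auto
    also have "\<dots> = (\<Sum>i<N. (integral {\<sigma> + real i * h..\<sigma> + real (Suc i) * h} (F j))\<^sup>2 / (h * k))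
       + h\<^sup>2 * (integral {\<sigma>..R} (\<lambda>r. (F' j r)\<^sup>2) / k)"
      by (simp add: add_divide_distrib sum_divide_distrib)
    finally show ?thesis using 2 by linarith
  qed
  have "(norm (J f))\<^sup>2 = integral {\<sigma>..R} (\<lambda>r. integral {0..L} (\<lambda>z. (f (r, z))\<^sup>2))"
    unfolding norm_J[OF cf] by (rule integral_B(1)) (intro continuous_intros cf)
  also have "\<dots> \<le> integral {\<sigma>..R} (\<lambda>r. (\<Sum>j<N. (F j r)\<^sup>2 / k) + k\<^sup>2 * integral {0..L} (\<lambda>z. (pdz f (r, z))\<^sup>2))"
  proof (rule integral_le)
    fix r
    show "integral {0..L} (\<lambda>z. (f (r, z))\<^sup>2) \<le> (\<Sum>j<N. (F j r)\<^sup>2 / k) + k\<^sup>2 * integral {0..L} (\<lambda>z. (pdz f (r, z))\<^sup>2)"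
      using poincare_1d_partition[OF k0 smooth_pdz[OF f] continuous_slice(1)[OF cf'], of 0 N r] unfolding Nk F_def .
  next
    show "(\<lambda>r. integral {0..L} (\<lambda>z. (f (r, z))\<^sup>2)) integrable_on {\<sigma>..R}"
      by (intro integrable_continuous_interval continuous_integral_slice(1)[of "\<lambda>x. (f x)\<^sup>2"] continuous_intros cf)
    show "(\<lambda>r. (\<Sum>j<N. (F j r)\<^sup>2 / k) + k\<^sup>2 * integral {0..L} (\<lambda>z. (pdz f (r, z))\<^sup>2)) integrable_on {\<sigma>..R}"
      using k0 by (intro integrable_continuous_interval continuous_intros cF csl) auto
  qed
  also have "\<dots> = integral {\<sigma>..R} (\<lambda>r. \<Sum>j<N. (F j r)\<^sup>2 / k) + integral {\<sigma>..R} (\<lambda>r. k\<^sup>2 * integral {0..L} (\<lambda>z. (pdz f (r, z))\<^sup>2))"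
    using k0 by (intro integral_add integrable_continuous_interval continuous_intros cF csl) auto
  also have "integral {\<sigma>..R} (\<lambda>r. k\<^sup>2 * integral {0..L} (\<lambda>z. (pdz f (r, z))\<^sup>2)) = k\<^sup>2 * (norm (J (pdz f)))\<^sup>2"
    unfolding norm_J[OF cf'] using integral_B(1)[of "\<lambda>x. (pdz f x)\<^sup>2"] cf'[of B] by (simp add: continuous_on_power)
  also have "integral {\<sigma>..R} (\<lambda>r. \<Sum>j<N. (F j r)\<^sup>2 / k) = (\<Sum>j<N. integral {\<sigma>..R} (\<lambda>r. (F j r)\<^sup>2) / k)"
    using k0 by (subst integral_sum) (auto intro!: integrable_continuous_interval continuous_intros cF)
  also have "\<dots> \<le> (\<Sum>j<N. (\<Sum>i<N. (integral {\<sigma> + real i * h..\<sigma> + real (Suc i) * h} (F j))\<^sup>2 / (h * k))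
      + h\<^sup>2 * integral {\<sigma>..R} (\<lambda>r. integral {0 + real j * k..0 + real (Suc j) * k} (\<lambda>z. (pdr f (r, z))\<^sup>2)))"
    by (intro sum_mono S1)
  also have "\<dots> = (\<Sum>j<N. \<Sum>i<N. (integral {\<sigma> + real i * h..\<sigma> + real (Suc i) * h} (F j))\<^sup>2 / (h * k))
      + h\<^sup>2 * (\<Sum>j<N. integral {\<sigma>..R} (\<lambda>r. integral {0 + real j * k..0 + real (Suc j) * k} (\<lambda>z. (pdr f (r, z))\<^sup>2)))"
    by (simp add: sum.distrib sum_distrib_left)
  also have "(\<Sum>j<N. integral {\<sigma>..R} (\<lambda>r. integral {0 + real j * k..0 + real (Suc j) * k} (\<lambda>z. (pdr f (r, z))\<^sup>2)))
      = integral {\<sigma>..R} (\<lambda>r. \<Sum>j<N. integral {0 + real j * k..0 + real (Suc j) * k} (\<lambda>z. (pdr f (r, z))\<^sup>2))"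
    by (subst integral_sum) (auto intro!: integrable_continuous_interval csl simp del: add_0)
  also have "\<dots> = integral {\<sigma>..R} (\<lambda>r. integral {0..L} (\<lambda>z. (pdr f (r, z))\<^sup>2))"
  proof (intro integral_cong)
    fix r
    have c: "continuous_on S (\<lambda>z. (pdr f (r, z))\<^sup>2)" for S
      by (intro continuous_intros continuous_slice cf')
    show "(\<Sum>j<N. integral {0 + real j * k..0 + real (Suc j) * k} (\<lambda>z. (pdr f (r, z))\<^sup>2)) = integral {0..L} (\<lambda>z. (pdr f (r, z))\<^sup>2)"
      using integral_partition_sum[of k 0 N "\<lambda>z. (pdr f (r, z))\<^sup>2", OF less_imp_le[OF k0] c] unfolding Nk by simp
  qed
  also have "\<dots> = (norm (J (pdr f)))\<^sup>2"
    unfolding norm_J[OF cf'] using integral_B(1)[of "\<lambda>x. (pdr f x)\<^sup>2"] cf'[of B] by (simp add: continuous_on_power)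
  also have "(\<Sum>j<N. \<Sum>i<N. (integral {\<sigma> + real i * h..\<sigma> + real (Suc i) * h} (F j))\<^sup>2 / (h * k))
     = (\<Sum>j<N. \<Sum>i<N. (inner (J f) (cl (indicator (cbox (\<sigma> + real i * h, 0 + real j * k)
      (\<sigma> + real (Suc i) * h, 0 + real (Suc j) * k)))))\<^sup>2 / (h * k))"
    by (intro sum.cong refl) (simp only: cell lessThan_iff)
  finally show ?thesis by simp
qed

text \<open>H1 as a completion of smooth functions up to the boundary. The approximations built into
  \<open>has_trace\<close> place every field with a trace in this set, so no density theorem for
  weakly differentiable functions is called for.\<close>

definition G0 :: "h1 set" where "G0 = closure (Jh ` Collect smooth)"

lemma subspace_G0: "subspace G0"
proof -
  have "Jh (\<lambda>_. 0) = 0" using Jh_scale[of "\<lambda>_. 0" 0] by simp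
  then have S: "subspace (Jh ` Collect smooth)"
    unfolding subspace_def
    by (auto simp flip: Jh_add Jh_scale intro!: imageI smooth_add smooth_scale image_eqI[of _ Jh "\<lambda>_. 0"])
  show ?thesis
    unfolding subspace_def G0_def
  proof (intro conjI ballI allI)
    show "0 \<in> closure (Jh ` Collect smooth)"
      by (rule subsetD[OF closure_subset subspace_0[OF S]])
    fix x y c assume x: "x \<in> closure (Jh ` Collect smooth)"
    then obtain X where X: "\<And>n. X n \<in> Jh ` Collect smooth" "X \<longlonglongrightarrow> x" unfolding closure_sequential by blast
    show "c *\<^sub>R x \<in> closure (Jh ` Collect smooth)"
      unfolding closure_sequential
      by (rule exI[of _ "\<lambda>n. c *\<^sub>R X n"]) (intro conjI allI subspace_scale[OF S] X tendsto_intros)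
    assume "y \<in> closure (Jh ` Collect smooth)"
    then obtain Y where Y: "\<And>n. Y n \<in> Jh ` Collect smooth" "Y \<longlonglongrightarrow> y" unfolding closure_sequential by blast
    show "x + y \<in> closure (Jh ` Collect smooth)"
      unfolding closure_sequential
      by (rule exI[of _ "\<lambda>n. X n + Y n"]) (intro conjI allI subspace_add[OF S] X Y tendsto_intros)
  qed
qed

lemma Jh_G0: "smooth f \<Longrightarrow> Jh f \<in> G0"
  unfolding G0_def by (rule subsetD[OF closure_subset]) auto

lemma closed_G0: "closed G0"
  by (simp add: G0_def)

lemma G0_sequence:
  assumes "x \<in> G0"
  shows "\<exists>f. (\<forall>n. smooth (f n)) \<and> (\<lambda>n. Jh (f n)) \<longlonglongrightarrow> x"
proof -
  obtain y where y: "\<And>n. y n \<in> Jh ` Collect smooth" "y \<longlonglongrightarrow> x"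
    using assms unfolding G0_def closure_sequential by blast
  then have "\<forall>n. \<exists>f. smooth f \<and> y n = Jh f" by blast
  then obtain f where "\<forall>n. smooth (f n) \<and> y n = Jh (f n)" by metis
  moreover from this have "y = (\<lambda>n. Jh (f n))" by auto
  ultimately show ?thesis using y(2) by blast
qed

text \<open>Both sides are continuous in \<open>x\<close>, so the smooth estimate passes to the
  closure. It says that the values of an H1 function are determined, up to a small part of its H1
  norm, by finitely many linear functionals. \<open>N\<close> is taken large enough that the squared
  cell sides add up to at most \<open>e\<close>.\<close>

lemma rellich_G0_ineq:
  assumes "e > 0"
  shows "\<exists>(N::nat) (w::real) C. \<forall>x\<in>G0. (norm (fst x))\<^sup>2 \<le> (\<Sum>j<N. \<Sum>i<N. w * (inner (fst x) (C i j))\<^sup>2) + e * (norm x)\<^sup>2"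
proof -
  define M where "M = (R - \<sigma>)\<^sup>2 + L\<^sup>2"
  have M0: "M > 0" using L0 by (simp add: M_def add_nonneg_pos)
  obtain N :: nat where N: "M / e < real N" using reals_Archimedean2 by blast
  have N0: "real N > 0" using N M0 assms by (meson divide_pos_pos less_trans)
  then have N1: "N \<ge> 1" by simp
  define h k where "h = (R - \<sigma>) / real N" and "k = L / real N"
  define C where "C i j = cl (indicator (cbox (\<sigma> + real i * h, 0 + real j * k) (\<sigma> + real (Suc i) * h, 0 + real (Suc j) * k)))" for i j
  have hk: "h\<^sup>2 + k\<^sup>2 \<le> e"
  proof -
    have "h\<^sup>2 + k\<^sup>2 = M / (real N * real N)"
      by (simp add: h_def k_def M_def power_divide add_divide_distrib power2_eq_square)
    also have "\<dots> \<le> M / real N" using N1 M0 by (intro divide_left_mono) auto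
    also have "\<dots> \<le> e" using N assms N0 by (simp add: field_simps)
    finally show ?thesis .
  qed
  define rhs where "rhs x = (\<Sum>j<N. \<Sum>i<N. 1 / (h * k) * (inner (fst x) (C i j))\<^sup>2) + e * (norm x)\<^sup>2" for x :: h1
  have "G0 \<subseteq> {x. (norm (fst x))\<^sup>2 \<le> rhs x}"
    unfolding G0_def
  proof (rule closure_minimal)
    show "closed {x. (norm (fst x))\<^sup>2 \<le> rhs x}"
      unfolding rhs_def by (intro closed_Collect_le continuous_intros)
    show "Jh ` Collect smooth \<subseteq> {x. (norm (fst x))\<^sup>2 \<le> rhs x}"
    proof clarsimp
      fix f assume f: "smooth f"
      have "h\<^sup>2 * (norm (J (pdr f)))\<^sup>2 \<le> h\<^sup>2 * (norm (Jh f))\<^sup>2" "k\<^sup>2 * (norm (J (pdz f)))\<^sup>2 \<le> k\<^sup>2 * (norm (Jh f))\<^sup>2"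
        using norm_h1_comps(2,3)[of "Jh f"] by (auto intro!: mult_left_mono power_mono simp: Jh_def)
      moreover have "(h\<^sup>2 + k\<^sup>2) * (norm (Jh f))\<^sup>2 \<le> e * (norm (Jh f))\<^sup>2" by (rule mult_right_mono[OF hk]) simp
      ultimately show "(norm (fst (Jh f)))\<^sup>2 \<le> rhs (Jh f)"
        using rellich_smooth[OF f _ h_def k_def] N0 unfolding rhs_def C_def[symmetric]
        by (simp add: Jh_def distrib_right)
    qed
  qed
  then have "\<forall>x\<in>G0. (norm (fst x))\<^sup>2 \<le> (\<Sum>j<N. \<Sum>i<N. 1 / (h * k) * (inner (fst x) (C i j))\<^sup>2) + e * (norm x)\<^sup>2"
    unfolding rhs_def by blast
  then show ?thesis by (intro exI)
qed

text \<open>The finitely many functionals of the previous estimate tend to 0 along X n - x, and the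
  remainder is small because weakly convergent sequences are bounded.\<close>

theorem rellich:
  assumes X: "\<And>n. X n \<in> G0" and x: "x \<in> G0" and w: "weakly X x"
  shows "(\<lambda>n. fst (X n)) \<longlonglongrightarrow> fst x"
proof -
  obtain M where M: "\<And>n. norm (X n) \<le> M" using w by (auto simp: weakly_def)
  define K where "K = M + norm x + 1"
  have K: "norm (X n - x) \<le> K" for n
    using norm_triangle_ineq4[of "X n" x] M[of n] by (simp add: K_def)
  have K0: "K > 0" using order_trans[OF norm_ge_zero M[of 0]] norm_ge_zero[of x] unfolding K_def by linarith
  have "(\<lambda>n. (norm (fst (X n) - fst x))\<^sup>2) \<longlonglongrightarrow> 0"
  proof (rule LIMSEQ_I)
    fix e :: real assume e: "e > 0"
    define e' where "e' = e / (2 * K\<^sup>2)"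
    have "e' > 0" using e K0 by (simp add: e'_def)
    then obtain N :: nat and v :: real and C where
      C: "\<And>y. y \<in> G0 \<Longrightarrow> (norm (fst y))\<^sup>2 \<le> (\<Sum>j<N. \<Sum>i<N. v * (inner (fst y) (C i j))\<^sup>2) + e' * (norm y)\<^sup>2"
      using rellich_G0_ineq by blast
    have "(\<lambda>n. inner (fst (X n - x)) (C i j)) \<longlonglongrightarrow> 0" for i j
    proof -
      have "(\<lambda>n. inner (X n) (C i j, 0)) \<longlonglongrightarrow> inner x (C i j, 0)"
        using w unfolding weakly_def by blast
      then have "(\<lambda>n. inner (X n) (C i j, 0) - inner x (C i j, 0)) \<longlonglongrightarrow> inner x (C i j, 0) - inner x (C i j, 0)"
        by (rule tendsto_diff[OF _ tendsto_const])
      then show ?thesis by (simp add: inner_prod_def inner_diff_left)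
    qed
    then have "(\<lambda>n. \<Sum>j<N. \<Sum>i<N. v * (inner (fst (X n - x)) (C i j))\<^sup>2) \<longlonglongrightarrow> (\<Sum>j<N. \<Sum>i<N. v * 0\<^sup>2)"
      by (intro tendsto_intros)
    then have "(\<lambda>n. \<Sum>j<N. \<Sum>i<N. v * (inner (fst (X n - x)) (C i j))\<^sup>2) \<longlonglongrightarrow> 0" by simp
    from LIMSEQ_D[OF this, of "e / 2"] e obtain n0 where
      n0: "\<And>n. n \<ge> n0 \<Longrightarrow> \<bar>\<Sum>j<N. \<Sum>i<N. v * (inner (fst (X n - x)) (C i j))\<^sup>2\<bar> < e / 2" by auto
    have "norm ((norm (fst (X n) - fst x))\<^sup>2 - 0) < e" if "n \<ge> n0" for n
    proof -
      have "X n - x \<in> G0" using X x subspace_G0 by (intro subspace_diff)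
      from C[OF this] have "(norm (fst (X n) - fst x))\<^sup>2 \<le> (\<Sum>j<N. \<Sum>i<N. v * (inner (fst (X n - x)) (C i j))\<^sup>2) + e' * (norm (X n - x))\<^sup>2"
        by simp
      also have "\<dots> < e / 2 + e / 2"
      proof (rule add_less_le_mono)
        show "(\<Sum>j<N. \<Sum>i<N. v * (inner (fst (X n - x)) (C i j))\<^sup>2) < e / 2" using n0[OF that] by linarith
        have "e' * (norm (X n - x))\<^sup>2 \<le> e' * K\<^sup>2"
          using \<open>e' > 0\<close> K by (intro mult_left_mono power_mono) auto
        then show "e' * (norm (X n - x))\<^sup>2 \<le> e / 2" using K0 by (simp add: e'_def)
      qed
      finally show ?thesis by simp
    qed
    then show "\<exists>n0. \<forall>n\<ge>n0. norm ((norm (fst (X n) - fst x))\<^sup>2 - 0) < e" by blast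
  qed
  then have "(\<lambda>n. sqrt ((norm (fst (X n) - fst x))\<^sup>2)) \<longlonglongrightarrow> sqrt 0" by (rule tendsto_real_sqrt)
  then have "(\<lambda>n. norm (fst (X n) - fst x)) \<longlonglongrightarrow> 0" by simp
  then show ?thesis by (simp add: LIM_zero_iff tendsto_norm_zero_iff)
qed

text \<open>Products of L2-convergent sequences converge only pointwise, along a subsequence
  extracted first for one factor and then for the other. Fatou's lemma turns the uniform bounds for
  the smooth products into square integrability of the limit together with its bound.\<close>

theorem ladyzhenskaya:
  assumes x: "x \<in> G0" and y: "y \<in> G0"
  shows "mult_ok (fst x) (fst y)"
    and "(norm (pr (fst x) (fst y)))\<^sup>2 \<le> Klad * (norm (fst x) * norm x * (norm (fst y) * norm y))"
proof -
  obtain f where f: "\<And>n. smooth (f n)" "(\<lambda>n. Jh (f n)) \<longlonglongrightarrow> x" using G0_sequence[OF x] by blast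
  obtain g where g: "\<And>n. smooth (g n)" "(\<lambda>n. Jh (g n)) \<longlonglongrightarrow> y" using G0_sequence[OF y] by blast
  have "(\<lambda>n. J (f n)) \<longlonglongrightarrow> fst x" using tendsto_fst[OF f(2)] by (simp add: Jh_def)
  then obtain r where r: "strict_mono r" "AE t in lebesgue. (\<lambda>n. fn (J (f (r n))) t) \<longlonglongrightarrow> fn (fst x) t"
    by (rule l2_AE_subseq)
  have "(\<lambda>n. J (g n)) \<longlonglongrightarrow> fst y" using tendsto_fst[OF g(2)] by (simp add: Jh_def)
  from LIMSEQ_subseq_LIMSEQ[OF this r(1)] have "(\<lambda>n. J (g (r n))) \<longlonglongrightarrow> fst y" by (simp add: o_def)
  then obtain s where s: "strict_mono s" "AE t in lebesgue. (\<lambda>n. fn (J (g (r (s n)))) t) \<longlonglongrightarrow> fn (fst y) t"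
    by (rule l2_AE_subseq)
  define q where "q n = r (s n)" for n
  have q: "strict_mono q" using strict_mono_o[OF r(1) s(1)] by (simp add: q_def[abs_def] o_def)
  define p where "p n = (\<lambda>t. indicator B t * (f (q n) t * g (q n) t))" for n
  have cp: "continuous_on B (\<lambda>t. f (q n) t * g (q n) t)" for n
    by (intro continuous_intros smooth_continuous f g)
  have ps: "sqint (p n)" for n unfolding p_def by (rule sqint_B[OF cp])
  then have pm [measurable]: "p n \<in> borel_measurable lebesgue" for n by (simp add: sqint_def)
  have pn: "(norm (J (\<lambda>t. f (q n) t * g (q n) t)))\<^sup>2 = (LINT t|lebesgue. (p n t)\<^sup>2)" for n
    unfolding J_def p_def[symmetric] by (rule norm_cl[OF ps])
  have fnJ: "AE t in lebesgue. \<forall>n. fn (J (f n)) t = indicator B t * f n t"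
    by (subst AE_all_countable) (intro allI fn_J smooth_continuous f)
  have gnJ: "AE t in lebesgue. \<forall>n. fn (J (g n)) t = indicator B t * g n t"
    by (subst AE_all_countable) (intro allI fn_J smooth_continuous g)
  have plim: "AE t in lebesgue. (\<lambda>n. p n t) \<longlonglongrightarrow> fn (fst x) t * fn (fst y) t"
    using r(2) s(2) fnJ gnJ
  proof eventually_elim
    case (elim t)
    have "(\<lambda>n. fn (J (f (q n))) t) \<longlonglongrightarrow> fn (fst x) t"
      using LIMSEQ_subseq_LIMSEQ[OF elim(1) s(1)] by (simp add: o_def q_def)
    moreover have "(\<lambda>n. fn (J (g (q n))) t) \<longlonglongrightarrow> fn (fst y) t" using elim(2) by (simp add: q_def)
    ultimately have "(\<lambda>n. fn (J (f (q n))) t * fn (J (g (q n))) t) \<longlonglongrightarrow> fn (fst x) t * fn (fst y) t"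
      by (rule tendsto_mult)
    moreover have "fn (J (f (q n))) t * fn (J (g (q n))) t = p n t" for n
      using elim(3,4) by (simp add: p_def indicator_def)
    ultimately show ?case by simp
  qed
  define bd where "bd = Klad * (norm (fst x) * norm x * (norm (fst y) * norm y))"
  have bd0: "bd \<ge> 0" unfolding bd_def using Klad_pos by (intro mult_nonneg_nonneg) auto
  have "(\<integral>\<^sup>+t. ennreal ((fn (fst x) t * fn (fst y) t)\<^sup>2) \<partial>lebesgue)
      = (\<integral>\<^sup>+t. liminf (\<lambda>n. ennreal ((p n t)\<^sup>2)) \<partial>lebesgue)"
  proof (rule nn_integral_cong_AE, use plim in eventually_elim)
    case (elim t)
    then have "(\<lambda>n. ennreal ((p n t)\<^sup>2)) \<longlonglongrightarrow> ennreal ((fn (fst x) t * fn (fst y) t)\<^sup>2)"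
      by (intro tendsto_intros)
    from lim_imp_Liminf[OF _ this] show ?case by simp
  qed
  also have "\<dots> \<le> liminf (\<lambda>n. \<integral>\<^sup>+t. ennreal ((p n t)\<^sup>2) \<partial>lebesgue)"
    by (intro nn_integral_liminf) measurable
  also have "\<dots> \<le> liminf (\<lambda>n. ennreal (Klad * (norm (J (f (q n))) * norm (Jh (f (q n))) * (norm (J (g (q n))) * norm (Jh (g (q n)))))))"
  proof (rule Liminf_mono, rule always_eventually, rule allI)
    fix n
    have "(\<integral>\<^sup>+t. ennreal ((p n t)\<^sup>2) \<partial>lebesgue) = ennreal (LINT t|lebesgue. (p n t)\<^sup>2)"
      using ps[of n] by (intro nn_integral_eq_integral) (auto simp: sqint_def)
    also have "\<dots> \<le> ennreal (Klad * (norm (J (f (q n))) * norm (Jh (f (q n))) * (norm (J (g (q n))) * norm (Jh (g (q n))))))"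
      unfolding pn[symmetric] by (intro ennreal_leI ladyzhenskaya_smooth f g)
    finally show "(\<integral>\<^sup>+t. ennreal ((p n t)\<^sup>2) \<partial>lebesgue)
      \<le> ennreal (Klad * (norm (J (f (q n))) * norm (Jh (f (q n))) * (norm (J (g (q n))) * norm (Jh (g (q n))))))" .
  qed
  also have "\<dots> = ennreal bd"
  proof (rule lim_imp_Liminf)
    have fq: "(\<lambda>n. Jh (f (q n))) \<longlonglongrightarrow> x" and gq: "(\<lambda>n. Jh (g (q n))) \<longlonglongrightarrow> y"
      using LIMSEQ_subseq_LIMSEQ[OF f(2) q] LIMSEQ_subseq_LIMSEQ[OF g(2) q] by (simp_all add: o_def)
    have "(\<lambda>n. J (f (q n))) \<longlonglongrightarrow> fst x" "(\<lambda>n. J (g (q n))) \<longlonglongrightarrow> fst y"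
      using tendsto_fst[OF fq] tendsto_fst[OF gq] by (simp_all add: Jh_def)
    then show "(\<lambda>n. ennreal (Klad * (norm (J (f (q n))) * norm (Jh (f (q n))) * (norm (J (g (q n))) * norm (Jh (g (q n)))))))
      \<longlonglongrightarrow> ennreal bd"
      unfolding bd_def by (intro tendsto_intros fq gq)
  qed simp
  finally have le: "(\<integral>\<^sup>+t. ennreal ((fn (fst x) t * fn (fst y) t)\<^sup>2) \<partial>lebesgue) \<le> ennreal bd" .
  have "integrable lebesgue (\<lambda>t. (fn (fst x) t * fn (fst y) t)\<^sup>2)"
    using le by (intro integrableI_nonneg) (auto intro: le_less_trans)
  then show ok: "mult_ok (fst x) (fst y)" by (simp add: mult_ok_def sqint_def)
  have "ennreal ((norm (pr (fst x) (fst y)))\<^sup>2) = (\<integral>\<^sup>+t. ennreal ((fn (fst x) t * fn (fst y) t)\<^sup>2) \<partial>lebesgue)"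
    using ok norm_cl[of "\<lambda>t. fn (fst x) t * fn (fst y) t"] unfolding mult_ok_def pr_def
    by (subst nn_integral_eq_integral) (auto simp: sqint_def)
  then show "(norm (pr (fst x) (fst y)))\<^sup>2 \<le> Klad * (norm (fst x) * norm x * (norm (fst y) * norm y))"
    using le bd0 unfolding bd_def by (metis ennreal_le_iff)
qed

end

section \<open>Traces and integration by parts\<close>

context annulus begin

text \<open>The elements of \<open>H\<^sup>1\<close> with zero trace along the path \<open>P\<close> on \<open>[a, b]\<close>.\<close>

definition T :: "(real \<Rightarrow> real \<times> real) \<Rightarrow> real \<Rightarrow> real \<Rightarrow> h1 set" where
  "T P a b = {x. \<forall>\<epsilon>>0. \<exists>f. smooth f \<and> norm (Jh f - x) < \<epsilon> \<and> integral {a..b} (\<lambda>t. (f (P t))\<^sup>2) < \<epsilon>}"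

lemma T_sequence:
  assumes "x \<in> T P a b"
  shows "\<exists>f. (\<forall>n. smooth (f n)) \<and> (\<lambda>n. Jh (f n)) \<longlonglongrightarrow> x \<and> (\<forall>n. integral {a..b} (\<lambda>t. (f n (P t))\<^sup>2) < inverse (real (Suc n)))"
proof -
  have "\<exists>f. smooth f \<and> norm (Jh f - x) < inverse (real (Suc n)) \<and> integral {a..b} (\<lambda>t. (f (P t))\<^sup>2) < inverse (real (Suc n))" for n
    using assms unfolding T_def by simp
  then obtain f where f: "\<And>n. smooth (f n)" "\<And>n. norm (Jh (f n) - x) < inverse (real (Suc n))"
    "\<And>n. integral {a..b} (\<lambda>t. (f n (P t))\<^sup>2) < inverse (real (Suc n))" by metis
  have "(\<lambda>n. Jh (f n) - x) \<longlonglongrightarrow> 0"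
    by (rule Lim_null_comparison[OF always_eventually LIMSEQ_inverse_real_of_nat]) (use f(2) in \<open>auto intro: less_imp_le\<close>)
  then have "(\<lambda>n. Jh (f n)) \<longlonglongrightarrow> x" by (simp add: LIM_zero_iff)
  then show ?thesis using f(1,3) by blast
qed

lemma T_subset_G0: "T P a b \<subseteq> G0"
proof
  fix x assume "x \<in> T P a b"
  from T_sequence[OF this] obtain f where f: "\<And>n. smooth (f n)" "(\<lambda>n. Jh (f n)) \<longlonglongrightarrow> x" by blast
  show "x \<in> G0"
    by (rule closed_sequentially[OF closed_G0 _ f(2)]) (intro Jh_G0 f)
qed

lemma closed_T: "closed (T P a b)"
  unfolding closed_sequential_limits
proof (intro allI impI, elim conjE)
  fix X x assume X: "\<forall>n. X n \<in> T P a b" "X \<longlonglongrightarrow> x"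
  show "x \<in> T P a b"
    unfolding T_def
  proof (intro CollectI allI impI)
    fix e :: real assume "e > 0"
    then obtain n where n: "norm (X n - x) < e / 2"
      using LIMSEQ_D[OF X(2), of "e / 2"] by auto
    have "X n \<in> T P a b" "e / 2 > 0" using X(1) \<open>e > 0\<close> by auto
    then obtain f where f: "smooth f" "norm (Jh f - X n) < e / 2" "integral {a..b} (\<lambda>t. (f (P t))\<^sup>2) < e / 2"
      unfolding T_def by blast
    have "norm (Jh f - x) < e"
      using norm_triangle_ineq[of "Jh f - X n" "X n - x"] n f(2) by simp
    then show "\<exists>f. smooth f \<and> norm (Jh f - x) < e \<and> integral {a..b} (\<lambda>t. (f (P t))\<^sup>2) < e"
      using f(1,3) \<open>e > 0\<close> by (intro exI[of _ f]) auto
  qed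
qed

lemma T_I:
  assumes "\<And>n. smooth (f n)" "(\<lambda>n. Jh (f n)) \<longlonglongrightarrow> x" "(\<lambda>n. integral {a..b} (\<lambda>t. (f n (P t))\<^sup>2)) \<longlonglongrightarrow> 0"
  shows "x \<in> T P a b"
  unfolding T_def
proof (intro CollectI allI impI)
  fix e :: real assume "e > 0"
  have 1: "\<forall>\<^sub>F n in sequentially. norm (Jh (f n) - x) < e"
    using assms(2) \<open>e > 0\<close> by (simp add: tendsto_iff dist_norm)
  have 2: "\<forall>\<^sub>F n in sequentially. integral {a..b} (\<lambda>t. (f n (P t))\<^sup>2) < e"
    using assms(3) \<open>e > 0\<close> by (rule order_tendstoD(2))
  obtain n where "norm (Jh (f n) - x) < e \<and> integral {a..b} (\<lambda>t. (f n (P t))\<^sup>2) < e"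
    using eventually_happens'[OF sequentially_bot eventually_conj[OF 1 2]] by blast
  then show "\<exists>f. smooth f \<and> norm (Jh f - x) < e \<and> integral {a..b} (\<lambda>t. (f (P t))\<^sup>2) < e"
    using assms(1) by blast
qed

lemma subspace_T:
  assumes P: "continuous_on {a..b} P"
  shows "subspace (T P a b)"
  unfolding subspace_def
proof (intro conjI ballI allI)
  have cP: "continuous_on {a..b} (\<lambda>t. f (P t))" if "smooth f" for f
    by (rule continuous_on_compose2[OF smooth_continuous[OF that] P]) auto
  have J0: "Jh (\<lambda>_. 0) = 0" using Jh_scale[of "\<lambda>_. 0" 0] by simp
  have nn: "norm (integral {a..b} (\<lambda>t. (f (P t))\<^sup>2)) \<le> c" if "smooth f" "integral {a..b} (\<lambda>t. (f (P t))\<^sup>2) \<le> c" for f c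
  proof -
    have "integral {a..b} (\<lambda>t. (f (P t))\<^sup>2) \<ge> 0"
      by (intro integral_nonneg integrable_continuous_interval continuous_intros cP that(1)) auto
    then show ?thesis using that(2) by simp
  qed
  show "0 \<in> T P a b"
    by (rule T_I[of "\<lambda>_ _. 0"]) (auto simp: J0)
  fix x c assume x: "x \<in> T P a b"
  obtain f where f: "\<And>n. smooth (f n)" "(\<lambda>n. Jh (f n)) \<longlonglongrightarrow> x"
    "\<And>n. integral {a..b} (\<lambda>t. (f n (P t))\<^sup>2) < inverse (real (Suc n))" using T_sequence[OF x] by blast
  have fl: "(\<lambda>n. integral {a..b} (\<lambda>t. (f n (P t))\<^sup>2)) \<longlonglongrightarrow> 0"
    by (rule Lim_null_comparison[OF always_eventually LIMSEQ_inverse_real_of_nat], rule allI)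
       (intro nn f(1) less_imp_le f(3))
  show "c *\<^sub>R x \<in> T P a b"
  proof (rule T_I[of "\<lambda>n x. c * f n x"])
    show "smooth (\<lambda>x. c * f n x)" for n by (intro smooth_scale f)
    show "(\<lambda>n. Jh (\<lambda>x. c * f n x)) \<longlonglongrightarrow> c *\<^sub>R x" using f by (simp add: Jh_scale tendsto_scaleR)
    show "(\<lambda>n. integral {a..b} (\<lambda>t. (c * f n (P t))\<^sup>2)) \<longlonglongrightarrow> 0"
      using tendsto_mult_right_zero[OF fl, of "c\<^sup>2"] by (simp add: power_mult_distrib)
  qed
  fix y assume y: "y \<in> T P a b"
  obtain g where g: "\<And>n. smooth (g n)" "(\<lambda>n. Jh (g n)) \<longlonglongrightarrow> y"
    "\<And>n. integral {a..b} (\<lambda>t. (g n (P t))\<^sup>2) < inverse (real (Suc n))" using T_sequence[OF y] by blast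
  show "x + y \<in> T P a b"
  proof (rule T_I[of "\<lambda>n x. f n x + g n x"])
    show sfg: "smooth (\<lambda>x. f n x + g n x)" for n by (intro smooth_add f g)
    show "(\<lambda>n. Jh (\<lambda>x. f n x + g n x)) \<longlonglongrightarrow> x + y" using f g by (simp add: Jh_add tendsto_add)
    have bd: "integral {a..b} (\<lambda>t. (f n (P t) + g n (P t))\<^sup>2) \<le> 4 * inverse (real (Suc n))" for n
    proof -
      have "integral {a..b} (\<lambda>t. (f n (P t) + g n (P t))\<^sup>2) \<le> integral {a..b} (\<lambda>t. 2 * (f n (P t))\<^sup>2 + 2 * (g n (P t))\<^sup>2)"
      proof (rule integral_le)
        fix t
        show "(f n (P t) + g n (P t))\<^sup>2 \<le> 2 * (f n (P t))\<^sup>2 + 2 * (g n (P t))\<^sup>2"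
          using zero_le_power2[of "f n (P t) - g n (P t)"] by (simp add: power2_eq_square algebra_simps)
      qed (intro integrable_continuous_interval continuous_intros cP f g)+
      also have "\<dots> = integral {a..b} (\<lambda>t. 2 * (f n (P t))\<^sup>2) + integral {a..b} (\<lambda>t. 2 * (g n (P t))\<^sup>2)"
        by (intro integral_add integrable_continuous_interval continuous_intros cP f g)
      also have "\<dots> \<le> 4 * inverse (real (Suc n))" using f(3)[of n] g(3)[of n] by simp
      finally show ?thesis .
    qed
    show "(\<lambda>n. integral {a..b} (\<lambda>t. (f n (P t) + g n (P t))\<^sup>2)) \<longlonglongrightarrow> 0"
    proof (rule Lim_null_comparison[OF always_eventually], rule allI)
      show "(\<lambda>n. 4 * inverse (real (Suc n))) \<longlonglongrightarrow> 0"
        using tendsto_mult_right_zero[OF LIMSEQ_inverse_real_of_nat, of 4] .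
      show "norm (integral {a..b} (\<lambda>t. (f n (P t) + g n (P t))\<^sup>2)) \<le> 4 * inverse (real (Suc n))" for n
        by (rule nn[OF sfg bd])
    qed
  qed
qed

text \<open>One argument for all four sides: \<open>P\<close> runs along a side, \<open>d\<close>
  selects the partial derivative, and \<open>bnd\<close> says that only this side contributes, with
  the sign \<open>s\<close> of the outer normal. The boundary term is controlled by the square
  integral of the approximations on that side, which tends to 0.\<close>

lemma ibp_trace:
  assumes x: "x \<in> T P a b" and P: "continuous_on {a..b} P" and ab: "a \<le> b" and \<Psi>: "smooth \<Psi>"
    and d: "\<And>f. d (Jh f) = J (pd e f)" "bounded_linear d"
    and bnd: "\<And>f. smooth f \<Longrightarrow> integral B (pd e (\<lambda>x. f x * \<Psi> x)) = s * integral {a..b} (\<lambda>t. f (P t) * \<Psi> (P t))"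
  shows "inner (fst x) (J (pd e \<Psi>)) = - inner (d x) (J \<Psi>)"
proof -
  have cP: "continuous_on {a..b} (\<lambda>t. f (P t))" if "smooth f" for f
    by (rule continuous_on_compose2[OF smooth_continuous[OF that] P]) auto
  obtain f where f: "\<And>n. smooth (f n)" "(\<lambda>n. Jh (f n)) \<longlonglongrightarrow> x"
    "\<And>n. integral {a..b} (\<lambda>t. (f n (P t))\<^sup>2) < inverse (real (Suc n))" using T_sequence[OF x] by blast
  have eq: "inner (fst (Jh (f n))) (J (pd e \<Psi>)) + inner (d (Jh (f n))) (J \<Psi>) = s * integral {a..b} (\<lambda>t. f n (P t) * \<Psi> (P t))" for n
  proof -
    have "inner (fst (Jh (f n))) (J (pd e \<Psi>)) + inner (d (Jh (f n))) (J \<Psi>)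
        = integral B (\<lambda>x. f n x * pd e \<Psi> x) + integral B (\<lambda>x. pd e (f n) x * \<Psi> x)"
      unfolding d by (simp add: Jh_def inner_J smooth_continuous smooth_pd f(1) \<Psi>)
    also have "\<dots> = integral B (\<lambda>x. f n x * pd e \<Psi> x + pd e (f n) x * \<Psi> x)"
      unfolding B_def
      by (rule integral_add[symmetric]; intro integrable_continuous continuous_intros smooth_continuous smooth_pd f(1) \<Psi>)
    also have "(\<lambda>x. f n x * pd e \<Psi> x + pd e (f n) x * \<Psi> x) = pd e (\<lambda>x. f n x * \<Psi> x)"
      by (intro ext) (simp add: pd_smooth_mult f(1) \<Psi>)
    finally show ?thesis using bnd[OF f(1)] by simp
  qed
  have "compact ((\<lambda>t. \<Psi> (P t)) ` {a..b})" by (intro compact_continuous_image cP[OF \<Psi>] compact_Icc)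
  then have "bounded ((\<lambda>t. \<Psi> (P t)) ` {a..b})" by (rule compact_imp_bounded)
  then obtain K where "\<forall>y\<in>(\<lambda>t. \<Psi> (P t)) ` {a..b}. norm y \<le> K" unfolding bounded_iff by blast
  then have K: "\<bar>\<Psi> (P t)\<bar> \<le> K" if "t \<in> {a..b}" for t using that by auto
  have small: "(integral {a..b} (\<lambda>t. f n (P t) * \<Psi> (P t)))\<^sup>2 \<le> (b - a) * K\<^sup>2 * inverse (real (Suc n))" for n
  proof -
    have "(integral {a..b} (\<lambda>t. f n (P t) * \<Psi> (P t)))\<^sup>2 \<le> (b - a) * integral {a..b} (\<lambda>t. (f n (P t) * \<Psi> (P t))\<^sup>2)"
      by (rule integral_square_le[OF ab]) (intro continuous_intros cP f \<Psi>)
    also have "\<dots> \<le> (b - a) * (K\<^sup>2 * inverse (real (Suc n)))"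
    proof (rule mult_left_mono)
      have "integral {a..b} (\<lambda>t. (f n (P t) * \<Psi> (P t))\<^sup>2) \<le> integral {a..b} (\<lambda>t. K\<^sup>2 * (f n (P t))\<^sup>2)"
      proof (rule integral_le)
        fix t assume "t \<in> {a..b}"
        then have "(\<Psi> (P t))\<^sup>2 \<le> K\<^sup>2" using power_mono[OF K, of t 2] by simp
        then show "(f n (P t) * \<Psi> (P t))\<^sup>2 \<le> K\<^sup>2 * (f n (P t))\<^sup>2"
          by (simp add: power_mult_distrib mult.commute mult_right_mono)
      qed (intro integrable_continuous_interval continuous_intros cP f \<Psi>)+
      also have "\<dots> = K\<^sup>2 * integral {a..b} (\<lambda>t. (f n (P t))\<^sup>2)" by simp
      also have "\<dots> \<le> K\<^sup>2 * inverse (real (Suc n))" using f(3)[of n] by (intro mult_left_mono) auto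
      finally show "integral {a..b} (\<lambda>t. (f n (P t) * \<Psi> (P t))\<^sup>2) \<le> K\<^sup>2 * inverse (real (Suc n))" .
    qed (use ab in simp)
    finally show ?thesis by (simp add: mult.assoc)
  qed
  have "(\<lambda>n. (integral {a..b} (\<lambda>t. f n (P t) * \<Psi> (P t)))\<^sup>2) \<longlonglongrightarrow> 0"
  proof (rule Lim_null_comparison[OF always_eventually], rule allI)
    show "(\<lambda>n. (b - a) * K\<^sup>2 * inverse (real (Suc n))) \<longlonglongrightarrow> 0"
      using tendsto_mult_right_zero[OF LIMSEQ_inverse_real_of_nat] .
    show "norm ((integral {a..b} (\<lambda>t. f n (P t) * \<Psi> (P t)))\<^sup>2) \<le> (b - a) * K\<^sup>2 * inverse (real (Suc n))" for n
      using small[of n] by simp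
  qed
  from tendsto_real_sqrt[OF this]
  have "(\<lambda>n. integral {a..b} (\<lambda>t. f n (P t) * \<Psi> (P t))) \<longlonglongrightarrow> 0" by (simp add: tendsto_rabs_zero_iff)
  then have "(\<lambda>n. s * integral {a..b} (\<lambda>t. f n (P t) * \<Psi> (P t))) \<longlonglongrightarrow> 0" by (rule tendsto_mult_right_zero)
  then have "(\<lambda>n. inner (fst (Jh (f n))) (J (pd e \<Psi>)) + inner (d (Jh (f n))) (J \<Psi>)) \<longlonglongrightarrow> 0" unfolding eq .
  moreover have "(\<lambda>n. inner (fst (Jh (f n))) (J (pd e \<Psi>)) + inner (d (Jh (f n))) (J \<Psi>))
      \<longlonglongrightarrow> inner (fst x) (J (pd e \<Psi>)) + inner (d x) (J \<Psi>)"
    by (intro tendsto_intros f(2) bounded_linear.tendsto[OF d(2)])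
  ultimately have "inner (fst x) (J (pd e \<Psi>)) + inner (d x) (J \<Psi>) = 0" using LIMSEQ_unique by blast
  then show ?thesis by simp
qed

abbreviation Tz :: "real \<Rightarrow> h1 set" where "Tz z0 \<equiv> T (\<lambda>r. (r, z0)) \<sigma> R"
abbreviation Tr :: "real \<Rightarrow> h1 set" where "Tr r0 \<equiv> T (\<lambda>z. (r0, z)) 0 L"

lemma comp_Jh: "fst (snd (Jh f)) = J (pdr f)" "snd (snd (Jh f)) = J (pdz f)"
  by (simp_all add: Jh_def)

lemma bounded_linear_comp: "bounded_linear (\<lambda>x::h1. fst (snd x))" "bounded_linear (\<lambda>x::h1. snd (snd x))"
  by (intro bounded_linear_compose[OF bounded_linear_fst bounded_linear_snd]
      bounded_linear_compose[OF bounded_linear_snd bounded_linear_snd])+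

lemma ibp_r_half:
  assumes x: "x \<in> Tr r0" and r0: "r0 = \<sigma> \<and> r1 = R \<or> r0 = R \<and> r1 = \<sigma>" and \<Psi>: "smooth \<Psi>" and z: "\<And>z. \<Psi> (r1, z) = 0"
  shows "inner (fst x) (J (pdr \<Psi>)) = - inner (fst (snd x)) (J \<Psi>)"
proof (rule ibp_trace[OF x _ _ \<Psi> comp_Jh(1) bounded_linear_comp(1), where s="if r0 = \<sigma> then -1 else 1"])
  fix f assume f: "smooth f"
  show "integral B (pdr (\<lambda>x. f x * \<Psi> x)) = (if r0 = \<sigma> then - 1 else 1) * integral {0..L} (\<lambda>t. f (r0, t) * \<Psi> (r0, t))"
    using integral_pd_smooth(1)[OF smooth_mult[OF f \<Psi>]] r0 \<sigma>R z by auto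
qed (use L0 in \<open>auto intro!: continuous_intros\<close>)

lemma ibp_z_half:
  assumes x: "x \<in> Tz z0" and z0: "z0 = 0 \<and> z1 = L \<or> z0 = L \<and> z1 = 0" and \<Psi>: "smooth \<Psi>" and z: "\<And>r. \<Psi> (r, z1) = 0"
  shows "inner (fst x) (J (pdz \<Psi>)) = - inner (snd (snd x)) (J \<Psi>)"
proof (rule ibp_trace[OF x _ _ \<Psi> comp_Jh(2) bounded_linear_comp(2), where s="if z0 = 0 then -1 else 1"])
  fix f assume f: "smooth f"
  show "integral B (pdz (\<lambda>x. f x * \<Psi> x)) = (if z0 = 0 then - 1 else 1) * integral {\<sigma>..R} (\<lambda>t. f (t, z0) * \<Psi> (t, z0))"
    using integral_pd_smooth(2)[OF smooth_mult[OF f \<Psi>]] z0 L0 z by auto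
qed (use \<sigma>R in \<open>auto intro!: continuous_intros\<close>)

text \<open>The zero traces on the two sides come with different approximating sequences. The affine
  function \<open>c\<close> splits \<open>\<Psi>\<close> into a part vanishing at r = R and a part
  vanishing at r = \<sigma>; each is treated with the sequence belonging to the side where it
  survives.\<close>

lemma ibp_r:
  assumes x: "x \<in> Tr \<sigma>" "x \<in> Tr R" and \<Psi>: "smooth \<Psi>"
  shows "inner (fst x) (J (pdr \<Psi>)) = - inner (fst (snd x)) (J \<Psi>)"
proof -
  define c where "c y = (- 1 / (R - \<sigma>)) * fst y + 0 * snd y + R / (R - \<sigma>)" for y :: "real \<times> real"
  have c: "smooth c" unfolding c_def by (rule smooth_affine)
  have c01: "c (\<sigma>, z) = 1" "c (R, z) = 0" for z
  proof -
    have "c y = (R - fst y) / (R - \<sigma>)" for y by (simp add: c_def diff_divide_distrib)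
    then show "c (\<sigma>, z) = 1" "c (R, z) = 0" using \<sigma>R by simp_all
  qed
  have s1: "smooth (\<lambda>y. \<Psi> y * c y)" and s2: "smooth (\<lambda>y. \<Psi> y - \<Psi> y * c y)"
    by (intro smooth_mult smooth_diff \<Psi> c)+
  have e: "pdr (\<lambda>y. \<Psi> y * c y) y + pdr (\<lambda>y. \<Psi> y - \<Psi> y * c y) y = pdr \<Psi> y" for y
    using pd_smooth_diff[OF \<Psi> s1] by simp
  have "inner (fst x) (J (pdr (\<lambda>y. \<Psi> y * c y))) = - inner (fst (snd x)) (J (\<lambda>y. \<Psi> y * c y))"
    by (rule ibp_r_half[OF x(1) _ s1]) (auto simp: c01)
  moreover have "inner (fst x) (J (pdr (\<lambda>y. \<Psi> y - \<Psi> y * c y))) = - inner (fst (snd x)) (J (\<lambda>y. \<Psi> y - \<Psi> y * c y))"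
    by (rule ibp_r_half[OF x(2) _ s2]) (auto simp: c01)
  moreover have "J (pdr \<Psi>) = J (pdr (\<lambda>y. \<Psi> y * c y)) + J (pdr (\<lambda>y. \<Psi> y - \<Psi> y * c y))"
    by (subst J_add[symmetric]) (auto intro!: smooth_continuous smooth_pd s1 s2 simp: e)
  moreover have "J \<Psi> = J (\<lambda>y. \<Psi> y * c y) + J (\<lambda>y. \<Psi> y - \<Psi> y * c y)"
    by (subst J_add[symmetric]) (auto intro!: smooth_continuous s1 s2)
  ultimately show ?thesis by (simp add: inner_add_right)
qed

lemma ibp_z:
  assumes x: "x \<in> Tz 0" "x \<in> Tz L" and \<Psi>: "smooth \<Psi>"
  shows "inner (fst x) (J (pdz \<Psi>)) = - inner (snd (snd x)) (J \<Psi>)"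
proof -
  define c where "c y = 0 * fst y + (- 1 / L) * snd y + 1" for y :: "real \<times> real"
  have c: "smooth c" unfolding c_def by (rule smooth_affine)
  have c01: "c (r, 0) = 1" "c (r, L) = 0" for r using L0 by (auto simp: c_def field_simps)
  have s1: "smooth (\<lambda>y. \<Psi> y * c y)" and s2: "smooth (\<lambda>y. \<Psi> y - \<Psi> y * c y)"
    by (intro smooth_mult smooth_diff \<Psi> c)+
  have e: "pdz (\<lambda>y. \<Psi> y * c y) y + pdz (\<lambda>y. \<Psi> y - \<Psi> y * c y) y = pdz \<Psi> y" for y
    using pd_smooth_diff[OF \<Psi> s1] by simp
  have "inner (fst x) (J (pdz (\<lambda>y. \<Psi> y * c y))) = - inner (snd (snd x)) (J (\<lambda>y. \<Psi> y * c y))"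
    by (rule ibp_z_half[OF x(1) _ s1]) (auto simp: c01)
  moreover have "inner (fst x) (J (pdz (\<lambda>y. \<Psi> y - \<Psi> y * c y))) = - inner (snd (snd x)) (J (\<lambda>y. \<Psi> y - \<Psi> y * c y))"
    by (rule ibp_z_half[OF x(2) _ s2]) (auto simp: c01)
  moreover have "J (pdz \<Psi>) = J (pdz (\<lambda>y. \<Psi> y * c y)) + J (pdz (\<lambda>y. \<Psi> y - \<Psi> y * c y))"
    by (subst J_add[symmetric]) (auto intro!: smooth_continuous smooth_pd s1 s2 simp: e)
  moreover have "J \<Psi> = J (\<lambda>y. \<Psi> y * c y) + J (\<lambda>y. \<Psi> y - \<Psi> y * c y)"
    by (subst J_add[symmetric]) (auto intro!: smooth_continuous s1 s2)
  ultimately show ?thesis by (simp add: inner_add_right)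
qed

text \<open>Compactly supported \<open>\<Psi>\<close> sees no boundary, so membership in the closure
  suffices. This identifies the second and third component of an element of \<open>G0\<close> as
  weak derivatives of the first.\<close>

lemma ibp_test:
  assumes x: "x \<in> G0" and \<Psi>: "\<Psi> \<in> test_functions (interior B)"
  shows "inner (fst x) (J (pdr \<Psi>)) = - inner (fst (snd x)) (J \<Psi>)"
    and "inner (fst x) (J (pdz \<Psi>)) = - inner (snd (snd x)) (J \<Psi>)"
proof -
  obtain K where \<Psi>s: "smooth \<Psi>" and K: "K \<subseteq> interior B" "\<And>x. x \<notin> K \<Longrightarrow> \<Psi> x = 0"
    using \<Psi> by (auto simp: test_functions_def)
  have int: "interior B = box (\<sigma>, 0) (R, L)" unfolding B_def by simp
  have bz: "\<Psi> (\<sigma>, z) = 0" "\<Psi> (R, z) = 0" "\<Psi> (r, 0) = 0" "\<Psi> (r, L) = 0" for r z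
    using K unfolding int by (auto simp: mem_box Basis_prod_def subset_iff)
  obtain f where f: "\<And>n. smooth (f n)" "(\<lambda>n. Jh (f n)) \<longlonglongrightarrow> x" using G0_sequence[OF x] by blast
  have main: "inner (fst x) (J (pd e \<Psi>)) = - inner (d x) (J \<Psi>)"
    if d: "\<And>f. d (Jh f) = J (pd e f)" "bounded_linear d"
      and z: "\<And>f. smooth f \<Longrightarrow> integral B (pd e (\<lambda>x. f x * \<Psi> x)) = 0" for d :: "h1 \<Rightarrow> l2" and e
  proof -
    have eq: "inner (fst (Jh (f n))) (J (pd e \<Psi>)) + inner (d (Jh (f n))) (J \<Psi>) = 0" for n
    proof -
      have "inner (fst (Jh (f n))) (J (pd e \<Psi>)) + inner (d (Jh (f n))) (J \<Psi>)
          = integral B (\<lambda>x. f n x * pd e \<Psi> x) + integral B (\<lambda>x. pd e (f n) x * \<Psi> x)"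
        unfolding d by (simp add: Jh_def inner_J smooth_continuous smooth_pd f(1) \<Psi>s)
      also have "\<dots> = integral B (\<lambda>x. f n x * pd e \<Psi> x + pd e (f n) x * \<Psi> x)"
        unfolding B_def
        by (rule integral_add[symmetric]; intro integrable_continuous continuous_intros smooth_continuous smooth_pd f(1) \<Psi>s)
      also have "(\<lambda>x. f n x * pd e \<Psi> x + pd e (f n) x * \<Psi> x) = pd e (\<lambda>x. f n x * \<Psi> x)"
        by (intro ext) (simp add: pd_smooth_mult f(1) \<Psi>s)
      finally show ?thesis using z[OF f(1)] by simp
    qed
    have "(\<lambda>n. inner (fst (Jh (f n))) (J (pd e \<Psi>)) + inner (d (Jh (f n))) (J \<Psi>))
        \<longlonglongrightarrow> inner (fst x) (J (pd e \<Psi>)) + inner (d x) (J \<Psi>)"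
      by (intro tendsto_intros f(2) bounded_linear.tendsto[OF d(2)])
    then have "inner (fst x) (J (pd e \<Psi>)) + inner (d x) (J \<Psi>) = 0" unfolding eq by (simp add: LIMSEQ_const_iff)
    then show ?thesis by simp
  qed
  show "inner (fst x) (J (pdr \<Psi>)) = - inner (fst (snd x)) (J \<Psi>)"
    by (rule main[OF comp_Jh(1) bounded_linear_comp(1)]) (simp add: integral_pd_smooth(1) smooth_mult \<Psi>s bz)
  show "inner (fst x) (J (pdz \<Psi>)) = - inner (snd (snd x)) (J \<Psi>)"
    by (rule main[OF comp_Jh(2) bounded_linear_comp(2)]) (simp add: integral_pd_smooth(2) smooth_mult \<Psi>s bz)
qed

lemma test_in_T:
  assumes \<Psi>: "\<Psi> \<in> test_functions (interior B)"
  shows "smooth \<Psi>" "Jh \<Psi> \<in> Tz 0" "Jh \<Psi> \<in> Tz L" "Jh \<Psi> \<in> Tr \<sigma>" "Jh \<Psi> \<in> Tr R"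
proof -
  obtain K where \<Psi>s: "smooth \<Psi>" and K: "K \<subseteq> interior B" "\<And>x. x \<notin> K \<Longrightarrow> \<Psi> x = 0"
    using \<Psi> by (auto simp: test_functions_def)
  have int: "interior B = box (\<sigma>, 0) (R, L)" unfolding B_def by simp
  have bz: "\<Psi> (\<sigma>, z) = 0" "\<Psi> (R, z) = 0" "\<Psi> (r, 0) = 0" "\<Psi> (r, L) = 0" for r z
    using K unfolding int by (auto simp: mem_box Basis_prod_def subset_iff)
  show "smooth \<Psi>" by (rule \<Psi>s)
  show "Jh \<Psi> \<in> Tz 0" "Jh \<Psi> \<in> Tz L" "Jh \<Psi> \<in> Tr \<sigma>" "Jh \<Psi> \<in> Tr R"
    by (rule T_I[of "\<lambda>_. \<Psi>"]; simp add: \<Psi>s bz)+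
qed

lemma bmeas_B: "bmeas (indicator B)"
proof -
  have "B \<in> sets lebesgue" by (simp add: B_def)
  then show ?thesis unfolding bmeas_def by (auto intro!: borel_measurable_indicator exI[of _ 1] simp: indicator_def)
qed

lemma bmeas_continuous_B:
  assumes "continuous_on B f" shows "bmeas (\<lambda>x. indicator B x * f x)"
proof -
  have "compact (f ` B)" unfolding B_def using assms[unfolded B_def] by (intro compact_continuous_image compact_cbox)
  then obtain K where K: "\<forall>y\<in>f ` B. norm y \<le> K" unfolding bounded_iff using compact_imp_bounded bounded_iff by blast
  have "\<bar>indicator B x * f x\<bar> \<le> \<bar>K\<bar>" for x
    using K by (cases "x \<in> B") (auto simp: indicator_def intro: order_trans[OF _ abs_ge_self])
  then show ?thesis unfolding bmeas_def using sqint_B[OF assms] by (auto simp: sqint_def)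
qed

text \<open>Being fixed under multiplication by \<open>indicator B\<close> is a closed condition,
  and the smooth functions cut off to \<open>B\<close> satisfy it.\<close>

lemma G0_support:
  assumes "x \<in> G0"
  shows "AE t in lebesgue. t \<notin> B \<longrightarrow> fn (fst x) t = 0"
    "AE t in lebesgue. t \<notin> B \<longrightarrow> fn (fst (snd x)) t = 0"
    "AE t in lebesgue. t \<notin> B \<longrightarrow> fn (snd (snd x)) t = 0"
proof -
  let ?w = "wt (indicator B)"
  have JB: "?w (J f) = J f" if "continuous_on B f" for f
    unfolding J_def wt_cl[OF bmeas_B sqint_B[OF that]] by (intro arg_cong[of _ _ cl]) (auto simp: indicator_def)
  have cont: "continuous_on UNIV ?w" by (rule linear_continuous_on[OF bounded_linear_wt[OF bmeas_B]])
  have "G0 \<subseteq> {x. ?w (fst x) = fst x \<and> ?w (fst (snd x)) = fst (snd x) \<and> ?w (snd (snd x)) = snd (snd x)}"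
    unfolding G0_def
  proof (rule closure_minimal)
    show "closed {x::h1. ?w (fst x) = fst x \<and> ?w (fst (snd x)) = fst (snd x) \<and> ?w (snd (snd x)) = snd (snd x)}"
      by (intro closed_Collect_conj closed_Collect_eq continuous_intros continuous_on_compose2[OF cont]) auto
  qed (auto simp: Jh_def JB smooth_continuous smooth_pd)
  then have w: "?w (fst x) = fst x" "?w (fst (snd x)) = fst (snd x)" "?w (snd (snd x)) = snd (snd x)"
    using assms by auto
  have AEB: "AE t in lebesgue. t \<notin> B \<longrightarrow> fn y t = 0" if "?w y = y" for y
    using fn_wt[OF bmeas_B, of y] unfolding that by eventually_elim auto
  show "AE t in lebesgue. t \<notin> B \<longrightarrow> fn (fst x) t = 0"
    "AE t in lebesgue. t \<notin> B \<longrightarrow> fn (fst (snd x)) t = 0"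
    "AE t in lebesgue. t \<notin> B \<longrightarrow> fn (snd (snd x)) t = 0"
    by (intro AEB w)+
qed

lemma pr_bound:
  assumes "x \<in> G0" "y \<in> G0"
  shows "norm (pr (fst x) (fst y)) \<le> sqrt Klad * norm x * norm y"
proof (rule power2_le_imp_le)
  have "(norm (pr (fst x) (fst y)))\<^sup>2 \<le> Klad * (norm (fst x) * norm x * (norm (fst y) * norm y))"
    by (rule ladyzhenskaya(2)[OF assms])
  also have "\<dots> \<le> Klad * (norm x * norm x * (norm y * norm y))"
    using Klad_pos norm_h1_comps(1) by (intro mult_left_mono mult_mono) auto
  also have "\<dots> = (sqrt Klad * norm x * norm y)\<^sup>2"
    using Klad_pos by (simp add: power_mult_distrib power2_eq_square)
  finally show "(norm (pr (fst x) (fst y)))\<^sup>2 \<le> (sqrt Klad * norm x * norm y)\<^sup>2" .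
qed (use Klad_pos in simp)

text \<open>Ladyzhenskaya's bound contains the L2 norm of each factor as well as its H1 norm. Strong
  convergence of the values together with mere boundedness in H1, which is what Rellich's theorem
  delivers, is therefore enough.\<close>

lemma pr_tendsto:
  assumes X: "\<And>n. X n \<in> G0" "x \<in> G0" and y: "y \<in> G0"
    and lim: "(\<lambda>n. fst (X n)) \<longlonglongrightarrow> fst x" and bd: "\<And>n. norm (X n) \<le> M"
  shows "(\<lambda>n. pr (fst (X n)) (fst y)) \<longlonglongrightarrow> pr (fst x) (fst y)"
proof -
  have "(\<lambda>n. (norm (pr (fst (X n)) (fst y) - pr (fst x) (fst y)))\<^sup>2) \<longlonglongrightarrow> 0"
  proof (rule Lim_null_comparison[OF always_eventually], rule allI)
    fix n
    have d: "X n - x \<in> G0" using X subspace_G0 by (intro subspace_diff)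
    have "pr (fst (X n)) (fst y) - pr (fst x) (fst y) = pr (fst (X n - x)) (fst y)"
      by (simp add: pr_diff ladyzhenskaya(1) X y)
    then have "(norm (pr (fst (X n)) (fst y) - pr (fst x) (fst y)))\<^sup>2
        \<le> Klad * (norm (fst (X n - x)) * norm (X n - x) * (norm (fst y) * norm y))"
      using ladyzhenskaya(2)[OF d y] by simp
    also have "\<dots> \<le> Klad * (norm (fst (X n - x)) * (M + norm x) * (norm (fst y) * norm y))"
      using Klad_pos norm_triangle_ineq4[of "X n" x] bd[of n] by (intro mult_left_mono mult_right_mono) auto
    finally show "norm ((norm (pr (fst (X n)) (fst y) - pr (fst x) (fst y)))\<^sup>2)
      \<le> Klad * (norm (fst (X n) - fst x) * (M + norm x) * (norm (fst y) * norm y))" by simp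
  next
    have "(\<lambda>n. norm (fst (X n) - fst x)) \<longlonglongrightarrow> 0"
      using lim by (simp add: tendsto_norm_zero_iff LIM_zero_iff)
    then have "(\<lambda>n. Klad * (norm (fst (X n) - fst x) * (M + norm x) * (norm (fst y) * norm y)))
      \<longlonglongrightarrow> Klad * (0 * (M + norm x) * (norm (fst y) * norm y))" by (intro tendsto_intros)
    then show "(\<lambda>n. Klad * (norm (fst (X n) - fst x) * (M + norm x) * (norm (fst y) * norm y))) \<longlonglongrightarrow> 0" by simp
  qed
  from tendsto_real_sqrt[OF this] show ?thesis by (simp add: tendsto_norm_zero_iff LIM_zero_iff)
qed

section \<open>Poincare's inequality and the transport identity\<close>

definition rr :: "real \<times> real \<Rightarrow> real" where "rr x = indicator B x * fst x"

lemma bmeas_rr: "bmeas rr"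
  unfolding rr_def[abs_def] by (intro bmeas_continuous_B continuous_intros)

lemma rr_le: "\<bar>rr x\<bar> \<le> R"
  using \<sigma>0 \<sigma>R by (auto simp: rr_def indicator_def mem_B)

lemma wt_rr_J: "continuous_on B f \<Longrightarrow> wt rr (J f) = J (\<lambda>x. fst x * f x)"
  unfolding J_def by (subst wt_cl[OF bmeas_rr sqint_B]) (auto intro!: arg_cong[of _ _ cl] simp: rr_def indicator_def)

text \<open>Integrating by parts against r x gives |x|^2 = - 2 (r x, x_r) with x_r the radial
  derivative, since the derivative of r x contains x itself. This is why the constant is 2 R. The
  factor \<open>x\<close> in the test function is approximated, as integration by parts is available
  for smooth \<open>\<Psi>\<close> only.\<close>

lemma poincare_r:
  assumes x: "x \<in> Tr \<sigma>" "x \<in> Tr R"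
  shows "norm (fst x) \<le> 2 * R * norm (fst (snd x))"
proof -
  have "x \<in> G0" using x(1) T_subset_G0 by blast
  from G0_sequence[OF this] obtain f where f: "\<And>n. smooth (f n)" "(\<lambda>n. Jh (f n)) \<longlonglongrightarrow> x" by blast
  have c0: "(\<lambda>n. J (f n)) \<longlonglongrightarrow> fst x" using tendsto_fst[OF f(2)] by (simp add: Jh_def)
  have c1: "(\<lambda>n. J (pdr (f n))) \<longlonglongrightarrow> fst (snd x)" using tendsto_fst[OF tendsto_snd[OF f(2)]] by (simp add: Jh_def)
  have wl: "bounded_linear (wt rr)" by (rule bounded_linear_wt[OF bmeas_rr])
  have "inner (fst x) (J (f n) + wt rr (J (pdr (f n)))) = - inner (fst (snd x)) (wt rr (J (f n)))" for n
  proof -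
    have e: "pdr (\<lambda>y. fst y * f n y) = (\<lambda>y. f n y + fst y * pdr (f n) y)"
      by (intro ext) (simp add: pd_smooth_mult smooth_fst f(1) pd_fst)
    have "J (pdr (\<lambda>y. fst y * f n y)) = J (f n) + wt rr (J (pdr (f n)))"
      unfolding e by (subst J_add) (auto simp: wt_rr_J smooth_continuous smooth_pd f(1) intro!: continuous_intros)
    then show ?thesis
      using ibp_r[OF x smooth_mult[OF smooth_fst f(1)], of n] by (simp add: wt_rr_J smooth_continuous f(1))
  qed
  moreover have "(\<lambda>n. inner (fst x) (J (f n) + wt rr (J (pdr (f n))))) \<longlonglongrightarrow> inner (fst x) (fst x + wt rr (fst (snd x)))"
    by (intro tendsto_intros c0 bounded_linear.tendsto[OF wl] c1)
  moreover have "(\<lambda>n. - inner (fst (snd x)) (wt rr (J (f n)))) \<longlonglongrightarrow> - inner (fst (snd x)) (wt rr (fst x))"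
    by (intro tendsto_intros c0 bounded_linear.tendsto[OF wl])
  ultimately have "inner (fst x) (fst x + wt rr (fst (snd x))) = - inner (fst (snd x)) (wt rr (fst x))"
    using LIMSEQ_unique by simp
  then have "(norm (fst x))\<^sup>2 = - 2 * inner (wt rr (fst x)) (fst (snd x))"
    using inner_wt_commute[OF bmeas_rr, of "fst x" "fst (snd x)"]
    by (simp add: inner_add_right power2_norm_eq_inner inner_commute)
  also have "\<dots> \<le> 2 * (norm (wt rr (fst x)) * norm (fst (snd x)))"
    using Cauchy_Schwarz_ineq2[of "wt rr (fst x)" "fst (snd x)"] by linarith
  also have "\<dots> \<le> 2 * (R * norm (fst x) * norm (fst (snd x)))"
    by (intro mult_left_mono mult_right_mono norm_wt_le[OF bmeas_rr rr_le]) auto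
  finally have "norm (fst x) * norm (fst x) \<le> norm (fst x) * (2 * R * norm (fst (snd x)))"
    by (simp add: power2_eq_square mult_ac)
  then show ?thesis
    using \<sigma>0 \<sigma>R by (cases "norm (fst x) = 0") (auto simp: mult_le_cancel_left)
qed

lemma inner_pr_J:
  assumes ok: "mult_ok x (J f)" and f: "continuous_on B f" and g: "continuous_on B g"
  shows "inner (wt rr (pr x (J f))) (J g) = inner x (J (\<lambda>y. fst y * (f y * g y)))"
proof -
  have c: "continuous_on B (\<lambda>y. fst y * (f y * g y))" by (intro continuous_intros f g)
  have "inner (wt rr (pr x (J f))) (J g) = (LINT t|lebesgue. rr t * fn (pr x (J f)) t * fn (J g) t)"
    by (rule inner_wt[OF bmeas_rr])
  also have "\<dots> = (LINT t|lebesgue. fn x t * fn (J (\<lambda>y. fst y * (f y * g y))) t)"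
  proof (rule integral_cong_AE)
    show "(\<lambda>t. rr t * fn (pr x (J f)) t * fn (J g) t) \<in> borel_measurable lebesgue"
      using bmeas_rr unfolding bmeas_def by auto
    show "AE t in lebesgue. rr t * fn (pr x (J f)) t * fn (J g) t = fn x t * fn (J (\<lambda>y. fst y * (f y * g y))) t"
      using fn_pr[OF ok] fn_J[OF f] fn_J[OF g] fn_J[OF c]
      by eventually_elim (simp add: rr_def indicator_def)
  qed auto
  finally show ?thesis by (simp add: inner_fn)
qed

text \<open>The integrand is half of r U . grad (y^2). Integration by parts moves the derivative
  onto r U, whose divergence is zero. \<open>y\<close> carries no boundary condition: the boundary
  terms vanish because \<open>u\<close> does so at r = \<sigma>, R and \<open>w\<close> at z = 0, L.
  Accordingly only \<open>y\<close> is replaced by smooth functions.\<close>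

theorem transport_antisymmetric:
  assumes u: "u \<in> Tr \<sigma>" "u \<in> Tr R" and w: "w \<in> Tz 0" "w \<in> Tz L"
    and div: "fst u + wt rr (fst (snd u)) + wt rr (snd (snd w)) = 0" and y: "y \<in> G0"
  shows "inner (wt rr (pr (fst u) (fst y))) (fst (snd y)) + inner (wt rr (pr (fst w) (fst y))) (snd (snd y)) = 0"
proof -
  have uG: "u \<in> G0" and wG: "w \<in> G0" using u(1) w(1) T_subset_G0 by auto
  obtain f where f: "\<And>n. smooth (f n)" "(\<lambda>n. Jh (f n)) \<longlonglongrightarrow> y" using G0_sequence[OF y] by blast
  have cf: "continuous_on B (f n)" "continuous_on B (pd e (f n))" for n e
    by (auto intro!: smooth_continuous smooth_pd f(1))
  have fstJ: "fst (Jh g) = J g" for g by (simp add: Jh_def)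
  have "inner (wt rr (pr (fst u) (J (f n)))) (J (pdr (f n))) + inner (wt rr (pr (fst w) (J (f n)))) (J (pdz (f n))) = 0" for n
  proof -
    \<comment> \<open>The smooth test function is r times \<open>\<Phi>\<close>, the factor r being
      the one of the volume element; its radial derivative also produces the term
      \<open>\<Phi>\<close> that meets the summand u of the divergence.\<close>
    define \<Phi> where "\<Phi> x = f n x * f n x" for x
    have \<Phi>: "smooth \<Phi>" unfolding \<Phi>_def by (intro smooth_mult f)
    have c\<Phi>: "continuous_on B \<Phi>" "continuous_on B (pd e \<Phi>)" for e by (intro smooth_continuous smooth_pd \<Phi>)+
    have pd\<Phi>: "pd e \<Phi> x = 2 * (f n x * pd e (f n) x)" for e x
      unfolding \<Phi>_def by (simp add: pd_smooth_mult f(1))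
    have r\<Phi>: "smooth (\<lambda>x. fst x * \<Phi> x)" by (intro smooth_mult smooth_fst \<Phi>)
    have okn: "mult_ok (fst u) (J (f n))" "mult_ok (fst w) (J (f n))"
      using ladyzhenskaya(1)[OF uG Jh_G0[OF f(1)], of n] ladyzhenskaya(1)[OF wG Jh_G0[OF f(1)], of n] by (simp_all add: fstJ)
    have half: "J (\<lambda>x. fst x * (f n x * pd e (f n) x)) = (1/2) *\<^sub>R J (\<lambda>x. fst x * pd e \<Phi> x)" for e
      by (subst J_scale[symmetric]) (auto intro!: continuous_intros c\<Phi> cf simp: pd\<Phi>)
    have e1: "pdr (\<lambda>x. fst x * \<Phi> x) = (\<lambda>x. \<Phi> x + fst x * pdr \<Phi> x)"
      by (intro ext) (simp add: pd_smooth_mult smooth_fst \<Phi> pd_fst)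
    have e2: "pdz (\<lambda>x. fst x * \<Phi> x) = (\<lambda>x. fst x * pdz \<Phi> x)"
      by (intro ext) (simp add: pd_smooth_mult smooth_fst \<Phi> pd_fst)
    have i1: "inner (fst u) (J \<Phi>) + inner (fst u) (J (\<lambda>x. fst x * pdr \<Phi> x)) = - inner (fst (snd u)) (wt rr (J \<Phi>))"
    proof -
      have "J (pdr (\<lambda>x. fst x * \<Phi> x)) = J \<Phi> + J (\<lambda>x. fst x * pdr \<Phi> x)"
        unfolding e1 by (rule J_add) (intro continuous_intros c\<Phi>)+
      then show ?thesis using ibp_r[OF u r\<Phi>] by (simp add: wt_rr_J c\<Phi> inner_add_right)
    qed
    have i2: "inner (fst w) (J (\<lambda>x. fst x * pdz \<Phi> x)) = - inner (snd (snd w)) (wt rr (J \<Phi>))"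
      using ibp_z[OF w r\<Phi>] unfolding e2 by (simp add: wt_rr_J c\<Phi>)
    have "inner (fst u + wt rr (fst (snd u)) + wt rr (snd (snd w))) (J \<Phi>) = 0" unfolding div by simp
    then have i3: "inner (fst u) (J \<Phi>) + inner (fst (snd u)) (wt rr (J \<Phi>)) + inner (snd (snd w)) (wt rr (J \<Phi>)) = 0"
      by (simp add: inner_add_left inner_wt_commute[OF bmeas_rr])
    show ?thesis
      unfolding inner_pr_J[OF okn(1) cf] inner_pr_J[OF okn(2) cf] half inner_scaleR_right using i1 i2 i3 by simp
  qed
  moreover have "(\<lambda>n. inner (wt rr (pr (fst u) (J (f n)))) (J (pdr (f n))) + inner (wt rr (pr (fst w) (J (f n)))) (J (pdz (f n))))
      \<longlonglongrightarrow> inner (wt rr (pr (fst u) (fst y))) (fst (snd y)) + inner (wt rr (pr (fst w) (fst y))) (snd (snd y))"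
  proof -
    have "Bseq (\<lambda>n. Jh (f n))" using f(2) by (intro convergent_imp_Bseq convergentI)
    then obtain M where M: "\<And>n. norm (Jh (f n)) \<le> M" by (auto simp: Bseq_def)
    have prl: "(\<lambda>n. pr (fst v) (J (f n))) \<longlonglongrightarrow> pr (fst v) (fst y)" if "v \<in> G0" for v
      using pr_tendsto[OF Jh_G0[OF f(1)] y that tendsto_fst[OF f(2)] M] by (simp add: fstJ pr_commute)
    have c1: "(\<lambda>n. J (pdr (f n))) \<longlonglongrightarrow> fst (snd y)" "(\<lambda>n. J (pdz (f n))) \<longlonglongrightarrow> snd (snd y)"
      using tendsto_fst[OF tendsto_snd[OF f(2)]] tendsto_snd[OF tendsto_snd[OF f(2)]] by (simp_all add: Jh_def)
    show ?thesis
      by (intro tendsto_intros bounded_linear.tendsto[OF bounded_linear_wt[OF bmeas_rr]] prl uG wG c1)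
  qed
  ultimately show ?thesis by (simp add: LIMSEQ_const_iff)
qed

end

section \<open>The weak problem in Hilbert space\<close>

lemma weak_strong_tendsto_inner:
  fixes X Y :: "nat \<Rightarrow> 'a::real_inner"
  assumes X: "weakly X x" and Y: "Y \<longlonglongrightarrow> y"
  shows "(\<lambda>n. inner (Y n) (X n)) \<longlonglongrightarrow> inner y x"
proof -
  obtain M where M: "\<And>n. norm (X n) \<le> M" using X by (auto simp: weakly_def)
  have "(\<lambda>n. inner (Y n - y) (X n)) \<longlonglongrightarrow> 0"
  proof (rule Lim_null_comparison[OF always_eventually], rule allI)
    fix n
    have "\<bar>inner (Y n - y) (X n)\<bar> \<le> norm (Y n - y) * norm (X n)" by (rule Cauchy_Schwarz_ineq2)
    also have "\<dots> \<le> norm (Y n - y) * M" by (rule mult_left_mono[OF M]) simp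
    finally show "norm (inner (Y n - y) (X n)) \<le> norm (Y n - y) * M" by simp
    have "(\<lambda>n. norm (Y n - y)) \<longlonglongrightarrow> 0" using Y by (simp add: tendsto_norm_zero_iff LIM_zero_iff)
    then show "(\<lambda>n. norm (Y n - y) * M) \<longlonglongrightarrow> 0" by (rule tendsto_mult_left_zero)
  qed
  moreover have "(\<lambda>n. inner (X n) y) \<longlonglongrightarrow> inner x y" using X by (simp add: weakly_def)
  ultimately have "(\<lambda>n. inner (Y n - y) (X n) + inner (X n) y) \<longlonglongrightarrow> 0 + inner x y" by (rule tendsto_add)
  then show ?thesis by (simp add: inner_diff_left inner_commute[of _ y])
qed

lemma weakly_fst_snd:
  assumes "weakly X x"
  shows "weakly (\<lambda>n. fst (X n)) (fst x)" "weakly (\<lambda>n. snd (X n)) (snd x)"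
proof -
  obtain M where M: "\<And>n. norm (X n) \<le> M" using assms by (auto simp: weakly_def)
  have lim: "(\<lambda>n. inner (X n) z) \<longlonglongrightarrow> inner x z" for z using assms unfolding weakly_def by blast
  have "norm (fst (X n)) \<le> M" "norm (snd (X n)) \<le> M" for n
    using norm_fst_le[of "fst (X n)" "snd (X n)"] norm_snd_le[of "snd (X n)" "fst (X n)"] M[of n] by auto
  moreover have "(\<lambda>n. inner (fst (X n)) z) \<longlonglongrightarrow> inner (fst x) z" "(\<lambda>n. inner (snd (X n)) z') \<longlonglongrightarrow> inner (snd x) z'" for z z'
    using lim[of "(z, 0)"] lim[of "(0, z')"] by (simp_all add: inner_prod_def)
  ultimately show "weakly (\<lambda>n. fst (X n)) (fst x)" "weakly (\<lambda>n. snd (X n)) (snd x)"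
    unfolding weakly_def by blast+
qed

lemma sqint_fn_mult: "integrable lebesgue (\<lambda>t. fn x t * fn y t)"
  by (rule sqint_mult_integrable) auto

context annulus begin

text \<open>No condition at z = L for the radial and azimuthal components: there the Neumann
  condition is natural and is encoded by the choice of test fields.\<close>

definition V :: "h1 set" where "V = Tz 0 \<inter> Tr \<sigma> \<inter> Tr R"
definition W :: "h1 set" where "W = V \<inter> Tz L"
text \<open>\<open>\<partial>\<^sub>r (r u) + \<partial>\<^sub>z (r w)\<close> is expanded by the product rule.\<close>

definition S :: "(h1 \<times> h1 \<times> h1) set" where
  "S = {(u, w, v). u \<in> V \<and> w \<in> W \<and> v \<in> V \<and> fst u + wt rr (fst (snd u)) + wt rr (snd (snd w)) = 0}"

lemma continuous_paths: "continuous_on X (\<lambda>r. (r, z0 :: real))" "continuous_on X (\<lambda>z. (r0 :: real, z :: real))"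
  by (intro continuous_intros)+

lemma subspace_V: "subspace V" and subspace_W: "subspace W"
  unfolding W_def V_def by (intro subspace_inter subspace_T continuous_paths)+

lemma closed_V: "closed V" and closed_W: "closed W"
  unfolding W_def V_def by (intro closed_Int closed_T)+

lemma V_G0: "x \<in> V \<Longrightarrow> x \<in> G0" and W_V: "x \<in> W \<Longrightarrow> x \<in> V"
  using T_subset_G0 by (auto simp: V_def W_def)

lemma S_G0:
  assumes "(u, w, v) \<in> S" shows "u \<in> G0" "w \<in> G0" "v \<in> G0"
  using assms V_G0 W_V by (auto simp: S_def)

lemma wt_rr_linear: "bounded_linear (wt rr)"
  by (rule bounded_linear_wt[OF bmeas_rr])

lemma subspace_S: "subspace S"
proof -
  interpret r: bounded_linear "wt rr" by (rule wt_rr_linear)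
  have ring: "a + b + c = 0 \<Longrightarrow> a' + b' + c' = 0 \<Longrightarrow> (a + a') + (b + b') + (c + c') = 0" for a b c a' b' c' :: l2
    by (simp add: algebra_simps) (metis add.commute add.left_commute add_0)
  show ?thesis
    unfolding subspace_def
  proof (intro conjI ballI allI)
    have "(0, 0, 0) \<in> S" by (simp add: S_def subspace_0 subspace_V subspace_W r.zero)
    then show "0 \<in> S" by (simp add: zero_prod_def)
    fix x y c assume x: "x \<in> S"
    show "c *\<^sub>R x \<in> S"
    proof -
      obtain u w v where xe: "x = (u, w, v)" by (cases x)
      show ?thesis
        using x subspace_scale[OF subspace_V] subspace_scale[OF subspace_W]
        by (simp add: xe S_def r.scaleR flip: scaleR_add_right)
    qed
    assume y: "y \<in> S"
    show "x + y \<in> S"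
    proof -
      obtain u w v where xe: "x = (u, w, v)" by (cases x)
      obtain u' w' v' where ye: "y = (u', w', v')" by (cases y)
      show ?thesis
        using x y subspace_add[OF subspace_V] subspace_add[OF subspace_W]
        by (simp add: xe ye S_def r.add ring)
    qed
  qed
qed

lemma closed_S: "closed S"
proof -
  have "S = {x. fst x \<in> V \<and> fst (snd x) \<in> W \<and> snd (snd x) \<in> V
      \<and> fst (fst x) + wt rr (fst (snd (fst x))) + wt rr (snd (snd (fst (snd x)))) = 0}"
    by (auto simp: S_def)
  also have "closed \<dots>"
    by (intro closed_Collect_conj closed_Collect_eq continuous_intros
        closed_vimage[OF closed_V, unfolded vimage_def] closed_vimage[OF closed_W, unfolded vimage_def]
        continuous_on_compose2[OF linear_continuous_on[OF wt_rr_linear, of UNIV]]) auto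
  finally show ?thesis .
qed

section \<open>Coercivity and the operators of the weak problem\<close>

definition ir :: "real \<times> real \<Rightarrow> real" where "ir x = indicator B x * (1 / fst x)"

lemma bmeas_ir: "bmeas ir"
  unfolding ir_def[abs_def] using \<sigma>0 by (intro bmeas_continuous_B continuous_intros) (auto simp: mem_B)

lemma inner_wt_ir_nonneg: "inner (wt ir x) x \<ge> 0"
  unfolding inner_wt[OF bmeas_ir] using \<sigma>0
  by (intro integral_nonneg_AE AE_I2) (auto simp: ir_def indicator_def mem_B mult.assoc)

lemma inner_wt_rr_ge:
  assumes "AE t in lebesgue. t \<notin> B \<longrightarrow> fn x t = 0"
  shows "inner (wt rr x) x \<ge> \<sigma> * (norm x)\<^sup>2"
proof -
  have "\<sigma> * (norm x)\<^sup>2 = (LINT t|lebesgue. \<sigma> * (fn x t * fn x t))"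
    unfolding norm_fn by (simp add: power2_eq_square)
  also have "\<dots> \<le> (LINT t|lebesgue. rr t * fn x t * fn x t)"
  proof (rule integral_mono_AE)
    show "integrable lebesgue (\<lambda>t. \<sigma> * (fn x t * fn x t))" using sqint_fn_mult by simp
    show "integrable lebesgue (\<lambda>t. rr t * fn x t * fn x t)"
      by (rule sqint_mult_integrable[OF sqint_bmeas[OF bmeas_rr sqint_fn] sqint_fn])
    show "AE t in lebesgue. \<sigma> * (fn x t * fn x t) \<le> rr t * fn x t * fn x t"
      using assms
    proof eventually_elim
      case (elim t)
      show ?case
      proof (cases "t \<in> B")
        case True
        then have "\<sigma> \<le> rr t" by (simp add: rr_def mem_B)
        then show ?thesis unfolding mult.assoc by (rule mult_right_mono) simp
      qed (use elim in simp)
    qed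
  qed
  also have "\<dots> = inner (wt rr x) x" by (simp add: inner_wt[OF bmeas_rr])
  finally show ?thesis .
qed

lemma norm_h1_sq: "(norm x)\<^sup>2 = (norm (fst x))\<^sup>2 + (norm (fst (snd x)))\<^sup>2 + (norm (snd (snd x)))\<^sup>2" for x :: h1
  by (simp add: power2_norm_eq_inner inner_prod_def)

text \<open>The weight r is at least \<sigma> on the support. By \<open>poincare_r\<close> the
  values cost at most (2 R)^2 times the squared radial derivative, which makes the full norm at most
  4 R^2 + 1 times the gradient part.\<close>

lemma dirichlet_coercive:
  assumes "x \<in> V"
  shows "\<sigma> / (4 * R\<^sup>2 + 1) * (norm x)\<^sup>2 \<le> inner (wt rr (fst (snd x))) (fst (snd x)) + inner (wt rr (snd (snd x))) (snd (snd x))"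
proof -
  have "norm (fst x) \<le> 2 * R * norm (fst (snd x))" using assms by (intro poincare_r) (auto simp: V_def)
  then have "(norm (fst x))\<^sup>2 \<le> (2 * R * norm (fst (snd x)))\<^sup>2" by (rule power_mono) simp
  then have "(norm x)\<^sup>2 \<le> (4 * R\<^sup>2 + 1) * ((norm (fst (snd x)))\<^sup>2 + (norm (snd (snd x)))\<^sup>2)"
    unfolding norm_h1_sq[of x] by (simp add: power_mult_distrib algebra_simps add_increasing2)
  then have "\<sigma> / (4 * R\<^sup>2 + 1) * (norm x)\<^sup>2 \<le> \<sigma> / (4 * R\<^sup>2 + 1) * ((4 * R\<^sup>2 + 1) * ((norm (fst (snd x)))\<^sup>2 + (norm (snd (snd x)))\<^sup>2))"
    using \<sigma>0 by (intro mult_left_mono) (auto intro!: divide_nonneg_pos add_nonneg_pos)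
  also have "\<dots> = \<sigma> * (norm (fst (snd x)))\<^sup>2 + \<sigma> * (norm (snd (snd x)))\<^sup>2"
  proof -
    have "4 * R\<^sup>2 + 1 \<noteq> 0" by (metis add_nonneg_pos less_irrefl mult_nonneg_nonneg zero_le_numeral zero_le_power2 zero_less_one)
    then show ?thesis by (simp add: distrib_left)
  qed
  also have "\<dots> \<le> inner (wt rr (fst (snd x))) (fst (snd x)) + inner (wt rr (snd (snd x))) (snd (snd x))"
    by (intro add_mono inner_wt_rr_ge G0_support V_G0 assms)
  finally show ?thesis .
qed

text \<open>
  With \<open>x = (u, w, v)\<close>, \<open>y\<close> a test field and \<open>k = v\<^sub>s\<close>, both equations of the weak problem add up
  to \<open>\<langle>Aop \<nu> x, y\<rangle> + \<langle>Pop x y, x\<rangle> + \<langle>Lop k x, y\<rangle> + \<langle>fop k, y\<rangle> = 0\<close>: viscous, convective,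
  linear in \<open>v\<^sub>s\<close>, and the inhomogeneity from \<open>v\<^sub>s\<^sup>2\<close>.  In \<open>\<langle>Pop x y, x\<rangle>\<close> the products are formed
  from the values of \<open>x\<close> and \<open>y\<close>, so that the derivatives come from the second argument \<open>x\<close>.
\<close>

definition Aop :: "real \<Rightarrow> h1 \<times> h1 \<times> h1 \<Rightarrow> h1 \<times> h1 \<times> h1" where
  "Aop \<nu> x = (case x of ((u0, u1, u2), (w0, w1, w2), (v0, v1, v2)) \<Rightarrow>
     \<nu> *\<^sub>R ((wt ir u0, wt rr u1, wt rr u2), (0, wt rr w1, wt rr w2), (wt ir v0, wt rr v1, wt rr v2)))"

definition Lop :: "(real \<times> real \<Rightarrow> real) \<Rightarrow> h1 \<times> h1 \<times> h1 \<Rightarrow> h1 \<times> h1 \<times> h1" where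
  "Lop k x = (case x of ((u0, u1, u2), (w0, w1, w2), (v0, v1, v2)) \<Rightarrow>
     (((-2) *\<^sub>R wt k v0, 0, 0), (0, 0, 0), (wt k u0, - wt k (wt rr u0), - wt k (wt rr w0))))"

definition Pop :: "h1 \<times> h1 \<times> h1 \<Rightarrow> h1 \<times> h1 \<times> h1 \<Rightarrow> h1 \<times> h1 \<times> h1" where
  "Pop x y = (case (x, y) of (((u0, u1, u2), (w0, w1, w2), (v0, v1, v2)), ((u0', u1', u2'), (w0', w1', w2'), (v0', v1', v2'))) \<Rightarrow>
     ((0, wt rr (pr u0 u0'), wt rr (pr w0 u0')), (0, wt rr (pr u0 w0'), wt rr (pr w0 w0')),
      (pr u0 v0' - pr v0 u0', wt rr (pr u0 v0'), wt rr (pr w0 v0'))))"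

definition fop :: "(real \<times> real \<Rightarrow> real) \<Rightarrow> h1 \<times> h1 \<times> h1" where
  "fop k = ((- wt k (cl k), 0, 0), 0, 0)"

lemma bounded_linear_Aop: "bounded_linear (Aop \<nu>)"
  unfolding Aop_def case_prod_unfold
  by (intro bounded_linear_intros bounded_linear_compose[OF bounded_linear_wt[OF bmeas_rr]]
      bounded_linear_compose[OF bounded_linear_wt[OF bmeas_ir]] bounded_linear_Pair)

lemma bounded_linear_Lop: "bmeas k \<Longrightarrow> bounded_linear (Lop k)"
  unfolding Lop_def case_prod_unfold
  by (intro bounded_linear_intros bounded_linear_compose[OF bounded_linear_wt[OF bmeas_rr]]
      bounded_linear_compose[OF bounded_linear_wt] bounded_linear_Pair bounded_linear_minus)

text \<open>Symmetry moves the operator to the fixed argument, so that weak continuity of the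
  viscous form is immediate.\<close>

lemma Aop_symmetric: "inner (Aop \<nu> x) y = inner x (Aop \<nu> y)"
  by (simp add: Aop_def case_prod_unfold inner_prod_def inner_wt_commute[OF bmeas_rr] inner_wt_commute[OF bmeas_ir])

lemma Aop_coercive:
  assumes \<nu>: "\<nu> > 0" and x: "x \<in> S"
  shows "inner (Aop \<nu> x) x \<ge> \<nu> * (\<sigma> / (4 * R\<^sup>2 + 1)) * (norm x)\<^sup>2"
proof -
  obtain u w v where xe: "x = (u, w, v)" by (cases x)
  have V: "u \<in> V" "w \<in> V" "v \<in> V" using x W_V by (auto simp: S_def xe)
  have "\<sigma> / (4 * R\<^sup>2 + 1) * (norm x)\<^sup>2 = \<sigma> / (4 * R\<^sup>2 + 1) * (norm u)\<^sup>2 + \<sigma> / (4 * R\<^sup>2 + 1) * (norm w)\<^sup>2 + \<sigma> / (4 * R\<^sup>2 + 1) * (norm v)\<^sup>2"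
    by (simp add: xe power2_norm_eq_inner inner_prod_def distrib_left)
  also have "\<dots> \<le> inner (wt ir (fst u)) (fst u) + (inner (wt rr (fst (snd u))) (fst (snd u)) + inner (wt rr (snd (snd u))) (snd (snd u)))
    + (inner (wt rr (fst (snd w))) (fst (snd w)) + inner (wt rr (snd (snd w))) (snd (snd w)))
    + (inner (wt ir (fst v)) (fst v) + (inner (wt rr (fst (snd v))) (fst (snd v)) + inner (wt rr (snd (snd v))) (snd (snd v))))"
    using dirichlet_coercive[OF V(1)] dirichlet_coercive[OF V(2)] dirichlet_coercive[OF V(3)]
      inner_wt_ir_nonneg[of "fst u"] inner_wt_ir_nonneg[of "fst v"] by linarith
  finally have "\<nu> * (\<sigma> / (4 * R\<^sup>2 + 1) * (norm x)\<^sup>2) \<le> \<nu> * \<dots>" using \<nu> by (intro mult_left_mono) auto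
  also have "\<dots> = inner (Aop \<nu> x) x"
    by (simp add: Aop_def xe case_prod_unfold inner_prod_def algebra_simps)
  finally show ?thesis by (simp add: mult.assoc)
qed

lemma S_weakly_strong:
  assumes X: "\<And>n. (U n, Y n, Z n) \<in> S" and x: "(u, w, v) \<in> S" and wk: "weakly (\<lambda>n. (U n, Y n, Z n)) (u, w, v)"
  shows "(\<lambda>n. fst (U n)) \<longlonglongrightarrow> fst u" "(\<lambda>n. fst (Y n)) \<longlonglongrightarrow> fst w" "(\<lambda>n. fst (Z n)) \<longlonglongrightarrow> fst v"
proof -
  note wf = weakly_fst_snd[OF wk, simplified] 
  note ws = weakly_fst_snd[OF wf(2), simplified]
  show "(\<lambda>n. fst (U n)) \<longlonglongrightarrow> fst u" by (rule rellich[OF S_G0(1)[OF X] S_G0(1)[OF x] wf(1)])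
  show "(\<lambda>n. fst (Y n)) \<longlonglongrightarrow> fst w" by (rule rellich[OF S_G0(2)[OF X] S_G0(2)[OF x] ws(1)])
  show "(\<lambda>n. fst (Z n)) \<longlonglongrightarrow> fst v" by (rule rellich[OF S_G0(3)[OF X] S_G0(3)[OF x] ws(2)])
qed

text \<open>In \<open>Lop\<close> the argument enters through its values only, all derivatives being
  left to the test field. By Rellich's theorem it is therefore compact.\<close>

lemma Lop_strong:
  assumes k: "bmeas k" and X: "\<And>n. X n \<in> S" and x: "x \<in> S" and wk: "weakly X x"
  shows "(\<lambda>n. Lop k (X n)) \<longlonglongrightarrow> Lop k x"
proof -
  define U Y Z where "U n = fst (X n)" and "Y n = fst (snd (X n))" and "Z n = snd (snd (X n))" for n
  have Xe: "X = (\<lambda>n. (U n, Y n, Z n))" by (simp add: U_def Y_def Z_def)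
  obtain u w v where xe: "x = (u, w, v)" by (cases x)
  have s: "(\<lambda>n. fst (U n)) \<longlonglongrightarrow> fst u" "(\<lambda>n. fst (Y n)) \<longlonglongrightarrow> fst w" "(\<lambda>n. fst (Z n)) \<longlonglongrightarrow> fst v"
    by (rule S_weakly_strong[of U Y Z u w v]; use X x wk in \<open>simp add: Xe xe\<close>)+
  show ?thesis
    unfolding Xe xe Lop_def case_prod_unfold
    by (simp, intro tendsto_intros bounded_linear.tendsto[OF bounded_linear_wt[OF bmeas_rr]]
      bounded_linear.tendsto[OF bounded_linear_wt[OF k]] s)
qed

lemma norm_S_comps:
  "norm u \<le> norm (u, w, v)" "norm w \<le> norm (u, w, v)" "norm v \<le> norm (u, w, v)" for u w v :: h1
  using norm_fst_le[of u "(w, v)"] norm_snd_le[of "(w, v)" u] norm_fst_le[of w v] norm_snd_le[of v w]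
  by (auto intro: order_trans)

text \<open>\<open>Pop\<close> multiplies values by values of a fixed test field. These products
  converge strongly, and pairing them with the weakly convergent derivatives of \<open>X n\<close>
  gives the limit of the convective form.\<close>

lemma Pop_strong:
  assumes X: "\<And>n. X n \<in> S" and x: "x \<in> S" and y: "y \<in> S" and wk: "weakly X x"
  shows "(\<lambda>n. Pop (X n) y) \<longlonglongrightarrow> Pop x y"
proof -
  define U Y Z where "U n = fst (X n)" and "Y n = fst (snd (X n))" and "Z n = snd (snd (X n))" for n
  have Xe: "X = (\<lambda>n. (U n, Y n, Z n))" by (simp add: U_def Y_def Z_def)
  obtain u w v where xe: "x = (u, w, v)" by (cases x)
  obtain u' w' v' where ye: "y = (u', w', v')" by (cases y)
  have XS: "(U n, Y n, Z n) \<in> S" for n using X[of n] by (simp add: Xe)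
  have xS: "(u, w, v) \<in> S" and yS: "(u', w', v') \<in> S" using x y by (simp_all add: xe ye)
  have s: "(\<lambda>n. fst (U n)) \<longlonglongrightarrow> fst u" "(\<lambda>n. fst (Y n)) \<longlonglongrightarrow> fst w" "(\<lambda>n. fst (Z n)) \<longlonglongrightarrow> fst v"
    by (rule S_weakly_strong[of U Y Z u w v]; use X x wk in \<open>simp add: Xe xe\<close>)+
  obtain M where "\<And>n. norm (X n) \<le> M" using wk by (auto simp: weakly_def)
  then have M: "norm (U n) \<le> M" "norm (Y n) \<le> M" "norm (Z n) \<le> M" for n
    using norm_S_comps[where u="U n" and w="Y n" and v="Z n"] order_trans unfolding Xe by blast+
  have pu: "(\<lambda>n. pr (fst (U n)) (fst q)) \<longlonglongrightarrow> pr (fst u) (fst q)" if "q \<in> G0" for q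
    by (rule pr_tendsto[OF S_G0(1)[OF XS] S_G0(1)[OF xS] that s(1) M(1)])
  have pw: "(\<lambda>n. pr (fst (Y n)) (fst q)) \<longlonglongrightarrow> pr (fst w) (fst q)" if "q \<in> G0" for q
    by (rule pr_tendsto[OF S_G0(2)[OF XS] S_G0(2)[OF xS] that s(2) M(2)])
  have pv: "(\<lambda>n. pr (fst (Z n)) (fst q)) \<longlonglongrightarrow> pr (fst v) (fst q)" if "q \<in> G0" for q
    by (rule pr_tendsto[OF S_G0(3)[OF XS] S_G0(3)[OF xS] that s(3) M(3)])
  show ?thesis
    unfolding Xe xe ye Pop_def case_prod_unfold
    by (simp, intro tendsto_intros bounded_linear.tendsto[OF bounded_linear_wt[OF bmeas_rr]] pu pw pv S_G0[OF yS])
qed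

lemma Pop_add:
  assumes x: "x \<in> S" and y: "y \<in> S" and z: "z \<in> S"
  shows "Pop x (y + z) = Pop x y + Pop x z"
proof -
  obtain u w v where xe: "x = (u, w, v)" by (cases x)
  obtain u' w' v' where ye: "y = (u', w', v')" by (cases y)
  obtain u'' w'' v'' where ze: "z = (u'', w'', v'')" by (cases z)
  interpret r: bounded_linear "wt rr" by (rule wt_rr_linear)
  have p: "pr (fst a) (fst b + fst c) = pr (fst a) (fst b) + pr (fst a) (fst c)" if "a \<in> G0" "b \<in> G0" "c \<in> G0" for a b c
    using mult_ok_add(2)[OF ladyzhenskaya(1)[OF that(2,1)] ladyzhenskaya(1)[OF that(3,1)]] by (simp add: pr_commute)
  show ?thesis
    using S_G0[OF x[unfolded xe]] S_G0[OF y[unfolded ye]] S_G0[OF z[unfolded ze]]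
    by (simp add: xe ye ze Pop_def case_prod_unfold p r.add)
qed

lemma Pop_scale_right:
  assumes x: "x \<in> S" and y: "y \<in> S"
  shows "Pop x (c *\<^sub>R y) = c *\<^sub>R Pop x y"
proof -
  obtain u w v where xe: "x = (u, w, v)" by (cases x)
  obtain u' w' v' where ye: "y = (u', w', v')" by (cases y)
  interpret r: bounded_linear "wt rr" by (rule wt_rr_linear)
  have p: "pr (fst a) (c *\<^sub>R fst b) = c *\<^sub>R pr (fst a) (fst b)" if "a \<in> G0" "b \<in> G0" for a b
    using mult_ok_scale(2)[OF ladyzhenskaya(1)[OF that(2,1)]] by (simp add: pr_commute)
  show ?thesis
    using S_G0[OF x[unfolded xe]] S_G0[OF y[unfolded ye]]
    by (simp add: xe ye Pop_def case_prod_unfold p r.scaleR scaleR_diff_right)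
qed

lemma Pop_scale_left:
  assumes x: "x \<in> S" and y: "y \<in> S"
  shows "Pop (c *\<^sub>R x) y = c *\<^sub>R Pop x y"
proof -
  obtain u w v where xe: "x = (u, w, v)" by (cases x)
  obtain u' w' v' where ye: "y = (u', w', v')" by (cases y)
  interpret r: bounded_linear "wt rr" by (rule wt_rr_linear)
  have p: "pr (c *\<^sub>R fst a) (fst b) = c *\<^sub>R pr (fst a) (fst b)" if "a \<in> G0" "b \<in> G0" for a b
    using mult_ok_scale(2)[OF ladyzhenskaya(1)[OF that]] .
  show ?thesis
    using S_G0[OF x[unfolded xe]] S_G0[OF y[unfolded ye]]
    by (simp add: xe ye Pop_def case_prod_unfold p r.scaleR scaleR_diff_right)
qed

text \<open>Six of the eight products carry the weight r \<le> R, and two, the centrifugal term and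
  its azimuthal counterpart, carry none.\<close>

lemma Pop_bound:
  assumes x: "x \<in> S" and y: "y \<in> S"
  shows "norm (Pop x y) \<le> (6 * R + 2) * sqrt Klad * norm x * norm y"
proof -
  obtain u w v where xe: "x = (u, w, v)" by (cases x)
  obtain u' w' v' where ye: "y = (u', w', v')" by (cases y)
  define q where "q = sqrt Klad * norm x * norm y"
  have p: "norm (pr (fst a) (fst b)) \<le> q" if "a \<in> G0" "b \<in> G0" "norm a \<le> norm x" "norm b \<le> norm y" for a b
  proof -
    have "norm (pr (fst a) (fst b)) \<le> sqrt Klad * norm a * norm b" by (rule pr_bound[OF that(1,2)])
    also have "\<dots> \<le> q" unfolding q_def using that(3,4) Klad_pos by (intro mult_mono) auto
    finally show ?thesis .
  qed
  have pw: "norm (wt rr (pr (fst a) (fst b))) \<le> R * q" if "a \<in> G0" "b \<in> G0" "norm a \<le> norm x" "norm b \<le> norm y" for a b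
    using norm_wt_le[OF bmeas_rr rr_le, of "pr (fst a) (fst b)"] mult_left_mono[OF p[OF that], of R] \<sigma>0 \<sigma>R by linarith
  have G: "u \<in> G0" "w \<in> G0" "v \<in> G0" "u' \<in> G0" "w' \<in> G0" "v' \<in> G0"
    using S_G0[OF x[unfolded xe]] S_G0[OF y[unfolded ye]] by auto
  have N: "norm u \<le> norm x" "norm w \<le> norm x" "norm v \<le> norm x" "norm u' \<le> norm y" "norm w' \<le> norm y" "norm v' \<le> norm y"
    using norm_S_comps[where u=u and w=w and v=v] norm_S_comps[where u=u' and w=w' and v=v'] by (simp_all add: xe ye)
  have tri: "norm (a, b, c) \<le> norm a + norm b + norm c" for a b c :: l2
    using norm_Pair_le[of a "(b, c)"] norm_Pair_le[of b c] by linarith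
  have tri2: "norm (a, b, c) \<le> norm a + norm b + norm c" for a b c :: h1
    using norm_Pair_le[of a "(b, c)"] norm_Pair_le[of b c] by linarith
  have "norm (Pop x y) \<le> norm (0 :: l2, wt rr (pr (fst u) (fst u')), wt rr (pr (fst w) (fst u')))
    + norm (0 :: l2, wt rr (pr (fst u) (fst w')), wt rr (pr (fst w) (fst w')))
    + norm (pr (fst u) (fst v') - pr (fst v) (fst u'), wt rr (pr (fst u) (fst v')), wt rr (pr (fst w) (fst v')))"
    unfolding Pop_def xe ye case_prod_unfold by (rule order_trans[OF _ tri2]) simp
  also have "\<dots> \<le> (0 + R * q + R * q) + (0 + R * q + R * q) + ((q + q) + R * q + R * q)"
    by (intro add_mono order_trans[OF tri] order_trans[OF norm_triangle_ineq4] pw p G N) auto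
  also have "\<dots> = (6 * R + 2) * q" by (simp add: algebra_simps)
  finally show ?thesis by (simp add: q_def mult.assoc)
qed

text \<open>The transport identity applies to each of the three components, and the centrifugal term
  - v^2 u cancels against u v v from the azimuthal equation.\<close>

lemma Pop_diag:
  assumes x: "x \<in> S" shows "inner (Pop x x) x = 0"
proof -
  obtain u w v where xe: "x = (u, w, v)" by (cases x)
  have T: "u \<in> Tr \<sigma>" "u \<in> Tr R" "w \<in> Tz 0" "w \<in> Tz L"
    and div: "fst u + wt rr (fst (snd u)) + wt rr (snd (snd w)) = 0"
    using x by (auto simp: xe S_def V_def W_def)
  have G: "u \<in> G0" "w \<in> G0" "v \<in> G0" using S_G0[OF x[unfolded xe]] by auto
  have "inner (pr (fst u) (fst v)) (fst v) = inner (pr (fst v) (fst u)) (fst v)" by (simp add: pr_commute)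
  then show ?thesis
    using transport_antisymmetric[OF T div G(1)] transport_antisymmetric[OF T div G(2)] transport_antisymmetric[OF T div G(3)]
    by (simp add: xe Pop_def case_prod_unfold inner_prod_def inner_diff_left)
qed

text \<open>With \<open>g\<close> = r U . grad v + u v, the quadratic form of \<open>Lop k\<close>
  is minus the integral of \<open>k g\<close>. Testing with purely azimuthal fields, which are free
  of the divergence constraint, forces \<open>g\<close> = 0 almost everywhere by the fundamental
  lemma. The weight \<open>k\<close> then only has to be bounded.\<close>

lemma euler_degenerate:
  assumes k: "bmeas k" and k0: "\<And>x. x \<notin> B \<Longrightarrow> k x = 0" and x: "x \<in> S"
    and z: "\<And>y. y \<in> S \<Longrightarrow> inner (Pop x y) x = 0"
  shows "inner (Lop k x) x = 0"
proof -
  obtain u w v where xe: "x = (u, w, v)" by (cases x)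
  have G: "u \<in> G0" "w \<in> G0" "v \<in> G0" using S_G0[OF x[unfolded xe]] by auto
  define g where "g t = rr t * fn (fst u) t * fn (fst (snd v)) t + rr t * fn (fst w) t * fn (snd (snd v)) t
      + fn (fst u) t * fn (fst v) t" for t
  have gi: "integrable lebesgue g"
    unfolding g_def
    by (intro Bochner_Integration.integrable_add sqint_mult_integrable sqint_bmeas[OF bmeas_rr] sqint_fn)
  have int: "interior B = box (\<sigma>, 0) (R, L)" unfolding B_def by simp
  have "AE t in lebesgue. t \<in> interior B \<longrightarrow> g t = 0"
  proof (rule AE_zero_if_test_integrals_zero)
    show "locally_integrable_on (interior B) g"
      unfolding locally_integrable_on_def set_integrable_def
      using integrable_mult_indicator[OF _ gi] by (auto intro: lmeasurable_compact fmeasurableD)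
    fix \<phi> assume \<phi>: "\<phi> \<in> test_functions (interior B)"
    have s: "smooth \<phi>" by (rule test_in_T(1)[OF \<phi>])
    have JG: "Jh \<phi> \<in> G0" by (rule Jh_G0[OF s])
    \<comment> \<open>The velocity part of this test field is zero, so the divergence condition
      holds trivially and \<open>\<phi>\<close> is arbitrary.\<close>
    have "(0, 0, Jh \<phi>) \<in> S"
    proof -
      have "Jh \<phi> \<in> V" using test_in_T[OF \<phi>] by (simp add: V_def)
      then show ?thesis using bounded_linear.linear[OF wt_rr_linear]
        by (simp add: S_def subspace_0[OF subspace_V] subspace_0[OF subspace_W] linear_0)
    qed
    from z[OF this]
    have e0: "inner (wt rr (pr (fst u) (J \<phi>))) (fst (snd v)) + inner (wt rr (pr (fst w) (J \<phi>))) (snd (snd v))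
        + inner (pr (fst u) (J \<phi>)) (fst v) = 0"
    proof -
      have "pr a 0 = 0" for a
      proof -
        have "AE t in lebesgue. fn a t * fn 0 t = 0" using fn_zero by eventually_elim simp
        then have "cl (\<lambda>t. fn a t * fn 0 t) = cl (\<lambda>t. 0)"
          by (intro cl_cong_AE sqint_zero sqint_cong_AE[OF sqint_zero]) auto
        then show ?thesis by (simp add: pr_def cl_zero)
      qed
      then show ?thesis using z[OF \<open>(0, 0, Jh \<phi>) \<in> S\<close>] bounded_linear.linear[OF wt_rr_linear]
        by (simp add: xe Pop_def case_prod_unfold inner_prod_def Jh_def linear_0)
    qed
    have ok: "mult_ok (fst u) (J \<phi>)" "mult_ok (fst w) (J \<phi>)"
      using ladyzhenskaya(1)[OF G(1) JG] ladyzhenskaya(1)[OF G(2) JG] by (simp_all add: Jh_def)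
    have i: "integrable lebesgue (\<lambda>t. rr t * fn a t * fn b t)" for a b
      by (rule sqint_mult_integrable[OF sqint_bmeas[OF bmeas_rr sqint_fn] sqint_fn])
    have eq0: "(LINT t|lebesgue. rr t * fn (pr (fst u) (J \<phi>)) t * fn (fst (snd v)) t
        + rr t * fn (pr (fst w) (J \<phi>)) t * fn (snd (snd v)) t + fn (pr (fst u) (J \<phi>)) t * fn (fst v) t) = 0"
      using e0 unfolding inner_wt[OF bmeas_rr] inner_fn[of "pr (fst u) (J \<phi>)" "fst v"]
      using i sqint_fn_mult by simp
    have "(LINT t:interior B|lebesgue. g t * \<phi> t) = (LINT t|lebesgue. rr t * fn (pr (fst u) (J \<phi>)) t * fn (fst (snd v)) t
        + rr t * fn (pr (fst w) (J \<phi>)) t * fn (snd (snd v)) t + fn (pr (fst u) (J \<phi>)) t * fn (fst v) t)"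
      unfolding set_lebesgue_integral_def
    proof (rule integral_cong_AE)
      show "(\<lambda>t. indicator (interior B) t *\<^sub>R (g t * \<phi> t)) \<in> borel_measurable lebesgue"
        unfolding int
        by (intro borel_measurable_scaleR borel_measurable_indicator borel_measurable_times
            borel_measurable_integrable[OF gi] smooth_lebesgue_measurable[OF s]) auto
      show "(\<lambda>t. rr t * fn (pr (fst u) (J \<phi>)) t * fn (fst (snd v)) t
        + rr t * fn (pr (fst w) (J \<phi>)) t * fn (snd (snd v)) t + fn (pr (fst u) (J \<phi>)) t * fn (fst v) t) \<in> borel_measurable lebesgue"
        using i sqint_fn_mult by (intro borel_measurable_add borel_measurable_integrable)
      have \<phi>0: "\<phi> t = 0" if "t \<notin> interior B" for t
        using \<phi> that unfolding test_functions_def by blast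
      show "AE t in lebesgue. indicator (interior B) t *\<^sub>R (g t * \<phi> t) = rr t * fn (pr (fst u) (J \<phi>)) t * fn (fst (snd v)) t
        + rr t * fn (pr (fst w) (J \<phi>)) t * fn (snd (snd v)) t + fn (pr (fst u) (J \<phi>)) t * fn (fst v) t"
        using fn_pr[OF ok(1)] fn_pr[OF ok(2)] fn_J[OF smooth_continuous[OF s]]
      proof eventually_elim
        case (elim t)
        show ?case
        proof (cases "t \<in> interior B")
          case True
          then have "t \<in> B" using interior_subset by blast
          then show ?thesis using elim True by (simp add: g_def algebra_simps)
        next
          case False
          then show ?thesis using elim \<phi>0[OF False] by simp
        qed
      qed
    qed
    then show "(LINT t:interior B|lebesgue. g t * \<phi> t) = 0" using eq0 by simp
  qed simp
  moreover have "AE t in lebesgue. t \<notin> B - interior B"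
    unfolding int unfolding B_def by (rule AE_not_in[OF negligible_frontier_interval[unfolded negligible_iff_null_sets]])
  ultimately have kg: "AE t in lebesgue. k t * g t = 0"
    by eventually_elim (use k0 in auto)
  have ks: "integrable lebesgue (\<lambda>t. k t * fn a t * fn b t)" for a b
    by (rule sqint_mult_integrable[OF sqint_bmeas[OF k sqint_fn] sqint_fn])
  have krs: "inner (wt k (wt rr a)) b = (LINT t|lebesgue. k t * (rr t * fn a t) * fn b t)"
     "integrable lebesgue (\<lambda>t. k t * (rr t * fn a t) * fn b t)" for a b
    using inner_cl[of "\<lambda>t. k t * (rr t * fn a t)" "fn b"]
      sqint_mult_integrable[of "\<lambda>t. k t * (rr t * fn a t)" "fn b"]
      wt_cl[OF k sqint_bmeas[OF bmeas_rr sqint_fn[of a]]] sqint_bmeas[OF k sqint_bmeas[OF bmeas_rr sqint_fn[of a]]]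
    by (simp_all add: wt_def[of rr a])
  \<comment> \<open>The cross term of (v + vs)^2 contributes - 2 u v and the azimuthal equation + u
    v. What is left, - u v, is exactly the last summand of \<open>g\<close> with the common
    sign.\<close>
  have "inner (wt k (fst v)) (fst u) = inner (wt k (fst u)) (fst v)"
    unfolding inner_wt_commute[OF k, of "fst v" "fst u"] by (rule inner_commute)
  then have "inner (Lop k x) x = - (inner (wt k (fst u)) (fst v) + inner (wt k (wt rr (fst u))) (fst (snd v))
      + inner (wt k (wt rr (fst w))) (snd (snd v)))"
    by (simp add: xe Lop_def case_prod_unfold inner_prod_def)
  also have "\<dots> = - (LINT t|lebesgue. k t * g t)"
  proof -
    have "(LINT t|lebesgue. k t * g t) = (LINT t|lebesgue. k t * fn (fst u) t * fn (fst v) t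
       + k t * (rr t * fn (fst u) t) * fn (fst (snd v)) t + k t * (rr t * fn (fst w) t) * fn (snd (snd v)) t)"
      by (intro Bochner_Integration.integral_cong) (auto simp: g_def algebra_simps)
    then show ?thesis by (simp add: inner_wt[OF k, of "fst u" "fst v"] krs ks)
  qed
  also have "(LINT t|lebesgue. k t * g t) = 0" by (rule integral_eq_zero_AE[OF kg])
  finally show ?thesis by simp
qed

theorem hilbert_solution:
  assumes \<nu>: "\<nu> > 0" and k: "bmeas k" and k0: "\<And>x. x \<notin> B \<Longrightarrow> k x = 0"
  shows "\<exists>x\<in>S. \<forall>y\<in>S. inner (Aop \<nu> x) y + inner (Pop x y) x + inner (Lop k x) y + inner (fop k) y = 0"
proof (rule galerkin_leray[where A="\<lambda>x y. inner (Aop \<nu> x) y" and b="\<lambda>x y. inner (Pop x y) x" and l="\<lambda>x y. inner (Lop k x) y"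
      and f="\<lambda>y. inner (fop k) y" and \<alpha>="\<nu> * (\<sigma> / (4 * R\<^sup>2 + 1))" and Kb="(6 * R + 2) * sqrt Klad"])
  show "subspace S" "closed S" by (rule subspace_S closed_S)+
  show "bounded_bilinear (\<lambda>x y. inner (Aop \<nu> x) y)"
    using bounded_bilinear.comp[OF bounded_bilinear_inner bounded_linear_Aop bounded_linear_ident] .
  show "bounded_bilinear (\<lambda>x y. inner (Lop k x) y)"
    using bounded_bilinear.comp[OF bounded_bilinear_inner bounded_linear_Lop[OF k] bounded_linear_ident] .
  show "bounded_linear (\<lambda>y. inner (fop k) y)" by (rule bounded_linear_inner_right)
  have "4 * R\<^sup>2 + 1 > 0" by (rule add_nonneg_pos) auto
  then show "\<nu> * (\<sigma> / (4 * R\<^sup>2 + 1)) > 0" using \<nu> \<sigma>0 by simp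
  show "\<nu> * (\<sigma> / (4 * R\<^sup>2 + 1)) * (norm x)\<^sup>2 \<le> inner (Aop \<nu> x) x" if "x \<in> S" for x by (rule Aop_coercive[OF \<nu> that])
  show "inner (Pop x (y + z)) x = inner (Pop x y) x + inner (Pop x z) x" if "x \<in> S" "y \<in> S" "z \<in> S" for x y z
    by (simp add: Pop_add that inner_add_left)
  show "inner (Pop x (c *\<^sub>R y)) x = c * inner (Pop x y) x" if "x \<in> S" "y \<in> S" for x y c
    by (simp add: Pop_scale_right that)
  show "inner (Pop (c *\<^sub>R x) y) (c *\<^sub>R x) = c\<^sup>2 * inner (Pop x y) x" if "x \<in> S" "y \<in> S" for x y c
    by (simp add: Pop_scale_left that power2_eq_square)
  show "\<bar>inner (Pop x y) x\<bar> \<le> (6 * R + 2) * sqrt Klad * (norm x)\<^sup>2 * norm y" if "x \<in> S" "y \<in> S" for x y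
    using order_trans[OF Cauchy_Schwarz_ineq2[of "Pop x y" x] mult_right_mono[OF Pop_bound[OF that], of "norm x"]]
    by (simp add: power2_eq_square mult_ac)
  show "inner (Pop x x) x = 0" if "x \<in> S" for x by (rule Pop_diag[OF that])
  show "(\<lambda>n. inner (Aop \<nu> (X n)) y) \<longlonglongrightarrow> inner (Aop \<nu> x) y" if "weakly X x" for X x y
    using that unfolding weakly_def Aop_symmetric by blast
  show "(\<lambda>n. inner (Lop k (X n)) y) \<longlonglongrightarrow> inner (Lop k x) y" if "\<And>n. X n \<in> S" "x \<in> S" "weakly X x" for X x y
    by (intro tendsto_intros Lop_strong[OF k that])
  show "(\<lambda>n. inner (Lop k (X n)) (X n)) \<longlonglongrightarrow> inner (Lop k x) x" if "\<And>n. X n \<in> S" "x \<in> S" "weakly X x" for X x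
    by (rule weak_strong_tendsto_inner[OF that(3) Lop_strong[OF k that]])
  show "(\<lambda>n. inner (Pop (X n) y) (X n)) \<longlonglongrightarrow> inner (Pop x y) x"
    if "\<And>n. X n \<in> S" "x \<in> S" "y \<in> S" "weakly X x" for X x y
    by (rule weak_strong_tendsto_inner[OF that(4) Pop_strong[OF that]])
  show "inner (Lop k x) x = 0" if "x \<in> S" "\<And>y. y \<in> S \<Longrightarrow> inner (Pop x y) x = 0" for x
    by (rule euler_degenerate[OF k k0 that])
qed

end

section \<open>Weak derivatives\<close>

text \<open>Completeness of the measure makes the left function measurable as well. The integrands
  of the weak problem contain chosen weak derivatives and are known only up to null sets.\<close>

lemma integral_cong_AE_lebesgue:
  fixes f g :: "real \<times> real \<Rightarrow> real"
  assumes "g \<in> borel_measurable lebesgue" "AE x in lebesgue. f x = g x"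
  shows "f \<in> borel_measurable lebesgue" "(LINT x|lebesgue. f x) = (LINT x|lebesgue. g x)"
proof -
  have "AE x in lebesgue. g x = f x" using assms(2) by eventually_elim simp
  then show f: "f \<in> borel_measurable lebesgue" by (rule borel_measurable_AE[OF assms(1)])
  show "(LINT x|lebesgue. f x) = (LINT x|lebesgue. g x)" by (rule integral_cong_AE[OF f assms])
qed

lemma sqint_cong_AE_lebesgue:
  assumes "sqint g" "AE x in lebesgue. f x = g x" shows "sqint f"
  using integral_cong_AE_lebesgue(1)[OF _ assms(2)] assms by (intro sqint_cong_AE[OF assms(1)]) (auto simp: sqint_def)

lemma integrable_bmeas_mult:
  assumes k: "bmeas k" and g: "integrable lebesgue g"
  shows "integrable lebesgue (\<lambda>x. k x * g x)"
proof -
  obtain C where C: "\<And>x. \<bar>k x\<bar> \<le> C" using k by (auto simp: bmeas_def)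
  show ?thesis
  proof (rule Bochner_Integration.integrable_bound)
    show "integrable lebesgue (\<lambda>x. C * \<bar>g x\<bar>)" using g by (intro integrable_mult_right integrable_abs)
    show "(\<lambda>x. k x * g x) \<in> borel_measurable lebesgue" using k g by (auto simp: bmeas_def)
    show "AE x in lebesgue. norm (k x * g x) \<le> norm (C * \<bar>g x\<bar>)"
      using C by (intro AE_I2) (auto simp: abs_mult intro!: mult_right_mono order_trans[OF C abs_ge_self])
  qed
qed

lemma sqint_indicator: "K \<in> lmeasurable \<Longrightarrow> sqint (indicator K)"
proof -
  assume K: "K \<in> lmeasurable"
  have "(\<lambda>x. (indicator K x)\<^sup>2 :: real) = indicator K" by (auto simp: indicator_def)
  then show ?thesis using K by (auto simp: sqint_def fmeasurable_def intro!: borel_measurable_indicator)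
qed

lemma inner_pr_integrable:
  assumes "mult_ok a b"
  shows "integrable lebesgue (\<lambda>t. fn a t * fn b t * fn c t)" "inner (pr a b) c = (LINT t|lebesgue. fn a t * fn b t * fn c t)"
  using sqint_mult_integrable[OF assms[unfolded mult_ok_def] sqint_fn[of c]] inner_pr[OF assms] by auto

lemma inner_wt_pr_integrable:
  assumes k: "bmeas k" and ok: "mult_ok a b"
  shows "integrable lebesgue (\<lambda>t. k t * (fn a t * fn b t) * fn c t)"
    "inner (wt k (pr a b)) c = (LINT t|lebesgue. k t * (fn a t * fn b t) * fn c t)"
proof -
  have s: "sqint (\<lambda>t. k t * (fn a t * fn b t))" by (rule sqint_bmeas[OF k ok[unfolded mult_ok_def]])
  show "integrable lebesgue (\<lambda>t. k t * (fn a t * fn b t) * fn c t)" by (rule sqint_mult_integrable[OF s sqint_fn])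
  have "wt k (pr a b) = cl (\<lambda>t. k t * (fn a t * fn b t))"
    unfolding pr_def by (rule wt_cl[OF k ok[unfolded mult_ok_def]])
  then show "inner (wt k (pr a b)) c = (LINT t|lebesgue. k t * (fn a t * fn b t) * fn c t)"
    using inner_cl[OF s sqint_fn[of c]] by simp
qed

lemma inner_wt_integrable:
  assumes k: "bmeas k"
  shows "integrable lebesgue (\<lambda>t. k t * fn a t * fn c t)" "inner (wt k a) c = (LINT t|lebesgue. k t * fn a t * fn c t)"
  using sqint_mult_integrable[OF sqint_bmeas[OF k sqint_fn[of a]] sqint_fn[of c]] inner_wt[OF k] by auto

lemma inner_wt_wt_integrable:
  assumes k: "bmeas k" "bmeas k'"
  shows "integrable lebesgue (\<lambda>t. k t * (k' t * fn a t) * fn c t)" "inner (wt k (wt k' a)) c = (LINT t|lebesgue. k t * (k' t * fn a t) * fn c t)"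
proof -
  have s: "sqint (\<lambda>t. k t * (k' t * fn a t))" by (intro sqint_bmeas k sqint_fn)
  show "integrable lebesgue (\<lambda>t. k t * (k' t * fn a t) * fn c t)" by (rule sqint_mult_integrable[OF s sqint_fn])
  have "wt k (wt k' a) = cl (\<lambda>t. k t * (k' t * fn a t))"
    unfolding wt_def[of k'] by (rule wt_cl[OF k(1) sqint_bmeas[OF k(2) sqint_fn]])
  then show "inner (wt k (wt k' a)) c = (LINT t|lebesgue. k t * (k' t * fn a t) * fn c t)"
    using inner_cl[OF s sqint_fn[of c]] by simp
qed

lemma pr_zero: "pr a 0 = 0"
proof -
  have "AE t in lebesgue. fn a t * fn 0 t = 0" using fn_zero by eventually_elim simp
  then show ?thesis unfolding pr_def cl_zero[symmetric]
    by (intro cl_cong_AE sqint_zero sqint_cong_AE_lebesgue[OF sqint_zero])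
qed

lemma test_function_bounded:
  assumes "\<phi> \<in> test_functions S"
  shows "\<exists>K M. compact K \<and> K \<subseteq> S \<and> (\<forall>x. \<bar>\<phi> x\<bar> \<le> M * indicator K x)"
proof -
  obtain K where K: "smooth \<phi>" "compact K" "K \<subseteq> S" "\<And>x. x \<notin> K \<Longrightarrow> \<phi> x = 0"
    using assms unfolding test_functions_def by blast
  have "compact (\<phi> ` K)" by (intro compact_continuous_image smooth_continuous K)
  then obtain M where M: "\<forall>y\<in>\<phi> ` K. norm y \<le> M" using compact_imp_bounded bounded_iff by blast
  have "\<bar>\<phi> x\<bar> \<le> M * indicator K x" for x using M K(4)[of x] by (cases "x \<in> K") auto
  then show ?thesis using K by blast
qed

lemma integrable_test_mult:
  assumes g: "locally_integrable_on S g" and \<phi>: "\<phi> \<in> test_functions S"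
  shows "set_integrable lebesgue S (\<lambda>x. g x * \<phi> x)"
proof -
  obtain K M where K: "compact K" "K \<subseteq> S" "\<And>x. \<bar>\<phi> x\<bar> \<le> M * indicator K x"
    using test_function_bounded[OF \<phi>] by blast
  have s: "smooth \<phi>" using \<phi> by (simp add: test_functions_def)
  have gi: "integrable lebesgue (\<lambda>x. indicator K x * g x)"
    using g K by (auto simp: locally_integrable_on_def set_integrable_def)
  have z: "\<phi> x = 0" if "x \<notin> K" for x using K(3)[of x] that by simp
  have "integrable lebesgue (\<lambda>x. indicator K x * g x * \<phi> x)"
  proof (rule Bochner_Integration.integrable_bound)
    show "integrable lebesgue (\<lambda>x. M * \<bar>indicator K x * g x\<bar>)" using gi by (intro integrable_mult_right integrable_abs)
    show "(\<lambda>x. indicator K x * g x * \<phi> x) \<in> borel_measurable lebesgue"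
      by (rule borel_measurable_times[OF borel_measurable_integrable[OF gi] smooth_lebesgue_measurable[OF s]])
    have "\<bar>indicator K x * g x * \<phi> x\<bar> \<le> \<bar>M * \<bar>indicator K x * g x\<bar>\<bar>" for x
    proof (cases "x \<in> K")
      case True
      then have "\<bar>g x\<bar> * \<bar>\<phi> x\<bar> \<le> \<bar>g x\<bar> * \<bar>M\<bar>" using K(3)[of x] by (intro mult_left_mono) auto
      then show ?thesis using True by (simp add: abs_mult mult.commute)
    qed simp
    then show "AE x in lebesgue. norm (indicator K x * g x * \<phi> x) \<le> norm (M * \<bar>indicator K x * g x\<bar>)" by simp
  qed
  also have "(\<lambda>x. indicator K x * g x * \<phi> x) = (\<lambda>x. indicator S x *\<^sub>R (g x * \<phi> x))"
  proof (rule ext)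
    fix x show "indicator K x * g x * \<phi> x = indicator S x *\<^sub>R (g x * \<phi> x)"
      using K(2) z[of x] by (cases "x \<in> K") auto
  qed
  finally show ?thesis by (simp add: set_integrable_def)
qed

text \<open>The difference of two weak derivatives has zero integral against every test function. It
  is locally integrable, so the fundamental lemma applies.\<close>

lemma weak_deriv_unique:
  assumes g: "has_weak_deriv D e f g" and h: "has_weak_deriv D e f h"
  shows "AE x in lebesgue. x \<in> interior D \<longrightarrow> g x = h x"
proof -
  have lg: "locally_integrable_on (interior D) g" and lh: "locally_integrable_on (interior D) h"
    using g h by (auto simp: has_weak_deriv_def)
  have "AE x in lebesgue. x \<in> interior D \<longrightarrow> g x - h x = 0"
  proof (rule AE_zero_if_test_integrals_zero)
    show "locally_integrable_on (interior D) (\<lambda>x. g x - h x)"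
      using lg lh by (auto simp: locally_integrable_on_def intro: set_integral_diff)
    fix \<phi> assume \<phi>: "\<phi> \<in> test_functions (interior D)"
    have "(LINT x:interior D|lebesgue. (g x - h x) * \<phi> x) = (LINT x:interior D|lebesgue. g x * \<phi> x - h x * \<phi> x)"
      by (simp add: left_diff_distrib)
    also have "\<dots> = (LINT x:interior D|lebesgue. g x * \<phi> x) - (LINT x:interior D|lebesgue. h x * \<phi> x)"
      by (intro set_integral_diff integrable_test_mult lg lh \<phi>)
    also have "\<dots> = 0"
    proof -
      have "(LINT x:interior D|lebesgue. f x * pd e \<phi> x) = - (LINT x:interior D|lebesgue. g x * \<phi> x)"
        "(LINT x:interior D|lebesgue. f x * pd e \<phi> x) = - (LINT x:interior D|lebesgue. h x * \<phi> x)"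
        using g h \<phi> unfolding has_weak_deriv_def by blast+
      then show ?thesis by simp
    qed
    finally show "(LINT x:interior D|lebesgue. (g x - h x) * \<phi> x) = 0" .
  qed simp
  then show ?thesis by eventually_elim simp
qed

lemma wd_eq_AE:
  assumes "has_weak_deriv D e f g"
  shows "AE x in lebesgue. x \<in> interior D \<longrightarrow> wd D e f x = g x"
  unfolding wd_def by (rule weak_deriv_unique[OF someI[of "has_weak_deriv D e f", OF assms] assms])

lemma has_weak_deriv_wd: "has_weak_deriv D e f g \<Longrightarrow> has_weak_deriv D e f (wd D e f)"
  unfolding wd_def by (rule someI[of "has_weak_deriv D e f"])

lemma locally_integrable_fst_mult:
  assumes "locally_integrable_on S f" shows "locally_integrable_on S (\<lambda>x. fst x * f x)"
  unfolding locally_integrable_on_def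
proof (intro allI impI, elim conjE)
  fix K :: "(real \<times> real) set" assume K: "compact K" "K \<subseteq> S"
  have i: "integrable lebesgue (\<lambda>x. indicator K x * f x)"
    using assms K by (auto simp: locally_integrable_on_def set_integrable_def)
  have "compact (fst ` K)" by (intro compact_continuous_image continuous_intros K)
  then obtain M where M: "\<forall>y\<in>fst ` K. norm y \<le> M" using compact_imp_bounded bounded_iff by blast
  have "integrable lebesgue (\<lambda>x. fst x * (indicator K x * f x))"
  proof (rule Bochner_Integration.integrable_bound)
    show "integrable lebesgue (\<lambda>x. M * \<bar>indicator K x * f x\<bar>)" using i by (intro integrable_mult_right integrable_abs)
    show "(\<lambda>x. fst x * (indicator K x * f x)) \<in> borel_measurable lebesgue"
      by (rule borel_measurable_times[OF smooth_lebesgue_measurable[OF smooth_fst] borel_measurable_integrable[OF i]])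
    have "\<bar>fst x * (indicator K x * f x)\<bar> \<le> \<bar>M * \<bar>indicator K x * f x\<bar>\<bar>" for x
    proof (cases "x \<in> K")
      case True
      then have "\<bar>fst x\<bar> \<le> M" using M by auto
      then have "\<bar>fst x\<bar> * \<bar>f x\<bar> \<le> \<bar>M\<bar> * \<bar>f x\<bar>" by (intro mult_right_mono) auto
      then show ?thesis using True by (simp add: abs_mult)
    qed simp
    then show "AE x in lebesgue. norm (fst x * (indicator K x * f x)) \<le> norm (M * \<bar>indicator K x * f x\<bar>)" by simp
  qed
  then show "set_integrable lebesgue K (\<lambda>x. fst x * f x)" by (simp add: set_integrable_def mult.left_commute)
qed

lemma test_function_fst_mult: "\<phi> \<in> test_functions S \<Longrightarrow> (\<lambda>x. fst x * \<phi> x) \<in> test_functions S"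
  unfolding test_functions_def by (auto intro!: smooth_mult smooth_fst)

lemma test_function_pd:
  assumes "\<phi> \<in> test_functions S" "open S"
  shows "pd e \<phi> \<in> test_functions S"
proof -
  obtain K where K: "smooth \<phi>" "compact K" "K \<subseteq> S" "\<And>x. x \<notin> K \<Longrightarrow> \<phi> x = 0"
    using assms unfolding test_functions_def by blast
  have "pd e \<phi> x = 0" if "x \<notin> K" for x
  proof -
    have o: "open (- K)" using K(2) by (intro open_Compl compact_imp_closed)
    have "x \<in> - K" using that by simp
    from has_derivative_transform_within_open[OF has_derivative_const o this, of 0 \<phi>]
    have "(\<phi> has_derivative (\<lambda>_. 0)) (at x)" using K(4) by auto
    then show ?thesis by (rule pd_eqI)
  qed
  then show ?thesis using smooth_pd[OF K(1)] K unfolding test_functions_def by blast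
qed

text \<open>The factor r is moved into the test function, which stays admissible. The constant
  \<open>c\<close> is the derivative of r in the direction \<open>e\<close>: 1 for the radial and 0
  for the axial derivative.\<close>

lemma has_weak_deriv_fst_mult:
  assumes f: "has_weak_deriv D e f g" and c: "c = fst e"
  shows "has_weak_deriv D e (\<lambda>y. fst y * f y) (\<lambda>y. c * f y + fst y * g y)"
proof -
  have lf: "locally_integrable_on (interior D) f" and lg: "locally_integrable_on (interior D) g"
    using f by (auto simp: has_weak_deriv_def)
  have lcf: "locally_integrable_on (interior D) (\<lambda>y. c * f y)"
    using lf unfolding locally_integrable_on_def by simp
  show ?thesis
    unfolding has_weak_deriv_def
  proof (intro conjI ballI)
    show "locally_integrable_on (interior D) (\<lambda>y. fst y * f y)" by (rule locally_integrable_fst_mult[OF lf])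
    show "locally_integrable_on (interior D) (\<lambda>y. c * f y + fst y * g y)"
      using locally_integrable_fst_mult[OF lg] lcf unfolding locally_integrable_on_def
      by (auto intro: set_integral_add)
    fix \<phi> assume \<phi>: "\<phi> \<in> test_functions (interior D)"
    have s: "smooth \<phi>" using \<phi> by (simp add: test_functions_def)
    have rs: "(\<lambda>x. fst x * \<phi> x) \<in> test_functions (interior D)" by (rule test_function_fst_mult[OF \<phi>])
    have pdr: "pd e (\<lambda>x. fst x * \<phi> x) x = fst x * pd e \<phi> x + c * \<phi> x" for x
      by (simp add: pd_smooth_mult smooth_fst s pd_fst c)
    have wf: "(LINT x:interior D|lebesgue. f x * pd e (\<lambda>x. fst x * \<phi> x) x) = - (LINT x:interior D|lebesgue. g x * (fst x * \<phi> x))"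
      using f rs unfolding has_weak_deriv_def by blast
    have "(LINT x:interior D|lebesgue. fst x * f x * pd e \<phi> x) = (LINT x:interior D|lebesgue. f x * pd e (\<lambda>x. fst x * \<phi> x) x - c * f x * \<phi> x)"
      by (simp add: pdr algebra_simps)
    also have "\<dots> = (LINT x:interior D|lebesgue. f x * pd e (\<lambda>x. fst x * \<phi> x) x) - (LINT x:interior D|lebesgue. c * f x * \<phi> x)"
      by (intro set_integral_diff integrable_test_mult lf lcf \<phi> test_function_pd rs open_interior)
    also have "\<dots> = - ((LINT x:interior D|lebesgue. c * f x * \<phi> x) + (LINT x:interior D|lebesgue. fst x * g x * \<phi> x))"
      unfolding wf by (simp add: mult_ac)
    also have "(LINT x:interior D|lebesgue. c * f x * \<phi> x) + (LINT x:interior D|lebesgue. fst x * g x * \<phi> x)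
        = (LINT x:interior D|lebesgue. c * f x * \<phi> x + fst x * g x * \<phi> x)"
      by (intro set_integral_add(2)[symmetric] integrable_test_mult lcf locally_integrable_fst_mult lg \<phi>)
    also have "\<dots> = (LINT x:interior D|lebesgue. (c * f x + fst x * g x) * \<phi> x)"
      by (simp add: distrib_right)
    finally show "(LINT x:interior D|lebesgue. fst x * f x * pd e \<phi> x) = - (LINT x:interior D|lebesgue. (c * f x + fst x * g x) * \<phi> x)" .
  qed
qed

section \<open>Correspondence of function spaces\<close>

context annulus begin

abbreviation D :: "(real \<times> real) set" where "D \<equiv> Omega \<sigma> R L"

lemma interior_D: "interior D = interior B" "interior B = box (\<sigma>, 0) (R, L)"
  unfolding Omega_def B_def interior_Times
  using \<sigma>R L0 by (auto simp: mem_box Basis_prod_def)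

lemma D_subset_B: "D \<subseteq> B" "interior B \<subseteq> D"
proof -
  show "D \<subseteq> B" by (auto simp: Omega_def mem_B)
  show "interior B \<subseteq> D" unfolding interior_D(1)[symmetric] by (rule interior_subset)
qed

lemma AE_B_interior: "AE t in lebesgue. t \<in> B \<longrightarrow> t \<in> interior B"
proof -
  have "AE t in lebesgue. t \<notin> B - interior B"
    unfolding interior_D(2) unfolding B_def by (rule AE_not_in[OF negligible_frontier_interval[unfolded negligible_iff_null_sets]])
  then show ?thesis by eventually_elim auto
qed

lemma AE_indicator_D: "AE t in lebesgue. indicator D t = (indicator B t :: real) \<and> indicator (interior B) t = (indicator B t :: real)"
  using AE_B_interior by eventually_elim (use D_subset_B in \<open>auto simp: indicator_def\<close>)

definition clD :: "(real \<times> real \<Rightarrow> real) \<Rightarrow> l2" where "clD f = cl (\<lambda>x. indicator D x * f x)"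

definition cls :: "(real \<times> real \<Rightarrow> real) \<Rightarrow> h1" where "cls f = (clD f, clD (wdr D f), clD (wdz D f))"

text \<open>The weight r is bounded above and away from 0 on the rectangle: one direction multiplies
  by \<open>rr\<close>, the other by \<open>ir\<close>.\<close>

lemma axi_L2_iff: "f \<in> axi_L2 D \<longleftrightarrow> sqint (\<lambda>x. indicator D x * f x)"
proof -
  have m: "set_borel_measurable lebesgue D f \<longleftrightarrow> (\<lambda>x. indicator D x * f x) \<in> borel_measurable lebesgue"
    by (simp add: set_borel_measurable_def)
  have e: "(\<lambda>x. indicator D x *\<^sub>R ((f x)\<^sup>2 * fst x)) = (\<lambda>x. rr x * (indicator D x * f x)\<^sup>2)"
  proof (rule ext)
    fix x
    show "indicator D x *\<^sub>R ((f x)\<^sup>2 * fst x) = rr x * (indicator D x * f x)\<^sup>2"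
      using D_subset_B(1) by (cases "x \<in> D") (auto simp: rr_def)
  qed
  have e2: "(indicator D x * f x)\<^sup>2 = ir x * (rr x * (indicator D x * f x)\<^sup>2)" for x
  proof (cases "x \<in> D")
    case True
    then have "x \<in> B" using D_subset_B(1) by blast
    then show ?thesis using True \<sigma>0 by (simp add: rr_def ir_def mem_B)
  qed simp
  have "integrable lebesgue (\<lambda>x. rr x * (indicator D x * f x)\<^sup>2) \<longleftrightarrow> integrable lebesgue (\<lambda>x. (indicator D x * f x)\<^sup>2)"
    if "(\<lambda>x. indicator D x * f x) \<in> borel_measurable lebesgue"
  proof
    assume "integrable lebesgue (\<lambda>x. (indicator D x * f x)\<^sup>2)"
    then show "integrable lebesgue (\<lambda>x. rr x * (indicator D x * f x)\<^sup>2)" by (rule integrable_bmeas_mult[OF bmeas_rr])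
  next
    assume "integrable lebesgue (\<lambda>x. rr x * (indicator D x * f x)\<^sup>2)"
    then show "integrable lebesgue (\<lambda>x. (indicator D x * f x)\<^sup>2)"
      by (subst e2) (rule integrable_bmeas_mult[OF bmeas_ir])
  qed
  then show ?thesis unfolding axi_L2_def mem_Collect_eq axi_integrable_def set_integrable_def sqint_def
    unfolding e m by blast
qed

lemma axi_H1_iff:
  "f \<in> axi_H1 D \<longleftrightarrow> weakly_differentiable D f \<and> sqint (\<lambda>x. indicator D x * f x)
     \<and> sqint (\<lambda>x. indicator D x * wdr D f x) \<and> sqint (\<lambda>x. indicator D x * wdz D f x)"
  by (auto simp: axi_H1_def axi_L2_iff)

lemma inner_fn_J:
  assumes "continuous_on B g"
  shows "integrable lebesgue (\<lambda>t. fn y t * (indicator B t * g t))" "inner y (J g) = (LINT t|lebesgue. fn y t * (indicator B t * g t))"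
  using sqint_mult_integrable[OF sqint_fn sqint_B[OF assms], of y] inner_cl[OF sqint_fn sqint_B[OF assms], of y]
  by (simp_all add: J_def)

lemma sqint_locally_integrable: "sqint f \<Longrightarrow> locally_integrable_on Y f"
  unfolding locally_integrable_on_def set_integrable_def
  using sqint_mult_integrable[OF sqint_indicator[OF lmeasurable_compact]] by auto

lemma fn_weak_deriv:
  assumes x: "x \<in> G0"
  shows "has_weak_deriv D (1, 0) (fn (fst x)) (fn (fst (snd x)))" "has_weak_deriv D (0, 1) (fn (fst x)) (fn (snd (snd x)))"
proof -
  have conv: "(LINT t:interior D|lebesgue. fn y t * g t) = inner y (J g)" if "smooth g" for y g
  proof -
    note c = smooth_continuous[OF that, of B]
    have "(LINT t:interior D|lebesgue. fn y t * g t) = (LINT t|lebesgue. indicator (interior B) t *\<^sub>R (fn y t * g t))"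
      by (simp add: set_lebesgue_integral_def interior_D(1))
    also have "\<dots> = (LINT t|lebesgue. fn y t * (indicator B t * g t))"
    proof (rule integral_cong_AE_lebesgue(2)[OF borel_measurable_integrable[OF inner_fn_J(1)[OF c]]])
      show "AE t in lebesgue. indicator (interior B) t *\<^sub>R (fn y t * g t) = fn y t * (indicator B t * g t)"
        using AE_indicator_D by eventually_elim simp
    qed
    finally show ?thesis by (simp add: inner_fn_J(2)[OF c])
  qed
  have *: "has_weak_deriv D e (fn (fst x)) (fn y)"
    if "\<And>\<phi>. \<phi> \<in> test_functions (interior B) \<Longrightarrow> inner (fst x) (J (pd e \<phi>)) = - inner y (J \<phi>)" for e y
    unfolding has_weak_deriv_def
  proof (intro conjI ballI sqint_locally_integrable sqint_fn)
    fix \<phi> assume \<phi>: "\<phi> \<in> test_functions (interior D)"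
    then have s: "smooth \<phi>" by (simp add: test_functions_def)
    show "(LINT t:interior D|lebesgue. fn (fst x) t * pd e \<phi> t) = - (LINT t:interior D|lebesgue. fn y t * \<phi> t)"
      unfolding conv[OF s] conv[OF smooth_pd[OF s]] using that[of \<phi>] \<phi> by (simp add: interior_D(1))
  qed
  show "has_weak_deriv D (1, 0) (fn (fst x)) (fn (fst (snd x)))" by (rule *) (rule ibp_test(1)[OF x])
  show "has_weak_deriv D (0, 1) (fn (fst x)) (fn (snd (snd x)))" by (rule *) (rule ibp_test(2)[OF x])
qed

text \<open>Weak derivatives are determined on the interior only, while integrals run over
  \<open>D\<close>; the difference lies on the boundary of the rectangle and is null.\<close>

lemma AE_D_interior:
  assumes "AE t in lebesgue. t \<in> interior D \<longrightarrow> P t"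
  shows "AE t in lebesgue. t \<in> D \<longrightarrow> P t"
  using assms AE_B_interior by eventually_elim (use D_subset_B interior_D(1) in auto)

text \<open>A representative of the first component has the other two components as weak
  derivatives, by \<open>fn_weak_deriv\<close> and uniqueness. Hence solutions in \<open>h1\<close>
  turn into functions without loss, and \<open>cls\<close> recovers them.\<close>

lemma cls_fn:
  assumes x: "x \<in> G0"
  shows "fn (fst x) \<in> axi_H1 D" "cls (fn (fst x)) = x"
proof -
  have e1: "AE t in lebesgue. indicator D t * wdr D (fn (fst x)) t = fn (fst (snd x)) t"
    using AE_D_interior[OF wd_eq_AE[OF fn_weak_deriv(1)[OF x]]] G0_support(2)[OF x] AE_indicator_D
    by eventually_elim (auto simp: indicator_def split: if_splits)
  have e2: "AE t in lebesgue. indicator D t * wdz D (fn (fst x)) t = fn (snd (snd x)) t"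
    using AE_D_interior[OF wd_eq_AE[OF fn_weak_deriv(2)[OF x]]] G0_support(3)[OF x] AE_indicator_D
    by eventually_elim (auto simp: indicator_def split: if_splits)
  have e0: "AE t in lebesgue. indicator D t * fn (fst x) t = fn (fst x) t"
    using G0_support(1)[OF x] AE_indicator_D by eventually_elim (auto simp: indicator_def split: if_splits)
  note s = sqint_cong_AE_lebesgue[OF sqint_fn e0] sqint_cong_AE_lebesgue[OF sqint_fn e1] sqint_cong_AE_lebesgue[OF sqint_fn e2]
  show "fn (fst x) \<in> axi_H1 D"
    unfolding axi_H1_iff weakly_differentiable_def using s fn_weak_deriv[OF x] by blast
  have "clD (fn (fst x)) = cl (fn (fst x))" "clD (wdr D (fn (fst x))) = cl (fn (fst (snd x)))" "clD (wdz D (fn (fst x))) = cl (fn (snd (snd x)))"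
    unfolding clD_def by (intro cl_cong_AE s sqint_fn e0 e1 e2)+
  then show "cls (fn (fst x)) = x" by (simp add: cls_def)
qed

lemma fn_cls:
  assumes f: "f \<in> axi_H1 D"
  shows "AE t in lebesgue. fn (fst (cls f)) t = indicator D t * f t"
    "AE t in lebesgue. fn (fst (snd (cls f))) t = indicator D t * wdr D f t"
    "AE t in lebesgue. fn (snd (snd (cls f))) t = indicator D t * wdz D f t"
  using f unfolding axi_H1_iff cls_def clD_def by (auto intro: fn_cl)

text \<open>\<open>E\<close> is the quantity whose convergence to 0 is demanded in
  \<open>has_trace\<close>. It equals the squared distance in \<open>h1\<close> weighted by r, and r
  lies between \<sigma> and R on the rectangle.\<close>

lemma h1_distance:
  assumes f: "f \<in> axi_H1 D" and \<phi>: "smooth \<phi>"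
  defines "E \<equiv> axi_integral D (\<lambda>x. (\<phi> x - f x)\<^sup>2 + (pdr \<phi> x - wdr D f x)\<^sup>2 + (pdz \<phi> x - wdz D f x)\<^sup>2)"
  shows "\<sigma> * (norm (Jh \<phi> - cls f))\<^sup>2 \<le> E" "E \<le> R * (norm (Jh \<phi> - cls f))\<^sup>2"
proof -
  define x where "x = Jh \<phi> - cls f"
  define Q where "Q t = (fn (fst x) t)\<^sup>2 + (fn (fst (snd x)) t)\<^sup>2 + (fn (snd (snd x)) t)\<^sup>2" for t
  have Qi: "integrable lebesgue Q"
    unfolding Q_def using sqint_fn by (auto simp: sqint_def)
  have n: "(norm x)\<^sup>2 = (LINT t|lebesgue. Q t)"
    unfolding Q_def norm_h1_sq norm_fn using sqint_fn by (simp add: sqint_def)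
  have c: "continuous_on B \<phi>" "continuous_on B (pd e \<phi>)" for e by (intro smooth_continuous smooth_pd \<phi>)+
  have sup: "AE t in lebesgue. t \<notin> B \<longrightarrow> Q t = 0"
    using fn_cls[OF f] fn_J[OF c(1)] fn_J[OF c(2)[of "(1,0)"]] fn_J[OF c(2)[of "(0,1)"]]
      fn_diff[of "J \<phi>" "fst (cls f)"] fn_diff[of "J (pdr \<phi>)" "fst (snd (cls f))"] fn_diff[of "J (pdz \<phi>)" "snd (snd (cls f))"]
  proof eventually_elim
    case (elim t)
    show ?case
    proof
      assume "t \<notin> B"
      then have "t \<notin> D" using D_subset_B(1) by blast
      then show "Q t = 0" using elim \<open>t \<notin> B\<close> by (simp add: Q_def x_def Jh_def)
    qed
  qed
  have Ee: "AE t in lebesgue. indicator D t *\<^sub>R (((\<phi> t - f t)\<^sup>2 + (pdr \<phi> t - wdr D f t)\<^sup>2 + (pdz \<phi> t - wdz D f t)\<^sup>2) * fst t) = rr t * Q t"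
    using fn_cls[OF f] fn_J[OF c(1)] fn_J[OF c(2)[of "(1,0)"]] fn_J[OF c(2)[of "(0,1)"]]
      fn_diff[of "J \<phi>" "fst (cls f)"] fn_diff[of "J (pdr \<phi>)" "fst (snd (cls f))"] fn_diff[of "J (pdz \<phi>)" "snd (snd (cls f))"]
      AE_indicator_D
  proof eventually_elim
    case (elim t)
    show ?case
    proof (cases "t \<in> D")
      case True
      then have "t \<in> B" using D_subset_B(1) by blast
      then show ?thesis using elim(1-9) True by (simp add: Q_def x_def Jh_def rr_def)
    next
      case False
      then have "t \<notin> B" using elim(10) by (auto simp: indicator_def split: if_splits)
      then show ?thesis using False by (simp add: rr_def)
    qed
  qed
  have rQ: "integrable lebesgue (\<lambda>t. rr t * Q t)" by (rule integrable_bmeas_mult[OF bmeas_rr Qi])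
  have E: "E = (LINT t|lebesgue. rr t * Q t)"
    unfolding E_def axi_integral_def set_lebesgue_integral_def
    by (rule integral_cong_AE_lebesgue(2)[OF borel_measurable_integrable[OF rQ] Ee])
  have Q0: "Q t \<ge> 0" for t by (simp add: Q_def)
  have "\<sigma> * (norm x)\<^sup>2 = (LINT t|lebesgue. \<sigma> * Q t)" by (simp add: n)
  also have "\<dots> \<le> E"
    unfolding E
  proof (rule integral_mono_AE[OF _ rQ])
    show "AE t in lebesgue. \<sigma> * Q t \<le> rr t * Q t"
      using sup
    proof eventually_elim
      case (elim t)
      then show ?case using Q0[of t] by (cases "t \<in> B") (auto simp: rr_def mem_B intro!: mult_right_mono)
    qed
  qed (use Qi in simp)
  finally show "\<sigma> * (norm (Jh \<phi> - cls f))\<^sup>2 \<le> E" by (simp add: x_def)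
  have "E \<le> (LINT t|lebesgue. R * Q t)"
    unfolding E
  proof (rule integral_mono[OF rQ])
    show "rr t * Q t \<le> R * Q t" for t
      using rr_le[of t] Q0[of t] by (intro mult_right_mono) auto
  qed (use Qi in simp)
  also have "\<dots> = R * (norm x)\<^sup>2" by (simp add: n)
  finally show "E \<le> R * (norm (Jh \<phi> - cls f))\<^sup>2" by (simp add: x_def)
qed

lemma trace_integral:
  fixes P :: "real \<Rightarrow> real \<times> real"
  assumes P: "continuous_on {a..b} P" and \<phi>: "smooth \<phi>"
  shows "(LINT t:{a..b}|lebesgue. (\<phi> (P t) - 0)\<^sup>2) = integral {a..b} (\<lambda>t. (\<phi> (P t))\<^sup>2)"
proof -
  have "continuous_on {a..b} (\<lambda>t. (\<phi> (P t))\<^sup>2)"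
    by (intro continuous_intros continuous_on_compose2[OF smooth_continuous[OF \<phi>] P]) auto
  then have "set_integrable lebesgue {a..b} (\<lambda>t. (\<phi> (P t))\<^sup>2)"
    by (rule absolutely_integrable_continuous_real)
  then show ?thesis by (simp add: set_lebesgue_integral_eq_integral(2))
qed

text \<open>By \<open>h1_distance\<close> the approximating sequences in \<open>has_trace\<close>
  are the same as those described by \<open>T\<close>. This lets the closed subspaces of
  \<open>h1\<close> replace the function spaces of the statement.\<close>

lemma has_zero_trace_iff:
  assumes P: "continuous_on {a..b} P"
  shows "has_trace D f P {a..b} (\<lambda>_. 0) \<longleftrightarrow> f \<in> axi_H1 D \<and> cls f \<in> T P a b"
proof
  assume "has_trace D f P {a..b} (\<lambda>_. 0)"
  then obtain \<phi> where f: "f \<in> axi_H1 D" and s: "\<And>n. smooth (\<phi> n)"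
    and E: "(\<lambda>n. axi_integral D (\<lambda>x. (\<phi> n x - f x)\<^sup>2 + (pdr (\<phi> n) x - wdr D f x)\<^sup>2 + (pdz (\<phi> n) x - wdz D f x)\<^sup>2)) \<longlonglongrightarrow> 0"
    and tr: "(\<lambda>n. LINT t:{a..b}|lebesgue. (\<phi> n (P t) - 0)\<^sup>2) \<longlonglongrightarrow> 0"
    unfolding has_trace_def by blast
  have "(\<lambda>n. (norm (Jh (\<phi> n) - cls f))\<^sup>2) \<longlonglongrightarrow> 0"
  proof (rule Lim_null_comparison[OF always_eventually], rule allI)
    fix n
    show "norm ((norm (Jh (\<phi> n) - cls f))\<^sup>2) \<le> 1 / \<sigma> *
       axi_integral D (\<lambda>x. (\<phi> n x - f x)\<^sup>2 + (pdr (\<phi> n) x - wdr D f x)\<^sup>2 + (pdz (\<phi> n) x - wdz D f x)\<^sup>2)"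
      using h1_distance(1)[OF f s, of n] \<sigma>0 by (simp add: field_simps)
  qed (rule tendsto_mult_right_zero[OF E])
  from tendsto_real_sqrt[OF this] have "(\<lambda>n. Jh (\<phi> n)) \<longlonglongrightarrow> cls f"
    by (simp add: tendsto_norm_zero_iff LIM_zero_iff)
  moreover have "(\<lambda>n. integral {a..b} (\<lambda>t. (\<phi> n (P t))\<^sup>2)) \<longlonglongrightarrow> 0"
    using tr unfolding trace_integral[OF P s] .
  ultimately show "f \<in> axi_H1 D \<and> cls f \<in> T P a b" using f T_I[of \<phi>, OF s] by blast
next
  assume fT: "f \<in> axi_H1 D \<and> cls f \<in> T P a b"
  then have f: "f \<in> axi_H1 D" by blast
  obtain \<phi> where s: "\<And>n. smooth (\<phi> n)" and lim: "(\<lambda>n. Jh (\<phi> n)) \<longlonglongrightarrow> cls f"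
    and tr: "\<And>n. integral {a..b} (\<lambda>t. (\<phi> n (P t))\<^sup>2) < inverse (real (Suc n))"
    using T_sequence fT by blast
  have "(\<lambda>n. axi_integral D (\<lambda>x. (\<phi> n x - f x)\<^sup>2 + (pdr (\<phi> n) x - wdr D f x)\<^sup>2 + (pdz (\<phi> n) x - wdz D f x)\<^sup>2)) \<longlonglongrightarrow> 0"
  proof (rule Lim_null_comparison[OF always_eventually], rule allI)
    fix n
    have "0 \<le> \<sigma> * (norm (Jh (\<phi> n) - cls f))\<^sup>2" using \<sigma>0 by simp
    then show "norm (axi_integral D (\<lambda>x. (\<phi> n x - f x)\<^sup>2 + (pdr (\<phi> n) x - wdr D f x)\<^sup>2 + (pdz (\<phi> n) x - wdz D f x)\<^sup>2))
       \<le> R * (norm (Jh (\<phi> n) - cls f))\<^sup>2"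
      using h1_distance[OF f s, of n] by simp
    have "(\<lambda>n. norm (Jh (\<phi> n) - cls f)) \<longlonglongrightarrow> 0" using lim by (simp add: tendsto_norm_zero_iff LIM_zero_iff)
    then have "(\<lambda>n. R * (norm (Jh (\<phi> n) - cls f))\<^sup>2) \<longlonglongrightarrow> R * 0\<^sup>2" by (intro tendsto_intros)
    then show "(\<lambda>n. R * (norm (Jh (\<phi> n) - cls f))\<^sup>2) \<longlonglongrightarrow> 0" by simp
  qed
  moreover have "(\<lambda>n. LINT t:{a..b}|lebesgue. (\<phi> n (P t) - 0)\<^sup>2) \<longlonglongrightarrow> 0"
    unfolding trace_integral[OF P s]
  proof (rule Lim_null_comparison[OF always_eventually LIMSEQ_inverse_real_of_nat], rule allI)
    fix n
    have "continuous_on {a..b} (\<lambda>t. (\<phi> n (P t))\<^sup>2)"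
      by (intro continuous_intros continuous_on_compose2[OF smooth_continuous[OF s] P]) auto
    then have "integral {a..b} (\<lambda>t. (\<phi> n (P t))\<^sup>2) \<ge> 0"
      by (intro integral_nonneg integrable_continuous_interval) auto
    then show "norm (integral {a..b} (\<lambda>t. (\<phi> n (P t))\<^sup>2)) \<le> inverse (real (Suc n))" using tr[of n] by simp
  qed
  moreover have "set_borel_measurable lebesgue {a..b} (\<lambda>_. 0 :: real)" "set_integrable lebesgue {a..b} (\<lambda>_. 0\<^sup>2 :: real)"
    by (simp_all add: set_borel_measurable_def set_integrable_def)
  ultimately show "has_trace D f P {a..b} (\<lambda>_. 0)"
    unfolding has_trace_def using f s by blast
qed

lemma V1_iff: "f \<in> V1 \<sigma> R L \<longleftrightarrow> f \<in> axi_H1 D \<and> cls f \<in> V"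
  unfolding V1_def V_def zero_trace_at_z_def zero_trace_at_r_def
  by (auto simp: has_zero_trace_iff[OF continuous_paths(1)] has_zero_trace_iff[OF continuous_paths(2)])

lemma W1_iff: "f \<in> W1 \<sigma> R L \<longleftrightarrow> f \<in> axi_H1 D \<and> cls f \<in> W"
  unfolding W1_def W_def V_def zero_trace_at_z_def zero_trace_at_r_def
  by (auto simp: has_zero_trace_iff[OF continuous_paths(1)] has_zero_trace_iff[OF continuous_paths(2)])

lemma axi_H1_weak_deriv:
  assumes "f \<in> axi_H1 D"
  shows "has_weak_deriv D (1, 0) f (wdr D f)" "has_weak_deriv D (0, 1) f (wdz D f)"
  using assms has_weak_deriv_wd unfolding axi_H1_iff weakly_differentiable_def by blast+

text \<open>The weak derivatives of r u and r w are computed by the product rule for the factor r,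
  which turns the divergence condition into the linear equation in \<open>S\<close>. The azimuthal
  component is included so that one equivalence serves both for the solution and for the test
  fields.\<close>

lemma V2_iff:
  "(u, w) \<in> V2 \<sigma> R L \<and> v \<in> V1 \<sigma> R L \<longleftrightarrow>
     u \<in> axi_H1 D \<and> w \<in> axi_H1 D \<and> v \<in> axi_H1 D \<and> (cls u, cls w, cls v) \<in> S"
proof -
  have "(AE x in lebesgue. x \<in> D \<longrightarrow> wdr D (\<lambda>y. fst y * u y) x + wdz D (\<lambda>y. fst y * w y) x = 0)
     \<longleftrightarrow> fst (cls u) + wt rr (fst (snd (cls u))) + wt rr (snd (snd (cls w))) = 0" (is "?l \<longleftrightarrow> ?r")
    if u: "u \<in> axi_H1 D" and w: "w \<in> axi_H1 D"
  proof -
    have 1: "AE x in lebesgue. x \<in> D \<longrightarrow> wdr D (\<lambda>y. fst y * u y) x = u x + fst x * wdr D u x"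
      using AE_D_interior[OF wd_eq_AE[OF has_weak_deriv_fst_mult[OF axi_H1_weak_deriv(1)[OF u], of 1]]] by simp
    have 2: "AE x in lebesgue. x \<in> D \<longrightarrow> wdz D (\<lambda>y. fst y * w y) x = fst x * wdz D w x"
      using AE_D_interior[OF wd_eq_AE[OF has_weak_deriv_fst_mult[OF axi_H1_weak_deriv(2)[OF w], of 0]]] by simp
    let ?z = "fst (cls u) + wt rr (fst (snd (cls u))) + wt rr (snd (snd (cls w)))"
    have e: "AE t in lebesgue. fn ?z t = indicator D t * (wdr D (\<lambda>y. fst y * u y) t + wdz D (\<lambda>y. fst y * w y) t)"
      using 1 2 fn_cls[OF u] fn_cls[OF w] fn_wt[OF bmeas_rr, of "fst (snd (cls u))"] fn_wt[OF bmeas_rr, of "snd (snd (cls w))"]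
        fn_add[of "fst (cls u)" "wt rr (fst (snd (cls u)))"]
        fn_add[of "fst (cls u) + wt rr (fst (snd (cls u)))" "wt rr (snd (snd (cls w)))"]
    proof eventually_elim
      case (elim t)
      show ?case
      proof (cases "t \<in> D")
        case True
        then have "t \<in> B" using D_subset_B(1) by blast
        then show ?thesis using elim True by (simp add: rr_def)
      qed (use elim in simp)
    qed
    show ?thesis
    proof
      assume ?l
      then have "AE t in lebesgue. fn ?z t = fn 0 t" using e fn_zero
        by eventually_elim (auto simp: indicator_def)
      then show ?r unfolding l2_eq_iff .
    next
      assume ?r
      then have "AE t in lebesgue. fn ?z t = 0" using fn_zero by simp
      then show ?l using e by eventually_elim (auto simp: indicator_def)
    qed
  qed
  then show ?thesis unfolding V2_def S_def using V1_iff[of u] W1_iff[of w] V1_iff[of v] by auto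
qed

end

section \<open>The weak equations, translated integral by integral\<close>

context annulus begin

lemma axi_integral_eqI:
  assumes "integrable lebesgue h" "AE t in lebesgue. indicator D t *\<^sub>R (F t * fst t) = h t"
  shows "axi_integral D F = (LINT t|lebesgue. h t)"
  unfolding axi_integral_def set_lebesgue_integral_def
  by (rule integral_cong_AE_lebesgue(2)[OF borel_measurable_integrable[OF assms(1)] assms(2)])

text \<open>Only the interior of the rectangle enters the assumptions on \<open>vs\<close>, because
  its boundary values are attained merely as nontangential limits almost everywhere.\<close>

theorem shifted_solution_exists:
  assumes \<nu>: "\<nu> > 0" and vs: "continuous_on (interior B) vs" "bounded (vs ` interior B)"
  shows "\<exists>u v w. shifted_weak_solution \<sigma> R L \<nu> vs u v w"
proof -
  \<comment> \<open>\<open>vs\<close> has arbitrary values outside the open rectangle. Cutting it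
    off there gives a weight that is measurable and bounded on the whole plane and agrees with
    \<open>vs\<close> almost everywhere on \<open>D\<close>.\<close>
  define k where "k x = indicator (interior B) x * vs x" for x
  have "(\<lambda>x. indicator (interior B) x *\<^sub>R vs x) \<in> borel_measurable borel"
    by (rule borel_measurable_continuous_on_indicator[OF _ vs(1)]) simp
  then have km: "k \<in> borel_measurable lebesgue"
    unfolding k_def[abs_def] by (simp add: measurable_completion)
  obtain M where "\<forall>y\<in>vs ` interior B. norm y \<le> M" using vs(2) unfolding bounded_iff by blast
  then have "\<bar>k x\<bar> \<le> \<bar>M\<bar>" for x by (cases "x \<in> interior B") (auto simp: k_def intro: order_trans[OF _ abs_ge_self])
  then have k: "bmeas k" using km unfolding bmeas_def by blast
  have k0: "k x = 0" if "x \<notin> B" for x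
  proof -
    have "x \<notin> interior B" using that interior_subset[of B] by blast
    then show ?thesis by (simp add: k_def)
  qed
  have "sqint (\<lambda>x. k x * indicator B x)"
    using sqint_B[of "\<lambda>_. 1"] by (intro sqint_bmeas k) simp
  also have "(\<lambda>x. k x * indicator B x) = k" 
  proof (rule ext)
    fix x show "k x * indicator B x = k x" using k0[of x] by (cases "x \<in> B") auto
  qed
  finally have ks: "sqint k" .
  obtain x where x: "x \<in> S" and sol: "\<And>y. y \<in> S \<Longrightarrow>
      inner (Aop \<nu> x) y + inner (Pop x y) x + inner (Lop k x) y + inner (fop k) y = 0"
    using hilbert_solution[OF \<nu> k k0] by blast
  obtain u w v where xe: "x = (u, w, v)" by (cases x)
  have uwv: "(u, w, v) \<in> S" using x xe by simp
  note G = S_G0[OF uwv]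
  define fu fw fv where "fu = fn (fst u)" and "fw = fn (fst w)" and "fv = fn (fst v)"
  have H: "fu \<in> axi_H1 D" "fw \<in> axi_H1 D" "fv \<in> axi_H1 D" and C: "cls fu = u" "cls fw = w" "cls fv = v"
    unfolding fu_def fw_def fv_def by (intro cls_fn G)+
  have main: "(fu, fw) \<in> V2 \<sigma> R L \<and> fv \<in> V1 \<sigma> R L" unfolding V2_iff using H C uwv by simp
  have kvs: "AE t in lebesgue. t \<in> D \<longrightarrow> k t = vs t"
    using AE_B_interior by eventually_elim (use D_subset_B in \<open>auto simp: k_def\<close>)
  note AEx = fn_cls[OF H(1), unfolded C] fn_cls[OF H(2), unfolded C] fn_cls[OF H(3), unfolded C]
  have "axi_integral D (\<lambda>x. advect D fu fw fu x * u' x + advect D fu fw fw x * w' x)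
             - axi_integral D (\<lambda>x. (fv x + vs x)\<^sup>2 / fst x * u' x)
           = - \<nu> * axi_integral D (\<lambda>x. grad_dot D fu u' x + grad_dot D fw w' x)
             - \<nu> * axi_integral D (\<lambda>x. fu x * u' x / (fst x)\<^sup>2)
         \<and>
           axi_integral D (\<lambda>x. advect D fu fw fv x * v' x)
             - axi_integral D (\<lambda>x. vs x * advect D fu fw v' x)
             + axi_integral D (\<lambda>x. fu x * (fv x + vs x) / fst x * v' x)
           = - \<nu> * axi_integral D (\<lambda>x. grad_dot D fv v' x)
             - \<nu> * axi_integral D (\<lambda>x. fv x * v' x / (fst x)\<^sup>2)"
    if "(u', w') \<in> V2 \<sigma> R L \<and> v' \<in> V1 \<sigma> R L" for u' w' v'
  proof -
    define U W' V' where "U = cls u'" and "W' = cls w'" and "V' = cls v'"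
    have H': "u' \<in> axi_H1 D" "w' \<in> axi_H1 D" "v' \<in> axi_H1 D" and yS: "(U, W', V') \<in> S"
      using that unfolding V2_iff U_def W'_def V'_def by blast+
    note G' = S_G0[OF yS]
    note AEy = fn_cls[OF H'(1), folded U_def] fn_cls[OF H'(2), folded W'_def] fn_cls[OF H'(3), folded V'_def]
    have w0: "wt k 0 = 0" if "bmeas k" for k using linear_0[OF bounded_linear.linear[OF bounded_linear_wt[OF that]]] .
    \<comment> \<open>The Hilbert space equation is the sum of the two weak equations. Test fields
      with vanishing azimuthal part, or with vanishing velocity part, separate them again.\<close>
    have y1: "(U, W', 0) \<in> S" and y2: "(0, 0, V') \<in> S"
      using yS by (auto simp: S_def subspace_0[OF subspace_V] subspace_0[OF subspace_W] w0[OF bmeas_rr])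
    have inD: "t \<in> B \<and> fst t > 0 \<and> rr t = fst t \<and> ir t = 1 / fst t" if "t \<in> D" for t
    proof -
      have "t \<in> B" using that D_subset_B(1) by blast
      then show ?thesis using \<sigma>0 by (simp add: rr_def ir_def mem_B)
    qed
    have ok: "mult_ok (fst a) (fst b)" if "a \<in> G0" "b \<in> G0" for a b by (rule ladyzhenskaya(1)[OF that])
    \<comment> \<open>The three factors are grouped as (value times test value) times derivative: a
      product of two H1 functions is square integrable, while a value times a derivative need not
      be.\<close>
    have I1: "axi_integral D (\<lambda>x. advect D fu fw fu x * u' x + advect D fu fw fw x * w' x)
       = inner (wt rr (pr (fst u) (fst U))) (fst (snd u)) + inner (wt rr (pr (fst w) (fst U))) (snd (snd u))
       + inner (wt rr (pr (fst u) (fst W'))) (fst (snd w)) + inner (wt rr (pr (fst w) (fst W'))) (snd (snd w))"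
    proof -
      note i = inner_wt_pr_integrable[OF bmeas_rr ok[OF G(1) G'(1)], of "fst (snd u)"]
        inner_wt_pr_integrable[OF bmeas_rr ok[OF G(2) G'(1)], of "snd (snd u)"]
        inner_wt_pr_integrable[OF bmeas_rr ok[OF G(1) G'(2)], of "fst (snd w)"]
        inner_wt_pr_integrable[OF bmeas_rr ok[OF G(2) G'(2)], of "snd (snd w)"]
      have "axi_integral D (\<lambda>x. advect D fu fw fu x * u' x + advect D fu fw fw x * w' x)
        = (LINT t|lebesgue. rr t * (fn (fst u) t * fn (fst U) t) * fn (fst (snd u)) t + rr t * (fn (fst w) t * fn (fst U) t) * fn (snd (snd u)) t
         + rr t * (fn (fst u) t * fn (fst W') t) * fn (fst (snd w)) t + rr t * (fn (fst w) t * fn (fst W') t) * fn (snd (snd w)) t)"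
      proof (rule axi_integral_eqI)
        show "AE t in lebesgue. indicator D t *\<^sub>R ((advect D fu fw fu t * u' t + advect D fu fw fw t * w' t) * fst t)
          = rr t * (fn (fst u) t * fn (fst U) t) * fn (fst (snd u)) t + rr t * (fn (fst w) t * fn (fst U) t) * fn (snd (snd u)) t
         + rr t * (fn (fst u) t * fn (fst W') t) * fn (fst (snd w)) t + rr t * (fn (fst w) t * fn (fst W') t) * fn (snd (snd w)) t"
          using AEx AEy
        proof eventually_elim
          case (elim t)
          show ?case
          proof (cases "t \<in> D")
            case True
            then show ?thesis using elim inD[OF True] by (simp add: advect_def algebra_simps)
          qed (use elim in simp)
        qed
      qed (intro Bochner_Integration.integrable_add i)
      then show ?thesis by (simp add: i)
    qed
    have I2: "axi_integral D (\<lambda>x. (fv x + vs x)\<^sup>2 / fst x * u' x)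
       = inner (pr (fst v) (fst U)) (fst v) + 2 * inner (wt k (fst v)) (fst U) + inner (wt k (cl k)) (fst U)"
    proof -
      note i = inner_pr_integrable[OF ok[OF G(3) G'(1)], of "fst v"] inner_wt_integrable[OF k, of "fst v" "fst U"]
        inner_wt_integrable[OF k, of "cl k" "fst U"]
      have "axi_integral D (\<lambda>x. (fv x + vs x)\<^sup>2 / fst x * u' x)
        = (LINT t|lebesgue. fn (fst v) t * fn (fst U) t * fn (fst v) t + 2 * (k t * fn (fst v) t * fn (fst U) t) + k t * fn (cl k) t * fn (fst U) t)"
      proof (rule axi_integral_eqI)
        show "AE t in lebesgue. indicator D t *\<^sub>R ((fv t + vs t)\<^sup>2 / fst t * u' t * fst t)
          = fn (fst v) t * fn (fst U) t * fn (fst v) t + 2 * (k t * fn (fst v) t * fn (fst U) t) + k t * fn (cl k) t * fn (fst U) t"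
          using AEx AEy kvs fn_cl[OF ks]
        proof eventually_elim
          case (elim t)
          show ?case
          proof (cases "t \<in> D")
            case True
            \<comment> \<open>The factor 1 / r of the centrifugal term cancels the r of the volume
              element, so no weight is left in \<open>I2\<close>. The same happens in
              \<open>I7\<close>.\<close>
            have c: "(fv t + vs t)\<^sup>2 / fst t * u' t * fst t = (fv t + vs t)\<^sup>2 * u' t" using inD[OF True] by simp
            show ?thesis unfolding c using elim True by (simp add: power2_eq_square algebra_simps)
          qed (use elim in simp)
        qed
      qed (intro Bochner_Integration.integrable_add integrable_mult_right i)
      then show ?thesis by (simp add: i)
    qed
    have I3: "axi_integral D (\<lambda>x. grad_dot D fu u' x + grad_dot D fw w' x)
       = inner (wt rr (fst (snd u))) (fst (snd U)) + inner (wt rr (snd (snd u))) (snd (snd U))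
       + inner (wt rr (fst (snd w))) (fst (snd W')) + inner (wt rr (snd (snd w))) (snd (snd W'))"
    proof -
      note i = inner_wt_integrable[OF bmeas_rr, of "fst (snd u)" "fst (snd U)"] inner_wt_integrable[OF bmeas_rr, of "snd (snd u)" "snd (snd U)"]
        inner_wt_integrable[OF bmeas_rr, of "fst (snd w)" "fst (snd W')"] inner_wt_integrable[OF bmeas_rr, of "snd (snd w)" "snd (snd W')"]
      have "axi_integral D (\<lambda>x. grad_dot D fu u' x + grad_dot D fw w' x)
        = (LINT t|lebesgue. rr t * fn (fst (snd u)) t * fn (fst (snd U)) t + rr t * fn (snd (snd u)) t * fn (snd (snd U)) t
          + rr t * fn (fst (snd w)) t * fn (fst (snd W')) t + rr t * fn (snd (snd w)) t * fn (snd (snd W')) t)"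
      proof (rule axi_integral_eqI)
        show "AE t in lebesgue. indicator D t *\<^sub>R ((grad_dot D fu u' t + grad_dot D fw w' t) * fst t)
          = rr t * fn (fst (snd u)) t * fn (fst (snd U)) t + rr t * fn (snd (snd u)) t * fn (snd (snd U)) t
          + rr t * fn (fst (snd w)) t * fn (fst (snd W')) t + rr t * fn (snd (snd w)) t * fn (snd (snd W')) t"
          using AEx AEy
        proof eventually_elim
          case (elim t)
          show ?case
          proof (cases "t \<in> D")
            case True
            then show ?thesis using elim inD[OF True] by (simp add: grad_dot_def algebra_simps)
          qed (use elim in simp)
        qed
      qed (intro Bochner_Integration.integrable_add i)
      then show ?thesis by (simp add: i)
    qed
    \<comment> \<open>Stated for an arbitrary component \<open>q\<close>, since it occurs for u in
      the first equation and for v in the second. One power of 1 / r is used up by the volume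
      element, which leaves the weight \<open>ir\<close>.\<close>
    have I4: "axi_integral D (\<lambda>x. fn (fst q) x * h x / (fst x)\<^sup>2) = inner (wt ir (fst q)) (fst (cls h))"
      if h: "h \<in> axi_H1 D" for q :: h1 and h
    proof -
      have "axi_integral D (\<lambda>x. fn (fst q) x * h x / (fst x)\<^sup>2) = (LINT t|lebesgue. ir t * fn (fst q) t * fn (fst (cls h)) t)"
      proof (rule axi_integral_eqI[OF inner_wt_integrable(1)[OF bmeas_ir]])
        show "AE t in lebesgue. indicator D t *\<^sub>R (fn (fst q) t * h t / (fst t)\<^sup>2 * fst t) = ir t * fn (fst q) t * fn (fst (cls h)) t"
          using fn_cls(1)[OF h]
        proof eventually_elim
          case (elim t)
          show ?case
          proof (cases "t \<in> D")
            case True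
            then show ?thesis using elim inD[OF True] by (simp add: power2_eq_square)
          qed (use elim in simp)
        qed
      qed
      then show ?thesis by (simp add: inner_wt[OF bmeas_ir])
    qed
    have I5: "axi_integral D (\<lambda>x. advect D fu fw fv x * v' x)
       = inner (wt rr (pr (fst u) (fst V'))) (fst (snd v)) + inner (wt rr (pr (fst w) (fst V'))) (snd (snd v))"
    proof -
      note i = inner_wt_pr_integrable[OF bmeas_rr ok[OF G(1) G'(3)], of "fst (snd v)"]
        inner_wt_pr_integrable[OF bmeas_rr ok[OF G(2) G'(3)], of "snd (snd v)"]
      have "axi_integral D (\<lambda>x. advect D fu fw fv x * v' x)
        = (LINT t|lebesgue. rr t * (fn (fst u) t * fn (fst V') t) * fn (fst (snd v)) t + rr t * (fn (fst w) t * fn (fst V') t) * fn (snd (snd v)) t)"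
      proof (rule axi_integral_eqI)
        show "AE t in lebesgue. indicator D t *\<^sub>R (advect D fu fw fv t * v' t * fst t)
          = rr t * (fn (fst u) t * fn (fst V') t) * fn (fst (snd v)) t + rr t * (fn (fst w) t * fn (fst V') t) * fn (snd (snd v)) t"
          using AEx AEy
        proof eventually_elim
          case (elim t)
          show ?case
          proof (cases "t \<in> D")
            case True
            then show ?thesis using elim inD[OF True] by (simp add: advect_def algebra_simps)
          qed (use elim in simp)
        qed
      qed (intro Bochner_Integration.integrable_add i)
      then show ?thesis by (simp add: i)
    qed
    have I6: "axi_integral D (\<lambda>x. vs x * advect D fu fw v' x)
       = inner (wt k (wt rr (fst u))) (fst (snd V')) + inner (wt k (wt rr (fst w))) (snd (snd V'))"
    proof -
      note i = inner_wt_wt_integrable[OF k bmeas_rr, of "fst u" "fst (snd V')"] inner_wt_wt_integrable[OF k bmeas_rr, of "fst w" "snd (snd V')"]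
      have "axi_integral D (\<lambda>x. vs x * advect D fu fw v' x)
        = (LINT t|lebesgue. k t * (rr t * fn (fst u) t) * fn (fst (snd V')) t + k t * (rr t * fn (fst w) t) * fn (snd (snd V')) t)"
      proof (rule axi_integral_eqI)
        show "AE t in lebesgue. indicator D t *\<^sub>R (vs t * advect D fu fw v' t * fst t)
          = k t * (rr t * fn (fst u) t) * fn (fst (snd V')) t + k t * (rr t * fn (fst w) t) * fn (snd (snd V')) t"
          using AEx AEy kvs
        proof eventually_elim
          case (elim t)
          show ?case
          proof (cases "t \<in> D")
            case True
            then show ?thesis using elim inD[OF True] by (simp add: advect_def fu_def fw_def algebra_simps)
          qed (use elim in simp)
        qed
      qed (intro Bochner_Integration.integrable_add i)
      then show ?thesis by (simp add: i)
    qed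
    have I7: "axi_integral D (\<lambda>x. fu x * (fv x + vs x) / fst x * v' x)
       = inner (pr (fst u) (fst V')) (fst v) + inner (wt k (fst u)) (fst V')"
    proof -
      note i = inner_pr_integrable[OF ok[OF G(1) G'(3)], of "fst v"] inner_wt_integrable[OF k, of "fst u" "fst V'"]
      have "axi_integral D (\<lambda>x. fu x * (fv x + vs x) / fst x * v' x)
        = (LINT t|lebesgue. fn (fst u) t * fn (fst V') t * fn (fst v) t + k t * fn (fst u) t * fn (fst V') t)"
      proof (rule axi_integral_eqI)
        show "AE t in lebesgue. indicator D t *\<^sub>R (fu t * (fv t + vs t) / fst t * v' t * fst t)
          = fn (fst u) t * fn (fst V') t * fn (fst v) t + k t * fn (fst u) t * fn (fst V') t"
          using AEx AEy kvs
        proof eventually_elim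
          case (elim t)
          show ?case
          proof (cases "t \<in> D")
            case True
            have c: "fu t * (fv t + vs t) / fst t * v' t * fst t = fu t * (fv t + vs t) * v' t" using inD[OF True] by simp
            show ?thesis unfolding c using elim True by (simp add: algebra_simps)
          qed (use elim in simp)
        qed
      qed (intro Bochner_Integration.integrable_add i)
      then show ?thesis by (simp add: i)
    qed
    have I8: "axi_integral D (\<lambda>x. grad_dot D fv v' x)
       = inner (wt rr (fst (snd v))) (fst (snd V')) + inner (wt rr (snd (snd v))) (snd (snd V'))"
    proof -
      note i = inner_wt_integrable[OF bmeas_rr, of "fst (snd v)" "fst (snd V')"] inner_wt_integrable[OF bmeas_rr, of "snd (snd v)" "snd (snd V')"]
      have "axi_integral D (\<lambda>x. grad_dot D fv v' x)
        = (LINT t|lebesgue. rr t * fn (fst (snd v)) t * fn (fst (snd V')) t + rr t * fn (snd (snd v)) t * fn (snd (snd V')) t)"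
      proof (rule axi_integral_eqI)
        show "AE t in lebesgue. indicator D t *\<^sub>R (grad_dot D fv v' t * fst t)
          = rr t * fn (fst (snd v)) t * fn (fst (snd V')) t + rr t * fn (snd (snd v)) t * fn (snd (snd V')) t"
          using AEx AEy
        proof eventually_elim
          case (elim t)
          show ?case
          proof (cases "t \<in> D")
            case True
            then show ?thesis using elim inD[OF True] by (simp add: grad_dot_def algebra_simps)
          qed (use elim in simp)
        qed
      qed (intro Bochner_Integration.integrable_add i)
      then show ?thesis by (simp add: i)
    qed
    show ?thesis
      unfolding I1 I2 I3 I5 I6 I7 I8 I4[OF H'(1), of u, folded fu_def U_def] I4[OF H'(3), of v, folded fv_def V'_def]
      using sol[OF y1] sol[OF y2]
      by (simp add: xe Aop_def Pop_def Lop_def fop_def case_prod_unfold inner_prod_def pr_zero w0[OF bmeas_rr]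
          inner_diff_left algebra_simps)
  qed
  then have "shifted_weak_solution \<sigma> R L \<nu> vs fu fv fw"
    unfolding shifted_weak_solution_def Let_def using main by blast
  then show ?thesis by blast
qed

end

theorem theorem3p1:
  fixes \<sigma> R L \<nu> \<rho> \<gamma> :: real and vs :: "real \<times> real \<Rightarrow> real"
  assumes "\<sigma> > 0" and "R > \<sigma>" and "L > 0" and "\<nu> > 0" and "\<rho> > 0"
    and "azimuthal_stokes_field \<sigma> R L \<gamma> vs"
  shows "\<exists>u v w. ns_weak_solution \<sigma> R L \<nu> vs u v w"
proof -
  interpret annulus \<sigma> R L using assms by unfold_locales auto
  define E where "E = {\<sigma><..<R} \<times> {0<..<2 * L}"
  have "smooth_on E vs" "bounded (vs ` E)"
    using assms(6) unfolding azimuthal_stokes_field_def Let_def E_def by blast+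
  \<comment> \<open>The Stokes field lives on the rectangle doubled by reflection in z = L; the
    physical domain is its lower half.\<close>
  moreover have sub: "interior B \<subseteq> E"
    using \<open>L > 0\<close> by (auto simp: interior_D(2) E_def mem_box Basis_prod_def)
  ultimately have "continuous_on (interior B) vs" "bounded (vs ` interior B)"
    unfolding smooth_on_def using continuous_on_subset bounded_subset image_mono C_k_on.simps(1) by metis+
  from shifted_solution_exists[OF \<open>\<nu> > 0\<close> this]
  obtain u v w where "shifted_weak_solution \<sigma> R L \<nu> vs u v w" by blast
  \<comment> \<open>Adding \<open>vs\<close> undoes the shift at every point, so the shifted field
    is recovered exactly.\<close>
  then have "ns_weak_solution \<sigma> R L \<nu> vs u (\<lambda>x. v x + vs x) w"
    unfolding ns_weak_solution_def by simp
  then show ?thesis by blast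
qed

end
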